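(* The map $$\{(x,r)\in D\times[0,1] : Q(x,r)\subset D\}\longrightarrow \mathbb{C},\qquad (x,r)\longmapsto \mu(Q(x,r))$$ possesses a continuous modification. Moreover, for all compact subsets $K$ of $D$ and all $\alpha<1-\beta^2/4$, there exists a random constant $C_{K,\alpha}$, almost surely finite, such that (for this modification) for all $Q(x,r),Q(x',r')\subset K$, $$|\mu(Q(x,r))-\mu(Q(x',r'))|\le C_{K,\alpha}\,(r\vee r')^{\alpha}\,\|(x,r)-(x',r')\|^{\alpha}.$$
   Context: $\beta\in(0,\sqrt2)$ is fixed and $D\subset\mathbb{R}^2$ is an open bounded simply connected domain. $\Gamma$ is the Gaussian free field in $D$ with zero boundary condition: a centred Gaussian random Schwartz distribution with $\mathbb{E}[(\Gamma,\varphi)(\Gamma,\psi)]=\int_{D\times D}\varphi(x)G_D(x,y)\psi(y)\,dx\,dy$, where $G_D$ is the Green function of the Laplacian in $D$ with Dirichlet boundary condition, normalised so that $G_D(x,y)\sim-\log|x-y|$ as $x-y\to0$. For $\varepsilon>0$, $\Gamma_\varepsilon(x)$ is the average of $\Gamma$ on the circle of radius $\varepsilon$ about $x$. The imaginary chaos is $\mu(x)=\lim_{\varepsilon\to0}\varepsilon^{-\beta^2/2}e^{i\beta\Gamma_\varepsilon(x)}\mathbf{1}_{\{x\in D\}}$ (limit in $L^2$ in any Sobolev space $H^s$, $s<-1$), and for a Borel set $A\subset D$, $\mu(A)$ is the $L^2$ limit of $\varepsilon^{-\beta^2/2}\int_A e^{i\beta\Gamma_\varepsilon(x)}dx$. $Q(x,r)=x+[-r,r]^2$.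 $\|\cdot\|$ is a norm on $\mathbb{R}^3$, and $a\vee b=\max(a,b)$. *)

theory Defs
  imports "HOL-Probability.Probability"
begin

section \<open>Smooth and harmonic functions, distributions\<close>

definition pdir :: "2 \<Rightarrow> (real^2 \<Rightarrow> real) \<Rightarrow> real^2 \<Rightarrow> real" where
  "pdir j f x = frechet_derivative f (at x) (axis j 1)"

text \<open>Iterated partial derivatives, indexed by the list of directions.  The junk values of
  \<^const>\<open>frechet_derivative\<close> never matter: below, every function that is differentiated
  is also required to be differentiable.\<close>

primrec partials :: "2 list \<Rightarrow> (real^2 \<Rightarrow> real) \<Rightarrow> real^2 \<Rightarrow> real" where
  "partials [] f = f"
| "partials (j # js) f = pdir j (partials js f)"

definition smooth :: "(real^2 \<Rightarrow> real) \<Rightarrow> bool" where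
  "smooth f \<longleftrightarrow> (\<forall>js x. partials js f differentiable (at x))"

definition harmonic_on :: "(real^2) set \<Rightarrow> (real^2 \<Rightarrow> real) \<Rightarrow> bool" where
  "harmonic_on S h \<longleftrightarrow>
     (\<forall>js. length js < 2 \<longrightarrow> (\<forall>x\<in>S. partials js h differentiable (at x))) \<and>
     (\<forall>js. length js = 2 \<longrightarrow> continuous_on S (partials js h)) \<and>
     (\<forall>x\<in>S. (\<Sum>j\<in>UNIV. partials [j, j] h x) = 0)"

definition test_function :: "(real^2) set \<Rightarrow> (real^2 \<Rightarrow> real) \<Rightarrow> bool" where
  "test_function D \<phi> \<longleftrightarrow>
     smooth \<phi> \<and> compact (closure {x. \<phi> x \<noteq> 0}) \<and> closure {x. \<phi> x \<noteq> 0} \<subseteq> D"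

text \<open>Schwartz distributions on \<open>D\<close>: linear functionals on the test functions which, on every
  compact set, are bounded by a \<open>C\<^sup>N\<close>-norm.  Values outside the test functions are irrelevant.\<close>

definition schwartz_distribution :: "(real^2) set \<Rightarrow> ((real^2 \<Rightarrow> real) \<Rightarrow> real) \<Rightarrow> bool" where
  "schwartz_distribution D T \<longleftrightarrow>
     (\<forall>\<phi> \<psi> a b. test_function D \<phi> \<longrightarrow> test_function D \<psi> \<longrightarrow>
        T (\<lambda>x. a * \<phi> x + b * \<psi> x) = a * T \<phi> + b * T \<psi>) \<and>
     (\<forall>K. compact K \<and> K \<subseteq> D \<longrightarrow>
        (\<exists>C N. \<forall>\<phi> B. test_function D \<phi> \<longrightarrow> closure {x. \<phi> x \<noteq> 0} \<subseteq> K \<longrightarrow>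
           (\<forall>js x. length js \<le> N \<longrightarrow> \<bar>partials js \<phi> x\<bar> \<le> B) \<longrightarrow> \<bar>T \<phi>\<bar> \<le> C * B))"

section \<open>The Gaussian free field\<close>

text \<open>Dirichlet Green function normalised by \<open>G x y \<sim> - ln (dist x y)\<close>: for each pole \<open>x\<close>,
  \<open>G x y + ln (dist x y)\<close> is harmonic in \<open>y\<close> on all of \<open>D\<close>, and \<open>G x\<close> vanishes at the boundary.
  The values on the diagonal are left unspecified.\<close>

definition dirichlet_green :: "(real^2) set \<Rightarrow> (real^2 \<Rightarrow> real^2 \<Rightarrow> real) \<Rightarrow> bool" where
  "dirichlet_green D G \<longleftrightarrow>
     (\<forall>x\<in>D. (\<exists>h. harmonic_on D h \<and> (\<forall>y\<in>D - {x}. G x y = - ln (dist x y) + h y)) \<and>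
            (\<forall>z\<in>frontier D. (G x \<longlongrightarrow> 0) (at z within D)))"

text \<open>The completed measure \<^term>\<open>lebesgue\<close> makes the unspecified diagonal values harmless
  also for measurability.\<close>

definition green_energy ::
  "(real^2) set \<Rightarrow> (real^2 \<Rightarrow> real^2 \<Rightarrow> real) \<Rightarrow> (real^2 \<Rightarrow> real) \<Rightarrow> (real^2 \<Rightarrow> real) \<Rightarrow> real" where
  "green_energy D G \<phi> \<psi> =
     (LINT p:D \<times> D|lebesgue. \<phi> (fst p) * G (fst p) (snd p) * \<psi> (snd p))"

text \<open>The point mass at 0 counts as a (degenerate) Gaussian.\<close>

definition centred_gaussian :: "'a measure \<Rightarrow> ('a \<Rightarrow> real) \<Rightarrow> bool" where
  "centred_gaussian M X \<longleftrightarrow> X \<in> borel_measurable M \<and>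
     ((AE \<omega> in M. X \<omega> = 0) \<or> (\<exists>\<sigma>>0. distributed M lborel X (normal_density 0 \<sigma>)))"

text \<open>Joint Gaussianity of the pairings follows from linearity of each realisation.\<close>

definition gff ::
  "'a measure \<Rightarrow> (real^2) set \<Rightarrow> (real^2 \<Rightarrow> real^2 \<Rightarrow> real) \<Rightarrow>
   ('a \<Rightarrow> (real^2 \<Rightarrow> real) \<Rightarrow> real) \<Rightarrow> bool" where
  "gff M D G \<Gamma> \<longleftrightarrow>
     (\<forall>\<omega>\<in>space M. schwartz_distribution D (\<Gamma> \<omega>)) \<and>
     (\<forall>\<phi>. test_function D \<phi> \<longrightarrow> centred_gaussian M (\<lambda>\<omega>. \<Gamma> \<omega> \<phi>)) \<and>
     (\<forall>\<phi> \<psi>. test_function D \<phi> \<longrightarrow> test_function D \<psi> \<longrightarrow>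
        integral\<^sup>L M (\<lambda>\<omega>. \<Gamma> \<omega> \<phi> * \<Gamma> \<omega> \<psi>) = green_energy D G \<phi> \<psi>)"

section \<open>Circle averages\<close>

definition L2_tendsto ::
  "'a measure \<Rightarrow> ('t \<Rightarrow> 'a \<Rightarrow> 'b::real_normed_vector) \<Rightarrow> ('a \<Rightarrow> 'b) \<Rightarrow> 't filter \<Rightarrow> bool" where
  "L2_tendsto M X Y F \<longleftrightarrow>
     ((\<lambda>t. \<integral>\<^sup>+\<omega>. ennreal ((norm (X t \<omega> - Y \<omega>))\<^sup>2) \<partial>M) \<longlongrightarrow> 0) F"

definition mollifier :: "(real^2 \<Rightarrow> real) \<Rightarrow> bool" where
  "mollifier \<eta> \<longleftrightarrow> smooth \<eta> \<and> (\<forall>x. 0 \<le> \<eta> x) \<and>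
     closure {x. \<eta> x \<noteq> 0} \<subseteq> cball 0 1 \<and> integral\<^sup>L lborel \<eta> = 1"

text \<open>The convolution \<open>T * \<eta>\<^sub>\<delta>\<close> with \<open>\<eta>\<^sub>\<delta> z = \<delta>\<^sup>-\<^sup>2 \<eta> (z / \<delta>)\<close>; it is meaningful at points \<open>y\<close> whose
  distance to the complement of the domain exceeds \<open>\<delta>\<close>.\<close>

definition mollify ::
  "(real^2 \<Rightarrow> real) \<Rightarrow> real \<Rightarrow> ((real^2 \<Rightarrow> real) \<Rightarrow> real) \<Rightarrow> real^2 \<Rightarrow> real" where
  "mollify \<eta> \<delta> T y = T (\<lambda>z. \<eta> ((y - z) /\<^sub>R \<delta>) / \<delta>\<^sup>2)"

definition circle_mean :: "(real^2 \<Rightarrow> real) \<Rightarrow> real^2 \<Rightarrow> real \<Rightarrow> real" where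
  "circle_mean f x \<epsilon> =
     (LINT \<theta>:{0..2 * pi}|lborel. f (x + \<epsilon> *\<^sub>R vector [cos \<theta>, sin \<theta>])) / (2 * pi)"

text \<open>A distribution has no pointwise values on a circle: its circle average is the \<open>L\<^sup>2\<close> limit of
  the circle averages of its mollifications.  The limit does not depend on the mollifier.\<close>

definition circle_average ::
  "'a measure \<Rightarrow> ('a \<Rightarrow> (real^2 \<Rightarrow> real) \<Rightarrow> real) \<Rightarrow> real^2 \<Rightarrow> real \<Rightarrow> ('a \<Rightarrow> real) \<Rightarrow> bool" where
  "circle_average M \<Gamma> x \<epsilon> X \<longleftrightarrow> X \<in> borel_measurable M \<and>
     (\<exists>\<eta>. mollifier \<eta> \<and>
        L2_tendsto M (\<lambda>\<delta> \<omega>. circle_mean (mollify \<eta> \<delta> (\<Gamma> \<omega>)) x \<epsilon>) X (at_right 0))"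

text \<open>A choice \<open>\<Gamma>\<^sub>\<epsilon>(x)(\<omega>) = \<Gamma>c \<epsilon> x \<omega>\<close> of the circle averages, for closed discs inside \<open>D\<close>.  Each of
  them is determined up to a null set only; joint measurability gives a meaning to integrals over
  \<open>x\<close>, and by Fubini these do not depend (almost surely) on the choice.\<close>

definition circle_average_process ::
  "'a measure \<Rightarrow> (real^2) set \<Rightarrow> ('a \<Rightarrow> (real^2 \<Rightarrow> real) \<Rightarrow> real) \<Rightarrow>
   (real \<Rightarrow> real^2 \<Rightarrow> 'a \<Rightarrow> real) \<Rightarrow> bool" where
  "circle_average_process M D \<Gamma> \<Gamma>c \<longleftrightarrow>
     (\<forall>\<epsilon>>0. (\<lambda>(x, \<omega>). \<Gamma>c \<epsilon> x \<omega>)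
        \<in> borel_measurable (restrict_space borel {x. cball x \<epsilon> \<subseteq> D} \<Otimes>\<^sub>M M)) \<and>
     (\<forall>\<epsilon>>0. \<forall>x. cball x \<epsilon> \<subseteq> D \<longrightarrow> circle_average M \<Gamma> x \<epsilon> (\<Gamma>c \<epsilon> x))"

section \<open>Imaginary chaos\<close>

text \<open>\<open>Y\<close> is (a version of) \<open>\<mu>(A)\<close>.  When \<open>A\<close> has compact closure in \<open>D\<close>, as do all the squares to
  which this is applied, only discs inside \<open>D\<close> matter for small \<open>\<epsilon>\<close>.\<close>

definition chaos_mass ::
  "'a measure \<Rightarrow> real \<Rightarrow> (real \<Rightarrow> real^2 \<Rightarrow> 'a \<Rightarrow> real) \<Rightarrow> (real^2) set \<Rightarrow> ('a \<Rightarrow> complex) \<Rightarrow> bool" where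
  "chaos_mass M \<beta> \<Gamma>c A Y \<longleftrightarrow> Y \<in> borel_measurable M \<and>
     L2_tendsto M
       (\<lambda>\<epsilon> \<omega>. \<epsilon> powr (- (\<beta>\<^sup>2 / 2)) *\<^sub>R
          (LINT x:A|lborel. exp (\<i> * complex_of_real (\<beta> * \<Gamma>c \<epsilon> x \<omega>))))
       Y (at_right 0)"

definition Q :: "real^2 \<Rightarrow> real \<Rightarrow> (real^2) set" where
  "Q x r = cbox (x - vec r) (x + vec r)"

definition squares :: "(real^2) set \<Rightarrow> ((real^2) \<times> real) set" where
  "squares D = {(x, r). x \<in> D \<and> r \<in> {0..1} \<and> Q x r \<subseteq> D}"

definition is_norm :: "('v::real_vector \<Rightarrow> real) \<Rightarrow> bool" where
  "is_norm N \<longleftrightarrow> (\<forall>v. 0 \<le> N v) \<and> (\<forall>v. N v = 0 \<longrightarrow> v = 0) \<and>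
     (\<forall>c v. N (c *\<^sub>R v) = \<bar>c\<bar> * N v) \<and> (\<forall>v w. N (v + w) \<le> N v + N w)"

end

theory Submission
  imports Defs "HOL-Complex_Analysis.Cauchy_Integral_Formula"
begin

text \<open>The heart of the matter is an Onsager-type inequality.  Let \<open>r\<^sub>i\<close> be half the distance from \<open>z\<^sub>i\<close> to the
  nearest other point.  Enlarging the circle of radius \<open>\<epsilon>\<close> about \<open>z\<^sub>i\<close> to radius \<open>r\<^sub>i \<ge> \<epsilon>\<close>, for every \<open>i\<close>,
  keeps the circles non-overlapping, so by the mean value property it does not change their mutual
  logarithmic energies; it only lowers the self-energies by \<open>ln (r\<^sub>i / \<epsilon>)\<close>.  As the variance of the enlarged
  configuration is nonnegative, \<open>Var (\<Sum>i. \<plusminus> \<Gamma>\<^sub>\<epsilon> (z\<^sub>i)) \<ge> (\<Sum>i. ln (r\<^sub>i / \<epsilon>)) - C\<close>, for any signs.  Hence the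
  \<open>2 n\<close>-point function of the normalised chaos is at most a constant times the product of the
  \<open>r\<^sub>i powr (- \<beta>\<^sup>2 / 2)\<close>, uniformly in \<open>\<epsilon>\<close>.  Joining every point to its nearest neighbour gives a functional
  graph, along which this bound integrates over the points of a rectangle: the moment of order \<open>2 n\<close> of
  the mass of a rectangle of area \<open>a\<close> is at most \<open>C a powr (2 n (1 - \<beta>\<^sup>2 / 4))\<close>.  Two nearby squares differ by
  four thin rectangles of area at most a multiple of \<open>(r \<or> r') |(x, r) - (x', r')|\<close>, and dyadic chaining as
  in Kolmogorov's continuity theorem, with \<open>r \<or> r'\<close> kept as a weight, concludes.\<close>

section \<open>Dyadic chaining\<close>

text \<open>The condition \<open>\<beta> < sqrt 2\<close> comes from the cycles of the functional
  graph. Opening a cycle leaves a point joined to two others, and then the square of the kernel, of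
  order \<open>dist powr (- \<beta>\<^sup>2)\<close>, has to be integrable in the plane; leaves
  involve only the kernel itself. The singularity is shared between the two coordinates, so that an
  integral over a rectangle depends on its area and not on its shape, although the rectangles are
  thin. A realisation of the field is a distribution and respects finite sums only. Its circle
  averages are reached through Riemann sums and then through mollification at a scale
  \<open>\<delta>\<close>; the errors are of order \<open>\<delta> / \<epsilon>\<close> and
  disappear before \<open>\<epsilon>\<close> moves. The Green function is known by its defining
  properties alone. A maximum principle bounds its regular part as long as one variable keeps a
  distance from the frontier. The domain may be so shaped that no chain of squares joins two given
  ones. Distant squares are therefore both shrunk to radius zero, where the mass vanishes; this also
  keeps the weight given by the radius.\<close>

lemma geometric_increments_limit:
  fixes u :: "nat \<Rightarrow> complex"
  assumes q: "0 < q" "q < 1"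
    and inc: "\<And>k. k0 \<le> k \<Longrightarrow> cmod (u (Suc k) - u k) \<le> A * q ^ k"
  shows "convergent u"
    and "k0 \<le> k \<Longrightarrow> cmod (lim u - u k) \<le> A * q ^ k / (1 - q)"
proof -
  have A0: "A \<ge> 0"
  proof -
    have "0 \<le> A * q ^ k0" using inc[of k0] norm_ge_zero order_trans by blast
    then show ?thesis using zero_less_power[OF q(1), of k0] by (auto simp: zero_le_mult_iff)
  qed
  have "summable (\<lambda>j. u (Suc (j + k0)) - u (j + k0))"
  proof (rule summable_comparison_test')
    show "summable (\<lambda>j. A * q ^ k0 * q ^ j)" using q by (intro summable_mult summable_geometric) auto
    show "norm (u (Suc (j + k0)) - u (j + k0)) \<le> A * q ^ k0 * q ^ j" if "j \<ge> 0" for j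
      using inc[of "j + k0"] by (simp add: power_add mult_ac)
  qed
  then obtain S where "(\<lambda>j. u (Suc (j + k0)) - u (j + k0)) sums S" by (auto simp: summable_def)
  then have "(\<lambda>n. \<Sum>j<n. u (Suc j + k0) - u (j + k0)) \<longlonglongrightarrow> S" by (simp add: sums_def)
  then have "(\<lambda>n. u (n + k0) - u (0 + k0)) \<longlonglongrightarrow> S"
    by (subst (asm) sum_lessThan_telescope)
  then have "(\<lambda>n. u (n + k0) - u (0 + k0) + u k0) \<longlonglongrightarrow> S + u k0" by (intro tendsto_intros)
  then have "(\<lambda>n. u (n + k0)) \<longlonglongrightarrow> S + u k0" by simp
  then have L: "u \<longlonglongrightarrow> S + u k0" by (rule LIMSEQ_offset)
  then show "convergent u" by (auto simp: convergent_def)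
  assume k: "k0 \<le> k"
  \<comment> \<open>The induction carries the exact partial sum of the geometric series; a bound by
    the full series would not reproduce itself.\<close>
  have "cmod (u (m + k) - u k) \<le> A * q ^ k / (1 - q) - A * q ^ (m + k) / (1 - q)" for m
  proof (induction m)
    case (Suc m)
    have "cmod (u (Suc m + k) - u k) \<le> cmod (u (Suc (m + k)) - u (m + k)) + cmod (u (m + k) - u k)"
      using norm_triangle_ineq[of "u (Suc (m + k)) - u (m + k)" "u (m + k) - u k"] by simp
    also have "\<dots> \<le> A * q ^ (m + k) + (A * q ^ k / (1 - q) - A * q ^ (m + k) / (1 - q))"
      using inc[of "m + k"] k Suc by (intro add_mono) auto
    also have "\<dots> = A * q ^ k / (1 - q) - A * q ^ (Suc m + k) / (1 - q)"
    proof -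
      have "x + (b / (1 - q) - x / (1 - q)) = b / (1 - q) - q * x / (1 - q)" for x b
        using q by (simp add: divide_simps) (simp add: algebra_simps)
      from this[of "A * q ^ (m + k)" "A * q ^ k"] show ?thesis by (simp add: mult_ac)
    qed
    finally show ?case .
  qed simp
  moreover have "0 \<le> A * q ^ (m + k) / (1 - q)" for m using A0 q by simp
  ultimately have "cmod (u (m + k) - u k) \<le> A * q ^ k / (1 - q)" for m
    by (meson diff_ge_0_iff_ge diff_le_eq le_add_same_cancel1 order_trans)
  moreover have "(\<lambda>m. cmod (u (m + k) - u k)) \<longlonglongrightarrow> cmod (lim u - u k)"
    using L limI[OF L] by (intro tendsto_intros LIMSEQ_ignore_initial_segment) auto
  ultimately show "cmod (lim u - u k) \<le> A * q ^ k / (1 - q)"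
    by (intro LIMSEQ_le_const2) auto
qed

section \<open>Rounding squares to dyadic grids, and chaining\<close>

text \<open>Closeness in the supremum distance on the three-dimensional parameter space, since
  rounding acts on each coordinate separately.\<close>

definition near :: "real \<Rightarrow> (real^2) \<times> real \<Rightarrow> (real^2) \<times> real \<Rightarrow> bool" where
  "near h p q \<longleftrightarrow> \<bar>fst p $ 1 - fst q $ 1\<bar> \<le> h \<and> \<bar>fst p $ 2 - fst q $ 2\<bar> \<le> h \<and> \<bar>snd p - snd q\<bar> \<le> h"

definition gridpt :: "nat \<Rightarrow> int \<times> int \<times> int \<Rightarrow> (real^2) \<times> real" where
  "gridpt k t = (vector [of_int (fst t) / 2 ^ k, of_int (fst (snd t)) / 2 ^ k], of_int (snd (snd t)) / 2 ^ k)"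

text \<open>Rounding down, not to the nearest point: the radius of the rounded square never exceeds
  the original one, so the weight in the increment bounds does not grow, and a nonnegative radius
  stays nonnegative.\<close>

definition gridfloor :: "nat \<Rightarrow> (real^2) \<times> real \<Rightarrow> int \<times> int \<times> int" where
  "gridfloor k p = (\<lfloor>2 ^ k * fst p $ 1\<rfloor>, \<lfloor>2 ^ k * fst p $ 2\<rfloor>, \<lfloor>2 ^ k * snd p\<rfloor>)"

lemma floor_scaled_close:
  fixes a :: real
  shows "of_int \<lfloor>2 ^ k * a\<rfloor> / 2 ^ k \<le> a" "a - of_int \<lfloor>2 ^ k * a\<rfloor> / 2 ^ k \<le> 1 / 2 ^ k"
proof -
  show "of_int \<lfloor>2 ^ k * a\<rfloor> / 2 ^ k \<le> a" by (simp add: divide_le_eq mult.commute)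
  have "2 ^ k * a < of_int \<lfloor>2 ^ k * a\<rfloor> + 1" by linarith
  then show "a - of_int \<lfloor>2 ^ k * a\<rfloor> / 2 ^ k \<le> 1 / 2 ^ k"
    by (metis add.commute add_divide_distrib diff_le_eq less_divide_eq less_imp_le mult.commute zero_less_numeral zero_less_power)
qed

lemma floor_scaled_diff:
  fixes a b :: real
  assumes "\<bar>a - b\<bar> \<le> 1 / 2 ^ k"
  shows "\<bar>of_int \<lfloor>2 ^ k * a\<rfloor> / 2 ^ k - of_int \<lfloor>2 ^ k * b\<rfloor> / 2 ^ k\<bar> \<le> (1 :: real) / 2 ^ k"
proof -
  have "\<bar>2 ^ k * a - 2 ^ k * b\<bar> \<le> 1"
  proof -
    have "\<bar>2 ^ k * a - 2 ^ k * b\<bar> = 2 ^ k * \<bar>a - b\<bar>" by (simp add: abs_mult flip: right_diff_distrib)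
    also have "\<dots> \<le> 2 ^ k * (1 / 2 ^ k)" using assms by (intro mult_left_mono) auto
    finally show ?thesis by simp
  qed
  then have "\<bar>\<lfloor>2 ^ k * a\<rfloor> - \<lfloor>2 ^ k * b\<rfloor>\<bar> \<le> 1" by linarith
  then have "\<bar>of_int \<lfloor>2 ^ k * a\<rfloor> - of_int \<lfloor>2 ^ k * b\<rfloor>\<bar> \<le> (1 :: real)" by linarith
  then have "\<bar>of_int \<lfloor>2 ^ k * a\<rfloor> - of_int \<lfloor>2 ^ k * b\<rfloor>\<bar> / 2 ^ k \<le> (1 :: real) / 2 ^ k"
    by (intro divide_right_mono) auto
  then show ?thesis by (simp add: abs_divide flip: diff_divide_distrib)
qed

lemma floor_scaled_step:
  fixes a :: real
  shows "\<bar>of_int \<lfloor>2 ^ Suc k * a\<rfloor> / 2 ^ Suc k - of_int (2 * \<lfloor>2 ^ k * a\<rfloor>) / 2 ^ Suc k\<bar> \<le> (1 :: real) / 2 ^ Suc k"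
proof -
  have "\<lfloor>2 ^ Suc k * a\<rfloor> = \<lfloor>2 * (2 ^ k * a)\<rfloor>" by (simp add: mult_ac)
  then have "\<bar>\<lfloor>2 ^ Suc k * a\<rfloor> - 2 * \<lfloor>2 ^ k * a\<rfloor>\<bar> \<le> 1" by linarith
  then have "\<bar>of_int \<lfloor>2 ^ Suc k * a\<rfloor> - of_int (2 * \<lfloor>2 ^ k * a\<rfloor>)\<bar> \<le> (1 :: real)" by linarith
  then have "\<bar>of_int \<lfloor>2 ^ Suc k * a\<rfloor> - of_int (2 * \<lfloor>2 ^ k * a\<rfloor>)\<bar> / 2 ^ Suc k \<le> (1 :: real) / 2 ^ Suc k"
    by (intro divide_right_mono) auto
  then show ?thesis by (simp add: abs_divide flip: diff_divide_distrib del: power_Suc)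
qed

lemma near_gridfloor: "near (1 / 2 ^ k) (gridpt k (gridfloor k p)) p"
  using floor_scaled_close[where a="fst p $ 1" and k=k] floor_scaled_close[where a="fst p $ 2" and k=k]
    floor_scaled_close[where a="snd p" and k=k]
  by (auto simp: near_def gridpt_def gridfloor_def)

lemma near_gridfloors:
  "near (1 / 2 ^ k) p q \<Longrightarrow> near (1 / 2 ^ k) (gridpt k (gridfloor k p)) (gridpt k (gridfloor k q))"
  using floor_scaled_diff[where k=k]
  by (auto simp: near_def gridpt_def gridfloor_def)

text \<open>The floor of \<open>2 * y\<close> exceeds twice the floor of \<open>y\<close> by 0 or 1,
  so two successive roundings of a point are neighbours in the finer grid.\<close>

lemma near_gridfloor_Suc:
  "near (1 / 2 ^ Suc k) (gridpt (Suc k) (gridfloor (Suc k) p)) (gridpt k (gridfloor k p))"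
  using floor_scaled_step[where a="fst p $ 1" and k=k] floor_scaled_step[where a="fst p $ 2" and k=k]
    floor_scaled_step[where a="snd p" and k=k]
  by (auto simp: near_def gridpt_def gridfloor_def)

text \<open>The grids are nested. The step from one level to the next is thus an increment between
  two points of the finer grid, to which the hypothesis of the chaining applies.\<close>

lemma gridpt_Suc:
  "gridpt k t = gridpt (Suc k) (2 * fst t, 2 * fst (snd t), 2 * snd (snd t))"
  by (simp add: gridpt_def)

lemma snd_gridfloor: "snd (gridpt k (gridfloor k p)) \<le> snd p"
  using floor_scaled_close[where a="snd p" and k=k] by (auto simp: gridpt_def gridfloor_def)

lemma snd_gridfloor_nonneg: "0 \<le> snd p \<Longrightarrow> 0 \<le> snd (gridpt k (gridfloor k p))"
  by (auto simp: gridpt_def gridfloor_def)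

lemma dyadic_bracket:
  fixes d :: real
  assumes "0 < d" "d \<le> 1 / 2 ^ k0"
  obtains k where "k0 \<le> k" "d \<le> 1 / 2 ^ k" "1 / 2 ^ Suc k < d"
proof -
  have "\<exists>n. (1 / 2) ^ n < d" using real_arch_pow_inv[of d "1/2"] assms by auto
  then obtain n where n: "1 / 2 ^ n < d" by (auto simp: power_divide)
  define m where "m = (LEAST n. 1 / 2 ^ n < d)"
  have m: "1 / 2 ^ m < d" unfolding m_def by (rule LeastI[of _ n]) (rule n)
  \<comment> \<open>This also makes \<open>m - 1\<close> a true predecessor, so that the minimality
    of \<open>m\<close> can be applied to it.\<close>
  have mk: "m > k0"
  proof (rule ccontr)
    assume "\<not> m > k0"
    then have "(1 :: real) / 2 ^ k0 \<le> 1 / 2 ^ m" by (intro divide_left_mono power_increasing) auto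
    with m assms show False by linarith
  qed
  have "\<not> 1 / 2 ^ (m - 1) < d"
    using not_less_Least[of "m - 1" "\<lambda>n. 1 / 2 ^ n < d"] mk unfolding m_def[symmetric] by auto
  with m mk show ?thesis by (intro that[of "m - 1"]) auto
qed

text \<open>Two points at distance about \<open>1 / 2 ^ k\<close> are compared through their
  roundings at level \<open>k\<close>, and the tails are geometric series. Roundings may leave
  \<open>T\<close>, hence the larger set \<open>T'\<close>. As \<open>T\<close> need not be
  connected, points farther apart than \<open>1 / 2 ^ k0\<close> are not joined by a chain: both are
  shrunk to radius zero, where \<open>f\<close> vanishes, and \<open>down\<close> keeps the path in
  \<open>T\<close>.\<close>

lemma dyadic_chaining:
  fixes f :: "(real^2) \<times> real \<Rightarrow> complex"
  assumes \<alpha>: "0 < \<alpha>" and W: "0 \<le> W"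
    and inc: "\<And>k t t'. k0 \<le> k \<Longrightarrow> gridpt k t \<in> T' \<Longrightarrow> gridpt k t' \<in> T' \<Longrightarrow>
      near (1 / 2 ^ k) (gridpt k t) (gridpt k t') \<Longrightarrow>
      cmod (f (gridpt k t) - f (gridpt k t'))
        \<le> W * (max (snd (gridpt k t)) (snd (gridpt k t')) / 2 ^ k) powr \<alpha>"
    and fl: "\<And>p k. p \<in> T \<Longrightarrow> k0 \<le> k \<Longrightarrow> gridpt k (gridfloor k p) \<in> T'"
    and rng: "\<And>p. p \<in> T \<Longrightarrow> 0 \<le> snd p \<and> snd p \<le> 1"
    and zero: "\<And>x. f (x, 0) = 0"
    and down: "\<And>x r s. (x, r) \<in> T \<Longrightarrow> 0 \<le> s \<Longrightarrow> s \<le> r \<Longrightarrow> (x, s) \<in> T"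
  defines "g \<equiv> \<lambda>p. lim (\<lambda>k. f (gridpt k (gridfloor k p)))"
    and "c \<equiv> 2 powr \<alpha> * (1 + 2 / (1 - 2 powr (- \<alpha>)))"
  shows "p \<in> T \<Longrightarrow> (\<lambda>k. f (gridpt k (gridfloor k p))) \<longlonglongrightarrow> g p"
    and "p \<in> T \<Longrightarrow> q \<in> T \<Longrightarrow> 0 < d \<Longrightarrow> near d p q \<Longrightarrow>
      cmod (g p - g q) \<le> W * c * 2 ^ (k0 + 1) * 2 powr (real k0 * \<alpha>) * (max (snd p) (snd q) * d) powr \<alpha>"
proof -
  define Q where "Q = (2 :: real) powr (- \<alpha>)"
  have Q: "0 < Q" "Q < 1" using \<alpha> by (auto simp: Q_def powr_less_one)
  have Qp: "(r / 2 ^ k) powr \<alpha> = r powr \<alpha> * Q ^ k" if "0 \<le> r" for r :: real and k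
  proof -
    have "(2 ^ k) powr \<alpha> = (2 powr \<alpha>) ^ k"
      by (simp add: powr_powr mult.commute flip: powr_realpow)
    moreover have "(r / 2 ^ k) powr \<alpha> = r powr \<alpha> / (2 ^ k) powr \<alpha>" using that by (subst powr_divide) auto
    ultimately show ?thesis by (simp add: Q_def powr_minus divide_inverse power_inverse)
  qed
  have step: "cmod (f (gridpt (Suc k) (gridfloor (Suc k) p)) - f (gridpt k (gridfloor k p)))
      \<le> (W * snd p powr \<alpha>) * Q ^ k" if p: "p \<in> T" and k: "k0 \<le> k" for p k
  proof -
    obtain t where t: "gridpt k (gridfloor k p) = gridpt (Suc k) t" using gridpt_Suc by metis
    let ?a = "gridpt (Suc k) (gridfloor (Suc k) p)"
    have "cmod (f ?a - f (gridpt (Suc k) t)) \<le> W * (max (snd ?a) (snd (gridpt (Suc k) t)) / 2 ^ Suc k) powr \<alpha>"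
      using fl[OF p, of k] fl[OF p, of "Suc k"] near_gridfloor_Suc[of k p] k t
      by (intro inc) auto
    also have "\<dots> \<le> W * (snd p / 2 ^ Suc k) powr \<alpha>"
      using snd_gridfloor[of "Suc k" p] snd_gridfloor[of k p] t \<alpha> W rng[OF p]
        snd_gridfloor_nonneg[of p "Suc k"]
      by (intro mult_left_mono powr_mono2 divide_right_mono) (auto simp: max_def)
    also have "\<dots> = W * snd p powr \<alpha> * Q ^ Suc k" using Qp[of "snd p" "Suc k"] rng[OF p] by simp
    also have "\<dots> \<le> W * snd p powr \<alpha> * Q ^ k"
      using Q W by (intro mult_left_mono power_decreasing) auto
    finally show ?thesis using t by simp
  qed
  show conv: "(\<lambda>k. f (gridpt k (gridfloor k p))) \<longlonglongrightarrow> g p" if p: "p \<in> T" for p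
    using geometric_increments_limit(1)[OF Q, of k0 "\<lambda>k. f (gridpt k (gridfloor k p))", OF step[OF p]]
    unfolding g_def by (simp add: convergent_LIMSEQ_iff)
  have app: "cmod (g p - f (gridpt k (gridfloor k p))) \<le> W * snd p powr \<alpha> * Q ^ k / (1 - Q)"
    if p: "p \<in> T" and k: "k0 \<le> k" for p k
    using geometric_increments_limit(2)[OF Q, of k0 "\<lambda>k. f (gridpt k (gridfloor k p))", OF step[OF p] k]
    unfolding g_def .
  \<comment> \<open>One grid increment and two tails give \<open>1 + 2 / (1 - Q)\<close>. The factor
    \<open>2 powr \<alpha>\<close> pays for replacing \<open>1 / 2 ^ k\<close> by
    \<open>2 * d\<close>.\<close>
  have c: "c = 2 powr \<alpha> * (1 + 2 / (1 - Q))" unfolding c_def Q_def ..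
  have c1: "c \<ge> 0" unfolding c using Q by simp
  have loc: "cmod (g p - g q) \<le> W * c * (max (snd p) (snd q) * d) powr \<alpha>"
    if p: "p \<in> T" and q: "q \<in> T" and d: "0 < d" "d \<le> 1 / 2 ^ k0" and n: "near d p q" for p q d
  proof -
    obtain k where k: "k0 \<le> k" "d \<le> 1 / 2 ^ k" "1 / 2 ^ Suc k < d"
      using dyadic_bracket[OF d] .
    define R where "R = max (snd p) (snd q)"
    have R: "0 \<le> R" "snd p \<le> R" "snd q \<le> R" "0 \<le> snd p" "0 \<le> snd q"
      using rng[OF p] rng[OF q] by (auto simp: R_def)
    let ?p = "gridpt k (gridfloor k p)" and ?q = "gridpt k (gridfloor k q)"
    have n': "near (1 / 2 ^ k) p q" using n k by (auto simp: near_def)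
    have 1: "cmod (f ?p - f ?q) \<le> W * (R powr \<alpha> * Q ^ k)"
    proof -
      have "cmod (f ?p - f ?q) \<le> W * (max (snd ?p) (snd ?q) / 2 ^ k) powr \<alpha>"
        using fl[OF p k(1)] fl[OF q k(1)] near_gridfloors[OF n'] k by (intro inc) auto
      also have "\<dots> \<le> W * (R / 2 ^ k) powr \<alpha>"
        using snd_gridfloor[of k p] snd_gridfloor[of k q] \<alpha> W R snd_gridfloor_nonneg[of p k]
        by (intro mult_left_mono powr_mono2 divide_right_mono) (auto simp: max_def)
      finally show ?thesis using Qp[OF R(1)] by simp
    qed
    have ap: "cmod (g s - f (gridpt k (gridfloor k s))) \<le> W * (R powr \<alpha> * Q ^ k) * (1 / (1 - Q))"
      if "s \<in> T" "snd s \<le> R" for s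
    proof -
      have "cmod (g s - f (gridpt k (gridfloor k s))) \<le> W * snd s powr \<alpha> * Q ^ k / (1 - Q)"
        using app that k by auto
      also have "\<dots> \<le> W * R powr \<alpha> * Q ^ k / (1 - Q)"
        using that rng[of s] Q W \<alpha>
        by (intro divide_right_mono mult_right_mono mult_left_mono powr_mono2) auto
      finally show ?thesis by simp
    qed
    have "cmod (g p - g q) = cmod ((g p - f ?p) + (f ?p - f ?q) - (g q - f ?q))" by simp
    also have "\<dots> \<le> cmod (g p - f ?p) + cmod (f ?p - f ?q) + cmod (g q - f ?q)"
      by (meson norm_triangle_ineq norm_triangle_ineq4 add_mono order_trans order_refl)
    also have "\<dots> \<le> W * (R powr \<alpha> * Q ^ k) * (1 / (1 - Q)) + W * (R powr \<alpha> * Q ^ k)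
        + W * (R powr \<alpha> * Q ^ k) * (1 / (1 - Q))"
      using ap[OF p] ap[OF q] 1 R by (intro add_mono) auto
    also have "\<dots> = W * (1 + 2 / (1 - Q)) * R powr \<alpha> * Q ^ k" by (simp add: field_simps)
    also have "\<dots> \<le> W * (1 + 2 / (1 - Q)) * R powr \<alpha> * (2 powr \<alpha> * d powr \<alpha>)"
    proof -
      have "(1 / 2 ^ k :: real) powr \<alpha> \<le> (2 * d) powr \<alpha>" using k \<alpha> by (intro powr_mono2) auto
      then have "Q ^ k \<le> 2 powr \<alpha> * d powr \<alpha>" using Qp[of 1 k] d by (simp add: powr_mult)
      then show ?thesis using W Q by (intro mult_left_mono) auto
    qed
    also have "\<dots> = W * c * (R * d) powr \<alpha>" using R d by (simp add: c powr_mult)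
    finally show ?thesis unfolding R_def .
  qed
  have gz: "g (x, 0) = 0" if "(x, 0) \<in> T" for x
  proof -
    have "f (gridpt k (gridfloor k (x, 0))) = 0" for k
      using zero[of "fst (gridpt k (gridfloor k (x, 0)))"] by (simp add: gridpt_def gridfloor_def)
    then show ?thesis unfolding g_def by simp
  qed
  \<comment> \<open>The radius grows from zero in steps of length \<open>1 / 2 ^ k0\<close>, each
    within reach of \<open>loc\<close>. As the radius is at most 1, \<open>2 ^ k0\<close> steps are
    enough; \<open>min\<close> stops the path at \<open>r\<close>.\<close>
  have size: "cmod (g p) \<le> 2 ^ k0 * (W * c * snd p powr \<alpha>)" if p: "p \<in> T" for p
  proof -
    obtain x r where pr: "p = (x, r)" by (cases p)
    have r: "0 \<le> r" using rng[OF p] pr by simp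
    define h :: real where "h = 1 / 2 ^ k0"
    have h: "0 < h" by (simp add: h_def)
    have "cmod (g (x, min r (of_nat j * h))) \<le> of_nat j * (W * c * r powr \<alpha>)" for j :: nat
    proof (induction j)
      case 0
      then show ?case using gz[of x] down[of x r 0] p pr r by (simp add: min_def)
    next
      case (Suc j)
      let ?s = "min r (of_nat j * h)" and ?s' = "min r (of_nat (Suc j) * h)"
      have s: "(x, ?s) \<in> T" "(x, ?s') \<in> T"
        using down[of x r] p pr r h by (auto simp: min_def)
      have "cmod (g (x, ?s') - g (x, ?s)) \<le> W * c * (max ?s' ?s * h) powr \<alpha>"
        using loc[OF s(2) s(1), of h] h by (auto simp: near_def h_def min_def field_simps)
      also have "\<dots> \<le> W * c * (r * 1) powr \<alpha>"
      proof -
        have "max ?s' ?s \<le> r" "0 \<le> max ?s' ?s" "h \<le> 1"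
          using r h by (auto simp: h_def le_max_iff_disj)
        then show ?thesis using W c1 \<alpha> h r by (intro mult_left_mono powr_mono2 mult_mono) auto
      qed
      finally have "cmod (g (x, ?s')) \<le> W * c * r powr \<alpha> + cmod (g (x, ?s))"
        using norm_triangle_ineq2[of "g (x, ?s')" "g (x, ?s)"] by simp
      with Suc show ?case by (simp add: algebra_simps)
    qed
    note a = this
    have "r \<le> 1" using rng[OF p] pr by simp
    then show ?thesis using a[of "2 ^ k0"] pr by (simp add: h_def)
  qed
  show "cmod (g p - g q) \<le> W * c * 2 ^ (k0 + 1) * 2 powr (real k0 * \<alpha>) * (max (snd p) (snd q) * d) powr \<alpha>"
    if p: "p \<in> T" and q: "q \<in> T" and d: "0 < d" and n: "near d p q" 
  proof -
    define R where "R = max (snd p) (snd q)"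
    have R: "0 \<le> R" "snd p \<le> R" "snd q \<le> R" "0 \<le> snd p" "0 \<le> snd q"
      using rng[OF p] rng[OF q] by (auto simp: R_def)
    show ?thesis
    proof (cases "d \<le> 1 / 2 ^ k0")
      case True
      have "cmod (g p - g q) \<le> W * c * (R * d) powr \<alpha>" using loc[OF p q d True n] by (simp add: R_def)
      also have "\<dots> \<le> W * c * (R * d) powr \<alpha> * (2 ^ (k0 + 1) * 2 powr (real k0 * \<alpha>))"
      proof -
        have "(1 :: real) \<le> 2 ^ (k0 + 1)" by (rule one_le_power) simp
        moreover have "(1 :: real) \<le> 2 powr (real k0 * \<alpha>)" using \<alpha> by (intro ge_one_powr_ge_zero) auto
        ultimately have "(1 :: real) * 1 \<le> 2 ^ (k0 + 1) * 2 powr (real k0 * \<alpha>)" by (intro mult_mono) auto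
        then show ?thesis using W c1 mult_left_mono[of 1 "2 ^ (k0 + 1) * 2 powr (real k0 * \<alpha>)" "W * c * (R * d) powr \<alpha>"]
          by simp
      qed
      finally show ?thesis by (simp add: R_def mult_ac)
    next
      case False
      \<comment> \<open>Beyond the local range the two values are bounded separately, whence
        \<open>2 ^ (k0 + 1)\<close>. The factor \<open>2 powr (real k0 * \<alpha>)\<close> then
        makes up for \<open>d powr \<alpha>\<close>, because \<open>d > 1 / 2 ^ k0\<close>.\<close>
      have "cmod (g p - g q) \<le> cmod (g p) + cmod (g q)" by (rule norm_triangle_ineq4)
      also have "\<dots> \<le> 2 ^ k0 * (W * c * R powr \<alpha>) + 2 ^ k0 * (W * c * R powr \<alpha>)"
      proof -
        have "2 ^ k0 * (W * c * s powr \<alpha>) \<le> 2 ^ k0 * (W * c * R powr \<alpha>)" if "0 \<le> s" "s \<le> R" for s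
          using that W c1 \<alpha> by (intro mult_left_mono powr_mono2) auto
        then show ?thesis using size[OF p] size[OF q] R by (meson add_mono order_trans)
      qed
      also have "\<dots> = W * c * 2 ^ (k0 + 1) * R powr \<alpha> * 1" by simp
      also have "\<dots> \<le> W * c * 2 ^ (k0 + 1) * R powr \<alpha> * (2 powr (real k0 * \<alpha>) * d powr \<alpha>)"
      proof -
        have "1 \<le> 2 ^ k0 * d" using False by (simp add: field_simps)
        then have "1 \<le> (2 ^ k0 * d) powr \<alpha>" using \<alpha> by (intro ge_one_powr_ge_zero) auto
        also have "\<dots> = (2 ^ k0) powr \<alpha> * d powr \<alpha>" using d by (simp add: powr_mult)
        also have "(2 ^ k0 :: real) powr \<alpha> = 2 powr (real k0 * \<alpha>)" by (simp add: powr_powr flip: powr_realpow)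
        finally show ?thesis using W c1 by (intro mult_left_mono) auto
      qed
      finally show ?thesis using R d by (simp add: R_def powr_mult mult_ac)
    qed
  qed
qed

section \<open>From moments of increments to one random constant\<close>

definition grid_edges :: "((real^2) \<times> real) set \<Rightarrow> nat \<Rightarrow> ((int \<times> int \<times> int) \<times> (int \<times> int \<times> int)) set" where
  "grid_edges T k = {(t, t'). gridpt k t \<in> T \<and> gridpt k t' \<in> T \<and> near (1 / 2 ^ k) (gridpt k t) (gridpt k t')}"

lemma scaled_int_le_1: "\<bar>of_int a / 2 ^ k - of_int b / 2 ^ k\<bar> \<le> (1 :: real) / 2 ^ k \<Longrightarrow> b - a \<in> {-1..1}"
proof -
  assume "\<bar>of_int a / 2 ^ k - of_int b / 2 ^ k\<bar> \<le> (1 :: real) / 2 ^ k"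
  then have "\<bar>of_int a - of_int b\<bar> / 2 ^ k \<le> (1 :: real) / 2 ^ k"
    by (simp add: abs_divide flip: diff_divide_distrib)
  then have "\<bar>of_int a - of_int b\<bar> \<le> (1 :: real)" by (simp add: divide_le_cancel)
  then show ?thesis by auto
qed

text \<open>Here \<open>486 = 3 * 3 * 2 * 27\<close>: at most \<open>3 * b * 2 ^ k\<close> values
  for either coordinate of the centre, \<open>2 * 2 ^ k\<close> for the radius, and 27 neighbours.
  What matters later is the growth \<open>8 ^ k\<close>.\<close>

lemma grid_edges_card:
  assumes b: "1 \<le> (b :: nat)"
    and T: "\<And>p. p \<in> T \<Longrightarrow> \<bar>fst p $ 1\<bar> \<le> b \<and> \<bar>fst p $ 2\<bar> \<le> b \<and> snd p \<in> {0..1}"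
  shows "finite (grid_edges T k)" "card (grid_edges T k) \<le> 486 * b\<^sup>2 * 8 ^ k"
proof -
  define N :: int where "N = int b * 2 ^ k"
  \<comment> \<open>An edge is recorded as its first endpoint together with the displacement, whose
    entries are -1, 0 or 1.\<close>
  define X where "X = ({-N..N} \<times> {-N..N} \<times> {0..(2::int) ^ k}) \<times> ({-1..1::int} \<times> {-1..1::int} \<times> {-1..1::int})"
  define F :: "(int \<times> int \<times> int) \<times> (int \<times> int \<times> int) \<Rightarrow> (int \<times> int \<times> int) \<times> (int \<times> int \<times> int)" where
    "F = (\<lambda>((a, b, c), (a', b', c')). ((a, b, c), (a + a', b + b', c + c')))"
  have "grid_edges T k \<subseteq> F ` X"
  proof
    fix e assume e: "e \<in> grid_edges T k"
    obtain a1 a2 a3 b1 b2 b3 where e': "e = ((a1, a2, a3), (b1, b2, b3))" by (metis prod_cases3 surj_pair)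
    have n: "\<bar>of_int a1 / 2 ^ k - of_int b1 / 2 ^ k\<bar> \<le> (1 :: real) / 2 ^ k"
      "\<bar>of_int a2 / 2 ^ k - of_int b2 / 2 ^ k\<bar> \<le> (1 :: real) / 2 ^ k"
      "\<bar>of_int a3 / 2 ^ k - of_int b3 / 2 ^ k\<bar> \<le> (1 :: real) / 2 ^ k"
      using e by (auto simp: grid_edges_def e' near_def gridpt_def)
    have t: "\<bar>of_int a1 / 2 ^ k\<bar> \<le> real b" "\<bar>of_int a2 / 2 ^ k\<bar> \<le> real b" "0 \<le> of_int a3 / (2 ^ k :: real)" "of_int a3 / 2 ^ k \<le> (1 :: real)"
      using e T[of "gridpt k (a1, a2, a3)"] by (auto simp: grid_edges_def e' gridpt_def)
    have N: "a \<in> {-N..N}" if "\<bar>of_int a / 2 ^ k\<bar> \<le> real b" for a :: int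
    proof -
      have "\<bar>of_int a\<bar> \<le> real b * 2 ^ k" using that by (simp add: abs_divide divide_le_eq)
      then have "of_int \<bar>a\<bar> \<le> (of_int N :: real)" by (simp add: N_def)
      then have "\<bar>a\<bar> \<le> N" by (simp only: of_int_le_iff)
      then show ?thesis by auto
    qed
    have "a3 \<in> {0..2 ^ k}"
    proof -
      have "0 \<le> a3"
        using t(3) divide_neg_pos[of "of_int a3 :: real" "2 ^ k"] by (cases "a3 < 0") auto
      moreover have "of_int a3 \<le> (of_int (2 ^ k) :: real)" using t(4) by (simp add: divide_le_eq)
      then have "a3 \<le> 2 ^ k" by (simp only: of_int_le_iff)
      ultimately show ?thesis by simp
    qed
    then have "((a1, a2, a3), (b1 - a1, b2 - a2, b3 - a3)) \<in> X"
      unfolding X_def using N[OF t(1)] N[OF t(2)] scaled_int_le_1[OF n(1)] scaled_int_le_1[OF n(2)] scaled_int_le_1[OF n(3)]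
      by blast
    moreover have "e = F ((a1, a2, a3), (b1 - a1, b2 - a2, b3 - a3))" by (simp add: F_def e')
    ultimately show "e \<in> F ` X" by blast
  qed
  moreover have fin: "finite X" unfolding X_def by simp
  ultimately show "finite (grid_edges T k)" by (meson finite_imageI finite_subset)
  have "card (grid_edges T k) \<le> card X"
    using \<open>grid_edges T k \<subseteq> F ` X\<close> fin by (meson card_image_le card_mono finite_imageI order_trans)
  also have "card X = nat (2 * N + 1) * nat (2 * N + 1) * (2 ^ k + 1) * 27"
    by (simp add: X_def card_cartesian_product nat_add_distrib nat_power_eq algebra_simps)
  also have "nat (2 * N + 1) = 2 * b * 2 ^ k + 1" by (simp add: N_def nat_add_distrib nat_mult_distrib nat_power_eq)
  also have "(2 * b * 2 ^ k + 1) * (2 * b * 2 ^ k + 1) * (2 ^ k + 1) * 27 \<le> (3 * b * 2 ^ k) * (3 * b * 2 ^ k) * (2 * 2 ^ k) * 27"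
  proof -
    have "1 \<le> b * 2 ^ k" using b by simp
    then have "2 * b * 2 ^ k + 1 \<le> 3 * b * 2 ^ k" by linarith
    moreover have "(2 :: nat) ^ k + 1 \<le> 2 * 2 ^ k" by simp
    ultimately show ?thesis by (intro mult_le_mono le_refl)
  qed
  also have "\<dots> = 486 * b\<^sup>2 * ((2 ^ k) * (2 ^ k) * (2 ^ k))" by (simp add: power2_eq_square)
  also have "(2 ^ k) * (2 ^ k) * (2 ^ k) = (8 ^ k :: nat)" by (simp flip: power_mult_distrib)
  finally show "card (grid_edges T k) \<le> 486 * b\<^sup>2 * 8 ^ k" .
qed

text \<open>The number 4 exceeds the dimension 3 of the parameter space. An edge of level
  \<open>k\<close> adds at most \<open>C / 16 ^ k\<close> to the expectation of \<open>Z\<close>,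
  there are of order \<open>8 ^ k\<close> such edges, and the sum over the levels converges. Every
  term of \<open>Z\<close> then bounds its own increment after taking a root of order
  \<open>P\<close>.\<close>

lemma kolmogorov_random_constant:
  fixes Y :: "(real^2) \<times> real \<Rightarrow> 'a \<Rightarrow> complex"
  assumes P: "0 < (P :: nat)" and \<alpha>: "real P * (\<gamma> - \<alpha>) = 4" and C: "0 \<le> C"
    and T: "\<And>p. p \<in> T \<Longrightarrow> \<bar>fst p $ 1\<bar> \<le> b \<and> \<bar>fst p $ 2\<bar> \<le> b \<and> snd p \<in> {0..1}"
    and meas: "\<And>p. p \<in> T \<Longrightarrow> Y p \<in> borel_measurable M"
    and zero: "\<And>x \<omega>. Y (x, 0) \<omega> = 0"
    and mom: "\<And>p q k. p \<in> T \<Longrightarrow> q \<in> T \<Longrightarrow> k0 \<le> k \<Longrightarrow> near (1 / 2 ^ k) p q \<Longrightarrow>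
      (\<integral>\<^sup>+\<omega>. ennreal (cmod (Y p \<omega> - Y q \<omega>) ^ P) \<partial>M)
        \<le> ennreal (C * (max (snd p) (snd q) / 2 ^ k) powr (P * \<gamma>))"
  obtains Z :: "'a \<Rightarrow> ennreal" where "Z \<in> borel_measurable M" "AE \<omega> in M. Z \<omega> < \<infinity>"
    "\<And>\<omega> k t t'. Z \<omega> < \<infinity> \<Longrightarrow> k0 \<le> k \<Longrightarrow> gridpt k t \<in> T \<Longrightarrow> gridpt k t' \<in> T \<Longrightarrow>
      near (1 / 2 ^ k) (gridpt k t) (gridpt k t') \<Longrightarrow>
      cmod (Y (gridpt k t) \<omega> - Y (gridpt k t') \<omega>)
        \<le> enn2real (Z \<omega>) powr (1 / P) * (max (snd (gridpt k t)) (snd (gridpt k t')) / 2 ^ k) powr \<alpha>"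
proof -
  obtain b' :: nat where b': "b \<le> b'" "1 \<le> b'"
    by (metis le_max_iff_disj real_arch_simple max_def nat_le_linear of_nat_mono order_trans)
  have T': "\<bar>fst p $ 1\<bar> \<le> b' \<and> \<bar>fst p $ 2\<bar> \<le> b' \<and> snd p \<in> {0..1}" if "p \<in> T" for p
    using T[OF that] b' by linarith
  note gc = grid_edges_card[OF b'(2) T']
  have fin: "finite (grid_edges T k)" for k using gc(1) by blast
  \<comment> \<open>The weight contains the radius. Between two squares of radius zero it is 0;
    since \<open>inverse 0 = 0\<close>, such an edge adds nothing to \<open>Z\<close>, and its
    increment is known to vanish from \<open>zero\<close>.\<close>
  define w where "w k e = (max (snd (gridpt k (fst e))) (snd (gridpt k (snd e))) / 2 ^ k) powr (P * \<alpha>)"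
    for k and e :: "(int \<times> int \<times> int) \<times> (int \<times> int \<times> int)"
  define V where "V k e \<omega> = ennreal (inverse (w k e)) * ennreal (cmod (Y (gridpt k (fst e)) \<omega> - Y (gridpt k (snd e)) \<omega>) ^ P)"
    for k e \<omega>
  define Z where "Z \<omega> = (\<Sum>k. \<Sum>e\<in>grid_edges T (k + k0). V (k + k0) e \<omega>)" for \<omega>
  have mY: "Y (gridpt k (fst e)) \<in> borel_measurable M" "Y (gridpt k (snd e)) \<in> borel_measurable M"
    if "e \<in> grid_edges T k" for k e
    using that meas[of "gridpt k (fst e)"] meas[of "gridpt k (snd e)"] by (simp_all add: grid_edges_def split: prod.splits)
  have mV: "V k e \<in> borel_measurable M" if "e \<in> grid_edges T k" for k e
    unfolding V_def using mY[OF that] by measurable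
  have mS: "(\<lambda>\<omega>. \<Sum>e\<in>grid_edges T k. V k e \<omega>) \<in> borel_measurable M" for k
    using mV by (intro borel_measurable_sum) auto
  have mZ: "Z \<in> borel_measurable M"
    unfolding Z_def[abs_def] using mS by (intro borel_measurable_suminf_order) auto
  have EV: "(\<integral>\<^sup>+\<omega>. V k e \<omega> \<partial>M) \<le> ennreal (C / 16 ^ k)" if e: "e \<in> grid_edges T k" and k: "k0 \<le> k" for k e
  proof -
    define R where "R = max (snd (gridpt k (fst e))) (snd (gridpt k (snd e)))"
    have eT: "gridpt k (fst e) \<in> T" "gridpt k (snd e) \<in> T" "near (1 / 2 ^ k) (gridpt k (fst e)) (gridpt k (snd e))"
      using e by (auto simp: grid_edges_def)
    have R: "0 \<le> R" "R \<le> 1" using T[OF eT(1)] T[OF eT(2)] by (auto simp: R_def)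
    have "(\<integral>\<^sup>+\<omega>. V k e \<omega> \<partial>M) = ennreal (inverse (w k e)) * (\<integral>\<^sup>+\<omega>. ennreal (cmod (Y (gridpt k (fst e)) \<omega> - Y (gridpt k (snd e)) \<omega>) ^ P) \<partial>M)"
      unfolding V_def using mY[OF e] by (intro nn_integral_cmult) measurable
    also have "\<dots> \<le> ennreal (inverse (w k e)) * ennreal (C * (R / 2 ^ k) powr (P * \<gamma>))"
      using mom[OF eT(1,2) k eT(3)] by (intro mult_left_mono) (auto simp: R_def)
    also have "\<dots> = ennreal (inverse (w k e) * (C * (R / 2 ^ k) powr (P * \<gamma>)))"
      using C by (simp add: ennreal_mult w_def)
    also have "\<dots> \<le> ennreal (C / 16 ^ k)"
    proof (cases "R = 0")
      case True
      then show ?thesis using C by (simp add: w_def R_def)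
    next
      case False
      have "inverse (w k e) * (C * (R / 2 ^ k) powr (P * \<gamma>)) = C * (R / 2 ^ k) powr (P * \<gamma> - P * \<alpha>)"
        by (simp add: w_def flip: R_def) (simp add: powr_diff divide_inverse)
      also have "P * \<gamma> - P * \<alpha> = 4" using \<alpha> by (simp add: algebra_simps)
      also have "C * (R / 2 ^ k) powr 4 \<le> C * (1 / 2 ^ k) powr 4"
        using R C by (intro mult_left_mono powr_mono2 divide_right_mono) auto
      also have "(1 / 2 ^ k :: real) powr 4 = 1 / 16 ^ k"
        by (simp add: power_divide power_mult_distrib[symmetric] flip: power_mult power_mult[of 2 4])
           (simp add: power_mult power_mult[of 2 4 k, simplified] mult.commute[of k])
      finally show ?thesis by (intro ennreal_leI) simp
    qed
    finally show ?thesis .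
  qed
  have "(\<integral>\<^sup>+\<omega>. Z \<omega> \<partial>M) = (\<Sum>k. \<integral>\<^sup>+\<omega>. (\<Sum>e\<in>grid_edges T (k + k0). V (k + k0) e \<omega>) \<partial>M)"
    unfolding Z_def using mS by (intro nn_integral_suminf) auto
  also have "\<dots> \<le> (\<Sum>k. ennreal (486 * b'\<^sup>2 * C * (1 / 2) ^ k))"
  proof (intro suminf_le allI)
    fix k
    have "(\<integral>\<^sup>+\<omega>. (\<Sum>e\<in>grid_edges T (k + k0). V (k + k0) e \<omega>) \<partial>M) = (\<Sum>e\<in>grid_edges T (k + k0). \<integral>\<^sup>+\<omega>. V (k + k0) e \<omega> \<partial>M)"
      using mV by (intro nn_integral_sum) auto
    also have "\<dots> \<le> (\<Sum>e\<in>grid_edges T (k + k0). ennreal (C / 16 ^ (k + k0)))"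
      using EV by (intro sum_mono) auto
    also have "\<dots> = ennreal (real (card (grid_edges T (k + k0))) * (C / 16 ^ (k + k0)))"
      using C by (simp only: sum_constant ennreal_mult ennreal_of_nat_eq_real_of_nat of_nat_0_le_iff divide_nonneg_nonneg zero_le_power zero_le_numeral)
    also have "\<dots> \<le> ennreal (486 * b'\<^sup>2 * C * (1 / 2) ^ k)"
    proof (intro ennreal_leI)
      have "real (card (grid_edges T (k + k0))) * (C / 16 ^ (k + k0)) \<le> real (486 * b'\<^sup>2 * 8 ^ (k + k0)) * (C / 16 ^ (k + k0))"
        using gc(2)[where k="k + k0"] C by (intro mult_right_mono) (simp_all only: of_nat_le_iff, simp)
      also have "\<dots> = 486 * b'\<^sup>2 * C * (8 / 16) ^ (k + k0)" by (simp only: power_divide) simp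
      also have "\<dots> \<le> 486 * b'\<^sup>2 * C * (1 / 2) ^ k"
        using C by (intro mult_left_mono) (auto intro!: power_decreasing)
      finally show "real (card (grid_edges T (k + k0))) * (C / 16 ^ (k + k0)) \<le> 486 * b'\<^sup>2 * C * (1 / 2) ^ k" .
    qed
    finally show "(\<integral>\<^sup>+\<omega>. (\<Sum>e\<in>grid_edges T (k + k0). V (k + k0) e \<omega>) \<partial>M) \<le> ennreal (486 * b'\<^sup>2 * C * (1 / 2) ^ k)" .
  qed auto
  also have "\<dots> < \<infinity>"
  proof -
    have "summable (\<lambda>k. 486 * b'\<^sup>2 * C * (1 / 2 :: real) ^ k)" by (intro summable_mult summable_geometric) auto
    then have "(\<Sum>k. ennreal (486 * b'\<^sup>2 * C * (1 / 2) ^ k)) = ennreal (\<Sum>k. 486 * b'\<^sup>2 * C * (1 / 2) ^ k)"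
      using C by (intro suminf_ennreal2) auto
    then show ?thesis by simp
  qed
  finally have "AE \<omega> in M. Z \<omega> < \<infinity>" using mZ nn_integral_PInf_AE[of Z M] by (auto simp: less_top)
  moreover have "cmod (Y (gridpt k t) \<omega> - Y (gridpt k t') \<omega>)
        \<le> enn2real (Z \<omega>) powr (1 / P) * (max (snd (gridpt k t)) (snd (gridpt k t')) / 2 ^ k) powr \<alpha>"
    if Zf: "Z \<omega> < \<infinity>" and k: "k0 \<le> k" and t: "gridpt k t \<in> T" "gridpt k t' \<in> T"
      "near (1 / 2 ^ k) (gridpt k t) (gridpt k t')" for \<omega> k t t'
  proof -
    define R where "R = max (snd (gridpt k t)) (snd (gridpt k t')) / 2 ^ k"
    have R0: "0 \<le> R" using T[OF t(1)] by (auto simp: R_def le_max_iff_disj)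
    have e: "(t, t') \<in> grid_edges T k" using t by (auto simp: grid_edges_def)
    define y where "y = cmod (Y (gridpt k t) \<omega> - Y (gridpt k t') \<omega>)"
    show ?thesis
    proof (cases "R = 0")
      case True
      then have "max (snd (gridpt k t)) (snd (gridpt k t')) = 0" by (simp add: R_def)
      then have "snd (gridpt k t) = 0" "snd (gridpt k t') = 0" using T[OF t(1)] T[OF t(2)]
        by (auto simp: max_def split: if_splits)
      then have "y = 0" using zero[of "fst (gridpt k t)" \<omega>] zero[of "fst (gridpt k t')" \<omega>]
        unfolding y_def by (metis diff_zero norm_zero prod.collapse)
      then show ?thesis by (simp add: y_def)
    next
      case False
      then have R: "0 < R" using R0 by simp
      \<comment> \<open>A single nonnegative term is at most the whole double sum; the levels of
        \<open>Z\<close> are numbered from \<open>k0\<close>, so level \<open>k\<close> is its term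
        \<open>k - k0\<close>.\<close>
      have "V k (t, t') \<omega> \<le> (\<Sum>e\<in>grid_edges T (k - k0 + k0). V (k - k0 + k0) e \<omega>)"
        using e k fin[of k] member_le_sum[of "(t, t')" "grid_edges T k" "\<lambda>e. V k e \<omega>"] by simp
      also have "\<dots> \<le> Z \<omega>" unfolding Z_def
        by (rule order_trans[OF _ sum_le_suminf[of _ "{k - k0}"]]) auto
      finally have "V k (t, t') \<omega> \<le> Z \<omega>" .
      moreover have "V k (t, t') \<omega> = ennreal (y ^ P / R powr (P * \<alpha>))"
        by (simp add: V_def w_def y_def R_def divide_inverse ennreal_mult mult.commute)
      ultimately have "ennreal (y ^ P / R powr (P * \<alpha>)) \<le> ennreal (enn2real (Z \<omega>))"
        using Zf by simp
      then have "y ^ P / R powr (P * \<alpha>) \<le> enn2real (Z \<omega>)" by (simp add: ennreal_le_iff)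
      then have 1: "y ^ P \<le> enn2real (Z \<omega>) * R powr (P * \<alpha>)" using R by (simp add: divide_le_eq)
      have "y = (y ^ P) powr (1 / P)"
        using P by (cases "y = 0") (simp_all add: y_def powr_powr flip: powr_realpow)
      also have "\<dots> \<le> (enn2real (Z \<omega>) * R powr (P * \<alpha>)) powr (1 / P)"
        using 1 by (intro powr_mono2) (auto simp: y_def)
      also have "\<dots> = enn2real (Z \<omega>) powr (1 / P) * R powr \<alpha>"
        using P by (simp add: powr_mult powr_powr)
      finally show ?thesis by (simp add: y_def R_def)
    qed
  qed
  ultimately show ?thesis using that[of Z] mZ by blast
qed

section \<open>Continuous modifications indexed by squares\<close>

text \<open>Squares with a margin \<open>\<kappa>\<close> around them. By compactness each element
  of \<open>squares D\<close> has some positive margin, and constants are allowed to depend on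
  it.\<close>

definition inner_squares :: "(real^2) set \<Rightarrow> real \<Rightarrow> ((real^2) \<times> real) set" where
  "inner_squares D \<kappa> = {(x, r). r \<in> {0..1} \<and> (\<forall>y\<in>Q x r. cball y \<kappa> \<subseteq> D)}"

lemma mem_Q: "y \<in> Q x r \<longleftrightarrow> \<bar>y $ 1 - x $ 1\<bar> \<le> r \<and> \<bar>y $ 2 - x $ 2\<bar> \<le> r"
  by (auto simp: Q_def mem_box_cart forall_2)

lemma inner_squares_subset: "0 \<le> \<kappa> \<Longrightarrow> inner_squares D \<kappa> \<subseteq> squares D"
proof (intro subsetI, clarify)
  fix x r assume \<kappa>: "0 \<le> \<kappa>" and p: "(x, r) \<in> inner_squares D \<kappa>"
  then have D: "y \<in> D" if "y \<in> Q x r" for y using that by (force simp: inner_squares_def)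
  moreover have "x \<in> Q x r" using p by (auto simp: mem_Q inner_squares_def)
  ultimately show "(x, r) \<in> squares D" using p by (auto simp: squares_def inner_squares_def)
qed

lemma inner_squares_down: "(x, r) \<in> inner_squares D \<kappa> \<Longrightarrow> 0 \<le> s \<Longrightarrow> s \<le> r \<Longrightarrow> (x, s) \<in> inner_squares D \<kappa>"
  by (auto simp: inner_squares_def mem_Q)

lemma inner_squares_mono: "\<kappa>' \<le> \<kappa> \<Longrightarrow> inner_squares D \<kappa> \<subseteq> inner_squares D \<kappa>'"
  by (force simp: inner_squares_def)

lemma near_Q:
  assumes n: "near h (x, r) (x', r')" and r: "0 \<le> r" and y': "y' \<in> Q x' r'"
  obtains y where "y \<in> Q x r" "dist y y' \<le> 4 * h"
proof -
  \<comment> \<open>The point \<open>y'\<close> is clamped to the square in each coordinate. It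
    moves by at most \<open>2 * h\<close> there, once for the shift of the centre and once for the
    change of the radius; adding the two coordinates bounds the Euclidean distance.\<close>
  define y :: "real^2" where "y = (\<chi> i. max (x $ i - r) (min (x $ i + r) (y' $ i)))"
  have "y \<in> Q x r" using r by (auto simp: y_def mem_Q)
  moreover have "dist y y' \<le> 4 * h"
  proof -
    have c: "\<bar>y $ i - y' $ i\<bar> \<le> 2 * h" if "\<bar>x $ i - x' $ i\<bar> \<le> h" "\<bar>r - r'\<bar> \<le> h" "\<bar>y' $ i - x' $ i\<bar> \<le> r'" for i
      using that r by (auto simp: y_def max_def min_def abs_if split: if_splits)
    have "dist y y' \<le> (\<Sum>i\<in>UNIV. \<bar>(y - y') $ i\<bar>)" unfolding dist_norm by (rule norm_le_l1_cart)
    also have "\<dots> = \<bar>y $ 1 - y' $ 1\<bar> + \<bar>y $ 2 - y' $ 2\<bar>" by (simp add: sum_2)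
    also have "\<dots> \<le> 2 * h + 2 * h" using n y' by (intro add_mono c) (auto simp: near_def mem_Q)
    finally show ?thesis by simp
  qed
  ultimately show ?thesis by (rule that)
qed

lemma inner_squares_near:
  assumes p: "p \<in> inner_squares D \<kappa>" and n: "near h p q" and h: "4 * h \<le> \<kappa> / 2" and q: "snd q \<in> {0..1}"
  shows "q \<in> inner_squares D (\<kappa> / 2)"
proof -
  obtain x r x' r' where pq: "p = (x, r)" "q = (x', r')" by (metis surj_pair)
  have "cball y' (\<kappa> / 2) \<subseteq> D" if y': "y' \<in> Q x' r'" for y'
  proof -
    obtain y where y: "y \<in> Q x r" "dist y y' \<le> 4 * h"
      using near_Q[of h x r x' r' y'] n y' p by (auto simp: pq inner_squares_def)
    have "cball y' (\<kappa> / 2) \<subseteq> cball y \<kappa>"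
    proof
      fix z assume "z \<in> cball y' (\<kappa> / 2)"
      then show "z \<in> cball y \<kappa>" using y h dist_triangle[of y z y'] by auto
    qed
    then show ?thesis using p y by (auto simp: pq inner_squares_def)
  qed
  then show ?thesis using q by (auto simp: pq inner_squares_def)
qed

lemma compact_in_open_cball:
  fixes K D :: "(real^2) set"
  assumes "compact K" "open D" "K \<subseteq> D"
  obtains \<kappa> where "0 < \<kappa>" "\<And>y. y \<in> K \<Longrightarrow> cball y \<kappa> \<subseteq> D"
proof -
  obtain e where e: "0 < e" "(\<Union>x\<in>K. ball x e) \<subseteq> D"
    by (rule compact_subset_open_imp_ball_epsilon_subset[OF assms])
  show ?thesis
  proof (rule that[of "e / 2"])
    show "cball y (e / 2) \<subseteq> D" if "y \<in> K" for y using e that by (force simp: subset_eq)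
  qed (use e in simp)
qed

lemma squares_inner:
  assumes "open D" "p \<in> squares D"
  obtains \<kappa> where "0 < \<kappa>" "p \<in> inner_squares D \<kappa>"
proof -
  obtain x r where p: "p = (x, r)" by fastforce
  have "compact (Q x r)" "Q x r \<subseteq> D" using assms by (auto simp: p squares_def Q_def)
  then obtain \<kappa> where "0 < \<kappa>" "\<And>y. y \<in> Q x r \<Longrightarrow> cball y \<kappa> \<subseteq> D"
    using compact_in_open_cball assms(1) by metis
  then show ?thesis using that[of \<kappa>] assms by (auto simp: p squares_def inner_squares_def)
qed

lemma near_norm: "near (norm (p - q)) p q"
proof -
  have "\<bar>fst p $ i - fst q $ i\<bar> \<le> norm (p - q)" for i
    using component_le_norm_cart[of "fst (p - q)" i] norm_fst_le[of "fst (p - q)" "snd (p - q)"]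
    unfolding prod.collapse by simp
  moreover have "\<bar>snd p - snd q\<bar> \<le> norm (p - q)"
    using norm_snd_le[of "snd (p - q)" "fst (p - q)"] unfolding prod.collapse by simp
  ultimately show ?thesis by (auto simp: near_def)
qed

lemma near_sym: "near h p q \<Longrightarrow> near h q p" by (auto simp: near_def abs_minus_commute)

lemma half_powers_small: "0 < (e :: real) \<Longrightarrow> \<exists>k0. \<forall>k\<ge>k0. 1 / 2 ^ k \<le> e"
proof -
  assume e: "0 < e"
  obtain n where n: "(1 / 2) ^ n < e" using real_arch_pow_inv[OF e, of "1/2"] by auto
  have "1 / 2 ^ k \<le> e" if "n \<le> k" for k
  proof -
    have "(1 / 2 :: real) ^ k \<le> (1 / 2) ^ n" using that by (intro power_decreasing) auto
    with n show ?thesis by (simp add: power_divide)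
  qed
  then show ?thesis by blast
qed

section \<open>Kolmogorov's theorem on an exhaustion of the set of squares\<close>

text \<open>One margin and one order of the moment at a time. The moment bound is required for the
  margin \<open>\<kappa> / 2\<close>, which is what the roundings of squares with margin
  \<open>\<kappa>\<close> retain. The limits along the roundings involve neither
  \<open>\<kappa>\<close> nor \<open>P\<close>, which permits gluing afterwards.\<close>

lemma kolmogorov_level:
  fixes Y :: "(real^2) \<times> real \<Rightarrow> 'a \<Rightarrow> complex"
  assumes D: "bounded D" and \<kappa>: "0 < \<kappa>" and P: "0 < (P :: nat)" and \<alpha>: "real P * (\<gamma> - \<alpha>) = 4" "0 < \<alpha>"
    and meas: "\<And>p. p \<in> squares D \<Longrightarrow> Y p \<in> borel_measurable M"
    and zero: "\<And>x \<omega>. Y (x, 0) \<omega> = 0"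
    and C: "0 \<le> C" and h0: "0 < h0"
    and mom: "\<And>p q h. p \<in> inner_squares D (\<kappa> / 2) \<Longrightarrow> q \<in> inner_squares D (\<kappa> / 2) \<Longrightarrow> 0 < h \<Longrightarrow> h \<le> h0 \<Longrightarrow> near h p q \<Longrightarrow>
      (\<integral>\<^sup>+\<omega>. ennreal (cmod (Y p \<omega> - Y q \<omega>) ^ P) \<partial>M) \<le> ennreal (C * (max (snd p) (snd q) * h) powr (P * \<gamma>))"
  shows "\<exists>(Z :: 'a \<Rightarrow> real) G k0. Z \<in> borel_measurable M \<and> G \<in> sets M \<and> (AE \<omega> in M. \<omega> \<in> G) \<and>
    (\<forall>p\<in>inner_squares D \<kappa>. \<forall>k\<ge>k0. gridpt k (gridfloor k p) \<in> squares D) \<and>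
    (\<forall>p\<in>inner_squares D \<kappa>. AE \<omega> in M. (\<lambda>k. Y (gridpt k (gridfloor k p)) \<omega>) \<longlonglongrightarrow> Y p \<omega>) \<and>
    (\<forall>\<omega>\<in>G. 0 \<le> Z \<omega> \<and> (\<forall>p\<in>inner_squares D \<kappa>. convergent (\<lambda>k. Y (gridpt k (gridfloor k p)) \<omega>)) \<and>
      (\<forall>p\<in>inner_squares D \<kappa>. \<forall>q\<in>inner_squares D \<kappa>. \<forall>d>0. near d p q \<longrightarrow>
        cmod (lim (\<lambda>k. Y (gridpt k (gridfloor k p)) \<omega>) - lim (\<lambda>k. Y (gridpt k (gridfloor k q)) \<omega>))
          \<le> Z \<omega> * (max (snd p) (snd q) * d) powr \<alpha>))"
proof -
  let ?T = "inner_squares D \<kappa>" and ?T' = "inner_squares D (\<kappa> / 2)"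
  \<comment> \<open>\<open>\<kappa> / 8\<close> is the largest mesh that
    \<open>inner_squares_near\<close> admits.\<close>
  have "0 < min h0 (\<kappa> / 8)" using h0 \<kappa> by simp
  from half_powers_small[OF this] obtain k0 where "\<forall>k\<ge>k0. 1 / 2 ^ k \<le> min h0 (\<kappa> / 8)" by blast
  then have k0: "1 / 2 ^ k \<le> h0" "4 * (1 / 2 ^ k) \<le> \<kappa> / 2" if "k0 \<le> k" for k using that by simp_all
  obtain b where b: "\<And>x. x \<in> D \<Longrightarrow> norm x \<le> b" using D by (auto simp: bounded_iff)
  have T'sq: "?T' \<subseteq> squares D" and Tsq: "?T \<subseteq> squares D" using inner_squares_subset \<kappa> by auto
  have box: "\<bar>fst p $ 1\<bar> \<le> b \<and> \<bar>fst p $ 2\<bar> \<le> b \<and> snd p \<in> {0..1}" if "p \<in> squares D" for p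
    using that b[of "fst p"] component_le_norm_cart[of "fst p" 1] component_le_norm_cart[of "fst p" 2]
    by (auto simp: squares_def)
  have fl: "gridpt k (gridfloor k p) \<in> ?T'" if "p \<in> ?T" "k0 \<le> k" for p k
  proof (rule inner_squares_near[OF that(1) near_sym[OF near_gridfloor] k0(2)[OF that(2)]])
    have "snd p \<in> {0..1}" using box[of p] Tsq that by blast
    then show "snd (gridpt k (gridfloor k p)) \<in> {0..1}"
      using snd_gridfloor[of k p] snd_gridfloor_nonneg[of p k] by simp
  qed
  have TT': "p \<in> ?T'" if "p \<in> ?T" for p using inner_squares_mono[of "\<kappa> / 2" \<kappa>] \<kappa> that by auto
  obtain Z where Z: "Z \<in> borel_measurable M" "AE \<omega> in M. Z \<omega> < \<infinity>"
    and ZZ: "\<And>\<omega> k t t'. Z \<omega> < \<infinity> \<Longrightarrow> k0 \<le> k \<Longrightarrow> gridpt k t \<in> ?T' \<Longrightarrow> gridpt k t' \<in> ?T' \<Longrightarrow>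
      near (1 / 2 ^ k) (gridpt k t) (gridpt k t') \<Longrightarrow>
      cmod (Y (gridpt k t) \<omega> - Y (gridpt k t') \<omega>)
        \<le> enn2real (Z \<omega>) powr (1 / P) * (max (snd (gridpt k t)) (snd (gridpt k t')) / 2 ^ k) powr \<alpha>"
  proof (rule kolmogorov_random_constant[OF P \<alpha>(1) C, of ?T' b Y M k0])
    show "(\<integral>\<^sup>+\<omega>. ennreal (cmod (Y p \<omega> - Y q \<omega>) ^ P) \<partial>M)
        \<le> ennreal (C * (max (snd p) (snd q) / 2 ^ k) powr (P * \<gamma>))"
      if "p \<in> ?T'" "q \<in> ?T'" "k0 \<le> k" "near (1 / 2 ^ k) p q" for p q k
      using mom[OF that(1,2) _ _ that(4)] k0(1)[OF that(3)] by simp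
  qed (use box T'sq meas zero in auto)
  define G where "G = {\<omega>\<in>space M. Z \<omega> < \<infinity>}"
  define c where "c = 2 powr \<alpha> * (1 + 2 / (1 - 2 powr (- \<alpha>))) * 2 ^ (k0 + 1) * 2 powr (real k0 * \<alpha>)"
  have "(2 :: real) powr (- \<alpha>) < 1" using \<alpha> by (auto intro: powr_less_one)
  then have c0: "0 \<le> c" unfolding c_def by (intro mult_nonneg_nonneg) auto
  define Z' where "Z' \<omega> = enn2real (Z \<omega>) powr (1 / P) * c" for \<omega>
  have rng: "0 \<le> snd p \<and> snd p \<le> 1" if "p \<in> ?T" for p using box[of p] that Tsq by auto
  have 1: "convergent (\<lambda>k. Y (gridpt k (gridfloor k p)) \<omega>)" if "\<omega> \<in> G" "p \<in> ?T" for \<omega> p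
  proof -
    have "(\<lambda>k. Y (gridpt k (gridfloor k p)) \<omega>) \<longlonglongrightarrow> lim (\<lambda>k. Y (gridpt k (gridfloor k p)) \<omega>)"
      by (rule dyadic_chaining(1)[OF \<alpha>(2), where T="?T" and T'="?T'" and ?k0.0=k0 and f="\<lambda>p. Y p \<omega>" and W="enn2real (Z \<omega>) powr (1 / P)"])
         (simp, use that(1) ZZ[of \<omega>] in \<open>simp add: G_def\<close>, erule fl, assumption, erule rng, rule zero,
           erule inner_squares_down, assumption+, rule that(2))
    then show ?thesis by (auto simp: convergent_def)
  qed
  have 2: "cmod (lim (\<lambda>k. Y (gridpt k (gridfloor k p)) \<omega>) - lim (\<lambda>k. Y (gridpt k (gridfloor k q)) \<omega>))
          \<le> Z' \<omega> * (max (snd p) (snd q) * d) powr \<alpha>"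
    if that': "\<omega> \<in> G" "p \<in> ?T" "q \<in> ?T" "0 < d" "near d p q" for \<omega> p q d
  proof -
    have "cmod (lim (\<lambda>k. Y (gridpt k (gridfloor k p)) \<omega>) - lim (\<lambda>k. Y (gridpt k (gridfloor k q)) \<omega>))
          \<le> enn2real (Z \<omega>) powr (1 / P) * (2 powr \<alpha> * (1 + 2 / (1 - 2 powr (- \<alpha>)))) * 2 ^ (k0 + 1) * 2 powr (real k0 * \<alpha>) * (max (snd p) (snd q) * d) powr \<alpha>"
      by (rule dyadic_chaining(2)[OF \<alpha>(2), where T="?T" and T'="?T'" and ?k0.0=k0 and f="\<lambda>p. Y p \<omega>" and W="enn2real (Z \<omega>) powr (1 / P)"])
         (simp, use that'(1) ZZ[of \<omega>] in \<open>simp add: G_def\<close>, erule fl, assumption, erule rng, rule zero,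
           erule inner_squares_down, assumption+, rule that'(2), rule that'(3), rule that'(4), rule that'(5))
    then show ?thesis by (simp only: Z'_def c_def mult.assoc)
  qed
  \<comment> \<open>The moments of order \<open>P\<close> of the rounding errors at a fixed
    \<open>p\<close> are summable over the levels, so the errors tend to 0 almost surely. This
    identifies the limit as a version of \<open>Y p\<close>.\<close>
  have 3: "AE \<omega> in M. (\<lambda>k. Y (gridpt k (gridfloor k p)) \<omega>) \<longlonglongrightarrow> Y p \<omega>" if p: "p \<in> ?T" for p
  proof -
    define f where "f k \<omega> = cmod (Y (gridpt (k + k0) (gridfloor (k + k0) p)) \<omega> - Y p \<omega>) ^ P" for k \<omega>
    have mf [measurable]: "f k \<in> borel_measurable M" for k
    proof -
      have [measurable]: "Y p \<in> borel_measurable M" "Y (gridpt (k + k0) (gridfloor (k + k0) p)) \<in> borel_measurable M"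
        using meas[of p] meas[of "gridpt (k + k0) (gridfloor (k + k0) p)"] fl[OF p, of "k + k0"] p Tsq T'sq
        by (simp_all only: subset_eq le_add2 Ball_def)
      show ?thesis unfolding f_def by measurable
    qed
    define q :: real where "q = 2 powr - (P * \<gamma>)"
    have "P * \<gamma> = 4 + P * \<alpha>" using \<alpha> by (simp add: algebra_simps)
    then have \<gamma>: "0 < P * \<gamma>" using P \<alpha> by (simp add: add_pos_pos)
    have q: "0 < q" "q < 1" using \<gamma> by (auto simp: q_def powr_less_one)
    have fb: "(\<integral>\<^sup>+\<omega>. ennreal (f k \<omega>) \<partial>M) \<le> ennreal (C * q ^ k)" for k
    proof -
      let ?p = "gridpt (k + k0) (gridfloor (k + k0) p)"
      have "(\<integral>\<^sup>+\<omega>. ennreal (f k \<omega>) \<partial>M) \<le> ennreal (C * (max (snd ?p) (snd p) * (1 / 2 ^ (k + k0))) powr (P * \<gamma>))"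
        unfolding f_def using fl[OF p, of "k + k0"] TT'[OF p] near_gridfloor[of "k + k0" p] k0(1)[of "k + k0"]
        by (intro mom) auto
      also have "\<dots> \<le> ennreal (C * (1 / 2 ^ k) powr (P * \<gamma>))"
      proof (intro ennreal_leI mult_left_mono powr_mono2)
        have "max (snd ?p) (snd p) \<le> 1" "0 \<le> max (snd ?p) (snd p)" using snd_gridfloor[of "k + k0" p] rng[OF p] by auto
        moreover have "(1 :: real) / 2 ^ (k + k0) \<le> 1 / 2 ^ k" by (intro divide_left_mono power_increasing) auto
        ultimately have "max (snd ?p) (snd p) * (1 / 2 ^ (k + k0)) \<le> 1 * (1 / 2 ^ k)" by (intro mult_mono) auto
        then show "max (snd ?p) (snd p) * (1 / 2 ^ (k + k0)) \<le> 1 / 2 ^ k" by simp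
        show "0 \<le> max (snd ?p) (snd p) * (1 / 2 ^ (k + k0))" using \<open>0 \<le> max (snd ?p) (snd p)\<close> by simp
      qed (use C \<gamma> in auto)
      also have "(1 / 2 ^ k :: real) powr (P * \<gamma>) = q ^ k"
      proof -
        have "(1 / 2 ^ k :: real) = 2 powr (- real k)" by (simp add: powr_minus powr_realpow divide_inverse)
        moreover have "q ^ k = q powr real k" using q by (simp add: powr_realpow)
        ultimately show ?thesis by (simp add: q_def powr_powr mult.commute)
      qed
      finally show ?thesis .
    qed
    have "(\<integral>\<^sup>+\<omega>. (\<Sum>k. ennreal (f k \<omega>)) \<partial>M) = (\<Sum>k. \<integral>\<^sup>+\<omega>. ennreal (f k \<omega>) \<partial>M)"
      using mf by (intro nn_integral_suminf) auto
    also have "\<dots> \<le> (\<Sum>k. ennreal (C * q ^ k))" using fb by (intro suminf_le) auto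
    also have "\<dots> = ennreal (\<Sum>k. C * q ^ k)"
      using C q by (intro suminf_ennreal2 summable_mult summable_geometric) auto
    also have "\<dots> < \<infinity>" by simp
    finally have "(\<integral>\<^sup>+\<omega>. (\<Sum>k. ennreal (f k \<omega>)) \<partial>M) \<noteq> \<infinity>" by simp
    then have "AE \<omega> in M. (\<Sum>k. ennreal (f k \<omega>)) \<noteq> \<infinity>"
      using mf by (intro nn_integral_PInf_AE) auto
    then show ?thesis
    proof (eventually_elim)
      case (elim \<omega>)
      have f0: "0 \<le> f k \<omega>" for k by (simp add: f_def)
      have "summable (\<lambda>k. f k \<omega>)" by (rule summable_suminf_not_top) (use f0 elim in auto)
      then have "(\<lambda>k. f k \<omega>) \<longlonglongrightarrow> 0" by (rule summable_LIMSEQ_zero)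
      then have "(\<lambda>k. root P (f k \<omega>)) \<longlonglongrightarrow> root P 0" by (rule tendsto_real_root)
      then have "(\<lambda>k. cmod (Y (gridpt (k + k0) (gridfloor (k + k0) p)) \<omega> - Y p \<omega>)) \<longlonglongrightarrow> 0"
        using P by (simp add: f_def real_root_power_cancel)
      then have "(\<lambda>k. Y (gridpt (k + k0) (gridfloor (k + k0) p)) \<omega>) \<longlonglongrightarrow> Y p \<omega>"
        by (simp add: tendsto_norm_zero_iff LIM_zero_iff)
      then show ?case by (rule LIMSEQ_offset)
    qed
  qed
  have "Z' \<in> borel_measurable M" unfolding Z'_def using Z(1) by measurable
  moreover have "G \<in> sets M" unfolding G_def using Z(1) by measurable
  moreover have "AE \<omega> in M. \<omega> \<in> G" using Z(2) by (auto simp: G_def)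
  moreover have "0 \<le> Z' \<omega>" for \<omega> using c0 by (simp add: Z'_def)
  moreover have "gridpt k (gridfloor k p) \<in> squares D" if "p \<in> ?T" "k0 \<le> k" for p k using fl[OF that] T'sq by blast
  ultimately show ?thesis
    by (intro exI[of _ Z'] exI[of _ G] exI[of _ k0] conjI ballI allI impI 1 2 3)
qed

lemma ex_imp_distrib3: "\<exists>x y z. P x y z \<Longrightarrow> \<exists>x y z. A \<longrightarrow> P x y z"
  by blast

text \<open>Countably many margins and exponents suffice, so the exceptional null sets can be
  united. All of them speak of the same limits along roundings; hence one modification serves every
  margin and every exponent.\<close>

lemma kolmogorov_squares:
  fixes Y :: "(real^2) \<times> real \<Rightarrow> 'a \<Rightarrow> complex"
  assumes D: "open D" "bounded D" and \<gamma>: "0 < \<gamma>"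
    and meas: "\<And>p. p \<in> squares D \<Longrightarrow> Y p \<in> borel_measurable M"
    and zero: "\<And>x \<omega>. Y (x, 0) \<omega> = 0"
    and mom: "\<And>\<kappa> n. 0 < \<kappa> \<Longrightarrow> 0 < (n :: nat) \<Longrightarrow> \<exists>C\<ge>0. \<exists>h0>0. \<forall>p\<in>inner_squares D \<kappa>. \<forall>q\<in>inner_squares D \<kappa>. \<forall>h>0.
      h \<le> h0 \<longrightarrow> near h p q \<longrightarrow>
      (\<integral>\<^sup>+\<omega>. ennreal (cmod (Y p \<omega> - Y q \<omega>) ^ (2 * n)) \<partial>M)
        \<le> ennreal (C * (max (snd p) (snd q) * h) powr (real (2 * n) * \<gamma>))"
  shows "\<exists>\<nu>. (\<forall>p\<in>squares D. \<nu> p \<in> borel_measurable M \<and> (AE \<omega> in M. \<nu> p \<omega> = Y p \<omega>)) \<and>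
    (\<forall>\<omega>. continuous_on (squares D) (\<lambda>p. \<nu> p \<omega>)) \<and>
    (\<forall>\<kappa>>0. \<forall>\<alpha><\<gamma>. \<exists>\<alpha>'>max \<alpha> 0. \<exists>Z. Z \<in> borel_measurable M \<and>
      (AE \<omega> in M. 0 \<le> Z \<omega> \<and> (\<forall>p\<in>inner_squares D \<kappa>. \<forall>q\<in>inner_squares D \<kappa>.
        cmod (\<nu> p \<omega> - \<nu> q \<omega>) \<le> Z \<omega> * (max (snd p) (snd q) * norm (p - q)) powr \<alpha>')))"
proof -
  \<comment> \<open>The moment of order \<open>2 * Suc n\<close> loses
    \<open>4 / (2 * Suc n)\<close> in the exponent. For small \<open>n\<close> the result may fail
    to be positive, hence the guards \<open>0 < a n\<close> below.\<close>
  define a where "a n = \<gamma> - 2 / real (Suc n)" for n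
  define \<kappa> where "\<kappa> m = 1 / real (Suc m)" for m
  define u where "u p \<omega> k = Y (gridpt k (gridfloor k p)) \<omega>" for p \<omega> k
  have \<kappa>: "0 < \<kappa> m" for m by (simp add: \<kappa>_def)
  have \<kappa>_ex: "\<exists>m. \<kappa> m \<le> e" if "0 < e" for e
    using reals_Archimedean[OF that] by (auto simp: \<kappa>_def inverse_eq_divide intro: less_imp_le)
  have a_ex: "\<exists>n. \<alpha> < a n" if "\<alpha> < \<gamma>" for \<alpha>
  proof -
    have "0 < (\<gamma> - \<alpha>) / 2" using that by simp
    from reals_Archimedean[OF this] obtain n t where t: "t = inverse (real (Suc n))" "t < (\<gamma> - \<alpha>) / 2" by blast
    have "a n = \<gamma> - 2 * t" by (simp only: a_def divide_inverse t)
    moreover have "2 * t < \<gamma> - \<alpha>" using t(2) by (simp add: field_simps)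
    ultimately have "\<alpha> < a n" by simp
    then show ?thesis by blast
  qed
  have in_ex: "\<exists>m. p \<in> inner_squares D (\<kappa> m)" if p: "p \<in> squares D" for p
  proof -
    obtain e where e: "0 < e" "p \<in> inner_squares D e" using squares_inner[OF D(1) p] .
    with \<kappa>_ex[of e] inner_squares_mono[of _ e D] show ?thesis by blast
  qed
  define \<Phi> where "\<Phi> m n Z G k0 \<longleftrightarrow> Z \<in> borel_measurable M \<and> G \<in> sets M \<and> (AE \<omega> in M. \<omega> \<in> G) \<and>
    (\<forall>p\<in>inner_squares D (\<kappa> m). \<forall>k\<ge>k0. gridpt k (gridfloor k p) \<in> squares D) \<and>
    (\<forall>p\<in>inner_squares D (\<kappa> m). AE \<omega> in M. u p \<omega> \<longlonglongrightarrow> Y p \<omega>) \<and>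
    (\<forall>\<omega>\<in>G. 0 \<le> Z \<omega> \<and> (\<forall>p\<in>inner_squares D (\<kappa> m). convergent (u p \<omega>)) \<and>
      (\<forall>p\<in>inner_squares D (\<kappa> m). \<forall>q\<in>inner_squares D (\<kappa> m). \<forall>d>0. near d p q \<longrightarrow>
        cmod (lim (u p \<omega>) - lim (u q \<omega>)) \<le> Z \<omega> * (max (snd p) (snd q) * d) powr a n))"
    for m n and Z :: "'a \<Rightarrow> real" and G and k0 :: nat
  have ex: "\<exists>Z G k0. 0 < a n \<longrightarrow> \<Phi> m n Z G k0" for m n
  proof (cases "0 < a n")
    case True
    from mom[OF half_gt_zero[OF \<kappa>[of m]] zero_less_Suc[of n]] obtain C h0 where C: "0 \<le> C" "0 < h0"
      and m': "\<forall>p\<in>inner_squares D (\<kappa> m / 2). \<forall>q\<in>inner_squares D (\<kappa> m / 2). \<forall>h>0. h \<le> h0 \<longrightarrow> near h p q \<longrightarrow>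
        (\<integral>\<^sup>+\<omega>. ennreal (cmod (Y p \<omega> - Y q \<omega>) ^ (2 * Suc n)) \<partial>M)
          \<le> ennreal (C * (max (snd p) (snd q) * h) powr (real (2 * Suc n) * \<gamma>))" by blast
    have mom': "(\<integral>\<^sup>+\<omega>. ennreal (cmod (Y p \<omega> - Y q \<omega>) ^ (2 * Suc n)) \<partial>M)
        \<le> ennreal (C * (max (snd p) (snd q) * h) powr (real (2 * Suc n) * \<gamma>))"
      if "p \<in> inner_squares D (\<kappa> m / 2)" "q \<in> inner_squares D (\<kappa> m / 2)" "0 < h" "h \<le> h0" "near h p q" for p q h
      using m' that by blast
    have 1: "real (2 * Suc n) * (\<gamma> - a n) = 4" by (simp add: a_def field_simps)
    have 2: "0 < 2 * Suc n" by simp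
    show ?thesis
      unfolding \<Phi>_def u_def by (intro ex_imp_distrib3 kolmogorov_level[OF D(2) \<kappa>[of m] 2 1 True meas zero C mom'])
  qed auto
  \<comment> \<open>The choices are made once for all pairs of indices, so that the countable
    intersection of the good sets can be formed.\<close>
  define t where "t m n = (SOME (Z, G, k0). 0 < a n \<longrightarrow> \<Phi> m n Z G k0)" for m n
  define Z where "Z m n = fst (t m n)" for m n
  define G where "G m n = fst (snd (t m n))" for m n
  define k0 where "k0 m n = snd (snd (t m n))" for m n
  have *: "0 < a n \<longrightarrow> \<Phi> m n (Z m n) (G m n) (k0 m n)" for m n
  proof -
    have "\<exists>t. case t of (Z, G, k0) \<Rightarrow> 0 < a n \<longrightarrow> \<Phi> m n Z G k0" using ex[of n m] by auto
    then have "case t m n of (Z, G, k0) \<Rightarrow> 0 < a n \<longrightarrow> \<Phi> m n Z G k0" unfolding t_def by (rule someI_ex)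
    then show ?thesis by (simp add: Z_def G_def k0_def split: prod.splits)
  qed
  have mZ: "Z m n \<in> borel_measurable M" and mG: "G m n \<in> sets M" and AEG: "AE \<omega> in M. \<omega> \<in> G m n"
    if "0 < a n" for m n using * that unfolding \<Phi>_def by blast+
  have grid: "gridpt k (gridfloor k p) \<in> squares D" if "0 < a n" "p \<in> inner_squares D (\<kappa> m)" "k0 m n \<le> k" for m n p k
    using * that unfolding \<Phi>_def by blast
  have AEu: "AE \<omega> in M. u p \<omega> \<longlonglongrightarrow> Y p \<omega>" if "0 < a n" "p \<in> inner_squares D (\<kappa> m)" for m n p
    using * that unfolding \<Phi>_def by blast
  have Z0: "0 \<le> Z m n \<omega>" and conv: "p \<in> inner_squares D (\<kappa> m) \<Longrightarrow> convergent (u p \<omega>)"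
    and hoel: "p \<in> inner_squares D (\<kappa> m) \<Longrightarrow> q \<in> inner_squares D (\<kappa> m) \<Longrightarrow> 0 < d \<Longrightarrow> near d p q \<Longrightarrow>
      cmod (lim (u p \<omega>) - lim (u q \<omega>)) \<le> Z m n \<omega> * (max (snd p) (snd q) * d) powr a n"
    if "0 < a n" "\<omega> \<in> G m n" for m n \<omega> p q d using * that unfolding \<Phi>_def by blast+
  obtain n0 where n0: "0 < a n0" using a_ex[OF \<gamma>] by blast
  define \<Omega> where "\<Omega> = {\<omega>\<in>space M. \<forall>m n. 0 < a n \<longrightarrow> \<omega> \<in> G m n}"
  have m\<Omega>: "\<Omega> \<in> sets M"
  proof -
    have "{\<omega>\<in>space M. 0 < a n \<longrightarrow> \<omega> \<in> G m n} \<in> sets M" for m n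
    proof (cases "0 < a n")
      case True
      then have "{\<omega>\<in>space M. 0 < a n \<longrightarrow> \<omega> \<in> G m n} = G m n" using sets.sets_into_space[OF mG] by auto
      then show ?thesis using mG[OF True] by simp
    qed auto
    then show ?thesis unfolding \<Omega>_def by (intro sets.sets_Collect_countable_All)
  qed
  have AE\<Omega>: "AE \<omega> in M. \<omega> \<in> \<Omega>"
  proof -
    have "AE \<omega> in M. 0 < a n \<longrightarrow> \<omega> \<in> G m n" for m n using AEG[of n m] by (cases "0 < a n") auto
    then have "AE \<omega> in M. \<forall>m n. 0 < a n \<longrightarrow> \<omega> \<in> G m n" by (simp add: AE_all_countable)
    then show ?thesis using AE_space by eventually_elim (auto simp: \<Omega>_def)
  qed
  \<comment> \<open>Off the good event the field is set to 0, which makes every path continuous and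
    not just almost every one.\<close>
  define \<nu> where "\<nu> p \<omega> = (if \<omega> \<in> \<Omega> then lim (u p \<omega>) else 0)" for p \<omega>
  have \<nu>_hoel: "cmod (\<nu> p \<omega> - \<nu> q \<omega>) \<le> Z m n \<omega> * (max (snd p) (snd q) * norm (p - q)) powr a n"
    if "0 < a n" "p \<in> inner_squares D (\<kappa> m)" "q \<in> inner_squares D (\<kappa> m)" "\<omega> \<in> \<Omega>" for p q m n \<omega>
  proof (cases "p = q")
    case False
    then show ?thesis using hoel[of n \<omega> m p q "norm (p - q)"] that near_norm by (auto simp: \<nu>_def \<Omega>_def)
  qed simp
  have 1: "\<nu> p \<in> borel_measurable M" "AE \<omega> in M. \<nu> p \<omega> = Y p \<omega>" if p: "p \<in> squares D" for p
  proof -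
    obtain m where m: "p \<in> inner_squares D (\<kappa> m)" using in_ex[OF p] by blast
    define k where "k = k0 m n0"
    have [measurable]: "(\<lambda>\<omega>. u p \<omega> (j + k)) \<in> borel_measurable M" for j
      unfolding u_def using grid[OF n0 m, of "j + k"] meas by (simp add: k_def)
    \<comment> \<open>Roundings of low level may lie outside \<open>squares D\<close>, where
      \<open>Y\<close> is not known to be measurable. The shift by \<open>k\<close> discards them
      and leaves the limit unchanged.\<close>
    have "\<nu> p = (\<lambda>\<omega>. if \<omega> \<in> \<Omega> then lim (\<lambda>j. u p \<omega> (j + k)) else 0)"
    proof
      fix \<omega>
      have "lim (\<lambda>j. u p \<omega> (j + k)) = lim (u p \<omega>)" if "\<omega> \<in> \<Omega>"
      proof -
        have "u p \<omega> \<longlonglongrightarrow> lim (u p \<omega>)" using conv[OF n0, of \<omega> m p] that m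
          by (simp add: \<Omega>_def n0 convergent_LIMSEQ_iff)
        then show ?thesis by (intro limI LIMSEQ_ignore_initial_segment)
      qed
      then show "\<nu> p \<omega> = (if \<omega> \<in> \<Omega> then lim (\<lambda>j. u p \<omega> (j + k)) else 0)" by (simp add: \<nu>_def)
    qed
    moreover have "(\<lambda>\<omega>. lim (\<lambda>j. u p \<omega> (j + k))) \<in> borel_measurable M"
      by (intro borel_measurable_lim_metric) measurable
    ultimately show "\<nu> p \<in> borel_measurable M" using m\<Omega> by simp
    show "AE \<omega> in M. \<nu> p \<omega> = Y p \<omega>"
      using AEu[OF n0 m] AE\<Omega> by eventually_elim (simp add: \<nu>_def limI)
  qed
  have 2: "continuous_on (squares D) (\<lambda>p. \<nu> p \<omega>)" for \<omega>
  proof (cases "\<omega> \<in> \<Omega>")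
    case True
    show ?thesis unfolding continuous_on_def
    proof
      fix p assume p: "p \<in> squares D"
      obtain m where m: "p \<in> inner_squares D (\<kappa> m)" using in_ex[OF p] by blast
      \<comment> \<open>Squares within \<open>\<kappa> m / 8\<close> of \<open>p\<close> retain half
        of its margin, so they fall under the same Hoelder estimate as \<open>p\<close>
        itself.\<close>
      obtain m' where m': "\<kappa> m' \<le> \<kappa> m / 2" using \<kappa>_ex[of "\<kappa> m / 2"] \<kappa>[of m] by auto
      have pm': "p \<in> inner_squares D (\<kappa> m')" using inner_squares_mono[of "\<kappa> m'" "\<kappa> m" D] m m' \<kappa>[of m] by auto
      have "eventually (\<lambda>q. dist q p < \<kappa> m / 8) (at p within squares D)"
        unfolding eventually_at using \<kappa>[of m] by (intro exI[of _ "\<kappa> m / 8"]) auto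
      moreover have "eventually (\<lambda>q. q \<in> squares D) (at p within squares D)"
        unfolding eventually_at_filter by (intro always_eventually) auto
      ultimately have ev: "eventually (\<lambda>q. norm (\<nu> q \<omega> - \<nu> p \<omega>) \<le> Z m' n0 \<omega> * (norm (q - p)) powr a n0) (at p within squares D)"
      proof eventually_elim
        case (elim q)
        have sq: "0 \<le> snd q" "snd q \<le> 1" "0 \<le> snd p" "snd p \<le> 1" using elim p by (auto simp: squares_def)
        have "q \<in> inner_squares D (\<kappa> m / 2)"
          using inner_squares_near[OF m, of "norm (p - q)" q] near_norm[of p q] elim sq by (auto simp: dist_norm norm_minus_commute)
        then have "q \<in> inner_squares D (\<kappa> m')" using inner_squares_mono[OF m'] by blast
        from \<nu>_hoel[OF n0 this pm' True]
        have "cmod (\<nu> q \<omega> - \<nu> p \<omega>) \<le> Z m' n0 \<omega> * (max (snd q) (snd p) * norm (q - p)) powr a n0" .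
        also have "\<dots> \<le> Z m' n0 \<omega> * (1 * norm (q - p)) powr a n0"
          using sq n0 Z0[OF n0, of \<omega> m'] True
          by (intro mult_left_mono powr_mono2 mult_right_mono) (auto simp: \<Omega>_def le_max_iff_disj)
        finally show ?case by simp
      qed
      have "((\<lambda>q. norm (q - p)) \<longlongrightarrow> 0) (at p within squares D)"
        by (intro tendsto_eq_intros) auto
      then have "((\<lambda>q. Z m' n0 \<omega> * norm (q - p) powr a n0) \<longlongrightarrow> 0) (at p within squares D)"
        using n0 by (intro tendsto_mult_right_zero tendsto_zero_powrI[where b="a n0"]) auto
      then have "((\<lambda>q. \<nu> q \<omega> - \<nu> p \<omega>) \<longlongrightarrow> 0) (at p within squares D)"
        using Lim_null_comparison[OF ev] by blast
      then show "((\<lambda>p. \<nu> p \<omega>) \<longlongrightarrow> \<nu> p \<omega>) (at p within squares D)" by (simp add: LIM_zero_iff)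
    qed
  qed (simp add: \<nu>_def)
  have 3: "\<exists>\<alpha>'>max \<alpha> 0. \<exists>Z. Z \<in> borel_measurable M \<and>
      (AE \<omega> in M. 0 \<le> Z \<omega> \<and> (\<forall>p\<in>inner_squares D e. \<forall>q\<in>inner_squares D e.
        cmod (\<nu> p \<omega> - \<nu> q \<omega>) \<le> Z \<omega> * (max (snd p) (snd q) * norm (p - q)) powr \<alpha>'))"
    if e: "0 < e" and \<alpha>: "\<alpha> < \<gamma>" for e \<alpha>
  proof -
    obtain n where n: "max \<alpha> 0 < a n" using a_ex[of "max \<alpha> 0"] \<alpha> \<gamma> by auto
    obtain m where m: "\<kappa> m \<le> e" using \<kappa>_ex[OF e] by blast
    have sub: "inner_squares D e \<subseteq> inner_squares D (\<kappa> m)" by (rule inner_squares_mono[OF m])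
    have an: "0 < a n" using n by simp
    have "AE \<omega> in M. 0 \<le> Z m n \<omega> \<and> (\<forall>p\<in>inner_squares D e. \<forall>q\<in>inner_squares D e.
        cmod (\<nu> p \<omega> - \<nu> q \<omega>) \<le> Z m n \<omega> * (max (snd p) (snd q) * norm (p - q)) powr a n)"
      using AE\<Omega>
    proof eventually_elim
      case (elim \<omega>)
      have "0 \<le> Z m n \<omega>" using Z0[OF an, of \<omega> m] elim an by (simp add: \<Omega>_def)
      moreover have "cmod (\<nu> p \<omega> - \<nu> q \<omega>) \<le> Z m n \<omega> * (max (snd p) (snd q) * norm (p - q)) powr a n"
        if "p \<in> inner_squares D e" "q \<in> inner_squares D e" for p q
        using \<nu>_hoel[OF an _ _ elim] that sub by blast
      ultimately show ?case by blast
    qed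
    then show ?thesis using n mZ[OF an, of m] by blast
  qed
  show ?thesis using 1 2 3 by (intro exI[of _ \<nu>]) blast
qed

section \<open>Rectangles and nearest-neighbour graphs\<close>

text \<open>Half-open, so that moving a side changes the indicator exactly by that of another such
  rectangle.\<close>

definition rect :: "real \<Rightarrow> real \<Rightarrow> real \<Rightarrow> real \<Rightarrow> (real^2) set" where
  "rect a b c d = {x. x $ 1 \<in> {a..<b} \<and> x $ 2 \<in> {c..<d}}"

section \<open>Power singularities over intervals and rectangles\<close>

lemma nn_integral_powr_ball:
  fixes w l s :: real
  assumes s: "0 < s" "s < 1" and l: "0 \<le> l"
  shows "(\<integral>\<^sup>+t. ennreal (\<bar>t - w\<bar> powr - s) * indicator {w - l..w + l} t \<partial>lborel) \<le> ennreal (2 * l powr (1 - s) / (1 - s))"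
proof -
  define g where "g t = ennreal (t powr - s) * indicator {0..l} t" for t :: real
  have g: "integral\<^sup>N lborel g = ennreal (l powr (1 - s) / (1 - s))"
    unfolding g_def
    using nn_integral_has_integral_lebesgue'[OF _ has_integral_powr_from_0[of "- s" l]] s l by (simp add: add.commute)
  have [measurable]: "g \<in> borel_measurable borel" unfolding g_def by measurable
  have "(\<integral>\<^sup>+t. ennreal (\<bar>t - w\<bar> powr - s) * indicator {w - l..w + l} t \<partial>lborel)
      = (\<integral>\<^sup>+t. ennreal (\<bar>t\<bar> powr - s) * indicator {- l..l} t \<partial>lborel)"
    by (subst nn_integral_real_affine[where t=w and c=1])
       (auto intro!: nn_integral_cong split: split_indicator)
  also have "\<dots> \<le> (\<integral>\<^sup>+t. g t + g (- t) \<partial>lborel)"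
    by (intro nn_integral_mono) (auto simp: g_def split: split_indicator)
  also have "\<dots> = integral\<^sup>N lborel g + (\<integral>\<^sup>+t. g (- t) \<partial>lborel)" by (intro nn_integral_add) measurable
  also have "(\<integral>\<^sup>+t. g (- t) \<partial>lborel) = integral\<^sup>N lborel g"
    by (subst (2) nn_integral_real_affine[where t=0 and c="-1"]) auto
  also have "integral\<^sup>N lborel g + integral\<^sup>N lborel g = ennreal (2 * l powr (1 - s) / (1 - s))"
    unfolding g using s by (simp flip: ennreal_plus)
  finally show ?thesis .
qed

text \<open>The bound must not depend on the place of the singularity. Within \<open>b - a\<close>
  of \<open>w\<close> the pure power is integrated, farther away the integrand is at most
  \<open>(b - a) powr - s\<close>; the two parts give \<open>3 = 2 + 1\<close>.\<close>

lemma nn_integral_powr_interval: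
  fixes w a b s :: real
  assumes s: "0 < s" "s < 1" and ab: "a \<le> b"
  shows "(\<integral>\<^sup>+t. ennreal (\<bar>t - w\<bar> powr - s) * indicator {a..<b} t \<partial>lborel) \<le> ennreal (3 / (1 - s) * (b - a) powr (1 - s))"
proof (cases "a = b")
  case False
  define l where "l = b - a"
  have l: "0 < l" using False ab by (simp add: l_def)
  have "(\<integral>\<^sup>+t. ennreal (\<bar>t - w\<bar> powr - s) * indicator {a..<b} t \<partial>lborel)
     \<le> (\<integral>\<^sup>+t. ennreal (\<bar>t - w\<bar> powr - s) * indicator {w - l..w + l} t + ennreal (l powr - s) * indicator {a..<b} t \<partial>lborel)"
  proof (intro nn_integral_mono)
    fix t :: real
    have "\<bar>t - w\<bar> powr - s \<le> l powr - s" if "\<not> (w - l \<le> t \<and> t \<le> w + l)"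
      using that l s by (intro powr_mono2') auto
    then show "ennreal (\<bar>t - w\<bar> powr - s) * indicator {a..<b} t
       \<le> ennreal (\<bar>t - w\<bar> powr - s) * indicator {w - l..w + l} t + ennreal (l powr - s) * indicator {a..<b} t"
      by (auto split: split_indicator simp: ennreal_leI)
  qed
  also have "\<dots> = (\<integral>\<^sup>+t. ennreal (\<bar>t - w\<bar> powr - s) * indicator {w - l..w + l} t \<partial>lborel)
      + (\<integral>\<^sup>+t. ennreal (l powr - s) * indicator {a..<b} t \<partial>lborel)"
    by (intro nn_integral_add) measurable
  also have "(\<integral>\<^sup>+t. ennreal (l powr - s) * indicator {a..<b} t \<partial>lborel) = ennreal (l powr - s) * ennreal (b - a)"
    using ab by (simp add: nn_integral_cmult_indicator)
  also have "\<dots> = ennreal (l powr (1 - s))"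
    using l by (simp add: l_def powr_diff powr_minus divide_inverse mult.commute flip: ennreal_mult)
  also have "(\<integral>\<^sup>+t. ennreal (\<bar>t - w\<bar> powr - s) * indicator {w - l..w + l} t \<partial>lborel) + ennreal (l powr (1 - s))
      \<le> ennreal (2 * l powr (1 - s) / (1 - s)) + ennreal (l powr (1 - s) / (1 - s))"
  proof (intro add_mono nn_integral_powr_ball s ennreal_leI)
    have "l powr (1 - s) * 1 \<le> l powr (1 - s) * (1 / (1 - s))" using s by (intro mult_left_mono) auto
    then show "l powr (1 - s) \<le> l powr (1 - s) / (1 - s)" by simp
  qed (use l in auto)
  also have "\<dots> = ennreal (3 / (1 - s) * (b - a) powr (1 - s))"
    using s by (simp add: l_def flip: ennreal_plus)
  finally show ?thesis .
qed simp

lemma axis_neq: "axis (1::2) (1::real) \<noteq> axis 2 1"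
  by (simp add: axis_eq_axis)

lemma Basis_real2: "(Basis :: (real^2) set) = {axis 1 1, axis 2 1}"
  by (auto simp: Basis_vec_def UNIV_2)

lemma nn_integral_product_real2:
  fixes f g :: "real \<Rightarrow> real"
  assumes [measurable]: "f \<in> borel_measurable borel" "g \<in> borel_measurable borel"
    and nn: "\<And>x. 0 \<le> f x" "\<And>x. 0 \<le> g x"
  shows "(\<integral>\<^sup>+z. ennreal (f (z $ 1) * g (z $ 2)) \<partial>(lborel :: (real^2) measure))
    = (\<integral>\<^sup>+x. ennreal (f x) \<partial>lborel) * (\<integral>\<^sup>+x. ennreal (g x) \<partial>lborel)"
proof -
  define F where "F b = (if b = axis (1::2) (1::real) then f else g)" for b
  have "(\<integral>\<^sup>+z. ennreal (f (z $ 1) * g (z $ 2)) \<partial>(lborel :: (real^2) measure))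
    = (\<integral>\<^sup>+z. (\<Prod>b\<in>Basis. ennreal (F b (z \<bullet> b))) \<partial>(lborel :: (real^2) measure))"
    using nn axis_neq by (simp add: Basis_real2 F_def inner_axis ennreal_mult)
  also have "\<dots> = (\<Prod>b\<in>(Basis :: (real^2) set). (\<integral>\<^sup>+x. ennreal (F b x) \<partial>lborel))"
    by (rule nn_integral_lborel_prod) (auto simp: F_def)
  also have "\<dots> = (\<integral>\<^sup>+x. ennreal (f x) \<partial>lborel) * (\<integral>\<^sup>+x. ennreal (g x) \<partial>lborel)"
    using axis_neq by (simp add: Basis_real2 F_def)
  finally show ?thesis .
qed

lemma rect_measurable [measurable]: "rect a b c d \<in> sets borel"
  unfolding rect_def by measurable

lemma indicator_rect: "indicator (rect a b c d) z = (indicator {a..<b} (z $ 1) * indicator {c..<d} (z $ 2) :: real)"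
  by (auto simp: rect_def split: split_indicator)

lemma emeasure_rect: "a \<le> b \<Longrightarrow> c \<le> d \<Longrightarrow> emeasure lborel (rect a b c d) = ennreal ((b - a) * (d - c))"
proof -
  assume ab: "a \<le> b" "c \<le> d"
  have "emeasure lborel (rect a b c d) = (\<integral>\<^sup>+z. ennreal (indicator {a..<b} (z $ 1) * indicator {c..<d} (z $ 2)) \<partial>(lborel :: (real^2) measure))"
    unfolding indicator_rect[symmetric]
    by (subst nn_integral_indicator[symmetric]) (auto simp: ennreal_indicator)
  also have "\<dots> = ennreal ((b - a) * (d - c))"
    using ab by (subst nn_integral_product_real2) (auto simp: ennreal_mult ennreal_indicator)
  finally show ?thesis .
qed

lemma AE_component_neq: "AE z in (lborel :: (real^2) measure). z $ i \<noteq> c"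
proof -
  have "axis i 1 \<in> (Basis :: (real^2) set)" by (auto simp: Basis_vec_def)
  then have "negligible {z :: real^2. z \<bullet> axis i 1 = c}" by (rule negligible_standard_hyperplane)
  then have "{z :: real^2. z $ i = c} \<in> null_sets lebesgue"
    by (simp add: cart_eq_inner_axis flip: negligible_iff_null_sets)
  then have "AE z in (lebesgue :: (real^2) measure). z \<notin> {z. z $ i = c}" by (rule AE_not_in)
  then show ?thesis by (simp add: AE_completion_iff)
qed

text \<open>Both coordinate differences are at most the distance, hence their product is at most its
  square. With the singularity split evenly the integral over a rectangle factorises and is
  controlled by the area alone, however thin the rectangle. The coordinates must differ because
  \<open>0 powr\<close> any exponent is 0, which would make the right-hand side vanish.\<close>

lemma powr_dist_le_components:
  fixes z w :: "real^2"
  assumes s: "0 < s" and ne: "z $ 1 \<noteq> w $ 1" "z $ 2 \<noteq> w $ 2"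
  shows "dist z w powr - s \<le> \<bar>z $ 1 - w $ 1\<bar> powr - (s / 2) * \<bar>z $ 2 - w $ 2\<bar> powr - (s / 2)"
proof -
  define p where "p = \<bar>z $ 1 - w $ 1\<bar>"
  define q where "q = \<bar>z $ 2 - w $ 2\<bar>"
  have pq: "0 < p" "0 < q" using ne by (auto simp: p_def q_def)
  have "p \<le> dist z w" "q \<le> dist z w"
    using component_le_norm_cart[of "z - w" 1] component_le_norm_cart[of "z - w" 2] by (auto simp: p_def q_def dist_norm)
  then have "p * q \<le> dist z w * dist z w" using pq by (intro mult_mono) auto
  then have "(dist z w * dist z w) powr - (s / 2) \<le> (p * q) powr - (s / 2)"
    using s pq by (intro powr_mono2') auto
  moreover have "(dist z w * dist z w) powr - (s / 2) = dist z w powr - s"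
    by (simp add: powr_mult flip: powr_add)
  ultimately show ?thesis using pq by (simp add: powr_mult p_def q_def)
qed

lemma nn_integral_powr_dist_rect:
  fixes w :: "real^2"
  assumes s: "0 < s" "s < 2" and ab: "a \<le> b" "c \<le> d"
  shows "(\<integral>\<^sup>+z\<in>rect a b c d. ennreal (dist z w powr - s) \<partial>lborel)
    \<le> ennreal ((3 / (1 - s / 2))\<^sup>2 * ((b - a) * (d - c)) powr (1 - s / 2))"
proof -
  define f where "f a b w t = \<bar>t - w\<bar> powr - (s / 2) * indicator {a..<b} t" for a b w t :: real
  have [measurable]: "f a b w \<in> borel_measurable borel" for a b w unfolding f_def by measurable
  have f: "(\<integral>\<^sup>+t. ennreal (f a b w t) \<partial>lborel) \<le> ennreal (3 / (1 - s / 2) * (b - a) powr (1 - s / 2))" if "a \<le> b" for a b w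
  proof -
    have "(\<integral>\<^sup>+t. ennreal (f a b w t) \<partial>lborel) = (\<integral>\<^sup>+t. ennreal (\<bar>t - w\<bar> powr - (s / 2)) * indicator {a..<b} t \<partial>lborel)"
      by (intro nn_integral_cong) (auto simp: f_def split: split_indicator)
    then show ?thesis using nn_integral_powr_interval[of "s / 2" a b w] s that by simp
  qed
  have "(\<integral>\<^sup>+z\<in>rect a b c d. ennreal (dist z w powr - s) \<partial>lborel)
    \<le> (\<integral>\<^sup>+z. ennreal (f a b (w $ 1) (z $ 1) * f c d (w $ 2) (z $ 2)) \<partial>(lborel :: (real^2) measure))"
    using AE_component_neq[where i=1 and c="w $ 1"] AE_component_neq[where i=2 and c="w $ 2"]
  proof (intro nn_integral_mono_AE, eventually_elim)
    case (elim z)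
    then show ?case using powr_dist_le_components[of s z w] s
      by (auto simp: f_def rect_def ennreal_leI split: split_indicator)
  qed
  also have "\<dots> = (\<integral>\<^sup>+t. ennreal (f a b (w $ 1) t) \<partial>lborel) * (\<integral>\<^sup>+t. ennreal (f c d (w $ 2) t) \<partial>lborel)"
    by (intro nn_integral_product_real2) (auto simp: f_def)
  also have "\<dots> \<le> ennreal (3 / (1 - s / 2) * (b - a) powr (1 - s / 2)) * ennreal (3 / (1 - s / 2) * (d - c) powr (1 - s / 2))"
    using ab by (intro mult_mono f) auto
  also have "\<dots> = ennreal ((3 / (1 - s / 2))\<^sup>2 * ((b - a) * (d - c)) powr (1 - s / 2))"
    using ab s by (simp add: powr_mult power2_eq_square flip: ennreal_mult)
  finally show ?thesis .
qed

section \<open>Integrating a product of kernels along a functional graph\<close>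

text \<open>The edges run from \<open>i\<close> to \<open>F i\<close> for \<open>i\<close> in
  \<open>E\<close>. A vertex that no edge enters is integrated out first: it yields \<open>t\<close>
  if an edge leaves it and the total mass otherwise. If every vertex is entered, then
  \<open>E = V\<close> and \<open>F\<close> permutes it, so a cycle has to be opened: one vertex is
  integrated against its two neighbours, which by \<open>b2\<close> costs the square of
  \<open>t\<close> over the total mass. Its predecessor is then left without an outgoing edge, which
  is why \<open>E\<close> may be smaller than \<open>V\<close>.\<close>

lemma (in sigma_finite_measure) nn_integral_functional_graph:
  fixes g :: "'a \<Rightarrow> 'a \<Rightarrow> ennreal" and V :: "'v set"
  assumes g[measurable]: "(\<lambda>(x, y). g x y) \<in> borel_measurable (M \<Otimes>\<^sub>M M)"
    and sym: "\<And>x y. g x y = g y x"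
    and b1: "\<And>w. w \<in> space M \<Longrightarrow> (\<integral>\<^sup>+z. g z w \<partial>M) \<le> t"
    and b2: "\<And>w w'. w \<in> space M \<Longrightarrow> w' \<in> space M \<Longrightarrow> (\<integral>\<^sup>+z. g z w * g z w' \<partial>M) * emeasure M (space M) \<le> t\<^sup>2"
    and fin: "finite V" and E: "E \<subseteq> V" "F ` E \<subseteq> V" "\<And>i. i \<in> E \<Longrightarrow> F i \<noteq> i"
  shows "(\<integral>\<^sup>+z. (\<Prod>i\<in>E. g (z i) (z (F i))) \<partial>PiM V (\<lambda>_. M)) \<le> t ^ card E * emeasure M (space M) ^ (card V - card E)"
  using fin E
proof (induction "card V" arbitrary: V E rule: less_induct)
  case less
  define m where "m = emeasure M (space M)"
  interpret P: product_sigma_finite "\<lambda>_ :: 'v. M" by standard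
  note fin = less.prems(1) and E = less.prems(2,3,4)
  have finE: "finite E" using fin E by (rule_tac finite_subset)
  have meas: "(\<lambda>z. \<Prod>i\<in>E'. g (z i) (z (F i))) \<in> borel_measurable (PiM V' (\<lambda>_. M))"
    if "E' \<subseteq> V'" "F ` E' \<subseteq> V'" for V' E'
  proof (intro borel_measurable_prod_ennreal)
    fix i assume i: "i \<in> E'"
    have [measurable]: "(\<lambda>z. z i) \<in> measurable (PiM V' (\<lambda>_. M)) M" "(\<lambda>z. z (F i)) \<in> measurable (PiM V' (\<lambda>_. M)) M"
      using that i by (auto intro!: measurable_component_singleton)
    have "(\<lambda>z. (\<lambda>(x, y). g x y) (z i, z (F i))) \<in> borel_measurable (PiM V' (\<lambda>_. M))"
      by measurable
    then show "(\<lambda>z. g (z i) (z (F i))) \<in> borel_measurable (PiM V' (\<lambda>_. M))" by simp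
  qed
  have gm: "(\<lambda>x. g x w) \<in> borel_measurable M" if w: "w \<in> space M" for w
  proof -
    have "(\<lambda>x. (\<lambda>(x, y). g x y) (x, w)) \<in> borel_measurable M" using w by measurable
    then show ?thesis by simp
  qed
  have split: "(\<integral>\<^sup>+z. (\<Prod>i\<in>E. g (z i) (z (F i))) \<partial>PiM V (\<lambda>_. M))
      = (\<integral>\<^sup>+z. (\<integral>\<^sup>+x. (\<Prod>i\<in>E. g ((z(v := x)) i) ((z(v := x)) (F i))) \<partial>M) \<partial>PiM (V - {v}) (\<lambda>_. M))" if v: "v \<in> V" for v
  proof -
    have "V = insert v (V - {v})" using v by blast
    then have "(\<integral>\<^sup>+z. (\<Prod>i\<in>E. g (z i) (z (F i))) \<partial>PiM V (\<lambda>_. M)) = (\<integral>\<^sup>+z. (\<Prod>i\<in>E. g (z i) (z (F i))) \<partial>PiM (insert v (V - {v})) (\<lambda>_. M))"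
      by simp
    also have "\<dots> = (\<integral>\<^sup>+z. (\<integral>\<^sup>+x. (\<Prod>i\<in>E. g ((z(v := x)) i) ((z(v := x)) (F i))) \<partial>M) \<partial>PiM (V - {v}) (\<lambda>_. M))"
      using fin E v by (intro P.product_nn_integral_insert meas) auto
    finally show ?thesis .
  qed
  have reduce: ?case
    if v: "v \<in> V" and E': "E' \<subseteq> V - {v}" "F ` E' \<subseteq> V - {v}" "E' \<subseteq> E"
      and inner: "\<And>z. z \<in> space (PiM (V - {v}) (\<lambda>_. M)) \<Longrightarrow>
        (\<integral>\<^sup>+x. (\<Prod>i\<in>E. g ((z(v := x)) i) ((z(v := x)) (F i))) \<partial>M) \<le> c * (\<Prod>i\<in>E'. g (z i) (z (F i)))"
      and c: "c * (t ^ card E' * m ^ (card (V - {v}) - card E')) \<le> t ^ card E * m ^ (card V - card E)"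
    for v E' c
  proof -
    have "(\<integral>\<^sup>+z. (\<Prod>i\<in>E. g (z i) (z (F i))) \<partial>PiM V (\<lambda>_. M))
      \<le> (\<integral>\<^sup>+z. c * (\<Prod>i\<in>E'. g (z i) (z (F i))) \<partial>PiM (V - {v}) (\<lambda>_. M))"
      unfolding split[OF v] by (intro nn_integral_mono inner)
    also have "\<dots> = c * (\<integral>\<^sup>+z. (\<Prod>i\<in>E'. g (z i) (z (F i))) \<partial>PiM (V - {v}) (\<lambda>_. M))"
      using E' by (intro nn_integral_cmult meas)
    also have "\<dots> \<le> c * (t ^ card E' * m ^ (card (V - {v}) - card E'))"
      unfolding m_def
    proof (rule mult_left_mono[OF less.hyps])
      show "card (V - {v}) < card V" using fin v by (rule card_Diff1_less)
    qed (use fin E E' in auto)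
    also note c
    finally show ?thesis by (simp add: m_def)
  qed
  show ?case
  proof (cases "V = {}")
    case True
    then show ?thesis using E by (simp add: P.nn_integral_empty del: nn_integral_const)
  next
    case ne: False
    have cV: "card (V - {v}) = card V - 1" "1 \<le> card V" if "v \<in> V" for v using fin that by (auto simp: Suc_le_eq card_gt_0_iff)
    have cEV: "card E \<le> card V" using fin E by (simp add: card_mono)
    show ?thesis
    proof (cases "V \<subseteq> F ` E")
      case False
      then obtain v where v: "v \<in> V" "v \<notin> F ` E" by blast
      show ?thesis
      proof (cases "v \<in> E")
        case True
        show ?thesis
        proof (rule reduce[OF v(1), of "E - {v}" t])
          fix z assume z: "z \<in> space (PiM (V - {v}) (\<lambda>_. M))"
          have Fv: "F v \<in> V" "F v \<noteq> v" using E True by auto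
          have zF: "z (F v) \<in> space M" using z Fv by (auto simp: space_PiM PiE_def Pi_def)
          have "(\<integral>\<^sup>+x. (\<Prod>i\<in>E. g ((z(v := x)) i) ((z(v := x)) (F i))) \<partial>M)
              = (\<integral>\<^sup>+x. g x (z (F v)) * (\<Prod>i\<in>E - {v}. g (z i) (z (F i))) \<partial>M)"
          proof (intro nn_integral_cong)
            fix x
            have "(\<Prod>i\<in>E - {v}. g ((z(v := x)) i) ((z(v := x)) (F i))) = (\<Prod>i\<in>E - {v}. g (z i) (z (F i)))"
              using v by (intro prod.cong) auto
            then show "(\<Prod>i\<in>E. g ((z(v := x)) i) ((z(v := x)) (F i))) = g x (z (F v)) * (\<Prod>i\<in>E - {v}. g (z i) (z (F i)))"
              using prod.remove[OF finE True, of "\<lambda>i. g ((z(v := x)) i) ((z(v := x)) (F i))"] Fv by simp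
          qed
          also have "\<dots> = (\<integral>\<^sup>+x. g x (z (F v)) \<partial>M) * (\<Prod>i\<in>E - {v}. g (z i) (z (F i)))"
            by (intro nn_integral_multc gm zF)
          also have "\<dots> \<le> t * (\<Prod>i\<in>E - {v}. g (z i) (z (F i)))" using b1[OF zF] by (intro mult_right_mono) auto
          finally show "(\<integral>\<^sup>+x. (\<Prod>i\<in>E. g ((z(v := x)) i) ((z(v := x)) (F i))) \<partial>M) \<le> t * (\<Prod>i\<in>E - {v}. g (z i) (z (F i)))" .
        next
          have "card E = Suc (card (E - {v}))" using finE True by (metis card.remove)
          then show "t * (t ^ card (E - {v}) * m ^ (card (V - {v}) - card (E - {v}))) \<le> t ^ card E * m ^ (card V - card E)"
            using cV[OF v(1)] by (simp add: mult_ac)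
        qed (use E v in auto)
      next
        case nE: False
        show ?thesis
        proof (rule reduce[OF v(1), of E m])
          fix z assume z: "z \<in> space (PiM (V - {v}) (\<lambda>_. M))"
          have "(\<integral>\<^sup>+x. (\<Prod>i\<in>E. g ((z(v := x)) i) ((z(v := x)) (F i))) \<partial>M)
              = (\<integral>\<^sup>+x. (\<Prod>i\<in>E. g (z i) (z (F i))) \<partial>M)"
          proof (intro nn_integral_cong prod.cong refl)
            fix x i assume "i \<in> E"
            then show "g ((z(v := x)) i) ((z(v := x)) (F i)) = g (z i) (z (F i))" using nE v by auto
          qed
          then show "(\<integral>\<^sup>+x. (\<Prod>i\<in>E. g ((z(v := x)) i) ((z(v := x)) (F i))) \<partial>M) \<le> m * (\<Prod>i\<in>E. g (z i) (z (F i)))"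
            by (simp add: m_def mult.commute)
        next
          have "E \<subseteq> V - {v}" using E nE by auto
          then have "card E \<le> card V - 1" using fin cV[OF v(1)] card_mono[of "V - {v}" E] by simp
          then have "card V - card E = Suc (card V - 1 - card E)" using cV[OF v(1)] by linarith
          then show "m * (t ^ card E * m ^ (card (V - {v}) - card E)) \<le> t ^ card E * m ^ (card V - card E)"
            using cV[OF v(1)] by (simp add: mult_ac)
        qed (use E v nE in auto)
      qed
    next
      case True
      then have "card V \<le> card (F ` E)" using finE by (intro card_mono) auto
      moreover have "card (F ` E) \<le> card E" using finE by (rule card_image_le)
      ultimately have cE: "card E = card V" "card (F ` E) = card E" using cEV by auto
      have EV: "E = V" using fin E cE by (intro card_subset_eq) auto
      have inj: "inj_on F E" using finE cE(2) by (rule eq_card_imp_inj_on)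
      obtain v where v: "v \<in> V" using ne by blast
      obtain u where u: "u \<in> E" "F u = v" using True v by blast
      have uv: "u \<noteq> v" using E(3)[OF u(1)] u(2) by simp
      have vE: "v \<in> E" using v EV by simp
      \<comment> \<open>The supremum replaces the quotient of \<open>t\<^sup>2\<close> by the total
        mass, since that mass may be 0.\<close>
      define s where "s = (SUP p\<in>space M \<times> space M. (\<integral>\<^sup>+z. g z (fst p) * g z (snd p) \<partial>M))"
      \<comment> \<open>Two edges disappear with \<open>v\<close>: its own and the one entering from
        \<open>u\<close>. One more vertex than edges remains free, whence the factor
        \<open>m\<close> that pairs with \<open>s\<close>. The case \<open>F v = u\<close>, a cycle
        of length two, is included.\<close>
      show ?thesis
      proof (rule reduce[OF v, of "E - {v} - {u}" s])
        fix z assume z: "z \<in> space (PiM (V - {v}) (\<lambda>_. M))"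
        have Fv: "F v \<in> V" "F v \<noteq> v" using E vE by auto
        have zF: "z (F v) \<in> space M" "z u \<in> space M" using z Fv uv u EV by (auto simp: space_PiM PiE_def Pi_def)
        have "(\<integral>\<^sup>+x. (\<Prod>i\<in>E. g ((z(v := x)) i) ((z(v := x)) (F i))) \<partial>M)
            = (\<integral>\<^sup>+x. (g x (z (F v)) * g x (z u)) * (\<Prod>i\<in>E - {v} - {u}. g (z i) (z (F i))) \<partial>M)"
        proof (intro nn_integral_cong)
          fix x
          let ?h = "\<lambda>i. g ((z(v := x)) i) ((z(v := x)) (F i))"
          have "(\<Prod>i\<in>E - {v} - {u}. ?h i) = (\<Prod>i\<in>E - {v} - {u}. g (z i) (z (F i)))"
          proof (intro prod.cong refl)
            fix i assume i: "i \<in> E - {v} - {u}"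
            then have "F i \<noteq> v" using inj u by (auto simp: inj_on_def)
            then show "?h i = g (z i) (z (F i))" using i by auto
          qed
          moreover have "(\<Prod>i\<in>E. ?h i) = ?h v * (\<Prod>i\<in>E - {v}. ?h i)" by (rule prod.remove[OF finE vE])
          moreover have "(\<Prod>i\<in>E - {v}. ?h i) = ?h u * (\<Prod>i\<in>E - {v} - {u}. ?h i)"
            using finE u uv by (intro prod.remove) auto
          ultimately show "(\<Prod>i\<in>E. ?h i) = (g x (z (F v)) * g x (z u)) * (\<Prod>i\<in>E - {v} - {u}. g (z i) (z (F i)))"
            using Fv u uv sym[of "z u" x] by (simp add: mult_ac)
        qed
        also have "\<dots> = (\<integral>\<^sup>+x. g x (z (F v)) * g x (z u) \<partial>M) * (\<Prod>i\<in>E - {v} - {u}. g (z i) (z (F i)))"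
          using gm[OF zF(1)] gm[OF zF(2)] by (intro nn_integral_multc borel_measurable_times_ennreal)
        also have "\<dots> \<le> s * (\<Prod>i\<in>E - {v} - {u}. g (z i) (z (F i)))"
          unfolding s_def using zF by (intro mult_right_mono SUP_upper2[of "(z (F v), z u)"]) auto
        finally show "(\<integral>\<^sup>+x. (\<Prod>i\<in>E. g ((z(v := x)) i) ((z(v := x)) (F i))) \<partial>M) \<le> s * (\<Prod>i\<in>E - {v} - {u}. g (z i) (z (F i)))" .
      next
        have "card E = Suc (Suc (card (E - {v} - {u})))"
          using finE vE u uv card.remove[of E v] card.remove[of "E - {v}" u] by simp
        then have c: "card E = card (E - {v} - {u}) + 2" by simp
        have "s * m \<le> t\<^sup>2"
          unfolding s_def SUP_mult_right_ennreal using b2 by (intro SUP_least) (auto simp: m_def)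
        then have "(s * m) * t ^ card (E - {v} - {u}) \<le> t\<^sup>2 * t ^ card (E - {v} - {u})" by (intro mult_right_mono) auto
        moreover have "card (V - {v}) - card (E - {v} - {u}) = 1" using cE c cV[OF v] by simp
        moreover have "t ^ card E = t\<^sup>2 * t ^ card (E - {v} - {u})" unfolding c power_add by (rule mult.commute)
        moreover have "card V - card E = 0" using cE by simp
        ultimately show "s * (t ^ card (E - {v} - {u}) * m ^ (card (V - {v}) - card (E - {v} - {u}))) \<le> t ^ card E * m ^ (card V - card E)"
          by (simp only: power_0 power_one_right mult_1_right) (simp only: mult_ac)
      qed (use E v u uv inj EV in \<open>auto simp: inj_on_def\<close>)
    qed
  qed
qed

section \<open>The regular part of the Green function\<close>

text \<open>Were \<open>c\<close> positive, the first derivative, which vanishes at 0, would be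
  positive just to the right of it, and \<open>g\<close> would increase there.\<close>

lemma second_derivative_at_max:
  fixes g g' :: "real \<Rightarrow> real"
  assumes e: "0 < e" and d1: "\<And>t. \<bar>t\<bar> < e \<Longrightarrow> (g has_real_derivative g' t) (at t)"
    and d2: "(g' has_real_derivative c) (at 0)" and mx: "\<And>t. \<bar>t\<bar> < e \<Longrightarrow> g t \<le> g 0"
  shows "c \<le> 0"
proof (rule ccontr)
  assume "\<not> c \<le> 0"
  then have c: "0 < c" by simp
  have "g' 0 = 0"
    using DERIV_local_max[OF d1[of 0] e] mx e by auto
  with DERIV_pos_inc_right[OF d2 c] obtain d where d: "0 < d" "\<And>h. 0 < h \<Longrightarrow> h < d \<Longrightarrow> 0 < g' h" by auto
  define h where "h = min d e / 2"
  have h: "0 < h" "h < d" "h < e" using d e by (auto simp: h_def min_def)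
  have "\<exists>z. 0 < z \<and> z < h \<and> g h - g 0 = (h - 0) * g' z"
    using h by (intro MVT2) (auto intro!: d1)
  then obtain z where z: "0 < z" "z < h" "g h - g 0 = h * g' z" by auto
  then have "0 < g h - g 0" using d(2)[of z] h by simp
  then show False using mx[of h] h by simp
qed

text \<open>A zero Laplacian does not contradict a maximum, so a small multiple of the squared norm
  is added to make it positive. Since \<open>D\<close> is open and \<open>u\<close> is controlled at
  the frontier only as a limit, the maximum is sought on a superlevel set \<open>C\<close>, which is
  closed because it stays away from the frontier.\<close>

lemma weak_maximum_principle:
  fixes u :: "real^2 \<Rightarrow> real"
  assumes D: "open D" "bounded D" and cont: "continuous_on D u"
    and d1: "\<And>x j. x \<in> D \<Longrightarrow> ((\<lambda>t. u (x + t *\<^sub>R axis j 1)) has_real_derivative u1 j x) (at 0)"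
    and d2: "\<And>x j. x \<in> D \<Longrightarrow> ((\<lambda>t. u1 j (x + t *\<^sub>R axis j 1)) has_real_derivative u2 j x) (at 0)"
    and lap: "\<And>x. x \<in> D \<Longrightarrow> (\<Sum>j\<in>UNIV. u2 j x) = 0"
    and bdry: "\<And>z e. z \<in> frontier D \<Longrightarrow> 0 < e \<Longrightarrow> eventually (\<lambda>x. u x < B + e) (at z within D)"
    and x0: "x0 \<in> D"
  shows "u x0 \<le> B"
proof (rule ccontr)
  assume "\<not> u x0 \<le> B"
  define m where "m = u x0 - B"
  have m: "0 < m" using \<open>\<not> u x0 \<le> B\<close> by (simp add: m_def)
  have ux0: "u x0 = B + m" by (simp add: m_def)
  obtain R where R: "0 < R" "\<And>x. x \<in> D \<Longrightarrow> norm x \<le> R" using D(2) by (auto simp: bounded_pos)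
  \<comment> \<open>The added term is then at most \<open>m / 4\<close> on \<open>D\<close>, less
    than the gap \<open>m / 2\<close> between the value at \<open>x0\<close> and the values off
    \<open>C\<close>. So a maximum over \<open>C\<close> is one over \<open>D\<close>.\<close>
  define \<epsilon> where "\<epsilon> = m / (4 * R\<^sup>2)"
  have \<epsilon>: "0 < \<epsilon>" using m R by (simp add: \<epsilon>_def)
  have \<epsilon>R: "\<epsilon> * R\<^sup>2 = m / 4" using R by (simp add: \<epsilon>_def)
  define v where "v x = u x + \<epsilon> * (norm x)\<^sup>2" for x
  define C where "C = {x\<in>D. B + m / 2 \<le> u x}"
  have "closed C"
    unfolding closed_sequential_limits
  proof (intro allI impI, elim conjE)
    fix f l assume f: "\<forall>n. f n \<in> C" "f \<longlonglongrightarrow> l"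
    show "l \<in> C"
    proof (cases "l \<in> D")
      case True
      have "(\<lambda>n. u (f n)) \<longlonglongrightarrow> u l"
        using cont f True by (intro continuous_on_tendsto_compose[OF cont f(2) True]) (auto simp: C_def)
      then have "B + m / 2 \<le> u l" using f by (intro LIMSEQ_le_const) (auto simp: C_def)
      then show ?thesis using True by (simp add: C_def)
    next
      case False
      have "l \<in> closure D" using f by (auto simp: closure_sequential C_def)
      then have fr: "l \<in> frontier D" using False D(1) by (simp add: frontier_def interior_open)
      have "filterlim f (at l within D) sequentially"
        using f False by (auto simp: filterlim_at C_def eventually_sequentially)
      then have "eventually (\<lambda>n. u (f n) < B + m / 2) sequentially"
        using eventually_compose_filterlim[OF bdry[OF fr, of "m / 2"]] m by simp
      then obtain n where "u (f n) < B + m / 2" by (auto simp: eventually_sequentially)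
      then show ?thesis using f(1) by (auto simp: C_def not_le[symmetric])
    qed
  qed
  moreover have "bounded C" using D(2) by (rule bounded_subset) (auto simp: C_def)
  ultimately have "compact C" by (simp add: compact_eq_bounded_closed)
  moreover have x0C: "x0 \<in> C" using x0 m by (simp add: C_def ux0)
  moreover have "continuous_on C v"
    unfolding v_def by (intro continuous_intros continuous_on_subset[OF cont]) (auto simp: C_def)
  ultimately obtain p where p: "p \<in> C" "\<And>x. x \<in> C \<Longrightarrow> v x \<le> v p"
    using continuous_attains_sup[of C v] by blast
  have pD: "p \<in> D" using p by (simp add: C_def)
  have vmax: "v x \<le> v p" if x: "x \<in> D" for x
  proof (cases "x \<in> C")
    case False
    have "(norm x)\<^sup>2 \<le> R\<^sup>2" using R(2)[OF x] by (intro power_mono) auto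
    then have "\<epsilon> * (norm x)\<^sup>2 \<le> m / 4" using \<epsilon> \<epsilon>R by (metis mult_left_mono less_imp_le)
    moreover have "u x < B + m / 2" using False x by (simp add: C_def)
    ultimately have "v x \<le> u x0" using m unfolding v_def ux0 by simp
    also have "\<dots> \<le> v x0" using \<epsilon> by (simp add: v_def)
    also have "\<dots> \<le> v p" using p(2)[OF x0C] .
    finally show ?thesis .
  qed (use p in auto)
  obtain e where e: "0 < e" "ball p e \<subseteq> D" using D(1) pD by (auto simp: open_contains_ball)
  have "u2 j p + 2 * \<epsilon> \<le> 0" for j
  proof (rule second_derivative_at_max[OF e(1)])
    let ?q = "\<lambda>t :: real. p + t *\<^sub>R axis j 1"
    have qD: "?q t \<in> D" if "\<bar>t\<bar> < e" for t
      using e(2) that by (auto simp: subset_eq dist_norm)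
    have nq: "(norm (?q t))\<^sup>2 = (norm p)\<^sup>2 + 2 * t * p $ j + t\<^sup>2" for t
      unfolding power2_norm_eq_inner by (simp add: inner_add_left inner_add_right inner_axis inner_axis' inner_axis_axis power2_eq_square distrib_left)
    show "((\<lambda>t. v (?q t)) has_real_derivative u1 j (?q t) + \<epsilon> * (2 * p $ j + 2 * t)) (at t)" if t: "\<bar>t\<bar> < e" for t
    proof -
      have "((\<lambda>s. u (?q t + s *\<^sub>R axis j 1)) has_real_derivative u1 j (?q t)) (at (t - t))" using d1[OF qD[OF t]] by simp
      then have "((\<lambda>s. u (?q t + (s - t) *\<^sub>R axis j 1)) has_real_derivative u1 j (?q t)) (at t)"
        using DERIV_shift[of "\<lambda>s. u (?q t + s *\<^sub>R axis j 1)" "u1 j (?q t)" t "- t"] by simp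
      moreover have "?q t + (s - t) *\<^sub>R axis j 1 = ?q s" for s by (simp add: algebra_simps)
      ultimately have "((\<lambda>s. u (?q s)) has_real_derivative u1 j (?q t)) (at t)" by simp
      then show ?thesis unfolding v_def nq by (auto intro!: derivative_eq_intros)
    qed
    show "((\<lambda>t. u1 j (?q t) + \<epsilon> * (2 * p $ j + 2 * t)) has_real_derivative u2 j p + 2 * \<epsilon>) (at 0)"
      by (auto intro!: derivative_eq_intros d2[OF pD])
    show "v (?q t) \<le> v (?q 0)" if "\<bar>t\<bar> < e" for t using vmax[OF qD[OF that]] by simp
  qed
  then have "(\<Sum>j\<in>(UNIV :: 2 set). u2 j p + 2 * \<epsilon>) \<le> 0" by (intro sum_nonpos) auto
  then have "(\<Sum>j\<in>(UNIV :: 2 set). u2 j p) + 4 * \<epsilon> \<le> 0" by (simp add: sum_2)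
  then show False using lap[OF pD] \<epsilon> by simp
qed

section \<open>Bounds for the regular part from its boundary values\<close>

lemma pdir_has_derivative:
  assumes "f differentiable (at (x :: real^2))"
  shows "((\<lambda>t. f (x + t *\<^sub>R axis j 1)) has_real_derivative pdir j f x) (at 0)"
proof -
  have "(f has_derivative frechet_derivative f (at x)) (at (x + 0 *\<^sub>R axis j 1))"
    using assms frechet_derivative_works[of f "at x"] by simp
  moreover have "((\<lambda>t. x + t *\<^sub>R axis j 1) has_derivative (\<lambda>t. t *\<^sub>R axis j 1)) (at 0)"
    by (auto intro!: derivative_eq_intros)
  ultimately have "((\<lambda>t. f (x + t *\<^sub>R axis j 1)) has_derivative (\<lambda>t. frechet_derivative f (at x) (t *\<^sub>R axis j 1))) (at 0)"
    by (rule has_derivative_compose[where f = "\<lambda>t. x + t *\<^sub>R axis j 1", rotated])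
  moreover have "linear (frechet_derivative f (at x))" using assms by (rule linear_frechet_derivative)
  then have "frechet_derivative f (at x) (t *\<^sub>R axis j 1) = pdir j f x * t" for t
    by (simp add: pdir_def linear_cmul)
  ultimately show ?thesis
    by (simp add: has_field_derivative_def)
qed

lemma harmonic_onD:
  assumes "harmonic_on S h"
  shows "x \<in> S \<Longrightarrow> ((\<lambda>t. h (x + t *\<^sub>R axis j 1)) has_real_derivative partials [j] h x) (at 0)"
    and "x \<in> S \<Longrightarrow> ((\<lambda>t. partials [j] h (x + t *\<^sub>R axis j 1)) has_real_derivative partials [j, j] h x) (at 0)"
    and "x \<in> S \<Longrightarrow> (\<Sum>j\<in>UNIV. partials [j, j] h x) = 0"
    and "continuous_on S h"
proof -
  have d: "length js < 2 \<Longrightarrow> x \<in> S \<Longrightarrow> partials js h differentiable (at x)" for js x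
    using assms by (auto simp: harmonic_on_def)
  show "x \<in> S \<Longrightarrow> ((\<lambda>t. h (x + t *\<^sub>R axis j 1)) has_real_derivative partials [j] h x) (at 0)"
    using pdir_has_derivative[OF d[of "[]" x]] by simp
  show "x \<in> S \<Longrightarrow> ((\<lambda>t. partials [j] h (x + t *\<^sub>R axis j 1)) has_real_derivative partials [j, j] h x) (at 0)"
    using pdir_has_derivative[OF d[of "[j]" x]] by simp
  show "x \<in> S \<Longrightarrow> (\<Sum>j\<in>UNIV. partials [j, j] h x) = 0"
    using assms by (auto simp: harmonic_on_def)
  show "continuous_on S h"
    using d[of "[]"] by (auto intro!: continuous_at_imp_continuous_on differentiable_imp_continuous_within)
qed

lemma harmonic_difference_bound:
  fixes B :: real
  assumes D: "open D" "bounded D" and h: "harmonic_on D h1" "harmonic_on D h2"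
    and lim: "\<And>z. z \<in> frontier D \<Longrightarrow> ((\<lambda>y. h1 y - h2 y) \<longlongrightarrow> l z) (at z within D)"
    and l: "\<And>z. z \<in> frontier D \<Longrightarrow> l z \<le> B" and x: "x \<in> D"
  shows "h1 x - h2 x \<le> B"
proof (rule weak_maximum_principle[OF D, where u = "\<lambda>x. h1 x - h2 x" and ?u1.0 = "\<lambda>j x. partials [j] h1 x - partials [j] h2 x"
      and ?u2.0 = "\<lambda>j x. partials [j, j] h1 x - partials [j, j] h2 x"])
  show "continuous_on D (\<lambda>x. h1 x - h2 x)" using harmonic_onD(4)[OF h(1)] harmonic_onD(4)[OF h(2)] by (intro continuous_intros)
  fix y j assume y: "y \<in> D"
  show "((\<lambda>t. h1 (y + t *\<^sub>R axis j 1) - h2 (y + t *\<^sub>R axis j 1)) has_real_derivative partials [j] h1 y - partials [j] h2 y) (at 0)"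
    by (intro DERIV_diff harmonic_onD(1)[OF h(1) y] harmonic_onD(1)[OF h(2) y])
  show "((\<lambda>t. partials [j] h1 (y + t *\<^sub>R axis j 1) - partials [j] h2 (y + t *\<^sub>R axis j 1)) has_real_derivative partials [j, j] h1 y - partials [j, j] h2 y) (at 0)"
    by (intro DERIV_diff harmonic_onD(2)[OF h(1) y] harmonic_onD(2)[OF h(2) y])
  show "(\<Sum>j\<in>UNIV. partials [j, j] h1 y - partials [j, j] h2 y) = 0"
    unfolding sum_subtractf using harmonic_onD(3)[OF h(1) y] harmonic_onD(3)[OF h(2) y] by simp
next
  fix z and e :: real assume z: "z \<in> frontier D" and e: "0 < e"
  show "\<forall>\<^sub>F x in at z within D. h1 x - h2 x < B + e"
    using order_tendstoD(2)[OF lim[OF z], of "B + e"] l[OF z] e by simp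
qed (rule x)

lemma harmonic_on_zero: "harmonic_on D (\<lambda>_. 0)"
proof -
  have "partials js (\<lambda>_. 0) = (\<lambda>_. 0)" for js
  proof (induction js)
    case (Cons j js)
    then show ?case by (auto simp: pdir_def)
  qed simp
  then show ?thesis by (simp add: harmonic_on_def del: partials.simps)
qed

lemma ln_diff_le:
  fixes a b c :: real
  assumes "0 < c" "c \<le> a" "c \<le> b"
  shows "\<bar>ln a - ln b\<bar> \<le> \<bar>a - b\<bar> / c"
proof -
  have *: "ln x - ln y \<le> \<bar>x - y\<bar> / c" if "c \<le> x" "c \<le> y" for x y
  proof -
    have "ln x - ln y = ln (x / y)" using that assms by (simp add: ln_div)
    also have "\<dots> \<le> x / y - 1" using that assms by (intro ln_le_minus_one) auto
    also have "\<dots> = (x - y) / y" using that assms by (simp add: field_simps)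
    also have "\<dots> \<le> \<bar>x - y\<bar> / c" using that assms by (intro frac_le) auto
    finally show ?thesis .
  qed
  show ?thesis using *[of a b] *[of b a] assms by (auto simp: abs_le_iff abs_minus_commute)
qed

text \<open>For a fixed pole \<open>x\<close> the function \<open>H x\<close> has boundary values
  \<open>ln (dist x z)\<close>, and the maximum principle carries estimates of these into
  \<open>D\<close>: a bound when \<open>x\<close> has the margin \<open>\<kappa>\<close>, and
  continuity in \<open>x\<close> uniformly in \<open>y\<close>. Together with the continuity of each
  \<open>H x\<close> this gives joint continuity, which supplies the measurability of the regular
  part in the energy integral.\<close>

lemma green_regular_part:
  assumes D: "open D" "bounded D" and G: "dirichlet_green D G"
  obtains H where "\<And>x y. x \<in> D \<Longrightarrow> y \<in> D \<Longrightarrow> x \<noteq> y \<Longrightarrow> G x y = - ln (dist x y) + H x y"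
    and "continuous_on (D \<times> D) (\<lambda>p. H (fst p) (snd p))"
    and "\<And>\<kappa>. 0 < \<kappa> \<Longrightarrow> \<exists>B\<ge>0. \<forall>x y. cball x \<kappa> \<subseteq> D \<longrightarrow> y \<in> D \<longrightarrow> \<bar>H x y\<bar> \<le> B"
proof -
  define H where "H x = (SOME h. harmonic_on D h \<and> (\<forall>y\<in>D - {x}. G x y = - ln (dist x y) + h y))" for x
  have H: "harmonic_on D (H x) \<and> (\<forall>y\<in>D - {x}. G x y = - ln (dist x y) + H x y)" if x: "x \<in> D" for x
  proof -
    have "\<exists>h. harmonic_on D h \<and> (\<forall>y\<in>D - {x}. G x y = - ln (dist x y) + h y)"
      using G x unfolding dirichlet_green_def by blast
    then show ?thesis unfolding H_def by (rule someI_ex)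
  qed
  have frD: "z \<notin> D" if "z \<in> frontier D" for z using that D(1) by (simp add: frontier_def interior_open)
  have lim: "(H x \<longlongrightarrow> ln (dist x z)) (at z within D)" if x: "x \<in> D" and z: "z \<in> frontier D" for x z
  proof -
    have xz: "x \<noteq> z" using frD[OF z] x by auto
    have "((\<lambda>y. G x y + ln (dist x y)) \<longlongrightarrow> 0 + ln (dist x z)) (at z within D)"
      using G x z xz by (intro tendsto_add tendsto_intros) (auto simp: dirichlet_green_def)
    moreover have "eventually (\<lambda>y. G x y + ln (dist x y) = H x y) (at z within D)"
    proof -
      have "eventually (\<lambda>y. y \<noteq> x) (at z within D)"
        using eventually_at_ball'[of "dist x z" z D] xz by (auto elim!: eventually_mono simp: dist_commute)
      moreover have "eventually (\<lambda>y. y \<in> D) (at z within D)"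
        unfolding eventually_at_filter by (intro always_eventually) auto
      ultimately show ?thesis by eventually_elim (use H[OF x] in auto)
    qed
    ultimately show ?thesis using Lim_transform_eventually by force
  qed
  have far: "\<kappa> \<le> dist x z" if "cball x \<kappa> \<subseteq> D" "z \<in> frontier D" for x z \<kappa>
    using that frD[of z] by (force simp: subset_eq not_le)
  \<comment> \<open>Half of the margin remains at \<open>x\<close>. Both distances to the frontier
    are at least \<open>\<kappa> / 2\<close>, where the logarithm has Lipschitz constant
    \<open>2 / \<kappa>\<close>.\<close>
  have diff: "\<bar>H x y - H x' y\<bar> \<le> dist x x' * (2 / \<kappa>)"
    if \<kappa>: "0 < \<kappa>" "cball x' \<kappa> \<subseteq> D" and xx: "dist x x' \<le> \<kappa> / 2" and y: "y \<in> D" for x x' y \<kappa>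
  proof -
    have D': "x' \<in> D" "x \<in> D" using \<kappa> xx by (auto simp: subset_eq dist_commute)
    have b: "\<bar>ln (dist x z) - ln (dist x' z)\<bar> \<le> dist x x' * (2 / \<kappa>)" if z: "z \<in> frontier D" for z
    proof -
      have 1: "\<kappa> \<le> dist x' z" by (rule far[OF \<kappa>(2) z])
      have 2: "\<kappa> / 2 \<le> dist x z" using 1 xx dist_triangle[of x' z x] by (simp add: dist_commute)
      have "\<bar>ln (dist x z) - ln (dist x' z)\<bar> \<le> \<bar>dist x z - dist x' z\<bar> / (\<kappa> / 2)"
        using 1 2 \<kappa> by (intro ln_diff_le) auto
      also have "\<dots> \<le> dist x x' / (\<kappa> / 2)"
        using dist_triangle[of x z x'] dist_triangle[of x' z x] \<kappa>
        by (intro divide_right_mono) (auto simp: dist_commute abs_le_iff)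
      finally show ?thesis by (simp add: field_simps)
    qed
    have "H x y - H x' y \<le> dist x x' * (2 / \<kappa>)"
      by (rule harmonic_difference_bound[OF D _ _ tendsto_diff[OF lim lim] _ y])
         (use H D' b in \<open>auto simp: abs_le_iff\<close>)
    moreover have "H x' y - H x y \<le> dist x x' * (2 / \<kappa>)"
      by (rule harmonic_difference_bound[OF D _ _ tendsto_diff[OF lim lim] _ y])
         (use H D' b in \<open>auto simp: abs_le_iff\<close>)
    ultimately show ?thesis by (simp add: abs_le_iff)
  qed
  show ?thesis
  proof (rule that[of H])
    show "G x y = - ln (dist x y) + H x y" if "x \<in> D" "y \<in> D" "x \<noteq> y" for x y using H[OF that(1)] that by auto
    show "continuous_on (D \<times> D) (\<lambda>p. H (fst p) (snd p))" unfolding continuous_on_def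
    proof
      fix p0 assume "p0 \<in> D \<times> D"
      then obtain x0 y0 where p0: "p0 = (x0, y0)" and xy: "x0 \<in> D" "y0 \<in> D" by auto
      obtain \<kappa> where \<kappa>: "0 < \<kappa>" "cball x0 \<kappa> \<subseteq> D" using D(1) xy(1) by (auto simp: open_contains_cball)
      let ?F = "at p0 within D \<times> D"
      have in_D: "eventually (\<lambda>p. p \<in> D \<times> D) ?F" unfolding eventually_at_filter by (intro always_eventually) auto
      have tf: "((\<lambda>p. fst p) \<longlongrightarrow> x0) ?F" "((\<lambda>p. snd p) \<longlongrightarrow> y0) ?F"
        by (auto intro!: tendsto_eq_intros simp: p0)
      then have df: "((\<lambda>p. dist (fst p) x0) \<longlongrightarrow> 0) ?F" by (simp add: tendsto_dist_iff[symmetric])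
      have "eventually (\<lambda>p. norm (H (fst p) (snd p) - H x0 (snd p)) \<le> dist (fst p) x0 * (2 / \<kappa>)) ?F"
        using in_D order_tendstoD(2)[OF df half_gt_zero[OF \<kappa>(1)]]
      proof eventually_elim
        case (elim p)
        then show ?case using diff[OF \<kappa>, of "fst p" "snd p"] by auto
      qed
      moreover have "((\<lambda>p. dist (fst p) x0 * (2 / \<kappa>)) \<longlongrightarrow> 0) ?F" using df by (rule tendsto_mult_left_zero)
      ultimately have 1: "((\<lambda>p. H (fst p) (snd p) - H x0 (snd p)) \<longlongrightarrow> 0) ?F" by (rule Lim_null_comparison)
      have "continuous_on D (H x0)" using harmonic_onD(4) H[OF xy(1)] by blast
      then have 2: "((\<lambda>p. H x0 (snd p)) \<longlongrightarrow> H x0 y0) ?F"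
        using tf(2) xy(2) in_D by (rule_tac continuous_on_tendsto_compose) (auto elim: eventually_mono)
      show "((\<lambda>p. H (fst p) (snd p)) \<longlongrightarrow> H (fst p0) (snd p0)) ?F"
        using tendsto_add[OF 1 2] by (simp add: p0)
    qed
    fix \<kappa> :: real assume \<kappa>: "0 < \<kappa>"
    obtain R where R: "0 < R" "\<And>x. x \<in> closure D \<Longrightarrow> norm x \<le> R"
      using bounded_closure[OF D(2)] by (auto simp: bounded_pos)
    define B where "B = max \<bar>ln \<kappa>\<bar> \<bar>ln (2 * R)\<bar>"
    have "\<bar>H x y\<bar> \<le> B" if x: "cball x \<kappa> \<subseteq> D" and y: "y \<in> D" for x y
    proof -
      have xD: "x \<in> D" using x \<kappa> by auto
      have b: "\<bar>ln (dist x z)\<bar> \<le> B" if z: "z \<in> frontier D" for z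
      proof -
        have 1: "\<kappa> \<le> dist x z" by (rule far[OF x z])
        have "x \<in> closure D" "z \<in> closure D" using xD z closure_subset by (auto simp: frontier_def)
        then have "dist x z \<le> 2 * R" using R(2)[of x] R(2)[of z] norm_triangle_ineq4[of x z] by (simp add: dist_norm)
        moreover have "0 < dist x z" using 1 \<kappa> by linarith
        ultimately have "ln \<kappa> \<le> ln (dist x z)" "ln (dist x z) \<le> ln (2 * R)"
          using 1 \<kappa> R by (simp_all add: ln_le_cancel_iff)
        then show ?thesis by (auto simp: B_def abs_le_iff)
      qed
      have "H x y - 0 \<le> B"
        by (rule harmonic_difference_bound[where ?h1.0 = "H x" and ?h2.0 = "\<lambda>_. 0", OF D _ harmonic_on_zero tendsto_diff[OF lim tendsto_const] _ y])
           (use H xD b in \<open>auto simp: abs_le_iff\<close>)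
      moreover have "0 - H x y \<le> B"
        by (rule harmonic_difference_bound[where ?h1.0 = "\<lambda>_. 0" and ?h2.0 = "H x", OF D harmonic_on_zero _ tendsto_diff[OF tendsto_const lim] _ y])
           (use H xD b in \<open>auto simp: abs_le_iff\<close>)
      ultimately show ?thesis by (simp add: abs_le_iff)
    qed
    then show "\<exists>B\<ge>0. \<forall>x y. cball x \<kappa> \<subseteq> D \<longrightarrow> y \<in> D \<longrightarrow> \<bar>H x y\<bar> \<le> B" by (intro exI[of _ B]) (auto simp: B_def)
  qed
qed

abbreviation circ :: "real \<Rightarrow> real^2" where "circ \<theta> \<equiv> vector [cos \<theta>, sin \<theta>]"

section \<open>Mollified circle averages\<close>

text \<open>As a probability measure on the angles it turns \<open>circle_mean\<close> into an
  expectation, to which Fubini's theorem and image measures apply.\<close>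

definition uniform_angle :: "real measure" where
  "uniform_angle = density lborel (\<lambda>\<theta>. ennreal (indicator {0..2 * pi} \<theta> / (2 * pi)))"

lemma sets_uniform_angle [simp, measurable_cong]: "sets uniform_angle = sets borel"
  by (simp add: uniform_angle_def)

lemma space_uniform_angle [simp]: "space uniform_angle = UNIV"
  by (simp add: uniform_angle_def)

lemma prob_space_uniform_angle: "prob_space uniform_angle"
proof
  have "emeasure uniform_angle UNIV = (\<integral>\<^sup>+\<theta>. ennreal (1 / (2 * pi)) * indicator {0..2 * pi} \<theta> \<partial>lborel)"
    by (subst uniform_angle_def, subst emeasure_density)
       (auto intro!: nn_integral_cong split: split_indicator)
  also have "\<dots> = 1" by (subst nn_integral_cmult_indicator) (auto simp flip: ennreal_mult)
  finally show "emeasure uniform_angle (space uniform_angle) = 1" by simp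
qed

interpretation uniform_angle: prob_space uniform_angle by (rule prob_space_uniform_angle)

lemma integral_uniform_angle:
  fixes f :: "real \<Rightarrow> real"
  assumes [measurable]: "f \<in> borel_measurable borel"
  shows "(\<integral>\<theta>. f \<theta> \<partial>uniform_angle) = (LINT \<theta>:{0..2 * pi}|lborel. f \<theta>) / (2 * pi)"
proof -
  have "(\<integral>\<theta>. f \<theta> \<partial>uniform_angle) = (\<integral>\<theta>. (1 / (2 * pi)) * (indicator {0..2 * pi} \<theta> *\<^sub>R f \<theta>) \<partial>lborel)"
    unfolding uniform_angle_def by (subst integral_density) (auto simp: mult_ac)
  then show ?thesis by (simp add: set_lebesgue_integral_def)
qed

lemma circ_measurable [measurable]: "circ \<in> borel_measurable borel"
proof -
  have "continuous_on UNIV (\<lambda>\<theta>. circ \<theta>)"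
  proof -
    have "circ = (\<lambda>\<theta>. cos \<theta> *\<^sub>R axis 1 1 + sin \<theta> *\<^sub>R axis 2 1)"
      by (auto simp: vec_eq_iff forall_2 axis_def)
    then show "continuous_on UNIV circ" by (simp only:) (intro continuous_intros)
  qed
  then show ?thesis by (rule borel_measurable_continuous_onI)
qed

lemma circle_mean_uniform_angle:
  assumes [measurable]: "f \<in> borel_measurable borel"
  shows "circle_mean f x r = (\<integral>\<theta>. f (x + r *\<^sub>R circ \<theta>) \<partial>uniform_angle)"
  unfolding circle_mean_def by (subst integral_uniform_angle) auto

definition moll :: "(real^2 \<Rightarrow> real) \<Rightarrow> real \<Rightarrow> real^2 \<Rightarrow> real^2 \<Rightarrow> real" where
  "moll \<eta> \<delta> y x = \<eta> ((y - x) /\<^sub>R \<delta>) / \<delta>\<^sup>2"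

text \<open>The density of the uniform law on a circle, blurred by \<open>\<eta>\<close> at scale
  \<open>\<delta>\<close>. Formally, pairing a distribution with it yields the circle mean of its
  mollification.\<close>

definition circle_density :: "(real^2 \<Rightarrow> real) \<Rightarrow> real \<Rightarrow> real^2 \<Rightarrow> real \<Rightarrow> real^2 \<Rightarrow> real" where
  "circle_density \<eta> \<delta> z r x = circle_mean (\<lambda>y. moll \<eta> \<delta> y x) z r"

lemma smooth_continuous: "smooth \<eta> \<Longrightarrow> continuous_on UNIV (partials js \<eta>)"
  by (auto simp: smooth_def intro!: continuous_at_imp_continuous_on differentiable_imp_continuous_within)

lemma mollifierD:
  assumes "mollifier \<eta>"
  shows "continuous_on UNIV \<eta>" "0 \<le> \<eta> x" "1 < norm x \<Longrightarrow> \<eta> x = 0" "(\<integral>x. \<eta> x \<partial>lborel) = 1" "integrable lborel \<eta>"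
    and "\<eta> \<in> borel_measurable borel" "\<exists>b>0. \<forall>x. \<eta> x \<le> b"
proof -
  show c: "continuous_on UNIV \<eta>" using assms smooth_continuous[of \<eta> "[]"] by (simp add: mollifier_def)
  then show "\<eta> \<in> borel_measurable borel" by (rule borel_measurable_continuous_onI)
  show p: "0 \<le> \<eta> x" for x using assms by (simp add: mollifier_def)
  show z: "\<eta> x = 0" if "1 < norm x" for x
  proof (rule ccontr)
    assume "\<eta> x \<noteq> 0"
    then have "x \<in> closure {x. \<eta> x \<noteq> 0}" using closure_subset[of "{x. \<eta> x \<noteq> 0}"] by auto
    with that assms show False by (auto simp: mollifier_def)
  qed
  show i: "(\<integral>x. \<eta> x \<partial>lborel) = 1" using assms by (simp add: mollifier_def)
  show "integrable lborel \<eta>" by (rule ccontr) (use i in \<open>simp add: not_integrable_integral_eq\<close>)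
  have "compact (\<eta> ` cball 0 1)" by (intro compact_continuous_image continuous_on_subset[OF c]) auto
  then obtain b where b: "0 < b" "\<And>x. x \<in> cball 0 1 \<Longrightarrow> \<bar>\<eta> x\<bar> \<le> b"
    by (auto dest!: compact_imp_bounded simp: bounded_pos)
  have "\<eta> x \<le> b" for x
  proof (cases "norm x \<le> 1")
    case True
    then show ?thesis using b(2)[of x] by simp
  next
    case False
    then show ?thesis using z[of x] b by simp
  qed
  then show "\<exists>b>0. \<forall>x. \<eta> x \<le> b" using b by blast
qed

lemma nn_integral_lborel_scale:
  fixes f :: "real^2 \<Rightarrow> ennreal"
  assumes [measurable]: "f \<in> borel_measurable borel" and d: "0 < \<delta>"
  shows "(\<integral>\<^sup>+x. f x \<partial>lborel) = ennreal (\<delta>\<^sup>2) * (\<integral>\<^sup>+a. f (c - \<delta> *\<^sub>R a) \<partial>lborel)"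
proof -
  have "(\<integral>\<^sup>+x. f x \<partial>lborel) = (\<integral>\<^sup>+x. f x \<partial>density (distr lborel borel (\<lambda>x. c + (- \<delta>) *\<^sub>R x)) (\<lambda>_. \<bar>- \<delta>\<bar> ^ DIM(real^2)))"
    using lborel_affine[of "- \<delta>" c] d by simp
  also have "\<dots> = (\<integral>\<^sup>+a. ennreal (\<delta>\<^sup>2) * f (c - \<delta> *\<^sub>R a) \<partial>lborel)"
    using d by (simp add: nn_integral_density nn_integral_distr power2_eq_square)
  also have "\<dots> = ennreal (\<delta>\<^sup>2) * (\<integral>\<^sup>+a. f (c - \<delta> *\<^sub>R a) \<partial>lborel)"
    by (intro nn_integral_cmult) measurable
  finally show ?thesis .
qed

definition moll_law :: "(real^2 \<Rightarrow> real) \<Rightarrow> (real^2) measure" where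
  "moll_law \<eta> = density lborel (\<lambda>x. ennreal (\<eta> x))"

lemma sets_moll_law [simp, measurable_cong]: "sets (moll_law \<eta>) = sets borel"
  by (simp add: moll_law_def)

lemma space_moll_law [simp]: "space (moll_law \<eta>) = UNIV"
  by (simp add: moll_law_def)

lemma prob_space_moll_law: "mollifier \<eta> \<Longrightarrow> prob_space (moll_law \<eta>)"
proof
  assume e: "mollifier \<eta>"
  note [measurable] = mollifierD(6)[OF e]
  have "emeasure (moll_law \<eta>) UNIV = (\<integral>\<^sup>+x. ennreal (\<eta> x) \<partial>lborel)"
    by (simp add: moll_law_def emeasure_density)
  also have "\<dots> = 1" using nn_integral_eq_integral[OF mollifierD(5)[OF e]] mollifierD(2,4)[OF e] by simp
  finally show "emeasure (moll_law \<eta>) (space (moll_law \<eta>)) = 1" by simp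
qed

lemma circle_density_facts:
  assumes e: "mollifier \<eta>" and d: "0 < \<delta>" and r: "0 < r"
  shows "circle_density \<eta> \<delta> z r \<in> borel_measurable borel" "0 \<le> circle_density \<eta> \<delta> z r x"
    "r + \<delta> < dist z x \<Longrightarrow> circle_density \<eta> \<delta> z r x = 0"
    "ennreal (circle_density \<eta> \<delta> z r x) = (\<integral>\<^sup>+\<theta>. ennreal (moll \<eta> \<delta> (z + r *\<^sub>R circ \<theta>) x) \<partial>uniform_angle)"
    "\<exists>b>0. \<forall>x. circle_density \<eta> \<delta> z r x \<le> b"
proof -
  note [measurable] = mollifierD(6)[OF e]
  obtain b where b: "0 < b" "\<And>x. \<eta> x \<le> b" using mollifierD(7)[OF e] by blast
  have m0: "0 \<le> moll \<eta> \<delta> y x" "moll \<eta> \<delta> y x \<le> b / \<delta>\<^sup>2" for y x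
    using mollifierD(2)[OF e] b by (auto simp: moll_def intro!: divide_right_mono)
  have [measurable]: "(\<lambda>(y, x). moll \<eta> \<delta> y x) \<in> borel_measurable (borel \<Otimes>\<^sub>M borel)"
    unfolding moll_def by measurable
  have cd: "circle_density \<eta> \<delta> z r x = (\<integral>\<theta>. moll \<eta> \<delta> (z + r *\<^sub>R circ \<theta>) x \<partial>uniform_angle)" for x
    unfolding circle_density_def by (subst circle_mean_uniform_angle) auto
  show "circle_density \<eta> \<delta> z r \<in> borel_measurable borel"
    unfolding cd[abs_def] by measurable
  have int: "integrable uniform_angle (\<lambda>\<theta>. moll \<eta> \<delta> (z + r *\<^sub>R circ \<theta>) x)" for x
    by (rule uniform_angle.integrable_const_bound[where B="b / \<delta>\<^sup>2"]) (use m0 in auto)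
  show "0 \<le> circle_density \<eta> \<delta> z r x" unfolding cd using m0 by (intro integral_nonneg_AE) auto
  show "ennreal (circle_density \<eta> \<delta> z r x) = (\<integral>\<^sup>+\<theta>. ennreal (moll \<eta> \<delta> (z + r *\<^sub>R circ \<theta>) x) \<partial>uniform_angle)"
    unfolding cd using int m0 by (intro nn_integral_eq_integral[symmetric]) auto
  show "circle_density \<eta> \<delta> z r x = 0" if "r + \<delta> < dist z x"
  proof -
    have "moll \<eta> \<delta> (z + r *\<^sub>R circ \<theta>) x = 0" for \<theta>
    proof -
      have n: "norm (circ \<theta>) = 1" by (simp add: norm_vec_def L2_set_def sum_2)
      have "dist z x \<le> norm (z + r *\<^sub>R circ \<theta> - x) + norm (r *\<^sub>R circ \<theta>)"
        using norm_triangle_ineq4[of "z + r *\<^sub>R circ \<theta> - x" "r *\<^sub>R circ \<theta>"] by (simp add: dist_norm)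
      then have "\<delta> < norm (z + r *\<^sub>R circ \<theta> - x)" using that n r by simp
      then have "1 < norm ((z + r *\<^sub>R circ \<theta> - x) /\<^sub>R \<delta>)" unfolding norm_scaleR using d by (simp add: field_simps)
      then show ?thesis using mollifierD(3)[OF e] by (simp add: moll_def)
    qed
    then show ?thesis by (simp add: cd)
  qed
  have "circle_density \<eta> \<delta> z r x \<le> b / \<delta>\<^sup>2" for x
    unfolding cd using m0 int by (intro uniform_angle.integral_le_const) auto
  then show "\<exists>b>0. \<forall>x. circle_density \<eta> \<delta> z r x \<le> b" using b d by (intro exI[of _ "b / \<delta>\<^sup>2"]) auto
qed

text \<open>A uniform point of the circle is displaced by \<open>- \<delta>\<close> times an
  independent point of law \<open>\<eta>\<close>. So the mollified circle is a mixture of exact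
  circles shifted by at most \<open>\<delta>\<close>, and its energies reduce to averages of the
  logarithm over exact circles.\<close>

lemma circle_density_law:
  assumes e: "mollifier \<eta>" and d: "0 < \<delta>" and r: "0 < r"
  shows "density lborel (\<lambda>x. ennreal (circle_density \<eta> \<delta> z r x))
    = distr (uniform_angle \<Otimes>\<^sub>M moll_law \<eta>) borel (\<lambda>(\<theta>, a). z + r *\<^sub>R circ \<theta> - \<delta> *\<^sub>R a)"
proof (rule measure_eqI)
  note [measurable] = mollifierD(6)[OF e] circle_density_facts(1)[OF e d r]
  have [measurable]: "(\<lambda>(y, x). moll \<eta> \<delta> y x) \<in> borel_measurable (borel \<Otimes>\<^sub>M borel)"
    unfolding moll_def by measurable
  interpret N: prob_space "moll_law \<eta>" by (rule prob_space_moll_law[OF e])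
  interpret UL: pair_sigma_finite uniform_angle lborel ..
  interpret UN: pair_sigma_finite uniform_angle "moll_law \<eta>" ..
  fix A assume "A \<in> sets (density lborel (\<lambda>x. ennreal (circle_density \<eta> \<delta> z r x)))"
  then have A[measurable]: "A \<in> sets borel" by simp
  have "emeasure (density lborel (\<lambda>x. ennreal (circle_density \<eta> \<delta> z r x))) A
      = (\<integral>\<^sup>+x. ennreal (circle_density \<eta> \<delta> z r x) * indicator A x \<partial>lborel)"
    by (simp add: emeasure_density)
  also have "\<dots> = (\<integral>\<^sup>+x. (\<integral>\<^sup>+\<theta>. ennreal (moll \<eta> \<delta> (z + r *\<^sub>R circ \<theta>) x) * indicator A x \<partial>uniform_angle) \<partial>lborel)"
    unfolding circle_density_facts(4)[OF e d r] by (intro nn_integral_cong nn_integral_multc[symmetric]) measurable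
  also have "\<dots> = (\<integral>\<^sup>+\<theta>. (\<integral>\<^sup>+x. ennreal (moll \<eta> \<delta> (z + r *\<^sub>R circ \<theta>) x) * indicator A x \<partial>lborel) \<partial>uniform_angle)"
    by (rule UL.Fubini') measurable
  also have "\<dots> = (\<integral>\<^sup>+\<theta>. (\<integral>\<^sup>+a. indicator A (z + r *\<^sub>R circ \<theta> - \<delta> *\<^sub>R a) \<partial>moll_law \<eta>) \<partial>uniform_angle)"
  proof (intro nn_integral_cong)
    fix \<theta>
    let ?c = "z + r *\<^sub>R circ \<theta>"
    have "(\<integral>\<^sup>+x. ennreal (moll \<eta> \<delta> ?c x) * indicator A x \<partial>lborel)
        = ennreal (\<delta>\<^sup>2) * (\<integral>\<^sup>+a. ennreal (moll \<eta> \<delta> ?c (?c - \<delta> *\<^sub>R a)) * indicator A (?c - \<delta> *\<^sub>R a) \<partial>lborel)"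
      by (rule nn_integral_lborel_scale[OF _ d]) measurable
    also have "\<dots> = (\<integral>\<^sup>+a. ennreal (\<delta>\<^sup>2) * (ennreal (moll \<eta> \<delta> ?c (?c - \<delta> *\<^sub>R a)) * indicator A (?c - \<delta> *\<^sub>R a)) \<partial>lborel)"
      by (rule nn_integral_cmult[symmetric]) measurable
    also have "\<dots> = (\<integral>\<^sup>+a. ennreal (\<eta> a) * indicator A (?c - \<delta> *\<^sub>R a) \<partial>lborel)"
      using d mollifierD(2)[OF e]
      by (intro nn_integral_cong) (auto simp: moll_def split: split_indicator simp flip: ennreal_mult)
    also have "\<dots> = (\<integral>\<^sup>+a. indicator A (?c - \<delta> *\<^sub>R a) \<partial>moll_law \<eta>)"
      by (simp add: moll_law_def nn_integral_density)
    finally show "(\<integral>\<^sup>+x. ennreal (moll \<eta> \<delta> ?c x) * indicator A x \<partial>lborel) = (\<integral>\<^sup>+a. indicator A (?c - \<delta> *\<^sub>R a) \<partial>moll_law \<eta>)" .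
  qed
  also have "\<dots> = (\<integral>\<^sup>+p. indicator A ((\<lambda>(\<theta>, a). z + r *\<^sub>R circ \<theta> - \<delta> *\<^sub>R a) p) \<partial>(uniform_angle \<Otimes>\<^sub>M moll_law \<eta>))"
    by (subst N.nn_integral_fst[symmetric]) (auto simp: split_beta)
  also have "\<dots> = emeasure (distr (uniform_angle \<Otimes>\<^sub>M moll_law \<eta>) borel (\<lambda>(\<theta>, a). z + r *\<^sub>R circ \<theta> - \<delta> *\<^sub>R a)) A"
    by (subst nn_integral_indicator[symmetric], simp, subst nn_integral_distr) (auto simp: split_beta)
  finally show "emeasure (density lborel (\<lambda>x. ennreal (circle_density \<eta> \<delta> z r x))) A
      = emeasure (distr (uniform_angle \<Otimes>\<^sub>M moll_law \<eta>) borel (\<lambda>(\<theta>, a). z + r *\<^sub>R circ \<theta> - \<delta> *\<^sub>R a)) A" .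
qed simp

section \<open>Logarithmic energy of circles\<close>

text \<open>This is the mean value property of \<open>Ln (1 + w * u)\<close> at
  \<open>u = 0\<close>, where its value is \<open>Ln 1 = 0\<close>, taken from Cauchy's formula on
  the unit circle. As \<open>cmod w < 1\<close>, the argument of \<open>Ln\<close> has positive real
  part. The factor \<open>\<i>\<close> from the parametrisation turns the real part of
  \<open>Ln\<close> into an imaginary part.\<close>

lemma has_integral_ln_cmod_one_plus:
  assumes w: "cmod w < 1"
  shows "((\<lambda>t. ln (cmod (1 + w * cis t))) has_integral 0) {0..2 * pi}"
proof -
  have nz: "1 + w * u \<notin> \<real>\<^sub>\<le>\<^sub>0" if "u \<in> cball 0 1" for u
  proof -
    have "cmod (w * u) < 1"
      using w that mult_left_le[of "cmod u" "cmod w"] by (simp add: norm_mult)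
    then have "0 < Re (1 + w * u)" using complex_Re_le_cmod[of "- (w * u)"] by (simp add: norm_minus_cancel)
    then show ?thesis by (auto simp: complex_nonpos_Reals_iff)
  qed
  have "(\<lambda>u. Ln (1 + w * u)) holomorphic_on cball 0 1"
    using nz by (intro holomorphic_intros) auto
  then have "((\<lambda>u. Ln (1 + w * u) / (u - 0)) has_contour_integral (2 * of_real pi * \<i> * Ln (1 + w * 0))) (circlepath 0 1)"
    by (rule Cauchy_integral_circlepath_simple) auto
  then have "((\<lambda>t. Ln (1 + w * cis t) / cis t * \<i> * cis t) has_integral 0) {0..2 * pi}"
    unfolding circlepath_def by (subst (asm) has_contour_integral_part_circlepath_iff) auto
  then have "((\<lambda>t. Im (Ln (1 + w * cis t) / cis t * \<i> * cis t)) has_integral Im 0) {0..2 * pi}"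
    by (rule has_integral_linear[OF _ bounded_linear_Im, unfolded o_def])
  moreover have "Im (Ln (1 + w * cis t) / cis t * \<i> * cis t) = ln (cmod (1 + w * cis t))" for t
  proof -
    have "1 + w * cis t \<noteq> 0" using nz[of "cis t"] by auto
    moreover have "Ln (1 + w * cis t) / cis t * \<i> * cis t = \<i> * Ln (1 + w * cis t)" by simp
    ultimately show ?thesis by simp
  qed
  ultimately show ?thesis by simp
qed

lemma norm_circ [simp]: "norm (circ \<theta>) = 1"
  by (simp add: norm_vec_def L2_set_def sum_2)

lemma norm_real2: "norm (x :: real^2) = cmod (Complex (x $ 1) (x $ 2))"
  by (simp add: norm_vec_def L2_set_def sum_2 cmod_def)

text \<open>The larger of \<open>norm x\<close> and \<open>r\<close> is factored out, which leaves
  \<open>1 + w * cis \<theta>\<close> with \<open>cmod w < 1\<close>. Inside the circle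
  \<open>cis \<theta>\<close> is factored out as well, and so the conjugate of \<open>x\<close>
  appears. For \<open>norm x = r\<close> the modulus of \<open>w\<close> would be 1; where this
  occurs later it is confined to a null set.\<close>

lemma has_integral_ln_norm_circle:
  fixes x :: "real^2"
  assumes r: "0 < r" and x: "norm x \<noteq> r"
  shows "((\<lambda>\<theta>. ln (norm (x + r *\<^sub>R circ \<theta>))) has_integral (2 * pi) * ln (max (norm x) r)) {0..2 * pi}"
proof -
  define a where "a = Complex (x $ 1) (x $ 2)"
  have na: "norm x = cmod a" by (simp add: a_def norm_real2)
  have n: "norm (x + r *\<^sub>R circ \<theta>) = cmod (a + r * cis \<theta>)" for \<theta>
  proof -
    have "Complex ((x + r *\<^sub>R circ \<theta>) $ 1) ((x + r *\<^sub>R circ \<theta>) $ 2) = a + r * cis \<theta>"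
      by (simp add: complex_eq_iff a_def)
    then show ?thesis by (simp add: norm_real2)
  qed
  define w where "w = (if cmod a < r then cnj a / r else r / a)"
  have w: "cmod w < 1" using x r by (auto simp: w_def na norm_divide divide_less_eq_1)
  have "ln (norm (x + r *\<^sub>R circ \<theta>)) = ln (max (norm x) r) + ln (cmod (1 + w * cis \<theta>))" for \<theta>
  proof -
    have "cmod (1 + w * cis \<theta>) \<noteq> 0"
    proof
      assume "cmod (1 + w * cis \<theta>) = 0"
      then have "w * cis \<theta> = - 1" by (simp add: add_eq_0_iff)
      then have "cmod (w * cis \<theta>) = 1" by simp
      with w show False by (simp add: norm_mult)
    qed
    moreover have "cmod (a + r * cis \<theta>) = max (cmod a) r * cmod (1 + w * cis \<theta>)"
    proof (cases "cmod a < r")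
      case True
      have "a + r * cis \<theta> = r * cis \<theta> * cnj (1 + w * cis \<theta>)"
        using True r by (simp add: w_def algebra_simps cis_cnj cis_mult)
      then have "cmod (a + r * cis \<theta>) = r * cmod (1 + w * cis \<theta>)"
        using r by (simp only: norm_mult complex_mod_cnj norm_cis) simp
      then show ?thesis using True by simp
    next
      case False
      then have "a \<noteq> 0" using r by auto
      then have "a + r * cis \<theta> = a * (1 + w * cis \<theta>)" using False by (simp add: w_def field_simps)
      then show ?thesis using False by (simp add: norm_mult)
    qed
    ultimately show ?thesis using r by (simp add: n na ln_mult)
  qed
  moreover have "((\<lambda>\<theta>. ln (max (norm x) r) + ln (cmod (1 + w * cis \<theta>))) has_integral (2 * pi - 0) *\<^sub>R ln (max (norm x) r) + 0) {0..2 * pi}"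
    by (intro has_integral_add has_integral_const_real[THEN has_integral_eq_rhs] has_integral_ln_cmod_one_plus w) auto
  ultimately show ?thesis by simp
qed

section \<open>Integrability of the logarithmic kernel\<close>

text \<open>Crude, but both terms are locally integrable as functions of a distance in the plane. At
  \<open>t = 0\<close> both sides are 0 by the default values of \<open>ln\<close> and
  \<open>powr\<close>.\<close>

lemma abs_ln_le: "0 \<le> t \<Longrightarrow> \<bar>ln t\<bar> \<le> t powr - 1 + (t :: real)"
proof (cases "t = 0")
  case False
  assume "0 \<le> t"
  then have t: "0 < t" using False by simp
  have "ln t \<le> t - 1" using t by (rule ln_le_minus_one)
  moreover have "ln (1 / t) \<le> 1 / t - 1" using t by (intro ln_le_minus_one) auto
  ultimately show ?thesis using t by (simp add: ln_div powr_minus_divide abs_le_iff add_increasing add_increasing2)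
qed simp

text \<open>The number 36 is the square of \<open>3 / (1 - s / 2)\<close> for the exponent
  \<open>s = 1\<close>. The ball is enclosed in a square of side \<open>2 * R + 1\<close>, where the
  extra 1 makes up for the missing right ends of a half-open rectangle, and \<open>2 * R\<close>
  bounds the distances.\<close>

lemma nn_integral_log_kernel:
  fixes y :: "real^2"
  assumes "norm y \<le> R"
  shows "(\<integral>\<^sup>+x\<in>cball 0 R. ennreal \<bar>ln (dist x y)\<bar> \<partial>lborel)
    \<le> ennreal (36 * ((2 * R + 1) * (2 * R + 1)) powr (1 / 2) + 2 * R * ((2 * R + 1) * (2 * R + 1)))"
proof -
  let ?A = "rect (- R) (R + 1) (- R) (R + 1)"
  have R: "0 \<le> R" using assms norm_ge_zero[of y] by linarith
  have sub: "x \<in> ?A" if "x \<in> cball 0 R" for x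
    using that component_le_norm_cart[of x 1] component_le_norm_cart[of x 2] by (auto simp: rect_def abs_le_iff)
  have "(\<integral>\<^sup>+x\<in>cball 0 R. ennreal \<bar>ln (dist x y)\<bar> \<partial>lborel)
      \<le> (\<integral>\<^sup>+x. ennreal (dist x y powr - 1) * indicator ?A x + ennreal (2 * R) * indicator ?A x \<partial>lborel)"
  proof (intro nn_integral_mono)
    fix x :: "real^2"
    show "ennreal \<bar>ln (dist x y)\<bar> * indicator (cball 0 R) x \<le> ennreal (dist x y powr - 1) * indicator ?A x + ennreal (2 * R) * indicator ?A x"
    proof (cases "x \<in> cball 0 R")
      case True
      have "dist x y \<le> 2 * R" using True assms norm_triangle_ineq4[of x y] by (simp add: dist_norm)
      then have "\<bar>ln (dist x y)\<bar> \<le> dist x y powr - 1 + 2 * R" using abs_ln_le[of "dist x y"] by simp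
      then show ?thesis using True sub[OF True] R by (simp add: ennreal_leI flip: ennreal_plus)
    qed simp
  qed
  also have "\<dots> = (\<integral>\<^sup>+x\<in>?A. ennreal (dist x y powr - 1) \<partial>lborel) + ennreal (2 * R) * emeasure lborel ?A"
    by (subst nn_integral_add) (auto simp: nn_integral_cmult_indicator)
  also have "\<dots> \<le> ennreal ((3 / (1 - 1 / 2))\<^sup>2 * ((R + 1 - - R) * (R + 1 - - R)) powr (1 - 1 / 2)) + ennreal (2 * R) * ennreal ((R + 1 - - R) * (R + 1 - - R))"
    using R by (intro add_mono nn_integral_powr_dist_rect mult_left_mono) (auto simp: emeasure_rect)
  also have "\<dots> = ennreal (36 * ((2 * R + 1) * (2 * R + 1)) powr (1 / 2) + 2 * R * ((2 * R + 1) * (2 * R + 1)))"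
    using R by (simp add: power2_eq_square flip: ennreal_plus ennreal_mult)
  finally show ?thesis .
qed

text \<open>On this class all logarithmic energies converge absolutely. The constants are explicit
  so that they can be kept uniform along a sequence of densities.\<close>

definition bounded_density :: "real \<Rightarrow> real \<Rightarrow> (real^2 \<Rightarrow> real) \<Rightarrow> bool" where
  "bounded_density b R f \<longleftrightarrow> f \<in> borel_measurable borel \<and> (\<forall>x. \<bar>f x\<bar> \<le> b) \<and> (\<forall>x. R < norm x \<longrightarrow> f x = 0)"

lemma integrable_bounded_density:
  assumes f: "bounded_density b R f"
  shows "integrable lborel f"
proof -
  have [measurable]: "f \<in> borel_measurable borel" using f by (simp add: bounded_density_def)
  have b: "0 \<le> b" using f by (auto simp: bounded_density_def intro: order_trans[OF abs_ge_zero])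
  have "(\<integral>\<^sup>+x. ennreal (norm (f x)) \<partial>lborel) \<le> (\<integral>\<^sup>+x. ennreal b * indicator (cball 0 R) x \<partial>(lborel :: (real^2) measure))"
    using f by (intro nn_integral_mono) (auto simp: bounded_density_def split: split_indicator intro: ennreal_leI)
  also have "\<dots> = ennreal b * emeasure lborel (cball (0 :: real^2) R)" by (simp add: nn_integral_cmult_indicator)
  also have "\<dots> < \<infinity>" using emeasure_lborel_cball_finite[of "0 :: real^2" R] by (simp add: ennreal_mult_less_top)
  finally show ?thesis by (intro integrableI_bounded) auto
qed

lemma integrable_log_kernel:
  assumes f: "bounded_density b R f"
  shows "integrable lborel (\<lambda>x. f x * - ln (dist x y))"
proof -
  have [measurable]: "f \<in> borel_measurable borel" using f by (simp add: bounded_density_def)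
  define S where "S = max R (norm y)"
  have [measurable]: "cball (0 :: real^2) S \<in> sets borel" by (intro borel_closed closed_cball)
  have b: "0 \<le> b" using f by (auto simp: bounded_density_def intro: order_trans[OF abs_ge_zero])
  have "(\<integral>\<^sup>+x. ennreal (norm (f x * - ln (dist x y))) \<partial>lborel) \<le> (\<integral>\<^sup>+x. ennreal b * (ennreal \<bar>ln (dist x y)\<bar> * indicator (cball 0 S) x) \<partial>lborel)"
    using f b by (intro nn_integral_mono)
      (auto simp: bounded_density_def S_def abs_mult split: split_indicator simp flip: ennreal_mult intro!: ennreal_leI mult_right_mono)
  also have "\<dots> = ennreal b * (\<integral>\<^sup>+x\<in>cball 0 S. ennreal \<bar>ln (dist x y)\<bar> \<partial>lborel)" by (intro nn_integral_cmult) measurable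
  also have "\<dots> \<le> ennreal b * ennreal (36 * ((2 * S + 1) * (2 * S + 1)) powr (1 / 2) + 2 * S * ((2 * S + 1) * (2 * S + 1)))"
    by (intro mult_left_mono nn_integral_log_kernel) (auto simp: S_def)
  also have "\<dots> < \<infinity>" by (simp add: ennreal_mult_less_top)
  finally show ?thesis by (intro integrableI_bounded) auto
qed

lemma integrable_log_kernel_pair:
  assumes f: "bounded_density b R f" and g: "bounded_density b' R' g"
  shows "integrable (lborel \<Otimes>\<^sub>M lborel) (\<lambda>p. f (fst p) * - ln (dist (fst p) (snd p)) * g (snd p))"
proof -
  have [measurable]: "f \<in> borel_measurable borel" "g \<in> borel_measurable borel" using f g by (auto simp: bounded_density_def)
  define S where "S = max R R'"
  have [measurable]: "cball (0 :: real^2) S \<in> sets borel" by (intro borel_closed closed_cball)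
  define C where "C = 36 * ((2 * S + 1) * (2 * S + 1)) powr (1 / 2) + 2 * S * ((2 * S + 1) * (2 * S + 1))"
  have b: "0 \<le> b" using f by (auto simp: bounded_density_def intro: order_trans[OF abs_ge_zero])
  have "(\<integral>\<^sup>+p. ennreal (norm (f (fst p) * - ln (dist (fst p) (snd p)) * g (snd p))) \<partial>(lborel \<Otimes>\<^sub>M lborel))
     = (\<integral>\<^sup>+y. (\<integral>\<^sup>+x. ennreal (norm (f x * - ln (dist x y) * g y)) \<partial>lborel) \<partial>lborel)"
    by (subst lborel_pair.nn_integral_snd[symmetric]) (auto simp: split_beta)
  also have "\<dots> \<le> (\<integral>\<^sup>+y. ennreal (norm (g y)) * (ennreal b * ennreal C) \<partial>lborel)"
  proof (intro nn_integral_mono)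
    fix y :: "real^2"
    show "(\<integral>\<^sup>+x. ennreal (norm (f x * - ln (dist x y) * g y)) \<partial>lborel) \<le> ennreal (norm (g y)) * (ennreal b * ennreal C)"
    proof (cases "g y = 0")
      case False
      then have "\<not> R' < norm y" using g by (auto simp: bounded_density_def)
      then have y: "norm y \<le> S" by (simp add: S_def)
      have "(\<integral>\<^sup>+x. ennreal (norm (f x * - ln (dist x y) * g y)) \<partial>lborel)
        \<le> (\<integral>\<^sup>+x. ennreal (norm (g y)) * (ennreal b * (ennreal \<bar>ln (dist x y)\<bar> * indicator (cball 0 S) x)) \<partial>lborel)"
        using f b by (intro nn_integral_mono)
          (auto simp: bounded_density_def S_def abs_mult mult_ac split: split_indicator simp flip: ennreal_mult intro!: ennreal_leI mult_right_mono mult_left_mono)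
      also have "\<dots> = ennreal (norm (g y)) * (ennreal b * (\<integral>\<^sup>+x\<in>cball 0 S. ennreal \<bar>ln (dist x y)\<bar> \<partial>lborel))"
        by (simp add: nn_integral_cmult)
      also have "\<dots> \<le> ennreal (norm (g y)) * (ennreal b * ennreal C)"
        unfolding C_def using nn_integral_log_kernel[OF y] by (intro mult_left_mono) auto
      finally show ?thesis .
    qed simp
  qed
  also have "\<dots> = (\<integral>\<^sup>+y. ennreal (norm (g y)) \<partial>lborel) * (ennreal b * ennreal C)" by (simp add: nn_integral_multc)
  also have "\<dots> < \<infinity>"
    using integrable_bounded_density[OF g] by (auto simp: integrable_iff_bounded ennreal_mult_less_top)
  finally show ?thesis by (intro integrableI_bounded) auto
qed

definition log_energy :: "(real^2 \<Rightarrow> real) \<Rightarrow> (real^2 \<Rightarrow> real) \<Rightarrow> real" where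
  "log_energy f g = (\<integral>p. f (fst p) * - ln (dist (fst p) (snd p)) * g (snd p) \<partial>(lborel \<Otimes>\<^sub>M lborel))"

lemma log_energy_iterated:
  assumes f: "bounded_density b R f" and g: "bounded_density b' R' g"
  shows "log_energy f g = (\<integral>y. g y * (\<integral>x. f x * - ln (dist x y) \<partial>lborel) \<partial>lborel)"
    and "integrable lborel (\<lambda>y. g y * (\<integral>x. f x * - ln (dist x y) \<partial>lborel))"
proof -
  have i: "integrable (lborel \<Otimes>\<^sub>M lborel) (\<lambda>(x, y). f x * - ln (dist x y) * g y)"
    using integrable_log_kernel_pair[OF f g] by (simp add: case_prod_unfold)
  have *: "(\<integral>x. f x * - ln (dist x y) * g y \<partial>lborel) = g y * (\<integral>x. f x * - ln (dist x y) \<partial>lborel)" for y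
    by (simp add: mult.commute)
  show "log_energy f g = (\<integral>y. g y * (\<integral>x. f x * - ln (dist x y) \<partial>lborel) \<partial>lborel)"
    using lborel_pair.integral_snd[OF i] unfolding * by (simp add: log_energy_def case_prod_unfold)
  show "integrable lborel (\<lambda>y. g y * (\<integral>x. f x * - ln (dist x y) \<partial>lborel))"
    using lborel_pair.integrable_snd[OF i] unfolding * .
qed

lemma log_energy_sum:
  assumes fin: "finite I" and f: "\<And>i. i \<in> I \<Longrightarrow> bounded_density b R (f i)"
  shows "log_energy (\<lambda>x. \<Sum>i\<in>I. c i * f i x) (\<lambda>x. \<Sum>i\<in>I. c i * f i x) = (\<Sum>i\<in>I. \<Sum>j\<in>I. c i * c j * log_energy (f i) (f j))"
proof -
  have "log_energy (\<lambda>x. \<Sum>i\<in>I. c i * f i x) (\<lambda>x. \<Sum>i\<in>I. c i * f i x)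
     = (\<integral>p. (\<Sum>i\<in>I. \<Sum>j\<in>I. (c i * c j) * (f i (fst p) * - ln (dist (fst p) (snd p)) * f j (snd p))) \<partial>(lborel \<Otimes>\<^sub>M lborel))"
    unfolding log_energy_def
    by (intro Bochner_Integration.integral_cong refl) (simp add: sum_distrib_left sum_distrib_right mult_ac sum_negf)
  also have "\<dots> = (\<Sum>i\<in>I. \<Sum>j\<in>I. \<integral>p. (c i * c j) * (f i (fst p) * - ln (dist (fst p) (snd p)) * f j (snd p)) \<partial>(lborel \<Otimes>\<^sub>M lborel))"
    by (subst Bochner_Integration.integral_sum, intro Bochner_Integration.integrable_sum integrable_mult_right integrable_log_kernel_pair[OF f f], assumption+,
        intro sum.cong refl Bochner_Integration.integral_sum integrable_mult_right integrable_log_kernel_pair[OF f f], assumption+)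
  finally show ?thesis by (simp add: log_energy_def)
qed

section \<open>Potentials and energies of mollified circles\<close>

lemma continuous_circ: "continuous_on A circ"
proof -
  have "circ = (\<lambda>\<theta>. cos \<theta> *\<^sub>R axis 1 1 + sin \<theta> *\<^sub>R axis 2 1)"
    by (auto simp: vec_eq_iff forall_2 axis_def)
  then show ?thesis by (simp only:) (intro continuous_intros)
qed

lemma integral_ln_norm_circle:
  fixes x :: "real^2"
  assumes r: "0 < r" and x: "norm x \<noteq> r"
  shows "(\<integral>\<theta>. - ln (norm (x + r *\<^sub>R circ \<theta>)) \<partial>uniform_angle) = - ln (max (norm x) r)"
proof -
  have "norm (x + r *\<^sub>R circ \<theta>) \<noteq> 0" for \<theta>
  proof
    assume "norm (x + r *\<^sub>R circ \<theta>) = 0"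
    then have "x = - (r *\<^sub>R circ \<theta>)" by (simp add: add_eq_0_iff2)
    then have "norm x = r" using r by simp
    with x show False by simp
  qed
  then have "continuous_on {0..2 * pi} (\<lambda>\<theta>. ln (norm (x + r *\<^sub>R circ \<theta>)))"
    by (intro continuous_intros continuous_circ) auto
  then have si: "set_integrable lborel {0..2 * pi} (\<lambda>\<theta>. ln (norm (x + r *\<^sub>R circ \<theta>)))"
    by (rule borel_integrable_atLeastAtMost')
  have "(\<integral>\<theta>. - ln (norm (x + r *\<^sub>R circ \<theta>)) \<partial>uniform_angle) = - (\<integral>\<theta>. ln (norm (x + r *\<^sub>R circ \<theta>)) \<partial>uniform_angle)" by simp
  also have "\<dots> = - ((LINT \<theta>:{0..2 * pi}|lborel. ln (norm (x + r *\<^sub>R circ \<theta>))) / (2 * pi))"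
    by (subst integral_uniform_angle) auto
  also have "\<dots> = - (2 * pi * ln (max (norm x) r) / (2 * pi))"
    using set_borel_integral_eq_integral(2)[OF si] has_integral_ln_norm_circle[OF r x] by (simp add: integral_unique)
  finally show ?thesis by simp
qed

lemma circle_density_bounded:
  assumes e: "mollifier \<eta>" and d: "0 < \<delta>" and r: "0 < r"
  shows "\<exists>b. bounded_density b (norm z + r + \<delta>) (circle_density \<eta> \<delta> z r)"
proof -
  obtain b where b: "0 < b" "\<And>x. circle_density \<eta> \<delta> z r x \<le> b" using circle_density_facts(5)[OF e d r] by blast
  have "circle_density \<eta> \<delta> z r x = 0" if "norm z + r + \<delta> < norm x" for x
    using circle_density_facts(3)[OF e d r, of z x] that norm_triangle_ineq2[of x z] by (simp add: dist_norm norm_minus_commute)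
  then show ?thesis using circle_density_facts(1,2)[OF e d r] b
    by (intro exI[of _ b]) (auto simp: bounded_density_def abs_le_iff intro: order_trans[OF _ less_imp_le])
qed

context
  fixes \<eta> :: "real^2 \<Rightarrow> real" and \<delta> r :: real and z :: "real^2"
  assumes e: "mollifier \<eta>" and d: "0 < \<delta>" and r: "0 < r"
begin

interpretation N: prob_space "moll_law \<eta>" by (rule prob_space_moll_law[OF e])
interpretation UN: pair_prob_space uniform_angle "moll_law \<eta>" ..

lemma circle_density_integral:
  fixes f :: "real^2 \<Rightarrow> real"
  assumes f[measurable]: "f \<in> borel_measurable borel"
    and i: "integrable lborel (\<lambda>x. circle_density \<eta> \<delta> z r x * f x)"
  shows "(\<integral>x. circle_density \<eta> \<delta> z r x * f x \<partial>lborel) = (\<integral>a. (\<integral>\<theta>. f (z + r *\<^sub>R circ \<theta> - \<delta> *\<^sub>R a) \<partial>uniform_angle) \<partial>moll_law \<eta>)"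
    and "(\<integral>x. circle_density \<eta> \<delta> z r x * f x \<partial>lborel) = (\<integral>p. f (z + r *\<^sub>R circ (fst p) - \<delta> *\<^sub>R snd p) \<partial>(uniform_angle \<Otimes>\<^sub>M moll_law \<eta>))"
proof -
  note [measurable] = circle_density_facts(1)[OF e d r]
  have W[measurable]: "(\<lambda>(\<theta>, a). z + r *\<^sub>R circ \<theta> - \<delta> *\<^sub>R a) \<in> measurable (uniform_angle \<Otimes>\<^sub>M moll_law \<eta>) borel"
    by measurable
  have "integrable (density lborel (\<lambda>x. ennreal (circle_density \<eta> \<delta> z r x))) f"
    using i circle_density_facts(2)[OF e d r] by (subst integrable_density) (auto simp: )
  then have ip: "integrable (uniform_angle \<Otimes>\<^sub>M moll_law \<eta>) (\<lambda>(\<theta>, a). f (z + r *\<^sub>R circ \<theta> - \<delta> *\<^sub>R a))"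
    unfolding circle_density_law[OF e d r] by (subst (asm) integrable_distr_eq[OF W]) (auto simp: case_prod_unfold)
  have "(\<integral>x. circle_density \<eta> \<delta> z r x * f x \<partial>lborel) = (\<integral>x. f x \<partial>density lborel (\<lambda>x. ennreal (circle_density \<eta> \<delta> z r x)))"
    using circle_density_facts(2)[OF e d r] by (subst integral_density) auto
  also have "\<dots> = (\<integral>p. f ((\<lambda>(\<theta>, a). z + r *\<^sub>R circ \<theta> - \<delta> *\<^sub>R a) p) \<partial>(uniform_angle \<Otimes>\<^sub>M moll_law \<eta>))"
    unfolding circle_density_law[OF e d r] by (rule integral_distr[OF W f])
  finally have 1: "(\<integral>x. circle_density \<eta> \<delta> z r x * f x \<partial>lborel) = (\<integral>(\<theta>, a). f (z + r *\<^sub>R circ \<theta> - \<delta> *\<^sub>R a) \<partial>(uniform_angle \<Otimes>\<^sub>M moll_law \<eta>))"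
    by (simp add: case_prod_unfold)
  then show "(\<integral>x. circle_density \<eta> \<delta> z r x * f x \<partial>lborel) = (\<integral>p. f (z + r *\<^sub>R circ (fst p) - \<delta> *\<^sub>R snd p) \<partial>(uniform_angle \<Otimes>\<^sub>M moll_law \<eta>))"
    by (simp add: case_prod_unfold)
  show "(\<integral>x. circle_density \<eta> \<delta> z r x * f x \<partial>lborel) = (\<integral>a. (\<integral>\<theta>. f (z + r *\<^sub>R circ \<theta> - \<delta> *\<^sub>R a) \<partial>uniform_angle) \<partial>moll_law \<eta>)"
    unfolding 1 by (rule UN.integral_snd[OF ip, symmetric])
qed

lemma AE_moll_law_small: "AE a in moll_law \<eta>. norm a \<le> 1"
proof -
  note [measurable] = mollifierD(6)[OF e]
  have "AE a in lborel. 0 < ennreal (\<eta> a) \<longrightarrow> norm a \<le> 1"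
    using mollifierD(3)[OF e] by (intro AE_I2) (metis ennreal_0 less_irrefl not_le)
  then show ?thesis unfolding moll_law_def by (subst AE_density) auto
qed

text \<open>The potential of an exact circle is a logarithm truncated at \<open>r\<close>, hence has
  Lipschitz constant \<open>1 / r\<close>. Averaging it over shifts of length at most
  \<open>\<delta>\<close> changes it by at most \<open>\<delta> / r\<close>.\<close>

lemma circle_density_potential:
  "\<bar>(\<integral>x. circle_density \<eta> \<delta> z r x * - ln (dist x y) \<partial>lborel) - - ln (max (dist z y) r)\<bar> \<le> \<delta> / r"
proof -
  note [measurable] = mollifierD(6)[OF e]
  obtain b where b: "bounded_density b (norm z + r + \<delta>) (circle_density \<eta> \<delta> z r)"
    using circle_density_bounded[OF e d r] by blast
  define F where "F a = - ln (max (norm (z - \<delta> *\<^sub>R a - y)) r)" for a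
  have [measurable]: "F \<in> borel_measurable borel" unfolding F_def by measurable
  have "(\<integral>x. circle_density \<eta> \<delta> z r x * - ln (dist x y) \<partial>lborel)
      = (\<integral>a. (\<integral>\<theta>. - ln (dist (z + r *\<^sub>R circ \<theta> - \<delta> *\<^sub>R a) y) \<partial>uniform_angle) \<partial>moll_law \<eta>)"
    by (rule circle_density_integral(1)[OF _ integrable_log_kernel[OF b]]) measurable
  also have "\<dots> = (\<integral>a. F a \<partial>moll_law \<eta>)"
  proof (rule integral_cong_AE)
    \<comment> \<open>The formula for exact circles excludes the shifts that place \<open>y\<close>
      on the circle. These shifts fill a sphere, which is a null set.\<close>
    have "sphere ((z - y) /\<^sub>R \<delta>) (r / \<delta>) \<in> null_sets lebesgue"
      using negligible_sphere negligible_iff_null_sets by blast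
    then have "AE a in (lebesgue :: (real^2) measure). a \<notin> sphere ((z - y) /\<^sub>R \<delta>) (r / \<delta>)" by (rule AE_not_in)
    then have "AE a in (lborel :: (real^2) measure). a \<notin> sphere ((z - y) /\<^sub>R \<delta>) (r / \<delta>)" by (simp only: AE_completion_iff)
    then have "AE a in moll_law \<eta>. a \<notin> sphere ((z - y) /\<^sub>R \<delta>) (r / \<delta>)"
      unfolding moll_law_def by (subst AE_density) auto
    then show "AE a in moll_law \<eta>. (\<integral>\<theta>. - ln (dist (z + r *\<^sub>R circ \<theta> - \<delta> *\<^sub>R a) y) \<partial>uniform_angle) = F a"
    proof eventually_elim
      case (elim a)
      have "(z - y) /\<^sub>R \<delta> - a = (z - \<delta> *\<^sub>R a - y) /\<^sub>R \<delta>" using d by (simp add: algebra_simps)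
      then have "dist ((z - y) /\<^sub>R \<delta>) a = norm (z - \<delta> *\<^sub>R a - y) / \<delta>" using d by (simp add: dist_norm divide_inverse_commute)
      then have n: "norm (z - \<delta> *\<^sub>R a - y) \<noteq> r" using elim d by auto
      have "dist (z + r *\<^sub>R circ \<theta> - \<delta> *\<^sub>R a) y = norm ((z - \<delta> *\<^sub>R a - y) + r *\<^sub>R circ \<theta>)" for \<theta>
        by (simp add: dist_norm algebra_simps)
      then show ?case unfolding F_def using integral_ln_norm_circle[OF r n] by simp
    qed
  qed measurable
  finally have 1: "(\<integral>x. circle_density \<eta> \<delta> z r x * - ln (dist x y) \<partial>lborel) = (\<integral>a. F a \<partial>moll_law \<eta>)" .
  have close: "\<bar>F a - - ln (max (dist z y) r)\<bar> \<le> \<delta> / r" if "norm a \<le> 1" for a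
  proof -
    have "\<bar>F a - - ln (max (dist z y) r)\<bar> = \<bar>ln (max (norm (z - \<delta> *\<^sub>R a - y)) r) - ln (max (dist z y) r)\<bar>" by (simp add: F_def)
    also have "\<dots> \<le> \<bar>max (norm (z - \<delta> *\<^sub>R a - y)) r - max (dist z y) r\<bar> / r" using r by (intro ln_diff_le) auto
    also have "\<dots> \<le> \<delta> / r"
    proof (intro divide_right_mono)
      have "\<bar>norm (z - \<delta> *\<^sub>R a - y) - dist z y\<bar> \<le> norm ((z - \<delta> *\<^sub>R a - y) - (z - y))"
        unfolding dist_norm by (rule norm_triangle_ineq3)
      also have "\<dots> = \<delta> * norm a" using d by simp
      also have "\<dots> \<le> \<delta>" using that d by (simp add: mult_left_le)
      finally show "\<bar>max (norm (z - \<delta> *\<^sub>R a - y)) r - max (dist z y) r\<bar> \<le> \<delta>" by (auto simp: max_def abs_le_iff)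
    qed (use r in auto)
    finally show ?thesis .
  qed
  have ae: "AE a in moll_law \<eta>. \<bar>F a - - ln (max (dist z y) r)\<bar> \<le> \<delta> / r"
    using AE_moll_law_small by eventually_elim (rule close)
  have i1: "integrable (moll_law \<eta>) (\<lambda>a. F a - - ln (max (dist z y) r))"
    using ae by (intro N.integrable_const_bound[where B="\<delta> / r"]) auto
  then have i2: "integrable (moll_law \<eta>) F"
    using Bochner_Integration.integrable_add[OF i1 N.integrable_const[of "- ln (max (dist z y) r)"]] by simp
  have "(\<integral>a. F a \<partial>moll_law \<eta>) - - ln (max (dist z y) r) = (\<integral>a. F a - - ln (max (dist z y) r) \<partial>moll_law \<eta>)"
    using i2 using N.prob_space by (subst Bochner_Integration.integral_diff) auto
  also have "\<bar>\<dots>\<bar> \<le> (\<integral>a. \<bar>F a - - ln (max (dist z y) r)\<bar> \<partial>moll_law \<eta>)" by (rule integral_abs_bound)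
  also have "\<dots> \<le> \<delta> / r" using ae i1 by (intro N.integral_le_const) auto
  finally show ?thesis unfolding 1 .
qed

end

lemma circle_density_integral_1:
  assumes e: "mollifier \<eta>" and d: "0 < \<delta>" and r: "0 < r"
  shows "(\<integral>x. circle_density \<eta> \<delta> z r x \<partial>lborel) = 1"
proof -
  interpret N: prob_space "moll_law \<eta>" by (rule prob_space_moll_law[OF e])
  obtain b where b: "bounded_density b (norm z + r + \<delta>) (circle_density \<eta> \<delta> z r)"
    using circle_density_bounded[OF e d r] by blast
  have "(\<integral>x. circle_density \<eta> \<delta> z r x * 1 \<partial>lborel) = (\<integral>a. (\<integral>\<theta>. 1 \<partial>uniform_angle) \<partial>moll_law \<eta>)"
    using integrable_bounded_density[OF b] by (intro circle_density_integral(1)[OF e d r]) auto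
  also have "\<dots> = 1" using N.prob_space uniform_angle.prob_space by simp
  finally show ?thesis by simp
qed

lemma truncated_log_lipschitz:
  fixes z :: "real^2"
  assumes r: "0 < r"
  shows "\<bar>- ln (max (dist z y) r) - - ln (max (dist z y') r)\<bar> \<le> dist y y' / r"
proof -
  have "\<bar>- ln (max (dist z y) r) - - ln (max (dist z y') r)\<bar> = \<bar>ln (max (dist z y) r) - ln (max (dist z y') r)\<bar>" by simp
  also have "\<dots> \<le> \<bar>max (dist z y) r - max (dist z y') r\<bar> / r" using r by (intro ln_diff_le) auto
  also have "\<bar>max (dist z y) r - max (dist z y') r\<bar> \<le> dist y y'"
    using dist_triangle[of z y y'] dist_triangle[of z y' y] by (auto simp: max_def abs_le_iff dist_commute)
  finally show ?thesis using r by (simp add: divide_right_mono)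
qed

text \<open>The error \<open>\<delta> / r\<close> is paid twice: once for passing from the potential
  of the first mollified circle to that of the exact one, and once for removing the mollification of
  the second circle. The latter uses that the truncated logarithm is Lipschitz, so \<open>s\<close>
  does not enter.\<close>

lemma log_energy_circle_density_aux:
  assumes e: "mollifier \<eta>" "mollifier \<eta>'" and d: "0 < \<delta>" and r: "0 < r" "0 < s"
    and k: "(\<integral>\<theta>. - ln (max (dist z (w + s *\<^sub>R circ \<theta>)) r) \<partial>uniform_angle) = k"
  shows "\<bar>log_energy (circle_density \<eta> \<delta> z r) (circle_density \<eta>' \<delta> w s) - k\<bar> \<le> 2 * \<delta> / r"
proof -
  interpret N: prob_space "moll_law \<eta>'" by (rule prob_space_moll_law[OF e(2)])
  define \<rho> where "\<rho> = circle_density \<eta> \<delta> z r"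
  define \<rho>' where "\<rho>' = circle_density \<eta>' \<delta> w s"
  define R where "R = norm w + s + \<delta>"
  obtain b where b: "bounded_density b (norm z + r + \<delta>) \<rho>"
    using circle_density_bounded[OF e(1) d r(1)] unfolding \<rho>_def by blast
  obtain b' where b': "bounded_density b' R \<rho>'"
    using circle_density_bounded[OF e(2) d r(2)] unfolding \<rho>'_def R_def by blast
  define h where "h y = - ln (max (dist z y) r)" for y
  have [measurable]: "h \<in> borel_measurable borel" "\<rho>' \<in> borel_measurable borel"
    using b' unfolding h_def by (auto simp: bounded_density_def)
  have lip: "\<bar>h y - h y'\<bar> \<le> dist y y' / r" for y y' unfolding h_def by (rule truncated_log_lipschitz[OF r(1)])
  have hb: "\<bar>h y\<bar> \<le> \<bar>h w\<bar> + c / r" if "dist y w \<le> c" for y c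
    using lip[of y w] divide_right_mono[OF that, of r] r by linarith
  define u where "u y = (\<integral>x. \<rho> x * - ln (dist x y) \<partial>lborel)" for y
  have uh: "\<bar>u y - h y\<bar> \<le> \<delta> / r" for y
    unfolding u_def h_def \<rho>_def by (rule circle_density_potential[OF e(1) d r(1)])
  have \<rho>'0: "0 \<le> \<rho>' y" for y unfolding \<rho>'_def by (rule circle_density_facts(2)[OF e(2) d r(2)])
  have i1: "integrable lborel (\<lambda>y. \<rho>' y * u y)" and E: "log_energy \<rho> \<rho>' = (\<integral>y. \<rho>' y * u y \<partial>lborel)"
    unfolding u_def by (rule log_energy_iterated[OF b b'])+
  have "bounded_density (b' * (\<bar>h w\<bar> + (R + norm w) / r)) R (\<lambda>y. \<rho>' y * h y)"
    unfolding bounded_density_def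
  proof (intro conjI allI impI)
    fix y
    have b'0: "0 \<le> b'" "\<bar>\<rho>' y\<bar> \<le> b'" using b' by (auto simp: bounded_density_def intro: order_trans[OF abs_ge_zero])
    show "\<bar>\<rho>' y * h y\<bar> \<le> b' * (\<bar>h w\<bar> + (R + norm w) / r)"
    proof (cases "R < norm y")
      case True
      have "0 \<le> R" using d r by (simp add: R_def)
      then show ?thesis using True b' b'0 r by (simp add: bounded_density_def)
    next
      case False
      then have "dist y w \<le> R + norm w" using norm_triangle_ineq4[of y w] by (simp add: dist_norm)
      from hb[OF this] show ?thesis unfolding abs_mult using b'0 by (intro mult_mono) auto
    qed
    show "R < norm y \<Longrightarrow> \<rho>' y * h y = 0" using b' by (simp add: bounded_density_def)
  qed measurable
  then have i2: "integrable lborel (\<lambda>y. \<rho>' y * h y)" by (rule integrable_bounded_density)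
  have i3: "integrable lborel \<rho>'" by (rule integrable_bounded_density[OF b'])
  have 1: "\<bar>log_energy \<rho> \<rho>' - (\<integral>y. \<rho>' y * h y \<partial>lborel)\<bar> \<le> \<delta> / r"
  proof -
    have "log_energy \<rho> \<rho>' - (\<integral>y. \<rho>' y * h y \<partial>lborel) = (\<integral>y. \<rho>' y * (u y - h y) \<partial>lborel)"
      unfolding E by (subst Bochner_Integration.integral_diff[OF i1 i2, symmetric]) (simp add: right_diff_distrib)
    also have "\<bar>\<dots>\<bar> \<le> (\<integral>y. \<bar>\<rho>' y * (u y - h y)\<bar> \<partial>lborel)" by (rule integral_abs_bound)
    also have "\<dots> \<le> (\<integral>y. \<rho>' y * (\<delta> / r) \<partial>lborel)"
    proof (rule integral_mono)
      show "integrable lborel (\<lambda>y. \<bar>\<rho>' y * (u y - h y)\<bar>)"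
        using Bochner_Integration.integrable_diff[OF i1 i2] by (simp add: right_diff_distrib)
      show "integrable lborel (\<lambda>y. \<rho>' y * (\<delta> / r))" using i3 by simp
      show "\<bar>\<rho>' y * (u y - h y)\<bar> \<le> \<rho>' y * (\<delta> / r)" for y
        using mult_left_mono[OF uh[of y] \<rho>'0[of y]] \<rho>'0[of y] by (simp add: abs_mult)
    qed
    also have "\<dots> = \<delta> / r" using circle_density_integral_1[OF e(2) d r(2), of w] by (simp add: \<rho>'_def)
    finally show ?thesis .
  qed
  have uint: "integrable uniform_angle (\<lambda>\<theta>. h (w + s *\<^sub>R circ \<theta> - \<delta> *\<^sub>R a))" for a
  proof (rule uniform_angle.integrable_const_bound[where B="\<bar>h w\<bar> + (s + norm (\<delta> *\<^sub>R a)) / r"])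
    have "dist (w + s *\<^sub>R circ \<theta> - \<delta> *\<^sub>R a) w \<le> s + norm (\<delta> *\<^sub>R a)" for \<theta>
      using norm_triangle_ineq4[of "s *\<^sub>R circ \<theta>" "\<delta> *\<^sub>R a"] r by (simp add: dist_norm)
    then show "AE \<theta> in uniform_angle. norm (h (w + s *\<^sub>R circ \<theta> - \<delta> *\<^sub>R a)) \<le> \<bar>h w\<bar> + (s + norm (\<delta> *\<^sub>R a)) / r"
      using hb by (intro AE_I2) auto
  qed measurable
  define q where "q a = (\<integral>\<theta>. h (w + s *\<^sub>R circ \<theta> - \<delta> *\<^sub>R a) \<partial>uniform_angle)" for a
  have q[measurable]: "q \<in> borel_measurable (moll_law \<eta>')" unfolding q_def by measurable
  have qk: "\<bar>q a - k\<bar> \<le> \<delta> / r" if a: "norm a \<le> 1" for a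
  proof -
    have "q a - k = (\<integral>\<theta>. h (w + s *\<^sub>R circ \<theta> - \<delta> *\<^sub>R a) - h (w + s *\<^sub>R circ \<theta>) \<partial>uniform_angle)"
      using uint[of a] uint[of 0] k unfolding q_def h_def by (subst Bochner_Integration.integral_diff) auto
    also have "\<bar>\<dots>\<bar> \<le> (\<integral>\<theta>. \<bar>h (w + s *\<^sub>R circ \<theta> - \<delta> *\<^sub>R a) - h (w + s *\<^sub>R circ \<theta>)\<bar> \<partial>uniform_angle)" by (rule integral_abs_bound)
    also have "\<dots> \<le> \<delta> / r"
    proof (rule uniform_angle.integral_le_const)
      show "integrable uniform_angle (\<lambda>\<theta>. \<bar>h (w + s *\<^sub>R circ \<theta> - \<delta> *\<^sub>R a) - h (w + s *\<^sub>R circ \<theta>)\<bar>)"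
        using uint[of a] uint[of 0] by auto
      have "\<bar>h (w + s *\<^sub>R circ \<theta> - \<delta> *\<^sub>R a) - h (w + s *\<^sub>R circ \<theta>)\<bar> \<le> \<delta> / r" for \<theta>
      proof -
        have "dist (w + s *\<^sub>R circ \<theta> - \<delta> *\<^sub>R a) (w + s *\<^sub>R circ \<theta>) \<le> \<delta>" using a d by (simp add: dist_norm mult_left_le)
        then show ?thesis using lip[of "w + s *\<^sub>R circ \<theta> - \<delta> *\<^sub>R a" "w + s *\<^sub>R circ \<theta>"] r by (meson divide_right_mono less_imp_le order_trans)
      qed
      then show "AE \<theta> in uniform_angle. \<bar>h (w + s *\<^sub>R circ \<theta> - \<delta> *\<^sub>R a) - h (w + s *\<^sub>R circ \<theta>)\<bar> \<le> \<delta> / r" by auto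
    qed
    finally show ?thesis .
  qed
  have 2: "\<bar>(\<integral>y. \<rho>' y * h y \<partial>lborel) - k\<bar> \<le> \<delta> / r"
  proof -
    have ae: "AE a in moll_law \<eta>'. \<bar>q a - k\<bar> \<le> \<delta> / r"
      using AE_moll_law_small[OF e(2) d r(2)] by eventually_elim (rule qk)
    have j1: "integrable (moll_law \<eta>') (\<lambda>a. q a - k)"
      using ae by (intro N.integrable_const_bound[where B="\<delta> / r"]) auto
    then have j2: "integrable (moll_law \<eta>') q"
      using Bochner_Integration.integrable_add[OF j1 N.integrable_const[of k]] by simp
    have "(\<integral>y. \<rho>' y * h y \<partial>lborel) = (\<integral>a. q a \<partial>moll_law \<eta>')"
      unfolding \<rho>'_def q_def by (rule circle_density_integral(1)[OF e(2) d r(2)]) (use i2 in \<open>auto simp: \<rho>'_def\<close>)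
    then have "(\<integral>y. \<rho>' y * h y \<partial>lborel) - k = (\<integral>a. q a - k \<partial>moll_law \<eta>')"
      using j2 N.prob_space by (subst Bochner_Integration.integral_diff) auto
    also have "\<bar>\<dots>\<bar> \<le> (\<integral>a. \<bar>q a - k\<bar> \<partial>moll_law \<eta>')" by (rule integral_abs_bound)
    also have "\<dots> \<le> \<delta> / r" using ae j1 by (intro N.integral_le_const) auto
    finally show ?thesis .
  qed
  show ?thesis using 1 2 unfolding \<rho>_def \<rho>'_def by (simp add: abs_le_iff)
qed

text \<open>Outside a circle the potential is that of a unit mass at its centre. Circles lying
  outside each other therefore interact like their centres, whatever the radii, tangency included.
  The two mollifiers may differ because each circle average comes with a mollifier of its
  own.\<close>

lemma log_energy_circle_density:
  assumes e: "mollifier \<eta>" "mollifier \<eta>'" and d: "0 < \<delta>" and r: "0 < r" "0 < s"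
  shows "r + s \<le> dist z w \<Longrightarrow>
      \<bar>log_energy (circle_density \<eta> \<delta> z r) (circle_density \<eta>' \<delta> w s) + ln (dist z w)\<bar> \<le> 2 * \<delta> / r"
    and "\<bar>log_energy (circle_density \<eta> \<delta> z r) (circle_density \<eta>' \<delta> z r) + ln r\<bar> \<le> 2 * \<delta> / r"
proof -
  assume far: "r + s \<le> dist z w"
  have "r \<le> dist z (w + s *\<^sub>R circ \<theta>)" for \<theta>
    using far r dist_triangle[of z w "w + s *\<^sub>R circ \<theta>"] by (simp add: dist_norm)
  then have "max (dist z (w + s *\<^sub>R circ \<theta>)) r = dist (w + s *\<^sub>R circ \<theta>) z" for \<theta>
    by (simp add: max_absorb1 dist_commute)
  then have "max (dist z (w + s *\<^sub>R circ \<theta>)) r = norm ((w - z) + s *\<^sub>R circ \<theta>)" for \<theta>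
    by (simp add: dist_norm algebra_simps)
  moreover have "norm (w - z) \<noteq> s" "max (norm (w - z)) s = dist z w"
    using far r by (auto simp: dist_norm norm_minus_commute)
  ultimately have "(\<integral>\<theta>. - ln (max (dist z (w + s *\<^sub>R circ \<theta>)) r) \<partial>uniform_angle) = - ln (dist z w)"
    using integral_ln_norm_circle[OF r(2), of "w - z"] by simp
  from log_energy_circle_density_aux[OF e d r this]
  show "\<bar>log_energy (circle_density \<eta> \<delta> z r) (circle_density \<eta>' \<delta> w s) + ln (dist z w)\<bar> \<le> 2 * \<delta> / r" by simp
next
  have "(\<integral>\<theta>. - ln (max (dist z (z + r *\<^sub>R circ \<theta>)) r) \<partial>uniform_angle) = - ln r"
    using r uniform_angle.prob_space by (simp add: dist_norm)
  from log_energy_circle_density_aux[OF e d r(1) r(1) this]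
  show "\<bar>log_energy (circle_density \<eta> \<delta> z r) (circle_density \<eta>' \<delta> z r) + ln r\<bar> \<le> 2 * \<delta> / r" by simp
qed

lemma bounded_density_mono: "bounded_density b R f \<Longrightarrow> b \<le> b' \<Longrightarrow> R \<le> R' \<Longrightarrow> bounded_density b' R' f"
  by (auto simp: bounded_density_def intro: order_trans)

lemma log_energy_tendsto:
  assumes fn: "\<And>n. bounded_density b R (f n)" and lim: "\<And>x. (\<lambda>n. f n x) \<longlonglongrightarrow> g x"
  shows "(\<lambda>n. log_energy (f n) (f n)) \<longlonglongrightarrow> log_energy g g"
proof -
  have [measurable]: "f n \<in> borel_measurable borel" for n using fn[of n] by (simp add: bounded_density_def)
  have [measurable]: "g \<in> borel_measurable borel" by (rule borel_measurable_LIMSEQ_metric[OF _ lim]) measurable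
  have b: "0 \<le> b" using fn[of 0] by (auto simp: bounded_density_def intro: order_trans[OF abs_ge_zero])
  define I :: "real^2 \<Rightarrow> real" where "I = indicator (cball 0 R)"
  have "cball (0 :: real^2) R \<in> sets borel" by (intro borel_closed closed_cball)
  then have "I \<in> borel_measurable borel" unfolding I_def by (rule borel_measurable_indicator)
  then have I: "bounded_density 1 R I" by (auto simp: bounded_density_def I_def split: split_indicator)
  have fI: "\<bar>f n x\<bar> \<le> b * I x" for n x using fn[of n] b by (auto simp: bounded_density_def I_def split: split_indicator)
  show ?thesis unfolding log_energy_def
  proof (rule integral_dominated_convergence[where w = "\<lambda>p. b\<^sup>2 * \<bar>I (fst p) * - ln (dist (fst p) (snd p)) * I (snd p)\<bar>"])
    show "integrable (lborel \<Otimes>\<^sub>M lborel) (\<lambda>p. b\<^sup>2 * \<bar>I (fst p) * - ln (dist (fst p) (snd p)) * I (snd p)\<bar>)"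
      using integrable_log_kernel_pair[OF I I] by (intro integrable_mult_right integrable_abs)
    show "AE p in lborel \<Otimes>\<^sub>M lborel. (\<lambda>n. f n (fst p) * - ln (dist (fst p) (snd p)) * f n (snd p)) \<longlonglongrightarrow> g (fst p) * - ln (dist (fst p) (snd p)) * g (snd p)"
      by (intro AE_I2 tendsto_intros lim)
    fix n
    show "AE p in lborel \<Otimes>\<^sub>M lborel. norm (f n (fst p) * - ln (dist (fst p) (snd p)) * f n (snd p)) \<le> b\<^sup>2 * \<bar>I (fst p) * - ln (dist (fst p) (snd p)) * I (snd p)\<bar>"
    proof (intro AE_I2)
      fix p :: "(real^2) \<times> (real^2)"
      have I0: "0 \<le> I x" for x by (simp add: I_def)
      have "\<bar>f n (fst p)\<bar> * \<bar>ln (dist (fst p) (snd p))\<bar> * \<bar>f n (snd p)\<bar> \<le> (b * I (fst p)) * \<bar>ln (dist (fst p) (snd p))\<bar> * (b * I (snd p))"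
        using fI b I0 by (intro mult_mono) auto
      also have "\<dots> = b\<^sup>2 * (I (fst p) * \<bar>ln (dist (fst p) (snd p))\<bar> * I (snd p))" by (simp add: power2_eq_square mult_ac)
      finally show "norm (f n (fst p) * - ln (dist (fst p) (snd p)) * f n (snd p)) \<le> b\<^sup>2 * \<bar>I (fst p) * - ln (dist (fst p) (snd p)) * I (snd p)\<bar>"
        using I0[of "fst p"] I0[of "snd p"] by (simp add: abs_mult)
    qed
  qed measurable
qed

section \<open>Green energy compared with logarithmic energy\<close>

lemma AE_pair_neq: "AE p in lborel \<Otimes>\<^sub>M (lborel :: (real^2) measure). fst p \<noteq> snd p"
proof (rule lborel_pair.AE_pair_measure)
  show "{p \<in> space (lborel \<Otimes>\<^sub>M (lborel :: (real^2) measure)). fst p \<noteq> snd p} \<in> sets (lborel \<Otimes>\<^sub>M lborel)"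
    by measurable
  show "AE x in (lborel :: (real^2) measure). AE y in lborel. fst (x, y) \<noteq> snd (x, y)"
  proof (rule AE_I2)
    fix x :: "real^2"
    show "AE y in lborel. fst (x, y) \<noteq> snd (x, y)" using AE_lborel_singleton[of x] by eventually_elim auto
  qed
qed

text \<open>The difference is the energy for the regular part alone, which is bounded where
  \<open>f\<close> lives. The constant is uniform over \<open>f\<close>, and only the integral of
  \<open>\<bar>f\<bar>\<close> enters; for combinations of circles it is controlled by the
  coefficients, however small the circles.\<close>

lemma green_energy_near_log_energy:
  assumes D: "open D" "bounded D" and G: "dirichlet_green D G" and \<kappa>: "0 < \<kappa>"
  obtains B where "0 \<le> B"
    "\<And>f b. f \<in> borel_measurable borel \<Longrightarrow> (\<And>x. \<bar>f x\<bar> \<le> b) \<Longrightarrow> (\<And>x. f x \<noteq> 0 \<Longrightarrow> cball x \<kappa> \<subseteq> D) \<Longrightarrow>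
      \<bar>green_energy D G f f - log_energy f f\<bar> \<le> B * (\<integral>x. \<bar>f x\<bar> \<partial>lborel)\<^sup>2"
proof -
  obtain H where H: "\<And>x y. x \<in> D \<Longrightarrow> y \<in> D \<Longrightarrow> x \<noteq> y \<Longrightarrow> G x y = - ln (dist x y) + H x y"
    and cH: "continuous_on (D \<times> D) (\<lambda>p. H (fst p) (snd p))"
    and bH: "\<And>\<kappa>. 0 < \<kappa> \<Longrightarrow> \<exists>B\<ge>0. \<forall>x y. cball x \<kappa> \<subseteq> D \<longrightarrow> y \<in> D \<longrightarrow> \<bar>H x y\<bar> \<le> B"
    by (rule green_regular_part[OF D G]) blast
  obtain B where B: "0 \<le> B" "\<And>x y. cball x \<kappa> \<subseteq> D \<Longrightarrow> y \<in> D \<Longrightarrow> \<bar>H x y\<bar> \<le> B" using bH[OF \<kappa>] by blast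
  obtain R where R: "\<And>x. x \<in> D \<Longrightarrow> norm x \<le> R" using D(2) by (auto simp: bounded_iff)
  have oDD: "open (D \<times> D)" using D(1) by (intro open_Times)
  show ?thesis
  proof (rule that[OF B(1)])
    fix f b
    assume f[measurable]: "f \<in> borel_measurable borel" and fb: "\<And>x. \<bar>f x\<bar> \<le> (b :: real)" and fD: "\<And>x. f x \<noteq> 0 \<Longrightarrow> cball x \<kappa> \<subseteq> D"
    have fD': "f x \<noteq> 0 \<Longrightarrow> x \<in> D" for x using fD[of x] \<kappa> by auto
    have bd: "bounded_density b R f" using fb fD' R by (auto simp: bounded_density_def not_le[symmetric])
    define F where "F p = f (fst p) * - ln (dist (fst p) (snd p)) * f (snd p)" for p
    define K where "K p = f (fst p) * (indicator (D \<times> D) p *\<^sub>R H (fst p) (snd p)) * f (snd p)" for p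
    define I where "I p = indicator (D \<times> D) p *\<^sub>R (f (fst p) * G (fst p) (snd p) * f (snd p))" for p
    have mH: "(\<lambda>p. indicator (D \<times> D) p *\<^sub>R H (fst p) (snd p)) \<in> borel_measurable borel"
      using oDD by (intro borel_measurable_continuous_on_indicator cH) auto
    then have mH': "(\<lambda>p. indicator (D \<times> D) p *\<^sub>R H (fst p) (snd p)) \<in> borel_measurable (lborel \<Otimes>\<^sub>M lborel)"
      by (simp add: lborel_prod)
    have mK: "K \<in> borel_measurable (lborel \<Otimes>\<^sub>M lborel)" unfolding K_def using mH' by measurable
    have mF: "F \<in> borel_measurable (lborel \<Otimes>\<^sub>M lborel)" unfolding F_def by measurable
    have iF: "integrable (lborel \<Otimes>\<^sub>M lborel) F" unfolding F_def by (rule integrable_log_kernel_pair[OF bd bd])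
    have nK: "(\<integral>\<^sup>+p. ennreal (norm (K p)) \<partial>(lborel \<Otimes>\<^sub>M lborel)) \<le> ennreal (B * (\<integral>x. \<bar>f x\<bar> \<partial>lborel)\<^sup>2)"
    proof -
      have "(\<integral>\<^sup>+p. ennreal (norm (K p)) \<partial>(lborel \<Otimes>\<^sub>M lborel)) \<le> (\<integral>\<^sup>+p. ennreal (\<bar>f (fst p)\<bar>) * (ennreal B * ennreal \<bar>f (snd p)\<bar>) \<partial>(lborel \<Otimes>\<^sub>M lborel))"
      proof (intro nn_integral_mono)
        fix p :: "(real^2) \<times> (real^2)"
        have "\<bar>K p\<bar> \<le> \<bar>f (fst p)\<bar> * (B * \<bar>f (snd p)\<bar>)"
        proof (cases "f (fst p) = 0 \<or> f (snd p) = 0")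
          case False
          then have "\<bar>H (fst p) (snd p)\<bar> \<le> B" using B(2) fD fD' by blast
          then have "\<bar>f (fst p)\<bar> * \<bar>indicator (D \<times> D) p *\<^sub>R H (fst p) (snd p)\<bar> * \<bar>f (snd p)\<bar> \<le> \<bar>f (fst p)\<bar> * B * \<bar>f (snd p)\<bar>"
            using B(1) by (intro mult_right_mono mult_left_mono) (auto split: split_indicator)
          then show ?thesis by (simp add: K_def abs_mult mult_ac)
        qed (auto simp: K_def)
        then show "ennreal (norm (K p)) \<le> ennreal (\<bar>f (fst p)\<bar>) * (ennreal B * ennreal \<bar>f (snd p)\<bar>)"
          using B(1) by (simp add: ennreal_leI flip: ennreal_mult)
      qed
      also have "\<dots> = (\<integral>\<^sup>+x. ennreal \<bar>f x\<bar> * (ennreal B * (\<integral>\<^sup>+y. ennreal \<bar>f y\<bar> \<partial>lborel)) \<partial>lborel)"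
        by (subst lborel.nn_integral_fst[symmetric]) (auto simp: nn_integral_cmult)
      also have "\<dots> = (\<integral>\<^sup>+x. ennreal \<bar>f x\<bar> \<partial>lborel) * (ennreal B * (\<integral>\<^sup>+y. ennreal \<bar>f y\<bar> \<partial>lborel))"
        by (rule nn_integral_multc) measurable
      also have "(\<integral>\<^sup>+x. ennreal \<bar>f x\<bar> \<partial>lborel) = ennreal (\<integral>x. \<bar>f x\<bar> \<partial>lborel)"
        using integrable_bounded_density[OF bd] by (intro nn_integral_eq_integral) auto
      also have "ennreal (\<integral>x. \<bar>f x\<bar> \<partial>lborel) * (ennreal B * ennreal (\<integral>x. \<bar>f x\<bar> \<partial>lborel)) = ennreal (B * (\<integral>x. \<bar>f x\<bar> \<partial>lborel)\<^sup>2)"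
        using B(1) by (simp add: power2_eq_square mult_ac flip: ennreal_mult)
      finally show ?thesis .
    qed
    have iK: "integrable (lborel \<Otimes>\<^sub>M lborel) K"
      using mK le_less_trans[OF nK ennreal_less_top] by (intro integrableI_bounded) auto
    have "AE p in lborel \<Otimes>\<^sub>M lborel. F p + K p = I p"
      using AE_pair_neq
    proof eventually_elim
      case (elim p)
      show ?case
      proof (cases "f (fst p) = 0 \<or> f (snd p) = 0")
        case False
        then have "fst p \<in> D" "snd p \<in> D" using fD' by auto
        moreover from this have "p \<in> D \<times> D" by (cases p) auto
        moreover from calculation elim have GH: "G (fst p) (snd p) = - ln (dist (fst p) (snd p)) + H (fst p) (snd p)"
          by (intro H) auto
        ultimately show ?thesis unfolding F_def K_def I_def GH by (simp add: algebra_simps)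
      qed (auto simp: F_def K_def I_def)
    qed
    \<comment> \<open>The Green energy is an integral for the completed measure. Off the diagonal
      its integrand agrees with the Borel function \<open>F + K\<close>, and this also makes it
      measurable.\<close>
    then have ae: "AE p in lebesgue. F p + K p = I p"
      unfolding lborel_prod by (rule AE_completion)
    have mFK: "(\<lambda>p. F p + K p) \<in> borel_measurable lborel" using mF mK by (simp add: lborel_prod)
    then have mFK': "(\<lambda>p. F p + K p) \<in> borel_measurable lebesgue" by (rule measurable_completion)
    have mI: "I \<in> borel_measurable lebesgue" by (rule borel_measurable_AE[OF mFK' ae])
    have "green_energy D G f f = (\<integral>p. I p \<partial>lebesgue)"
      unfolding green_energy_def I_def set_lebesgue_integral_def ..
    also have "\<dots> = (\<integral>p. F p + K p \<partial>lebesgue)"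
      using ae mI mFK' by (intro integral_cong_AE) (auto elim: eventually_mono)
    also have "\<dots> = (\<integral>p. F p + K p \<partial>(lborel \<Otimes>\<^sub>M lborel))" using mFK by (simp add: integral_completion lborel_prod)
    also have "\<dots> = log_energy f f + (\<integral>p. K p \<partial>(lborel \<Otimes>\<^sub>M lborel))"
      unfolding log_energy_def F_def[symmetric] by (rule Bochner_Integration.integral_add[OF iF iK])
    finally have "green_energy D G f f - log_energy f f = (\<integral>p. K p \<partial>(lborel \<Otimes>\<^sub>M lborel))" by simp
    moreover have "ennreal (norm (\<integral>p. K p \<partial>(lborel \<Otimes>\<^sub>M lborel))) \<le> ennreal (B * (\<integral>x. \<bar>f x\<bar> \<partial>lborel)\<^sup>2)"
      by (rule order_trans[OF integral_norm_bound_ennreal[OF iK] nK])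
    then have "\<bar>\<integral>p. K p \<partial>(lborel \<Otimes>\<^sub>M lborel)\<bar> \<le> B * (\<integral>x. \<bar>f x\<bar> \<partial>lborel)\<^sup>2"
      using B(1) by (simp add: ennreal_le_iff)
    ultimately show "\<bar>green_energy D G f f - log_energy f f\<bar> \<le> B * (\<integral>x. \<bar>f x\<bar> \<partial>lborel)\<^sup>2" by simp
  qed
qed

section \<open>Riemann sums along a circle\<close>

text \<open>A distribution respects finite linear combinations, whereas a circle mean of its
  mollification is an integral. Riemann sums provide the link.\<close>

lemma riemann_sum_tendsto:
  fixes g :: "real \<Rightarrow> real" and a :: real
  assumes a: "0 < a" and g: "continuous_on {0..a} g"
  shows "(\<lambda>n. (\<Sum>k<Suc n. g (a * k / Suc n)) / Suc n) \<longlonglongrightarrow> (LINT t:{0..a}|lborel. g t) / a"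
proof -
  have si: "set_integrable lborel {0..a} g" by (rule borel_integrable_atLeastAtMost'[OF g])
  define F where "F t = integral {0..t} g" for t
  have F: "(F has_real_derivative g t) (at t within {0..a})" if "t \<in> {0..a}" for t
    unfolding F_def by (rule integral_has_real_derivative[OF g that])
  have Fa: "(LINT t:{0..a}|lborel. g t) = F a" unfolding F_def by (rule set_borel_integral_eq_integral(2)[OF si])
  have uc: "uniformly_continuous_on {0..a} g" by (rule compact_uniformly_continuous[OF g]) simp
  show ?thesis
  proof (rule LIMSEQ_I)
    fix e :: real assume e: "0 < e"
    obtain d where d: "0 < d" "\<And>s t. s \<in> {0..a} \<Longrightarrow> t \<in> {0..a} \<Longrightarrow> dist t s < d \<Longrightarrow> dist (g t) (g s) < e"
      using uc e unfolding uniformly_continuous_on_def by metis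
    obtain n0 where n0: "a / Suc n0 < d"
    proof -
      obtain m where "inverse (real (Suc m)) < d / a" using reals_Archimedean[of "d / a"] d a by auto
      then have "a / Suc m < d" using a by (simp add: field_simps)
      then show ?thesis using that by blast
    qed
    show "\<exists>no. \<forall>n\<ge>no. norm ((\<Sum>k<Suc n. g (a * k / Suc n)) / Suc n - (LINT t:{0..a}|lborel. g t) / a) < e"
    proof (intro exI[of _ n0] allI impI)
      fix n assume n: "n0 \<le> n"
      define t where "t k = a * real k / Suc n" for k :: nat
      have step: "t (Suc k) - t k = a / Suc n" for k
        unfolding t_def diff_divide_distrib[symmetric] by (simp add: algebra_simps)
      have h: "0 < a / Suc n" "a / Suc n < d"
      proof -
        show "0 < a / Suc n" using a by simp
        have "a / Suc n \<le> a / Suc n0" using a n by (intro divide_left_mono) auto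
        then show "a / Suc n < d" using n0 by linarith
      qed
      have tin: "t k \<in> {0..a}" if "k \<le> Suc n" for k
      proof -
        have "a * real k \<le> a * real (Suc n)" using that a by (intro mult_left_mono) auto
        then show ?thesis using a by (simp add: t_def divide_le_eq)
      qed
      \<comment> \<open>The mean value theorem for the antiderivative turns its increment over a
        cell into a value of \<open>g\<close> inside the cell, which uniform continuity compares
        with \<open>g (t k)\<close>.\<close>
      have cell: "\<bar>F (t (Suc k)) - F (t k) - g (t k) * (a / Suc n)\<bar> < e * (a / Suc n)" if k: "k < Suc n" for k
      proof -
        have lt: "t k < t (Suc k)" using step[of k] h by linarith
        have sub: "{t k..t (Suc k)} \<subseteq> {0..a}" using tin[of k] tin[of "Suc k"] k by auto
        obtain x where x: "t k < x" "x < t (Suc k)" "F (t (Suc k)) - F (t k) = g x * (a / Suc n)"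
        proof (rule mvt[where f = F and f' = "\<lambda>x h. g x * h", OF lt])
          show "continuous_on {t k..t (Suc k)} F"
            using sub F by (intro continuous_on_subset[OF DERIV_continuous_on sub]) auto
          fix x assume x: "t k < x" "x < t (Suc k)"
          then have xin: "x \<in> {0<..<a}" using tin[of k] tin[of "Suc k"] k by auto
          have "(F has_real_derivative g x) (at x within {0..a})" using F xin by auto
          then show "(F has_derivative (*) (g x)) (at x)"
            using at_within_interior[of x "{0..a}"] xin by (simp add: has_field_derivative_def interior_atLeastAtMost_real)
        qed (use that step in auto)
        have "dist (g x) (g (t k)) < e"
          using x sub tin[of k] k h step[of k] by (intro d(2)) (auto simp: dist_real_def)
        then have "\<bar>g x - g (t k)\<bar> * (a / Suc n) < e * (a / Suc n)" using h by (intro mult_strict_right_mono) (auto simp: dist_real_def)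
        moreover have "F (t (Suc k)) - F (t k) - g (t k) * (a / Suc n) = (g x - g (t k)) * (a / Suc n)"
          unfolding x(3) by (rule left_diff_distrib[symmetric])
        ultimately show ?thesis using h a by (simp add: abs_mult)
      qed
      have "F a = (\<Sum>k<Suc n. F (t (Suc k)) - F (t k))"
        by (subst sum_lessThan_telescope) (simp add: t_def F_def)
      then have "\<bar>F a - (\<Sum>k<Suc n. g (t k)) * (a / Suc n)\<bar> = \<bar>\<Sum>k<Suc n. (F (t (Suc k)) - F (t k) - g (t k) * (a / Suc n))\<bar>"
        by (simp only: sum_subtractf sum_distrib_right)
      also have "\<dots> \<le> (\<Sum>k<Suc n. \<bar>F (t (Suc k)) - F (t k) - g (t k) * (a / Suc n)\<bar>)" by (rule sum_abs)
      also have "\<dots> < (\<Sum>k<Suc n. e * (a / Suc n))" using cell by (intro sum_strict_mono) auto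
      also have "\<dots> = e * a" by simp
      finally have *: "\<bar>F a - (\<Sum>k<Suc n. g (t k)) * (a / Suc n)\<bar> < e * a" .
      have "(\<Sum>k<Suc n. g (t k)) / Suc n - F a / a = - (F a - (\<Sum>k<Suc n. g (t k)) * (a / Suc n)) / a"
      proof -
        have "x / N - y / a = - (y - x * (a / N)) / a" if "0 < N" for x y N :: real
          using a that by (simp add: field_simps)
        then show ?thesis by simp
      qed
      then have "\<bar>(\<Sum>k<Suc n. g (t k)) / Suc n - F a / a\<bar> = \<bar>F a - (\<Sum>k<Suc n. g (t k)) * (a / Suc n)\<bar> / a"
        using a by (simp only: abs_divide abs_minus_cancel abs_of_pos)
      also have "\<dots> < e" using * a by (simp add: divide_less_eq)
      finally show "norm ((\<Sum>k<Suc n. g (a * k / Suc n)) / Suc n - (LINT t:{0..a}|lborel. g t) / a) < e"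
        by (simp add: t_def Fa)
    qed
  qed
qed

lemma circle_mean_riemann:
  fixes f :: "real^2 \<Rightarrow> real"
  assumes f: "continuous_on (sphere z r) f" and r: "0 < r"
  shows "(\<lambda>n. (\<Sum>k<Suc n. f (z + r *\<^sub>R circ (2 * pi * k / Suc n))) / Suc n) \<longlonglongrightarrow> circle_mean f z r"
  unfolding circle_mean_def
proof (rule riemann_sum_tendsto)
  show "continuous_on {0..2 * pi} (\<lambda>t. f (z + r *\<^sub>R circ t))"
    using r by (intro continuous_on_compose2[OF f] continuous_intros continuous_circ) (auto simp: dist_norm)
qed simp

section \<open>Characteristic functions of circle averages\<close>

lemma frechet_worksI: "f differentiable (at x) \<Longrightarrow> (f has_derivative frechet_derivative f (at x)) (at x)"
  using frechet_derivative_works by blast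

lemma pdir_lincomb:
  assumes "f differentiable (at x)" "g differentiable (at x)"
  shows "pdir j (\<lambda>x. a * f x + b * g x) x = a * pdir j f x + b * pdir j g x"
proof -
  have "((\<lambda>x. a * f x + b * g x) has_derivative (\<lambda>h. a * frechet_derivative f (at x) h + b * frechet_derivative g (at x) h)) (at x)"
    using assms by (intro has_derivative_add has_derivative_mult_right frechet_worksI)
  from fun_cong[OF frechet_derivative_at[OF this], of "axis j 1"] show ?thesis by (simp add: pdir_def)
qed

lemma partials_lincomb:
  assumes "smooth f" "smooth g"
  shows "partials js (\<lambda>x. a * f x + b * g x) = (\<lambda>x. a * partials js f x + b * partials js g x)"
proof (induction js)
  case (Cons j js)
  have "pdir j (\<lambda>x. a * partials js f x + b * partials js g x) x = a * pdir j (partials js f) x + b * pdir j (partials js g) x" for x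
    using assms by (intro pdir_lincomb) (auto simp: smooth_def)
  then show ?case unfolding partials.simps Cons by (intro ext)
qed simp

lemma smooth_lincomb: "smooth f \<Longrightarrow> smooth g \<Longrightarrow> smooth (\<lambda>x. a * f x + b * g x)"
  unfolding smooth_def[of "\<lambda>x. a * f x + b * g x"]
  by (simp add: partials_lincomb) (auto simp: smooth_def intro!: derivative_intros)

lemma pdir_affine:
  assumes "g differentiable (at ((y - z) /\<^sub>R \<delta>))"
  shows "pdir j (\<lambda>z. c * g ((y - z) /\<^sub>R \<delta>)) z = c * (- (1 / \<delta>)) * pdir j g ((y - z) /\<^sub>R \<delta>)"
    and "(\<lambda>z. c * g ((y - z) /\<^sub>R \<delta>)) differentiable (at z)"
proof -
  let ?g' = "frechet_derivative g (at ((y - z) /\<^sub>R \<delta>))"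
  have g: "(g has_derivative ?g') (at ((y - z) /\<^sub>R \<delta>))" using assms by (rule frechet_worksI)
  have "((\<lambda>z. (y - z) /\<^sub>R \<delta>) has_derivative (\<lambda>h. (0 - h) /\<^sub>R \<delta>)) (at z)"
    by (intro has_derivative_scaleR_right has_derivative_diff has_derivative_const has_derivative_ident)
  from has_derivative_compose[OF this g]
  have d: "((\<lambda>z. c * g ((y - z) /\<^sub>R \<delta>)) has_derivative (\<lambda>h. c * ?g' ((0 - h) /\<^sub>R \<delta>))) (at z)"
    by (rule has_derivative_mult_right)
  then show "(\<lambda>z. c * g ((y - z) /\<^sub>R \<delta>)) differentiable (at z)" by (auto simp: differentiable_def)
  have "linear ?g'" using assms by (rule linear_frechet_derivative)
  then have "?g' ((0 - h) /\<^sub>R \<delta>) = - (1 / \<delta>) * ?g' h" for h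
    using linear_cmul[of ?g' "- (1 / \<delta>)" h] by (simp add: divide_inverse)
  then show "pdir j (\<lambda>z. c * g ((y - z) /\<^sub>R \<delta>)) z = c * (- (1 / \<delta>)) * pdir j g ((y - z) /\<^sub>R \<delta>)"
    using fun_cong[OF frechet_derivative_at[OF d], of "axis j 1"] by (simp add: pdir_def)
qed

lemma partials_moll:
  assumes "smooth \<eta>"
  shows "partials js (moll \<eta> \<delta> y) = (\<lambda>z. ((- (1 / \<delta>)) ^ length js / \<delta>\<^sup>2) * partials js \<eta> ((y - z) /\<^sub>R \<delta>))"
proof (induction js)
  case Nil
  then show ?case by (simp add: moll_def fun_eq_iff)
next
  case (Cons j js)
  have "pdir j (\<lambda>z. ((- (1 / \<delta>)) ^ length js / \<delta>\<^sup>2) * partials js \<eta> ((y - z) /\<^sub>R \<delta>)) z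
      = ((- (1 / \<delta>)) ^ length js / \<delta>\<^sup>2) * (- (1 / \<delta>)) * pdir j (partials js \<eta>) ((y - z) /\<^sub>R \<delta>)" for z
    using assms by (intro pdir_affine) (auto simp: smooth_def)
  then show ?case unfolding partials.simps Cons by (intro ext) simp
qed

lemma smooth_moll: "smooth \<eta> \<Longrightarrow> smooth (moll \<eta> \<delta> y)"
  unfolding smooth_def[of "moll \<eta> \<delta> y"] partials_moll by (intro allI pdir_affine(2)) (auto simp: smooth_def)

lemma support_moll:
  assumes "mollifier \<eta>" "0 < \<delta>"
  shows "closure {x. moll \<eta> \<delta> y x \<noteq> 0} \<subseteq> cball y \<delta>"
proof (rule closure_minimal)
  show "{x. moll \<eta> \<delta> y x \<noteq> 0} \<subseteq> cball y \<delta>"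
  proof
    fix x assume "x \<in> {x. moll \<eta> \<delta> y x \<noteq> 0}"
    then have "\<not> 1 < norm ((y - x) /\<^sub>R \<delta>)" using mollifierD(3)[OF assms(1)] by (auto simp: moll_def)
    then have "norm (y - x) / \<delta> \<le> 1" using assms(2) unfolding norm_scaleR by (simp add: divide_inverse_commute)
    then show "x \<in> cball y \<delta>" using assms(2) by (simp add: dist_norm divide_le_eq)
  qed
qed simp

lemma test_function_moll:
  assumes "mollifier \<eta>" "0 < \<delta>" "cball y \<delta> \<subseteq> D"
  shows "test_function D (moll \<eta> \<delta> y)"
proof -
  have s: "closure {x. moll \<eta> \<delta> y x \<noteq> 0} \<subseteq> cball y \<delta>" by (rule support_moll[OF assms(1,2)])
  then have "bounded (closure {x. moll \<eta> \<delta> y x \<noteq> 0})" by (rule bounded_subset[OF bounded_cball])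
  then show ?thesis using s assms smooth_moll[of \<eta>] by (auto simp: test_function_def mollifier_def compact_eq_bounded_closed)
qed

lemma test_function_lincomb:
  assumes "test_function D f" "test_function D g"
  shows "test_function D (\<lambda>x. a * f x + b * g x)"
proof -
  have sub: "closure {x. a * f x + b * g x \<noteq> 0} \<subseteq> closure {x. f x \<noteq> 0} \<union> closure {x. g x \<noteq> 0}"
    unfolding closure_Un[symmetric] by (rule closure_mono) auto
  have "compact (closure {x. f x \<noteq> 0} \<union> closure {x. g x \<noteq> 0})" using assms by (intro compact_Un) (auto simp: test_function_def)
  then have "bounded (closure {x. a * f x + b * g x \<noteq> 0})" using sub by (intro bounded_subset[OF compact_imp_bounded sub])
  then show ?thesis using assms sub smooth_lincomb[of f g a b] by (auto simp: test_function_def compact_eq_bounded_closed)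
qed

lemma test_function_zero: "test_function D (\<lambda>_. 0)"
proof -
  have "partials js (\<lambda>_. 0) = (\<lambda>_. 0)" for js
  proof (induction js)
    case (Cons j js)
    then show ?case by (auto simp: pdir_def)
  qed simp
  then show ?thesis by (simp add: test_function_def smooth_def)
qed

lemma test_function_sum:
  assumes "finite I" "\<And>i. i \<in> I \<Longrightarrow> test_function D (f i)"
  shows "test_function D (\<lambda>x. \<Sum>i\<in>I. c i * f i x)"
  using assms
proof (induction I rule: finite_induct)
  case (insert i I)
  then show ?case using test_function_lincomb[of D "f i" "\<lambda>x. \<Sum>i\<in>I. c i * f i x" "c i" 1] by simp
qed (simp add: test_function_zero)

lemma schwartz_distribution_sum:
  assumes T: "schwartz_distribution D T" and "finite I" "\<And>i. i \<in> I \<Longrightarrow> test_function D (f i)"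
  shows "T (\<lambda>x. \<Sum>i\<in>I. c i * f i x) = (\<Sum>i\<in>I. c i * T (f i))"
proof -
  have lin: "T (\<lambda>x. a * \<phi> x + b * \<psi> x) = a * T \<phi> + b * T \<psi>" if "test_function D \<phi>" "test_function D \<psi>" for \<phi> \<psi> a b
    using T that unfolding schwartz_distribution_def by blast
  show ?thesis using assms(2,3)
  proof (induction I rule: finite_induct)
    case empty
    show ?case using lin[OF test_function_zero test_function_zero, of 0 0] by simp
  next
    case (insert i I)
    then show ?case using lin[of "f i" "\<lambda>x. \<Sum>i\<in>I. c i * f i x" "c i" 1] test_function_sum[of I D f c] by simp
  qed
qed

lemma partials_mollifier_zero:
  assumes "mollifier \<eta>" "1 < norm x"
  shows "partials js \<eta> x = 0"
  using assms(2)
proof (induction js arbitrary: x)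
  case Nil
  then show ?case using mollifierD(3)[OF assms(1)] by simp
next
  case (Cons j js)
  have "open (- cball (0 :: real^2) 1)" by (simp add: open_Compl)
  moreover have "x \<in> - cball 0 1" using Cons.prems by simp
  moreover have "partials js \<eta> y = 0" if "y \<in> - cball 0 1" for y using Cons.IH[of y] that by simp
  ultimately have "(partials js \<eta> has_derivative (\<lambda>_. 0)) (at x)"
    using has_derivative_transform_within_open[of "\<lambda>_. 0" "\<lambda>_. 0" x UNIV "- cball 0 1" "partials js \<eta>"] by auto
  from fun_cong[OF frechet_derivative_at[OF this], of "axis j 1"] show ?case by (simp add: pdir_def)
qed

lemma finite_lists_le: "finite {js :: 'a::finite list. length js \<le> N}"
  using finite_lists_length_le[of "UNIV :: 'a set" N] by simp

text \<open>A small translation of the bump changes all its partial derivatives up to order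
  \<open>N\<close> by little, uniformly in space, and on a fixed compact set the distribution is
  bounded in terms of these.\<close>

lemma continuous_pairing_moll:
  assumes T: "schwartz_distribution D T" and e: "mollifier \<eta>" and d: "0 < \<delta>" and z: "cball z (r + \<delta>) \<subseteq> D"
  shows "continuous_on (cball z r) (\<lambda>y. T (moll \<eta> \<delta> y))"
proof -
  define K where "K = cball z (r + \<delta>)"
  have K: "compact K" "K \<subseteq> D" using z by (simp_all add: K_def)
  from conjunct2[OF T[unfolded schwartz_distribution_def], rule_format, OF conjI[OF K]]
  obtain C N where CN': "\<forall>\<phi> B. test_function D \<phi> \<longrightarrow> closure {x. \<phi> x \<noteq> 0} \<subseteq> K \<longrightarrow>
      (\<forall>js x. length js \<le> N \<longrightarrow> \<bar>partials js \<phi> x\<bar> \<le> B) \<longrightarrow> \<bar>T \<phi>\<bar> \<le> C * B"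
    by (elim exE) (rule that)
  have CN: "\<bar>T \<phi>\<bar> \<le> C * B" if "test_function D \<phi>" "closure {x. \<phi> x \<noteq> 0} \<subseteq> K"
    "\<And>js x. length js \<le> N \<Longrightarrow> \<bar>partials js \<phi> x\<bar> \<le> B" for \<phi> B
    by (rule CN'[rule_format]) (fact that)+
  have sm: "smooth \<eta>" using e by (simp add: mollifier_def)
  have sub: "cball y \<delta> \<subseteq> K" if "y \<in> cball z r" for y
  proof
    fix x assume "x \<in> cball y \<delta>"
    then show "x \<in> K" using that dist_triangle[of z x y] by (simp add: K_def)
  qed
  have tf: "test_function D (moll \<eta> \<delta> y)" if "y \<in> cball z r" for y
    using test_function_moll[OF e d] sub[OF that] z by (auto simp: K_def)
  have lin: "T (moll \<eta> \<delta> y) - T (moll \<eta> \<delta> y') = T (\<lambda>x. 1 * moll \<eta> \<delta> y x + (-1) * moll \<eta> \<delta> y' x)"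
    if "y \<in> cball z r" "y' \<in> cball z r" for y y'
  proof -
    have "T (\<lambda>x. 1 * moll \<eta> \<delta> y x + (-1) * moll \<eta> \<delta> y' x) = 1 * T (moll \<eta> \<delta> y) + (-1) * T (moll \<eta> \<delta> y')"
      using T tf[OF that(1)] tf[OF that(2)] unfolding schwartz_distribution_def by blast
    then show ?thesis by simp
  qed
  \<comment> \<open>Differentiating the rescaled bump \<open>n\<close> times costs
    \<open>(1 / \<delta>) ^ n / \<delta>\<^sup>2\<close>. The sum dominates the cost for every order
    up to \<open>N\<close>, whether or not \<open>\<delta>\<close> is below 1.\<close>
  define A where "A = (\<Sum>n\<le>N. (1 / \<delta>) ^ n / \<delta>\<^sup>2)"
  have A: "(1 / \<delta>) ^ n / \<delta>\<^sup>2 \<le> A" if "n \<le> N" for n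
    unfolding A_def using that d by (intro member_le_sum) auto
  have A0: "0 < A" using A[of 0] d by (simp add: less_le_trans[rotated])
  \<comment> \<open>Compactness handles the ball of radius 3. If \<open>x\<close> has norm above 2,
    then all points within distance 1 of it, like \<open>x\<close> itself, lie off the
    support.\<close>
  have uc: "uniformly_continuous_on UNIV (partials js \<eta>)" for js
  proof -
    have c: "continuous_on UNIV (partials js \<eta>)" by (rule smooth_continuous[OF sm])
    have u: "uniformly_continuous_on (cball 0 3) (partials js \<eta>)"
      by (rule compact_uniformly_continuous[OF continuous_on_subset[OF c]]) auto
    show ?thesis unfolding uniformly_continuous_on_def
    proof (intro allI impI)
      fix e' :: real assume e': "0 < e'"
      obtain d' where d': "0 < d'" "\<And>x x'. x \<in> cball 0 3 \<Longrightarrow> x' \<in> cball 0 3 \<Longrightarrow> dist x' x < d' \<Longrightarrow> dist (partials js \<eta> x') (partials js \<eta> x) < e'"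
        using u[unfolded uniformly_continuous_on_def, rule_format, OF e'] by blast
      show "\<exists>d>0. \<forall>x\<in>UNIV. \<forall>x'\<in>UNIV. dist x' x < d \<longrightarrow> dist (partials js \<eta> x') (partials js \<eta> x) < e'"
      proof (intro exI[of _ "min d' 1"] conjI ballI impI)
        fix x x' :: "real^2" assume xx: "dist x' x < min d' 1"
        show "dist (partials js \<eta> x') (partials js \<eta> x) < e'"
        proof (cases "norm x \<le> 2")
          case True
          then have "norm x' \<le> 3" using xx norm_triangle_ineq2[of x' x] by (simp add: dist_norm)
          then show ?thesis using True xx d'(2)[of x x'] by simp
        next
          case False
          then have "1 < norm x'" using xx norm_triangle_ineq2[of x x'] by (simp add: dist_norm norm_minus_commute)
          then show ?thesis using False e' partials_mollifier_zero[OF e] by simp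
        qed
      qed (use d' in auto)
    qed
  qed
  show ?thesis unfolding continuous_on_iff
  proof (intro ballI allI impI)
    fix y and \<epsilon> :: real assume y: "y \<in> cball z r" and \<epsilon>: "0 < \<epsilon>"
    \<comment> \<open>The constant \<open>C\<close> may be zero or negative, hence
      \<open>\<bar>C\<bar> + 1\<close> in the denominator.\<close>
    define e' where "e' = \<epsilon> / (2 * (\<bar>C\<bar> + 1) * A)"
    have e': "0 < e'" using \<epsilon> A0 by (simp add: e'_def)
    have "\<forall>js\<in>{js :: 2 list. length js \<le> N}. eventually (\<lambda>h. \<forall>x x'. dist x' x < h \<longrightarrow> dist (partials js \<eta> x') (partials js \<eta> x) < e') (at_right 0)"
    proof
      fix js :: "2 list"
      obtain h where h: "0 < h" "\<And>x x'. dist x' x < h \<Longrightarrow> dist (partials js \<eta> x') (partials js \<eta> x) < e'"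
        using uc[of js, unfolded uniformly_continuous_on_def, rule_format, OF e'] by blast
      then show "eventually (\<lambda>h. \<forall>x x'. dist x' x < h \<longrightarrow> dist (partials js \<eta> x') (partials js \<eta> x) < e') (at_right 0)"
        unfolding eventually_at_right_field by (intro exI[of _ h]) (auto intro: less_trans)
    qed
    then have ev1: "eventually (\<lambda>h. \<forall>js\<in>{js :: 2 list. length js \<le> N}. \<forall>x x'. dist x' x < h \<longrightarrow> dist (partials js \<eta> x') (partials js \<eta> x) < e') (at_right 0)"
      by (rule eventually_ball_finite[OF finite_lists_le])
    have ev2: "eventually (\<lambda>h :: real. 0 < h) (at_right 0)" by (rule eventually_at_right_less)
    obtain h where h1: "\<forall>js\<in>{js :: 2 list. length js \<le> N}. \<forall>x x'. dist x' x < h \<longrightarrow> dist (partials js \<eta> x') (partials js \<eta> x) < e'" "0 < h"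
      using eventually_happens'[OF trivial_limit_at_right_real eventually_conj[OF ev1 ev2]] by (elim exE conjE) (rule that)
    have h: "0 < h" "\<And>js x x'. length js \<le> N \<Longrightarrow> dist x' x < h \<Longrightarrow> dist (partials js \<eta> x') (partials js \<eta> x) < e'"
      using h1 by simp_all
    show "\<exists>d>0. \<forall>x'\<in>cball z r. dist x' y < d \<longrightarrow> dist (T (moll \<eta> \<delta> x')) (T (moll \<eta> \<delta> y)) < \<epsilon>"
    proof (intro exI[of _ "h * \<delta>"] conjI ballI impI)
      show "0 < h * \<delta>" using h d by simp
      fix y' assume y': "y' \<in> cball z r" and yy: "dist y' y < h * \<delta>"
      let ?\<phi> = "\<lambda>x. 1 * moll \<eta> \<delta> y' x + (-1) * moll \<eta> \<delta> y x"
      have "\<bar>T ?\<phi>\<bar> \<le> C * (A * e')"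
      proof (rule CN)
        show "test_function D ?\<phi>" by (intro test_function_lincomb tf y y')
        have "closure {x. ?\<phi> x \<noteq> 0} \<subseteq> closure ({x. moll \<eta> \<delta> y' x \<noteq> 0} \<union> {x. moll \<eta> \<delta> y x \<noteq> 0})"
          by (rule closure_mono) auto
        also have "\<dots> \<subseteq> K" using support_moll[OF e d, of y] support_moll[OF e d, of y'] sub[OF y] sub[OF y'] by auto
        finally show "closure {x. ?\<phi> x \<noteq> 0} \<subseteq> K" .
        fix js :: "2 list" and x assume js: "length js \<le> N"
        let ?u = "(y' - x) /\<^sub>R \<delta>" and ?v = "(y - x) /\<^sub>R \<delta>"
        have "?u - ?v = (y' - y) /\<^sub>R \<delta>" by (simp add: algebra_simps)
        then have "dist ?u ?v = dist y' y / \<delta>" using d by (simp add: dist_norm divide_inverse_commute)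
        then have "dist ?u ?v < h" using yy d by (simp add: divide_less_eq)
        then have 1: "\<bar>partials js \<eta> ?u - partials js \<eta> ?v\<bar> \<le> e'" using h(2)[OF js, of ?u ?v] by (simp add: dist_real_def)
        have "partials js ?\<phi> x = ((- (1 / \<delta>)) ^ length js / \<delta>\<^sup>2) * (partials js \<eta> ?u - partials js \<eta> ?v)"
          by (subst partials_lincomb[OF smooth_moll[OF sm] smooth_moll[OF sm]]) (simp add: partials_moll[OF sm] right_diff_distrib)
        then have "\<bar>partials js ?\<phi> x\<bar> = ((1 / \<delta>) ^ length js / \<delta>\<^sup>2) * \<bar>partials js \<eta> ?u - partials js \<eta> ?v\<bar>"
          using d by (simp add: abs_mult power_abs abs_divide)
        also have "\<dots> \<le> A * e'" using A[OF js] 1 A0 by (intro mult_mono) auto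
        finally show "\<bar>partials js ?\<phi> x\<bar> \<le> A * e'" .
      qed
      also have "\<dots> \<le> (\<bar>C\<bar> + 1) * (A * e')" using A0 e' by (intro mult_right_mono) auto
      also have "\<dots> = \<epsilon> / 2"
      proof -
        have "c * (A * (\<epsilon> / (2 * c * A))) = \<epsilon> / 2" if "0 < c" for c using A0 that by simp
        from this[of "\<bar>C\<bar> + 1"] show ?thesis by (simp add: e'_def)
      qed
      also have "\<dots> < \<epsilon>" using \<epsilon> by simp
      finally show "dist (T (moll \<eta> \<delta> y')) (T (moll \<eta> \<delta> y)) < \<epsilon>" unfolding dist_real_def lin[OF y' y] .
    qed
  qed
qed

section \<open>Gaussian characteristic functions and discretised circles\<close>

text \<open>The point mass and the normal laws share one formula in terms of the second moment,
  which is the quantity that the covariance of the field prescribes.\<close>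

lemma (in prob_space) centred_gaussian_char:
  assumes X: "centred_gaussian M X"
  shows "(\<integral>\<omega>. exp (\<i> * complex_of_real (X \<omega>)) \<partial>M) = complex_of_real (exp (- (\<integral>\<omega>. X \<omega> * X \<omega> \<partial>M) / 2))"
proof -
  have [measurable]: "X \<in> borel_measurable M" using X by (simp add: centred_gaussian_def)
  consider "AE \<omega> in M. X \<omega> = 0" | \<sigma> where "0 < \<sigma>" "distributed M lborel X (normal_density 0 \<sigma>)"
    using X by (auto simp: centred_gaussian_def)
  then show ?thesis
  proof cases
    case 1
    then have "(\<integral>\<omega>. X \<omega> * X \<omega> \<partial>M) = (\<integral>\<omega>. 0 \<partial>M)" by (intro integral_cong_AE) auto
    moreover have "(\<integral>\<omega>. exp (\<i> * complex_of_real (X \<omega>)) \<partial>M) = (\<integral>\<omega>. 1 \<partial>M)"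
      using 1 by (intro integral_cong_AE) auto
    ultimately show ?thesis by (simp add: prob_space)
  next
    case (2 \<sigma>)
    have Z: "distributed M lborel (\<lambda>\<omega>. X \<omega> / \<sigma>) std_normal_density"
      using 2 normal_standard_normal_convert[of \<sigma> X 0] by simp
    have "(\<integral>\<omega>. exp (\<i> * complex_of_real (X \<omega>)) \<partial>M) = (\<integral>\<omega>. iexp (\<sigma> * (X \<omega> / \<sigma>)) \<partial>M)"
      using 2(1) by simp
    also have "\<dots> = (\<integral>x. iexp (\<sigma> * x) \<partial>distr M lborel (\<lambda>\<omega>. X \<omega> / \<sigma>))"
      by (subst integral_distr) auto
    also have "\<dots> = char std_normal_distribution \<sigma>"
      unfolding distributed_distr_eq_density[OF Z] char_def ..
    also have "\<dots> = complex_of_real (exp (- \<sigma>\<^sup>2 / 2))" by (simp add: char_std_normal_distribution)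
    also have "\<sigma>\<^sup>2 = (\<integral>\<omega>. X \<omega> * X \<omega> \<partial>M)"
      using normal_distributed_variance[OF 2] normal_distributed_expectation[OF 2(1), of X 0] 2
      by (simp add: power2_eq_square)
    finally show ?thesis .
  qed
qed

lemma moll_facts:
  assumes e: "mollifier \<eta>" and d: "0 < \<delta>"
  shows "(\<lambda>x. moll \<eta> \<delta> y x) \<in> borel_measurable borel" "0 \<le> moll \<eta> \<delta> y x" "\<delta> < dist y x \<Longrightarrow> moll \<eta> \<delta> y x = 0"
    "(\<integral>x. moll \<eta> \<delta> y x \<partial>lborel) = 1" "continuous_on A (\<lambda>y. moll \<eta> \<delta> y x)"
    "\<exists>b>0. \<forall>y x. moll \<eta> \<delta> y x \<le> b"
proof -
  note [measurable] = mollifierD(6)[OF e]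
  show m[measurable]: "(\<lambda>x. moll \<eta> \<delta> y x) \<in> borel_measurable borel" unfolding moll_def by measurable
  show p: "0 \<le> moll \<eta> \<delta> y x" for x using mollifierD(2)[OF e] by (simp add: moll_def)
  show "moll \<eta> \<delta> y x = 0" if "\<delta> < dist y x"
  proof -
    have "1 < norm ((y - x) /\<^sub>R \<delta>)" using that d unfolding norm_scaleR by (simp add: dist_norm field_simps)
    then show ?thesis using mollifierD(3)[OF e] by (simp add: moll_def)
  qed
  have "(\<integral>\<^sup>+x. ennreal (moll \<eta> \<delta> y x) \<partial>lborel) = ennreal (\<delta>\<^sup>2) * (\<integral>\<^sup>+a. ennreal (moll \<eta> \<delta> y (y - \<delta> *\<^sub>R a)) \<partial>lborel)"
    by (rule nn_integral_lborel_scale[OF _ d]) measurable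
  also have "\<dots> = (\<integral>\<^sup>+a. ennreal (\<delta>\<^sup>2) * ennreal (moll \<eta> \<delta> y (y - \<delta> *\<^sub>R a)) \<partial>lborel)"
    by (rule nn_integral_cmult[symmetric]) measurable
  also have "\<dots> = (\<integral>\<^sup>+a. ennreal (\<eta> a) \<partial>lborel)"
    using d mollifierD(2)[OF e] by (intro nn_integral_cong) (auto simp: moll_def simp flip: ennreal_mult)
  also have "\<dots> = 1" using nn_integral_eq_integral[OF mollifierD(5)[OF e]] mollifierD(2,4)[OF e] by simp
  finally have 1: "(\<integral>\<^sup>+x. ennreal (moll \<eta> \<delta> y x) \<partial>lborel) = 1" .
  then show "(\<integral>x. moll \<eta> \<delta> y x \<partial>lborel) = 1" using p by (subst integral_eq_nn_integral) auto
  show "continuous_on A (\<lambda>y. moll \<eta> \<delta> y x)"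
    unfolding moll_def using d by (intro continuous_intros continuous_on_compose2[OF mollifierD(1)[OF e]]) auto
  obtain b where "0 < b" "\<forall>x. \<eta> x \<le> b" using mollifierD(7)[OF e] by blast
  then show "\<exists>b>0. \<forall>y x. moll \<eta> \<delta> y x \<le> b"
    using d by (intro exI[of _ "b / \<delta>\<^sup>2"]) (auto simp: moll_def intro!: divide_right_mono)
qed

text \<open>A finite convex combination of bumps centred on the circle: it is a test function, and
  the linearity of a distribution computes its pairing. In the limit it becomes
  \<open>circle_density\<close>.\<close>

definition riemann_density :: "(real^2 \<Rightarrow> real) \<Rightarrow> real \<Rightarrow> real^2 \<Rightarrow> real \<Rightarrow> nat \<Rightarrow> real^2 \<Rightarrow> real" where
  "riemann_density \<eta> \<delta> z r n x = (\<Sum>k<Suc n. (1 / Suc n) * moll \<eta> \<delta> (z + r *\<^sub>R circ (2 * pi * k / Suc n)) x)"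

lemma riemann_density_facts:
  assumes e: "mollifier \<eta>" and d: "0 < \<delta>" and r: "0 < r"
  shows "riemann_density \<eta> \<delta> z r n \<in> borel_measurable borel" "0 \<le> riemann_density \<eta> \<delta> z r n x"
    "r + \<delta> < dist z x \<Longrightarrow> riemann_density \<eta> \<delta> z r n x = 0" "integrable lborel (riemann_density \<eta> \<delta> z r n)"
    "(\<integral>x. riemann_density \<eta> \<delta> z r n x \<partial>lborel) = 1"
    "(\<lambda>n. riemann_density \<eta> \<delta> z r n x) \<longlonglongrightarrow> circle_density \<eta> \<delta> z r x"
    "\<exists>b>0. \<forall>n x. riemann_density \<eta> \<delta> z r n x \<le> b"
    "cball z (r + \<delta>) \<subseteq> D \<Longrightarrow> test_function D (riemann_density \<eta> \<delta> z r n)"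
proof -
  note m = moll_facts[OF e d]
  show "riemann_density \<eta> \<delta> z r n \<in> borel_measurable borel"
    unfolding riemann_density_def[abs_def] using m(1) by measurable
  show "0 \<le> riemann_density \<eta> \<delta> z r n x" unfolding riemann_density_def using m(2) by (intro sum_nonneg) auto
  have dz: "dist z (z + r *\<^sub>R circ \<theta>) = r" for \<theta> using r by (simp add: dist_norm)
  show "riemann_density \<eta> \<delta> z r n x = 0" if "r + \<delta> < dist z x"
    unfolding riemann_density_def
  proof (intro sum.neutral ballI)
    fix k
    have "\<delta> < dist (z + r *\<^sub>R circ (2 * pi * real k / Suc n)) x"
      using that dz[of "2 * pi * real k / Suc n"] dist_triangle[of z x "z + r *\<^sub>R circ (2 * pi * real k / Suc n)"] by linarith
    then show "1 / real (Suc n) * moll \<eta> \<delta> (z + r *\<^sub>R circ (2 * pi * real k / Suc n)) x = 0" using m(3) by simp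
  qed
  have im: "integrable lborel (moll \<eta> \<delta> y)" for y by (rule ccontr) (use m(4)[of y] in \<open>simp add: not_integrable_integral_eq\<close>)
  show "integrable lborel (riemann_density \<eta> \<delta> z r n)"
    unfolding riemann_density_def[abs_def] using im by (intro Bochner_Integration.integrable_sum integrable_mult_right)
  show "(\<integral>x. riemann_density \<eta> \<delta> z r n x \<partial>lborel) = 1"
    unfolding riemann_density_def using im m(4)
    by (subst Bochner_Integration.integral_sum) (auto simp del: sum.lessThan_Suc)
  have "(\<lambda>n. (\<Sum>k<Suc n. moll \<eta> \<delta> (z + r *\<^sub>R circ (2 * pi * k / Suc n)) x) / Suc n) \<longlonglongrightarrow> circle_mean (\<lambda>y. moll \<eta> \<delta> y x) z r"
    by (rule circle_mean_riemann[OF m(5) r])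
  then show "(\<lambda>n. riemann_density \<eta> \<delta> z r n x) \<longlonglongrightarrow> circle_density \<eta> \<delta> z r x"
    by (simp add: riemann_density_def circle_density_def sum_divide_distrib del: sum.lessThan_Suc)
  obtain b where b: "0 < b" "\<And>y x. moll \<eta> \<delta> y x \<le> b" using m(6) by blast
  have "riemann_density \<eta> \<delta> z r n x \<le> b" for n x
  proof -
    have "riemann_density \<eta> \<delta> z r n x \<le> (\<Sum>k<Suc n. (1 / Suc n) * b)"
      unfolding riemann_density_def using b by (intro sum_mono mult_left_mono) auto
    then show ?thesis by (simp del: sum.lessThan_Suc)
  qed
  then show "\<exists>b>0. \<forall>n x. riemann_density \<eta> \<delta> z r n x \<le> b" using b(1) by blast
  show "test_function D (riemann_density \<eta> \<delta> z r n)" if "cball z (r + \<delta>) \<subseteq> D"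
    unfolding riemann_density_def[abs_def]
  proof (rule test_function_sum)
    fix k
    have "cball (z + r *\<^sub>R circ (2 * pi * real k / Suc n)) \<delta> \<subseteq> cball z (r + \<delta>)"
    proof
      fix x assume "x \<in> cball (z + r *\<^sub>R circ (2 * pi * real k / Suc n)) \<delta>"
      then show "x \<in> cball z (r + \<delta>)"
        using dz[of "2 * pi * real k / Suc n"] dist_triangle[of z x "z + r *\<^sub>R circ (2 * pi * real k / Suc n)"] by simp
    qed
    then show "test_function D (moll \<eta> \<delta> (z + r *\<^sub>R circ (2 * pi * real k / Suc n)))"
      using that by (intro test_function_moll[OF e d]) auto
  qed simp
qed

text \<open>By linearity the pairing is a Riemann sum for the circle mean of the function
  \<open>y \<mapsto> T (moll \<eta> \<delta> y)\<close>, which is continuous.\<close>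

lemma pairing_riemann_density:
  assumes T: "schwartz_distribution D T" and e: "mollifier \<eta>" and d: "0 < \<delta>" and r: "0 < r" and z: "cball z (r + \<delta>) \<subseteq> D"
  shows "(\<lambda>n. T (riemann_density \<eta> \<delta> z r n)) \<longlonglongrightarrow> circle_mean (mollify \<eta> \<delta> T) z r"
proof -
  have mm: "mollify \<eta> \<delta> T y = T (moll \<eta> \<delta> y)" for y by (simp add: mollify_def moll_def[abs_def])
  have "cball (z + r *\<^sub>R circ \<theta>) \<delta> \<subseteq> cball z (r + \<delta>)" for \<theta>
  proof
    fix x assume "x \<in> cball (z + r *\<^sub>R circ \<theta>) \<delta>"
    moreover have "dist z (z + r *\<^sub>R circ \<theta>) = r" using r by (simp add: dist_norm)
    ultimately show "x \<in> cball z (r + \<delta>)" using dist_triangle[of z x "z + r *\<^sub>R circ \<theta>"] by simp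
  qed
  then have tf: "test_function D (moll \<eta> \<delta> (z + r *\<^sub>R circ \<theta>))" for \<theta>
    using z by (intro test_function_moll[OF e d]) blast
  have "T (riemann_density \<eta> \<delta> z r n) = (\<Sum>k<Suc n. mollify \<eta> \<delta> T (z + r *\<^sub>R circ (2 * pi * k / Suc n))) / Suc n" for n
    unfolding riemann_density_def[abs_def] mm using tf
    by (subst schwartz_distribution_sum[OF T]) (auto simp: sum_divide_distrib simp del: sum.lessThan_Suc)
  moreover have "(\<lambda>n. (\<Sum>k<Suc n. mollify \<eta> \<delta> T (z + r *\<^sub>R circ (2 * pi * k / Suc n))) / Suc n) \<longlonglongrightarrow> circle_mean (mollify \<eta> \<delta> T) z r"
    unfolding mm[abs_def] using r
    by (intro circle_mean_riemann continuous_on_subset[OF continuous_pairing_moll[OF T e d z]]) auto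
  ultimately show ?thesis by simp
qed

text \<open>The exponential is 1-Lipschitz along the imaginary axis. The error term is a nonnegative
  integral and makes sense even if infinite.\<close>

lemma norm_integral_char_diff:
  fixes X Y :: "'a \<Rightarrow> real"
  assumes "prob_space M" and [measurable]: "X \<in> borel_measurable M" "Y \<in> borel_measurable M"
  shows "ennreal (cmod (\<integral>\<omega>. exp (\<i> * complex_of_real (X \<omega>)) \<partial>M)) \<le> ennreal (cmod (\<integral>\<omega>. exp (\<i> * complex_of_real (Y \<omega>)) \<partial>M)) + (\<integral>\<^sup>+\<omega>. ennreal \<bar>Y \<omega> - X \<omega>\<bar> \<partial>M)"
proof -
  interpret prob_space M by fact
  have i: "integrable M (\<lambda>\<omega>. exp (\<i> * complex_of_real (Z \<omega>)))" if [measurable]: "Z \<in> borel_measurable M" for Z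
    by (rule integrable_const_bound[where B=1]) auto
  have c: "cmod (exp (\<i> * complex_of_real x) - exp (\<i> * complex_of_real y)) \<le> \<bar>y - x\<bar>" for x y :: real
  proof -
    have "exp (\<i> * complex_of_real x) - exp (\<i> * complex_of_real y) = exp (\<i> * complex_of_real y) * (exp (\<i> * complex_of_real (x - y)) - 1)"
    proof -
      have "\<i> * complex_of_real x = \<i> * complex_of_real y + \<i> * complex_of_real (x - y)" by (simp add: algebra_simps)
      then have "exp (\<i> * complex_of_real x) = exp (\<i> * complex_of_real y) * exp (\<i> * complex_of_real (x - y))"
        by (simp only: exp_add)
      then show ?thesis by (simp add: right_diff_distrib)
    qed
    then have "cmod (exp (\<i> * complex_of_real x) - exp (\<i> * complex_of_real y)) = cmod (exp (\<i> * complex_of_real (x - y)) - 1)"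
      by (simp add: norm_mult)
    also have "\<dots> \<le> \<bar>x - y\<bar>" using iexp_approx1[of "x - y" 0] by simp
    finally show ?thesis by (simp add: abs_minus_commute)
  qed
  let ?a = "\<integral>\<omega>. exp (\<i> * complex_of_real (X \<omega>)) \<partial>M" and ?b = "\<integral>\<omega>. exp (\<i> * complex_of_real (Y \<omega>)) \<partial>M"
  have "?a - ?b = (\<integral>\<omega>. exp (\<i> * complex_of_real (X \<omega>)) - exp (\<i> * complex_of_real (Y \<omega>)) \<partial>M)"
    by (rule Bochner_Integration.integral_diff[symmetric]) (intro i, measurable)+
  then have "ennreal (cmod (?a - ?b)) \<le> (\<integral>\<^sup>+\<omega>. ennreal (cmod (exp (\<i> * complex_of_real (X \<omega>)) - exp (\<i> * complex_of_real (Y \<omega>)))) \<partial>M)"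
    using integral_norm_bound_ennreal[OF Bochner_Integration.integrable_diff[OF i i], of X Y] by simp
  also have "\<dots> \<le> (\<integral>\<^sup>+\<omega>. ennreal \<bar>Y \<omega> - X \<omega>\<bar> \<partial>M)" by (intro nn_integral_mono ennreal_leI c)
  finally have 1: "ennreal (cmod (?a - ?b)) \<le> (\<integral>\<^sup>+\<omega>. ennreal \<bar>Y \<omega> - X \<omega>\<bar> \<partial>M)" .
  have "ennreal (cmod ?a) \<le> ennreal (cmod ?b + cmod (?a - ?b))"
    using norm_triangle_sub[of ?a ?b] by (intro ennreal_leI) simp
  also have "\<dots> = ennreal (cmod ?b) + ennreal (cmod (?a - ?b))" by simp
  also have "\<dots> \<le> ennreal (cmod ?b) + (\<integral>\<^sup>+\<omega>. ennreal \<bar>Y \<omega> - X \<omega>\<bar> \<partial>M)" using 1 by (rule add_left_mono)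
  finally show ?thesis .
qed

section \<open>The Onsager-type inequality for mollified circle averages\<close>

context
  fixes M :: "'a measure" and D G \<Gamma> and V :: "'v set" and c :: "'v \<Rightarrow> real" and z :: "'v \<Rightarrow> real^2"
    and \<eta> :: "'v \<Rightarrow> real^2 \<Rightarrow> real" and \<kappa> \<delta> B :: real
  assumes M: "prob_space M" and D: "open D" "bounded D" and gff: "gff M D G \<Gamma>"
    and V: "finite V" and e: "\<And>i. i \<in> V \<Longrightarrow> mollifier (\<eta> i)" and z: "\<And>i. i \<in> V \<Longrightarrow> cball (z i) (3 * \<kappa>) \<subseteq> D"
    and \<delta>: "0 < \<delta>" "\<delta> \<le> \<kappa>"
    and B: "0 \<le> B" "\<And>f b. f \<in> borel_measurable borel \<Longrightarrow> (\<And>x. \<bar>f x\<bar> \<le> b) \<Longrightarrow> (\<And>x. f x \<noteq> 0 \<Longrightarrow> cball x \<kappa> \<subseteq> D) \<Longrightarrow>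
      \<bar>green_energy D G f f - log_energy f f\<bar> \<le> B * (\<integral>x. \<bar>f x\<bar> \<partial>lborel)\<^sup>2"
begin

interpretation prob_space M by (rule M)

text \<open>The radii are a parameter because two configurations with the same centres and
  coefficients are compared, the given one and the enlarged one. Of the margin
  \<open>3 * \<kappa>\<close> around the centres, the radius uses up to one \<open>\<kappa>\<close>
  and the mollification another; the last one remains around the support.\<close>

definition approx_density :: "('v \<Rightarrow> real) \<Rightarrow> nat \<Rightarrow> real^2 \<Rightarrow> real" where
  "approx_density r n x = (\<Sum>i\<in>V. c i * riemann_density (\<eta> i) \<delta> (z i) (r i) n x)"

context
  fixes r :: "'v \<Rightarrow> real"
  assumes r: "\<And>i. i \<in> V \<Longrightarrow> 0 < r i" "\<And>i. i \<in> V \<Longrightarrow> r i \<le> \<kappa>"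
begin

lemma ball_D: "i \<in> V \<Longrightarrow> cball (z i) (r i + \<delta>) \<subseteq> D"
  using z[of i] r[of i] \<delta> by (force simp: subset_eq)

lemma approx_density_test: "test_function D (approx_density r n)"
  unfolding approx_density_def[abs_def] using V riemann_density_facts(8)[OF e \<delta>(1) r(1) ball_D] by (intro test_function_sum) auto

lemma approx_density_meas: "approx_density r n \<in> borel_measurable borel"
  unfolding approx_density_def[abs_def] using riemann_density_facts(1)[OF e \<delta>(1) r(1)]
  by (intro borel_measurable_sum borel_measurable_times) auto

lemma approx_density_supp: "approx_density r n x \<noteq> 0 \<Longrightarrow> cball x \<kappa> \<subseteq> D"
proof -
  assume "approx_density r n x \<noteq> 0"
  then obtain i where i: "i \<in> V" "riemann_density (\<eta> i) \<delta> (z i) (r i) n x \<noteq> 0"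
    unfolding approx_density_def by (metis (no_types, lifting) mult_zero_right sum.neutral)
  then have "dist (z i) x \<le> r i + \<delta>" using riemann_density_facts(3)[OF e[OF i(1)] \<delta>(1) r(1)[OF i(1)], of "z i" x n] by force
  then have dx: "dist (z i) x \<le> 2 * \<kappa>" using r(2)[OF i(1)] \<delta> by linarith
  have "cball x \<kappa> \<subseteq> cball (z i) (3 * \<kappa>)"
  proof
    fix y assume "y \<in> cball x \<kappa>"
    then show "y \<in> cball (z i) (3 * \<kappa>)" using dx dist_triangle[of "z i" y x] by simp
  qed
  then show ?thesis using z[OF i(1)] by blast
qed

lemma approx_density_bounded: "\<exists>b R. \<forall>n. bounded_density b R (approx_density r n)"
proof -
  obtain R where R: "\<And>x. x \<in> D \<Longrightarrow> norm x \<le> R" using D(2) by (auto simp: bounded_iff)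
  have "\<forall>i\<in>V. \<exists>b>0. \<forall>n x. riemann_density (\<eta> i) \<delta> (z i) (r i) n x \<le> b"
    using riemann_density_facts(7)[OF e \<delta>(1) r(1)] by blast
  then obtain b where b: "\<And>i n x. i \<in> V \<Longrightarrow> riemann_density (\<eta> i) \<delta> (z i) (r i) n x \<le> b i" by metis
  have "bounded_density (\<Sum>i\<in>V. \<bar>c i\<bar> * b i) R (approx_density r n)" for n
    unfolding bounded_density_def
  proof (intro conjI allI impI)
    show "approx_density r n \<in> borel_measurable borel" by (rule approx_density_meas)
    fix x
    have "\<bar>approx_density r n x\<bar> \<le> (\<Sum>i\<in>V. \<bar>c i * riemann_density (\<eta> i) \<delta> (z i) (r i) n x\<bar>)" unfolding approx_density_def by (rule sum_abs)
    also have "\<dots> \<le> (\<Sum>i\<in>V. \<bar>c i\<bar> * b i)"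
      using b riemann_density_facts(2)[OF e \<delta>(1) r(1)] by (intro sum_mono) (auto simp: abs_mult intro!: mult_left_mono)
    finally show "\<bar>approx_density r n x\<bar> \<le> (\<Sum>i\<in>V. \<bar>c i\<bar> * b i)" .
    assume x: "R < norm x"
    show "approx_density r n x = 0"
    proof (rule ccontr)
      assume "approx_density r n x \<noteq> 0"
      from approx_density_supp[OF this] have "x \<in> D" using \<delta> by auto
      with R[of x] x show False by simp
    qed
  qed
  then show ?thesis by blast
qed

lemma approx_density_mass: "(\<integral>x. \<bar>approx_density r n x\<bar> \<partial>lborel) \<le> (\<Sum>i\<in>V. \<bar>c i\<bar>)"
proof -
  note f = riemann_density_facts[OF e \<delta>(1) r(1)]
  have "(\<integral>x. \<bar>approx_density r n x\<bar> \<partial>lborel) \<le> (\<integral>x. (\<Sum>i\<in>V. \<bar>c i\<bar> * riemann_density (\<eta> i) \<delta> (z i) (r i) n x) \<partial>lborel)"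
  proof (rule integral_mono)
    show "integrable lborel (\<lambda>x. \<bar>approx_density r n x\<bar>)"
      unfolding approx_density_def using f(4) by (intro integrable_abs Bochner_Integration.integrable_sum integrable_mult_right) auto
    show "integrable lborel (\<lambda>x. \<Sum>i\<in>V. \<bar>c i\<bar> * riemann_density (\<eta> i) \<delta> (z i) (r i) n x)"
      using f(4) by (intro Bochner_Integration.integrable_sum integrable_mult_right) auto
    fix x
    have "\<bar>approx_density r n x\<bar> \<le> (\<Sum>i\<in>V. \<bar>c i * riemann_density (\<eta> i) \<delta> (z i) (r i) n x\<bar>)" unfolding approx_density_def by (rule sum_abs)
    also have "\<dots> = (\<Sum>i\<in>V. \<bar>c i\<bar> * riemann_density (\<eta> i) \<delta> (z i) (r i) n x)"
      using f(2) by (intro sum.cong refl) (simp add: abs_mult)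
    finally show "\<bar>approx_density r n x\<bar> \<le> (\<Sum>i\<in>V. \<bar>c i\<bar> * riemann_density (\<eta> i) \<delta> (z i) (r i) n x)" .
  qed
  also have "\<dots> = (\<Sum>i\<in>V. \<bar>c i\<bar> * (\<integral>x. riemann_density (\<eta> i) \<delta> (z i) (r i) n x \<partial>lborel))"
    using f(4) by (subst Bochner_Integration.integral_sum) auto
  also have "\<dots> = (\<Sum>i\<in>V. \<bar>c i\<bar>)" using f(5) by (intro sum.cong refl) simp
  finally show ?thesis .
qed

lemma approx_density_energy: "\<bar>green_energy D G (approx_density r n) (approx_density r n) - log_energy (approx_density r n) (approx_density r n)\<bar> \<le> B * (\<Sum>i\<in>V. \<bar>c i\<bar>)\<^sup>2"
proof -
  obtain b R where b: "bounded_density b R (approx_density r n)" using approx_density_bounded by blast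
  have "\<bar>green_energy D G (approx_density r n) (approx_density r n) - log_energy (approx_density r n) (approx_density r n)\<bar> \<le> B * (\<integral>x. \<bar>approx_density r n x\<bar> \<partial>lborel)\<^sup>2"
    using b by (intro B(2)[OF approx_density_meas _ approx_density_supp]) (auto simp: bounded_density_def)
  also have "\<dots> \<le> B * (\<Sum>i\<in>V. \<bar>c i\<bar>)\<^sup>2" using B(1) approx_density_mass by (intro mult_left_mono power_mono) auto
  finally show ?thesis .
qed

lemma approx_density_log_energy:
  "(\<lambda>n. log_energy (approx_density r n) (approx_density r n)) \<longlonglongrightarrow>
    (\<Sum>i\<in>V. \<Sum>j\<in>V. c i * c j * log_energy (circle_density (\<eta> i) \<delta> (z i) (r i)) (circle_density (\<eta> j) \<delta> (z j) (r j)))"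
proof -
  obtain b R where b: "\<And>n. bounded_density b R (approx_density r n)" using approx_density_bounded by blast
  have "(\<lambda>n. log_energy (approx_density r n) (approx_density r n)) \<longlonglongrightarrow>
    log_energy (\<lambda>x. \<Sum>i\<in>V. c i * circle_density (\<eta> i) \<delta> (z i) (r i) x) (\<lambda>x. \<Sum>i\<in>V. c i * circle_density (\<eta> i) \<delta> (z i) (r i) x)"
    by (rule log_energy_tendsto[OF b]) (auto simp: approx_density_def intro!: tendsto_intros riemann_density_facts(6)[OF e \<delta>(1) r(1)])
  moreover have "\<exists>b'. \<forall>i\<in>V. bounded_density (b' i) (norm (z i) + r i + \<delta>) (circle_density (\<eta> i) \<delta> (z i) (r i))"
    using circle_density_bounded[OF e \<delta>(1) r(1)] by (intro bchoice) blast
  then obtain b' where b': "\<And>i. i \<in> V \<Longrightarrow> bounded_density (b' i) (norm (z i) + r i + \<delta>) (circle_density (\<eta> i) \<delta> (z i) (r i))" by blast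
  have "bounded_density (\<Sum>i\<in>V. \<bar>b' i\<bar>) (\<Sum>i\<in>V. \<bar>norm (z i) + r i + \<delta>\<bar>) (circle_density (\<eta> i) \<delta> (z i) (r i))" if i: "i \<in> V" for i
  proof (rule bounded_density_mono[OF b'[OF i]])
    have "\<bar>b' i\<bar> \<le> (\<Sum>i\<in>V. \<bar>b' i\<bar>)" by (rule member_le_sum) (use V i in auto)
    then show "b' i \<le> (\<Sum>i\<in>V. \<bar>b' i\<bar>)" by linarith
    have "\<bar>norm (z i) + r i + \<delta>\<bar> \<le> (\<Sum>i\<in>V. \<bar>norm (z i) + r i + \<delta>\<bar>)" by (rule member_le_sum) (use V i in auto)
    then show "norm (z i) + r i + \<delta> \<le> (\<Sum>i\<in>V. \<bar>norm (z i) + r i + \<delta>\<bar>)" by linarith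
  qed
  from log_energy_sum[OF V this, where c = c]
  have "log_energy (\<lambda>x. \<Sum>i\<in>V. c i * circle_density (\<eta> i) \<delta> (z i) (r i) x) (\<lambda>x. \<Sum>i\<in>V. c i * circle_density (\<eta> i) \<delta> (z i) (r i) x)
    = (\<Sum>i\<in>V. \<Sum>j\<in>V. c i * c j * log_energy (circle_density (\<eta> i) \<delta> (z i) (r i)) (circle_density (\<eta> j) \<delta> (z j) (r j)))" .
  ultimately show ?thesis by simp
qed

lemma approx_density_char:
  "(\<lambda>\<omega>. \<Gamma> \<omega> (approx_density r n)) \<in> borel_measurable M"
  "(\<integral>\<omega>. exp (\<i> * complex_of_real (\<Gamma> \<omega> (approx_density r n))) \<partial>M) = complex_of_real (exp (- green_energy D G (approx_density r n) (approx_density r n) / 2))"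
  "0 \<le> green_energy D G (approx_density r n) (approx_density r n)"
proof -
  have cg: "centred_gaussian M (\<lambda>\<omega>. \<Gamma> \<omega> (approx_density r n))" using gff approx_density_test by (simp add: gff_def)
  then show "(\<lambda>\<omega>. \<Gamma> \<omega> (approx_density r n)) \<in> borel_measurable M" by (simp add: centred_gaussian_def)
  have ge: "(\<integral>\<omega>. \<Gamma> \<omega> (approx_density r n) * \<Gamma> \<omega> (approx_density r n) \<partial>M) = green_energy D G (approx_density r n) (approx_density r n)"
    using gff approx_density_test unfolding gff_def by blast
  show "(\<integral>\<omega>. exp (\<i> * complex_of_real (\<Gamma> \<omega> (approx_density r n))) \<partial>M) = complex_of_real (exp (- green_energy D G (approx_density r n) (approx_density r n) / 2))"
    using centred_gaussian_char[OF cg] unfolding ge .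
  show "0 \<le> green_energy D G (approx_density r n) (approx_density r n)" unfolding ge[symmetric] by (intro integral_nonneg_AE) auto
qed

lemma approx_density_pairing:
  assumes "\<omega> \<in> space M"
  shows "(\<lambda>n. \<Gamma> \<omega> (approx_density r n)) \<longlonglongrightarrow> (\<Sum>i\<in>V. c i * circle_mean (mollify (\<eta> i) \<delta> (\<Gamma> \<omega>)) (z i) (r i))"
proof -
  have T: "schwartz_distribution D (\<Gamma> \<omega>)" using gff assms by (simp add: gff_def)
  have "\<Gamma> \<omega> (approx_density r n) = (\<Sum>i\<in>V. c i * \<Gamma> \<omega> (riemann_density (\<eta> i) \<delta> (z i) (r i) n))" for n
    unfolding approx_density_def[abs_def] using riemann_density_facts(8)[OF e \<delta>(1) r(1) ball_D]
    by (intro schwartz_distribution_sum[OF T V]) auto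
  then show ?thesis
    using pairing_riemann_density[OF T e \<delta>(1) r(1) ball_D] by (auto intro!: tendsto_intros)
qed

end

text \<open>A pair whose circles may overlap must keep both radii equal to
  \<open>\<epsilon>\<close>; its interaction then cancels exactly between the two configurations.
  Passing between Green and logarithmic energy costs
  \<open>B * (\<Sum>i\<in>V. \<bar>c i\<bar>)\<^sup>2\<close> for each configuration, and the factor
  2 is undone by the one half in the Gaussian exponent.\<close>

lemma circle_mean_char_bound:
  fixes r :: "'v \<Rightarrow> real" and \<epsilon> :: real
  assumes \<epsilon>: "0 < \<epsilon>" and r: "\<And>i. i \<in> V \<Longrightarrow> \<epsilon> \<le> r i" "\<And>i. i \<in> V \<Longrightarrow> r i \<le> \<kappa>" and \<epsilon>\<kappa>: "\<epsilon> \<le> \<kappa>"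
    and sep: "\<And>i j. i \<in> V \<Longrightarrow> j \<in> V \<Longrightarrow> i \<noteq> j \<Longrightarrow> (r i = \<epsilon> \<and> r j = \<epsilon>) \<or> r i + r j \<le> dist (z i) (z j)"
  defines "X \<equiv> \<lambda>\<omega>. \<Sum>i\<in>V. c i * circle_mean (mollify (\<eta> i) \<delta> (\<Gamma> \<omega>)) (z i) \<epsilon>"
  shows "X \<in> borel_measurable M"
    "cmod (\<integral>\<omega>. exp (\<i> * complex_of_real (X \<omega>)) \<partial>M)
      \<le> exp (- (\<Sum>i\<in>V. (c i)\<^sup>2 * ln (r i / \<epsilon>)) / 2 + (B + 2 * \<delta> / \<epsilon>) * (\<Sum>i\<in>V. \<bar>c i\<bar>)\<^sup>2)"
proof -
  let ?e = "\<lambda>_ :: 'v. \<epsilon>"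
  have r0: "0 < r i" if "i \<in> V" for i using r(1)[OF that] \<epsilon> by linarith
  note re = \<epsilon> \<epsilon>\<kappa>
  define E where "E r = (\<Sum>i\<in>V. \<Sum>j\<in>V. c i * c j * log_energy (circle_density (\<eta> i) \<delta> (z i) (r i)) (circle_density (\<eta> j) \<delta> (z j) (r j)))"
    for r :: "'v \<Rightarrow> real"
  have lim: "(\<lambda>n. \<Gamma> \<omega> (approx_density ?e n)) \<longlonglongrightarrow> X \<omega>" if "\<omega> \<in> space M" for \<omega>
    unfolding X_def using approx_density_pairing[of ?e, OF re that] .
  have m: "(\<lambda>\<omega>. \<Gamma> \<omega> (approx_density ?e n)) \<in> borel_measurable M" for n using approx_density_char(1)[of ?e, OF re] .
  show mX: "X \<in> borel_measurable M" by (rule borel_measurable_LIMSEQ_metric[OF m lim])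
  have "(\<lambda>n. \<integral>\<omega>. exp (\<i> * complex_of_real (\<Gamma> \<omega> (approx_density ?e n))) \<partial>M) \<longlonglongrightarrow> (\<integral>\<omega>. exp (\<i> * complex_of_real (X \<omega>)) \<partial>M)"
  proof (rule integral_dominated_convergence[where w="\<lambda>_. 1"])
    show "AE \<omega> in M. (\<lambda>n. exp (\<i> * complex_of_real (\<Gamma> \<omega> (approx_density ?e n)))) \<longlonglongrightarrow> exp (\<i> * complex_of_real (X \<omega>))"
      by (intro AE_I2 tendsto_intros lim)
  qed (use mX m in auto)
  then have l1: "(\<lambda>n. cmod (\<integral>\<omega>. exp (\<i> * complex_of_real (\<Gamma> \<omega> (approx_density ?e n))) \<partial>M)) \<longlonglongrightarrow> cmod (\<integral>\<omega>. exp (\<i> * complex_of_real (X \<omega>)) \<partial>M)"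
    by (rule tendsto_norm)
  have l2: "(\<lambda>n. exp (- (log_energy (approx_density ?e n) (approx_density ?e n) - log_energy (approx_density r n) (approx_density r n) - 2 * (B * (\<Sum>i\<in>V. \<bar>c i\<bar>)\<^sup>2)) / 2)) \<longlonglongrightarrow> exp (- (E ?e - E r - 2 * (B * (\<Sum>i\<in>V. \<bar>c i\<bar>)\<^sup>2)) / 2)"
    unfolding E_def using approx_density_log_energy[of ?e, OF re] approx_density_log_energy[of r, OF r0 r(2)] by (intro tendsto_intros) auto
  have "cmod (\<integral>\<omega>. exp (\<i> * complex_of_real (\<Gamma> \<omega> (approx_density ?e n))) \<partial>M) \<le> exp (- (log_energy (approx_density ?e n) (approx_density ?e n) - log_energy (approx_density r n) (approx_density r n) - 2 * (B * (\<Sum>i\<in>V. \<bar>c i\<bar>)\<^sup>2)) / 2)" for n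
  proof -
    have "cmod (\<integral>\<omega>. exp (\<i> * complex_of_real (\<Gamma> \<omega> (approx_density ?e n))) \<partial>M) = exp (- green_energy D G (approx_density ?e n) (approx_density ?e n) / 2)"
      unfolding approx_density_char(2)[of ?e, OF re] by (simp only: norm_of_real) simp
    moreover have "log_energy (approx_density ?e n) (approx_density ?e n) - log_energy (approx_density r n) (approx_density r n) - 2 * (B * (\<Sum>i\<in>V. \<bar>c i\<bar>)\<^sup>2) \<le> green_energy D G (approx_density ?e n) (approx_density ?e n)"
      using approx_density_energy[of ?e n, OF re] approx_density_energy[of r n, OF r0 r(2)] approx_density_char(3)[of r n, OF r0 r(2)] by linarith
    ultimately show ?thesis by simp
  qed
  then have 1: "cmod (\<integral>\<omega>. exp (\<i> * complex_of_real (X \<omega>)) \<partial>M) \<le> exp (- (E ?e - E r - 2 * (B * (\<Sum>i\<in>V. \<bar>c i\<bar>)\<^sup>2)) / 2)"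
    by (intro LIMSEQ_le[OF l1 l2]) auto
  define l where "l r i j = log_energy (circle_density (\<eta> i) \<delta> (z i) (r i)) (circle_density (\<eta> j) \<delta> (z j) (r j))" for r :: "'v \<Rightarrow> real" and i j
  \<comment> \<open>Up to mollification errors, each at most
    \<open>2 * \<delta> / \<epsilon>\<close> because no radius is below \<open>\<epsilon>\<close>,
    the two energy matrices differ on the diagonal only.\<close>
  have lb: "\<bar>l ?e i j - l r i j - (if i = j then ln (r i / \<epsilon>) else 0)\<bar> \<le> 4 * \<delta> / \<epsilon>" if i: "i \<in> V" and j: "j \<in> V" for i j
  proof -
    have q: "2 * \<delta> / r i \<le> 2 * \<delta> / \<epsilon>" using r(1)[OF i] \<epsilon> \<delta> by (intro divide_left_mono) auto
    show ?thesis
    proof (cases "i = j")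
      case True
      have "\<bar>l ?e i i + ln \<epsilon>\<bar> \<le> 2 * \<delta> / \<epsilon>" unfolding l_def by (rule log_energy_circle_density(2)[OF e[OF i] e[OF i] \<delta>(1) \<epsilon> \<epsilon>])
      moreover have "\<bar>l r i i + ln (r i)\<bar> \<le> 2 * \<delta> / r i" unfolding l_def by (rule log_energy_circle_density(2)[OF e[OF i] e[OF i] \<delta>(1) r0[OF i] r0[OF i]])
      moreover have "ln (r i / \<epsilon>) = ln (r i) - ln \<epsilon>" using r0[OF i] \<epsilon> by (simp add: ln_div)
      ultimately show ?thesis using True q by (simp add: abs_le_iff)
    next
      case False
      show ?thesis
      proof (cases "r i = \<epsilon> \<and> r j = \<epsilon>")
        case True
        then have "l ?e i j = l r i j" by (simp add: l_def)
        then show ?thesis using False \<delta> \<epsilon> by simp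
      next
        case F: False
        then have s: "r i + r j \<le> dist (z i) (z j)" using sep[OF i j False] by blast
        then have s': "\<epsilon> + \<epsilon> \<le> dist (z i) (z j)" using r(1)[OF i] r(1)[OF j] by linarith
        have "\<bar>l ?e i j + ln (dist (z i) (z j))\<bar> \<le> 2 * \<delta> / \<epsilon>" unfolding l_def by (rule log_energy_circle_density(1)[OF e[OF i] e[OF j] \<delta>(1) \<epsilon> \<epsilon> s'])
        moreover have "\<bar>l r i j + ln (dist (z i) (z j))\<bar> \<le> 2 * \<delta> / r i" unfolding l_def by (rule log_energy_circle_density(1)[OF e[OF i] e[OF j] \<delta>(1) r0[OF i] r0[OF j] s])
        ultimately show ?thesis using False q by (simp add: abs_le_iff)
      qed
    qed
  qed
  define t where "t = 4 * \<delta> / \<epsilon>"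
  have "E ?e - E r - (\<Sum>i\<in>V. (c i)\<^sup>2 * ln (r i / \<epsilon>)) = (\<Sum>i\<in>V. \<Sum>j\<in>V. c i * c j * (l ?e i j - l r i j - (if i = j then ln (r i / \<epsilon>) else 0)))"
  proof -
    have "(\<Sum>i\<in>V. \<Sum>j\<in>V. c i * c j * (if i = j then ln (r i / \<epsilon>) else 0)) = (\<Sum>i\<in>V. (c i)\<^sup>2 * ln (r i / \<epsilon>))"
    proof (intro sum.cong refl)
      fix i assume "i \<in> V"
      have "(\<Sum>j\<in>V. c i * c j * (if i = j then ln (r i / \<epsilon>) else 0)) = (\<Sum>j\<in>V. if i = j then c i * c j * ln (r i / \<epsilon>) else 0)"
        by (intro sum.cong) auto
      then show "(\<Sum>j\<in>V. c i * c j * (if i = j then ln (r i / \<epsilon>) else 0)) = (c i)\<^sup>2 * ln (r i / \<epsilon>)"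
        using V \<open>i \<in> V\<close> by (simp add: power2_eq_square)
    qed
    then show ?thesis by (simp only: E_def l_def right_diff_distrib sum_subtractf)
  qed
  also have "\<dots> \<ge> - (\<Sum>i\<in>V. \<Sum>j\<in>V. \<bar>c i\<bar> * \<bar>c j\<bar> * t)"
  proof -
    have "- (\<bar>c i\<bar> * \<bar>c j\<bar> * t) \<le> c i * c j * (l ?e i j - l r i j - (if i = j then ln (r i / \<epsilon>) else 0))" if "i \<in> V" "j \<in> V" for i j
    proof -
      have "\<bar>c i * c j * (l ?e i j - l r i j - (if i = j then ln (r i / \<epsilon>) else 0))\<bar> \<le> \<bar>c i\<bar> * \<bar>c j\<bar> * t"
        unfolding abs_mult t_def using lb[OF that] by (intro mult_left_mono) auto
      then show ?thesis by linarith
    qed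
    then show ?thesis unfolding sum_negf[symmetric] by (intro sum_mono)
  qed
  finally have "- (t * (\<Sum>i\<in>V. \<bar>c i\<bar>)\<^sup>2) \<le> E ?e - E r - (\<Sum>i\<in>V. (c i)\<^sup>2 * ln (r i / \<epsilon>))"
    by (simp add: power2_eq_square sum_product sum_distrib_left sum_distrib_right mult_ac)
  then have "- (E ?e - E r - 2 * (B * (\<Sum>i\<in>V. \<bar>c i\<bar>)\<^sup>2)) / 2 \<le> - (\<Sum>i\<in>V. (c i)\<^sup>2 * ln (r i / \<epsilon>)) / 2 + (B + t / 2) * (\<Sum>i\<in>V. \<bar>c i\<bar>)\<^sup>2"
    by (simp add: field_simps)
  then have "exp (- (E ?e - E r - 2 * (B * (\<Sum>i\<in>V. \<bar>c i\<bar>)\<^sup>2)) / 2) \<le> exp (- (\<Sum>i\<in>V. (c i)\<^sup>2 * ln (r i / \<epsilon>)) / 2 + (B + 2 * \<delta> / \<epsilon>) * (\<Sum>i\<in>V. \<bar>c i\<bar>)\<^sup>2)"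
    by (simp add: t_def)
  with 1 show "cmod (\<integral>\<omega>. exp (\<i> * complex_of_real (X \<omega>)) \<partial>M)
      \<le> exp (- (\<Sum>i\<in>V. (c i)\<^sup>2 * ln (r i / \<epsilon>)) / 2 + (B + 2 * \<delta> / \<epsilon>) * (\<Sum>i\<in>V. \<bar>c i\<bar>)\<^sup>2)"
    by linarith
qed

end

section \<open>Removing the mollification\<close>

text \<open>Where \<open>\<bar>f \<omega>\<bar>\<close> exceeds \<open>t\<close> it is at most its
  square divided by \<open>t\<close>, so \<open>t\<close> plus this quotient is always an upper
  bound. This takes the place of the Cauchy-Schwarz inequality.\<close>

lemma nn_integral_abs_le_L2:
  fixes f :: "'a \<Rightarrow> real"
  assumes M: "prob_space M" and [measurable]: "f \<in> borel_measurable M" and t: "0 < t"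
    and L: "(\<integral>\<^sup>+\<omega>. ennreal ((norm (f \<omega>))\<^sup>2) \<partial>M) \<le> ennreal (t\<^sup>2)"
  shows "(\<integral>\<^sup>+\<omega>. ennreal \<bar>f \<omega>\<bar> \<partial>M) \<le> ennreal (2 * t)"
proof -
  interpret prob_space M by fact
  have "(\<integral>\<^sup>+\<omega>. ennreal \<bar>f \<omega>\<bar> \<partial>M) \<le> (\<integral>\<^sup>+\<omega>. ennreal t + ennreal (1 / t) * ennreal ((norm (f \<omega>))\<^sup>2) \<partial>M)"
  proof (intro nn_integral_mono)
    fix \<omega>
    have "\<bar>f \<omega>\<bar> \<le> t + 1 / t * (norm (f \<omega>))\<^sup>2"
    proof (cases "\<bar>f \<omega>\<bar> \<le> t")
      case True
      then show ?thesis using t by (simp add: add_increasing2)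
    next
      case False
      then have "\<bar>f \<omega>\<bar> * t \<le> \<bar>f \<omega>\<bar> * \<bar>f \<omega>\<bar>" using t by (intro mult_left_mono) auto
      then have "\<bar>f \<omega>\<bar> \<le> 1 / t * (norm (f \<omega>))\<^sup>2" using t by (simp add: power2_eq_square pos_le_divide_eq)
      then show ?thesis using t by linarith
    qed
    then show "ennreal \<bar>f \<omega>\<bar> \<le> ennreal t + ennreal (1 / t) * ennreal ((norm (f \<omega>))\<^sup>2)"
      using t by (simp add: ennreal_leI flip: ennreal_mult ennreal_plus)
  qed
  also have "\<dots> = ennreal t + ennreal (1 / t) * (\<integral>\<^sup>+\<omega>. ennreal ((norm (f \<omega>))\<^sup>2) \<partial>M)"
    by (subst nn_integral_add) (auto simp: nn_integral_cmult emeasure_space_1)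
  also have "\<dots> \<le> ennreal t + ennreal (1 / t) * ennreal (t\<^sup>2)" using L by (intro add_left_mono mult_left_mono) auto
  also have "\<dots> = ennreal (2 * t)" using t by (simp add: power2_eq_square flip: ennreal_mult ennreal_plus)
  finally show ?thesis .
qed

text \<open>For a fixed \<open>\<epsilon>\<close> the mollification error
  \<open>2 * \<delta> / \<epsilon>\<close> tends to 0 with \<open>\<delta>\<close>, so that
  \<open>B\<close> remains independent of \<open>\<epsilon>\<close>, of the points and of the
  coefficients.\<close>

lemma circle_average_char_bound:
  fixes D :: "(real^2) set"
  assumes M: "prob_space M" and D: "open D" "bounded D" and G: "dirichlet_green D G" and gff: "gff M D G \<Gamma>"
    and ca: "circle_average_process M D \<Gamma> \<Gamma>c" and \<kappa>: "0 < \<kappa>"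
  obtains B where "0 \<le> B"
    "\<And>(V :: nat set) (c :: nat \<Rightarrow> real) z r \<epsilon>. finite V \<Longrightarrow> 0 < \<epsilon> \<Longrightarrow> \<epsilon> \<le> \<kappa> \<Longrightarrow> (\<And>i. i \<in> V \<Longrightarrow> cball (z i) (3 * \<kappa>) \<subseteq> D) \<Longrightarrow>
      (\<And>i. i \<in> V \<Longrightarrow> \<epsilon> \<le> r i) \<Longrightarrow> (\<And>i. i \<in> V \<Longrightarrow> r i \<le> \<kappa>) \<Longrightarrow>
      (\<And>i j. i \<in> V \<Longrightarrow> j \<in> V \<Longrightarrow> i \<noteq> j \<Longrightarrow> (r i = \<epsilon> \<and> r j = \<epsilon>) \<or> r i + r j \<le> dist (z i) (z j)) \<Longrightarrow>
      cmod (\<integral>\<omega>. exp (\<i> * complex_of_real (\<Sum>i\<in>V. c i * \<Gamma>c \<epsilon> (z i) \<omega>)) \<partial>M)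
        \<le> exp (- (\<Sum>i\<in>V. (c i)\<^sup>2 * ln (r i / \<epsilon>)) / 2 + B * (\<Sum>i\<in>V. \<bar>c i\<bar>)\<^sup>2)"
proof -
  obtain B where B: "0 \<le> B" "\<And>f b. f \<in> borel_measurable borel \<Longrightarrow> (\<And>x. \<bar>f x\<bar> \<le> b) \<Longrightarrow> (\<And>x. f x \<noteq> 0 \<Longrightarrow> cball x \<kappa> \<subseteq> D) \<Longrightarrow>
      \<bar>green_energy D G f f - log_energy f f\<bar> \<le> B * (\<integral>x. \<bar>f x\<bar> \<partial>lborel)\<^sup>2"
    by (rule green_energy_near_log_energy[OF D G \<kappa>]) blast
  show ?thesis
  proof (rule that[OF B(1)])
    fix V :: "nat set" and c :: "nat \<Rightarrow> real" and z :: "nat \<Rightarrow> real^2" and r :: "nat \<Rightarrow> real" and \<epsilon> :: real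
    assume V: "finite V" and \<epsilon>: "0 < \<epsilon>" "\<epsilon> \<le> \<kappa>" and z: "\<And>i. i \<in> V \<Longrightarrow> cball (z i) (3 * \<kappa>) \<subseteq> D"
      and r: "\<And>i. i \<in> V \<Longrightarrow> \<epsilon> \<le> r i" "\<And>i. i \<in> V \<Longrightarrow> r i \<le> \<kappa>"
      and sep: "\<And>i j. i \<in> V \<Longrightarrow> j \<in> V \<Longrightarrow> i \<noteq> j \<Longrightarrow> (r i = \<epsilon> \<and> r j = \<epsilon>) \<or> r i + r j \<le> dist (z i) (z j)"
    have z\<epsilon>: "cball (z i) \<epsilon> \<subseteq> D" if "i \<in> V" for i
      using z[OF that] \<epsilon> \<kappa> by (force simp: subset_eq)
    have cai: "\<Gamma>c \<epsilon> (z i) \<in> borel_measurable M \<and> (\<exists>\<eta>. mollifier \<eta> \<and>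
        L2_tendsto M (\<lambda>\<delta> \<omega>. circle_mean (mollify \<eta> \<delta> (\<Gamma> \<omega>)) (z i) \<epsilon>) (\<Gamma>c \<epsilon> (z i)) (at_right 0))" if "i \<in> V" for i
      using ca z\<epsilon>[OF that] \<epsilon> unfolding circle_average_process_def circle_average_def by blast
    then have mc: "\<And>i. i \<in> V \<Longrightarrow> \<Gamma>c \<epsilon> (z i) \<in> borel_measurable M" by blast
    have "\<exists>\<eta>. \<forall>i\<in>V. mollifier (\<eta> i) \<and>
        L2_tendsto M (\<lambda>\<delta> \<omega>. circle_mean (mollify (\<eta> i) \<delta> (\<Gamma> \<omega>)) (z i) \<epsilon>) (\<Gamma>c \<epsilon> (z i)) (at_right 0)"
      using cai by (intro bchoice) blast
    then obtain \<eta> where e: "\<And>i. i \<in> V \<Longrightarrow> mollifier (\<eta> i)"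
      and L2: "\<And>i. i \<in> V \<Longrightarrow> L2_tendsto M (\<lambda>\<delta> \<omega>. circle_mean (mollify (\<eta> i) \<delta> (\<Gamma> \<omega>)) (z i) \<epsilon>) (\<Gamma>c \<epsilon> (z i)) (at_right 0)" by blast
    define X where "X \<omega> = (\<Sum>i\<in>V. c i * \<Gamma>c \<epsilon> (z i) \<omega>)" for \<omega>
    define Y where "Y \<delta> i \<omega> = circle_mean (mollify (\<eta> i) \<delta> (\<Gamma> \<omega>)) (z i) \<epsilon>" for \<delta> i \<omega>
    have mX: "X \<in> borel_measurable M" unfolding X_def[abs_def] using mc by (intro borel_measurable_sum borel_measurable_times) auto
    have mY: "Y \<delta> i \<in> borel_measurable M" if "i \<in> V" "0 < \<delta>" "\<delta> \<le> \<kappa>" for \<delta> i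
    proof -
      \<comment> \<open>Measurability of one mollified average is read off the previous lemma for a
        singleton and the coefficient 1.\<close>
      have "(\<lambda>\<omega>. \<Sum>i\<in>{i}. 1 * circle_mean (mollify (\<eta> i) \<delta> (\<Gamma> \<omega>)) (z i) \<epsilon>) \<in> borel_measurable M"
      proof (rule circle_mean_char_bound(1)[where D=D and G=G and \<kappa>=\<kappa> and B=B and r="\<lambda>_. \<epsilon>"])
        fix f :: "real^2 \<Rightarrow> real" and b
        assume "f \<in> borel_measurable borel" "\<And>x. \<bar>f x\<bar> \<le> b" "\<And>x. f x \<noteq> 0 \<Longrightarrow> cball x \<kappa> \<subseteq> D"
        then show "\<bar>green_energy D G f f - log_energy f f\<bar> \<le> B * (\<integral>x. \<bar>f x\<bar> \<partial>lborel)\<^sup>2" by (rule B(2))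
      qed (use M D gff that e z \<epsilon> B(1) in auto)
      then show ?thesis by (simp add: Y_def[abs_def])
    qed
    let ?S = "\<Sum>i\<in>V. \<bar>c i\<bar>"
    let ?a = "- (\<Sum>i\<in>V. (c i)\<^sup>2 * ln (r i / \<epsilon>)) / 2"
    have S0: "0 \<le> ?S" by (simp add: sum_nonneg)
    \<comment> \<open>First \<open>\<delta>\<close> tends to 0 with the tolerance \<open>t\<close>
      for the \<open>L\<^sup>2\<close> errors fixed; \<open>t\<close> is removed last.\<close>
    have step: "cmod (\<integral>\<omega>. exp (\<i> * complex_of_real (X \<omega>)) \<partial>M) \<le> exp (?a + B * ?S\<^sup>2) + ?S * (2 * t)" if t: "0 < t" for t
    proof -
      have "\<forall>i\<in>V. eventually (\<lambda>\<delta>. (\<integral>\<^sup>+\<omega>. ennreal ((norm (Y \<delta> i \<omega> - \<Gamma>c \<epsilon> (z i) \<omega>))\<^sup>2) \<partial>M) < ennreal (t\<^sup>2)) (at_right 0)"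
      proof
        fix i assume i: "i \<in> V"
        have "((\<lambda>\<delta>. \<integral>\<^sup>+\<omega>. ennreal ((norm (Y \<delta> i \<omega> - \<Gamma>c \<epsilon> (z i) \<omega>))\<^sup>2) \<partial>M) \<longlongrightarrow> 0) (at_right 0)"
          using L2[OF i] unfolding L2_tendsto_def Y_def .
        then show "eventually (\<lambda>\<delta>. (\<integral>\<^sup>+\<omega>. ennreal ((norm (Y \<delta> i \<omega> - \<Gamma>c \<epsilon> (z i) \<omega>))\<^sup>2) \<partial>M) < ennreal (t\<^sup>2)) (at_right 0)"
          by (rule order_tendstoD(2)) (use t in simp)
      qed
      then have ev1: "eventually (\<lambda>\<delta>. \<forall>i\<in>V. (\<integral>\<^sup>+\<omega>. ennreal ((norm (Y \<delta> i \<omega> - \<Gamma>c \<epsilon> (z i) \<omega>))\<^sup>2) \<partial>M) < ennreal (t\<^sup>2)) (at_right 0)"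
        by (rule eventually_ball_finite[OF V])
      have ev2: "eventually (\<lambda>\<delta>. \<delta> \<in> {0<..<\<kappa>}) (at_right 0)" by (rule eventually_at_right_real[OF \<kappa>])
      have ev: "eventually (\<lambda>\<delta>. cmod (\<integral>\<omega>. exp (\<i> * complex_of_real (X \<omega>)) \<partial>M) \<le> exp (?a + (B + 2 * \<delta> / \<epsilon>) * ?S\<^sup>2) + ?S * (2 * t)) (at_right 0)"
        using ev1 ev2
      proof eventually_elim
        case (elim \<delta>)
        then have \<delta>: "0 < \<delta>" "\<delta> \<le> \<kappa>" by auto
        define W where "W \<omega> = (\<Sum>i\<in>V. c i * Y \<delta> i \<omega>)" for \<omega>
        have W: "W \<in> borel_measurable M" "cmod (\<integral>\<omega>. exp (\<i> * complex_of_real (W \<omega>)) \<partial>M) \<le> exp (?a + (B + 2 * \<delta> / \<epsilon>) * ?S\<^sup>2)"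
          unfolding W_def[abs_def] Y_def
          by (rule circle_mean_char_bound[OF M D gff V e z \<delta> B \<epsilon>(1) r \<epsilon>(2) sep]; assumption)+
        have "(\<integral>\<^sup>+\<omega>. ennreal \<bar>W \<omega> - X \<omega>\<bar> \<partial>M) \<le> (\<integral>\<^sup>+\<omega>. (\<Sum>i\<in>V. ennreal \<bar>c i\<bar> * ennreal \<bar>Y \<delta> i \<omega> - \<Gamma>c \<epsilon> (z i) \<omega>\<bar>) \<partial>M)"
        proof (intro nn_integral_mono)
          fix \<omega>
          have "\<bar>W \<omega> - X \<omega>\<bar> = \<bar>\<Sum>i\<in>V. c i * (Y \<delta> i \<omega> - \<Gamma>c \<epsilon> (z i) \<omega>)\<bar>"
            by (simp add: W_def X_def right_diff_distrib sum_subtractf)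
          also have "\<dots> \<le> (\<Sum>i\<in>V. \<bar>c i * (Y \<delta> i \<omega> - \<Gamma>c \<epsilon> (z i) \<omega>)\<bar>)" by (rule sum_abs)
          finally show "ennreal \<bar>W \<omega> - X \<omega>\<bar> \<le> (\<Sum>i\<in>V. ennreal \<bar>c i\<bar> * ennreal \<bar>Y \<delta> i \<omega> - \<Gamma>c \<epsilon> (z i) \<omega>\<bar>)"
            by (simp add: abs_mult sum_ennreal ennreal_leI flip: ennreal_mult)
        qed
        also have "\<dots> = (\<Sum>i\<in>V. ennreal \<bar>c i\<bar> * (\<integral>\<^sup>+\<omega>. ennreal \<bar>Y \<delta> i \<omega> - \<Gamma>c \<epsilon> (z i) \<omega>\<bar> \<partial>M))"
        proof (subst nn_integral_sum)
          fix i assume i: "i \<in> V"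
          note [measurable] = mY[OF i \<delta>] mc[OF i]
          show "(\<lambda>\<omega>. ennreal \<bar>c i\<bar> * ennreal \<bar>Y \<delta> i \<omega> - \<Gamma>c \<epsilon> (z i) \<omega>\<bar>) \<in> borel_measurable M" by measurable
        next
          show "(\<Sum>i\<in>V. \<integral>\<^sup>+\<omega>. ennreal \<bar>c i\<bar> * ennreal \<bar>Y \<delta> i \<omega> - \<Gamma>c \<epsilon> (z i) \<omega>\<bar> \<partial>M) = (\<Sum>i\<in>V. ennreal \<bar>c i\<bar> * (\<integral>\<^sup>+\<omega>. ennreal \<bar>Y \<delta> i \<omega> - \<Gamma>c \<epsilon> (z i) \<omega>\<bar> \<partial>M))"
          proof (intro sum.cong refl)
            fix i assume i: "i \<in> V"
            note [measurable] = mY[OF i \<delta>] mc[OF i]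
            show "(\<integral>\<^sup>+\<omega>. ennreal \<bar>c i\<bar> * ennreal \<bar>Y \<delta> i \<omega> - \<Gamma>c \<epsilon> (z i) \<omega>\<bar> \<partial>M) = ennreal \<bar>c i\<bar> * (\<integral>\<^sup>+\<omega>. ennreal \<bar>Y \<delta> i \<omega> - \<Gamma>c \<epsilon> (z i) \<omega>\<bar> \<partial>M)"
              by (intro nn_integral_cmult) measurable
          qed
        qed
        also have "\<dots> \<le> (\<Sum>i\<in>V. ennreal \<bar>c i\<bar> * ennreal (2 * t))"
        proof (intro sum_mono mult_left_mono)
          fix i assume i: "i \<in> V"
          show "(\<integral>\<^sup>+\<omega>. ennreal \<bar>Y \<delta> i \<omega> - \<Gamma>c \<epsilon> (z i) \<omega>\<bar> \<partial>M) \<le> ennreal (2 * t)"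
            using elim i mY[OF i \<delta>] mc[OF i] by (intro nn_integral_abs_le_L2[OF M _ t]) (auto intro: less_imp_le)
        qed simp
        also have "\<dots> = ennreal (?S * (2 * t))"
          using t by (simp add: sum_distrib_right sum_nonneg flip: ennreal_mult sum_ennreal)
        finally have WX: "(\<integral>\<^sup>+\<omega>. ennreal \<bar>W \<omega> - X \<omega>\<bar> \<partial>M) \<le> ennreal (?S * (2 * t))" .
        have "ennreal (cmod (\<integral>\<omega>. exp (\<i> * complex_of_real (X \<omega>)) \<partial>M)) \<le> ennreal (cmod (\<integral>\<omega>. exp (\<i> * complex_of_real (W \<omega>)) \<partial>M)) + (\<integral>\<^sup>+\<omega>. ennreal \<bar>W \<omega> - X \<omega>\<bar> \<partial>M)"
          by (rule norm_integral_char_diff[OF M mX W(1)])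
        also have "\<dots> \<le> ennreal (exp (?a + (B + 2 * \<delta> / \<epsilon>) * ?S\<^sup>2)) + ennreal (?S * (2 * t))"
          using W(2) WX by (intro add_mono ennreal_leI)
        also have "\<dots> = ennreal (exp (?a + (B + 2 * \<delta> / \<epsilon>) * ?S\<^sup>2) + ?S * (2 * t))"
          using S0 t by (intro ennreal_plus[symmetric]) auto
        finally show ?case using S0 t by (subst (asm) ennreal_le_iff) (auto intro!: add_nonneg_nonneg)
      qed
      have lim: "((\<lambda>\<delta>. exp (?a + (B + 2 * \<delta> / \<epsilon>) * ?S\<^sup>2) + ?S * (2 * t)) \<longlongrightarrow> exp (?a + (B + 2 * 0 / \<epsilon>) * ?S\<^sup>2) + ?S * (2 * t)) (at_right 0)"
        using \<epsilon> by (intro tendsto_intros) auto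
      have "cmod (\<integral>\<omega>. exp (\<i> * complex_of_real (X \<omega>)) \<partial>M) \<le> exp (?a + (B + 2 * 0 / \<epsilon>) * ?S\<^sup>2) + ?S * (2 * t)"
        by (rule tendsto_lowerbound[OF lim ev trivial_limit_at_right_real])
      then show ?thesis by simp
    qed
    have "cmod (\<integral>\<omega>. exp (\<i> * complex_of_real (X \<omega>)) \<partial>M) \<le> exp (?a + B * ?S\<^sup>2)"
    proof (rule field_le_epsilon)
      fix d :: real assume d: "0 < d"
      \<comment> \<open>The tolerance is \<open>d / (2 * (?S + 1))\<close>, where the added 1 covers
        the case \<open>?S = 0\<close>.\<close>
      have "?S * (2 * (d / (2 * (?S + 1)))) \<le> d"
      proof -
        have "x * (2 * (d / (2 * (x + 1)))) \<le> d" if "0 \<le> x" for x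
          using that d by (simp add: field_simps)
        from this[OF S0] show ?thesis .
      qed
      moreover have "0 < d / (2 * (?S + 1))" using d S0 by (intro divide_pos_pos mult_pos_pos add_nonneg_pos) auto
      ultimately show "cmod (\<integral>\<omega>. exp (\<i> * complex_of_real (X \<omega>)) \<partial>M) \<le> exp (?a + B * ?S\<^sup>2) + d"
        using step[of "d / (2 * (?S + 1))"] by linarith
    qed
    then show "cmod (\<integral>\<omega>. exp (\<i> * complex_of_real (\<Sum>i\<in>V. c i * \<Gamma>c \<epsilon> (z i) \<omega>)) \<partial>M) \<le> exp (?a + B * ?S\<^sup>2)"
      by (simp add: X_def)
  qed
qed

section \<open>Moments of the mass of a rectangle\<close>

text \<open>With \<open>a = \<beta>\<^sup>2 / 2\<close> and \<open>y\<close> the nearest neighbour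
  of \<open>x\<close>, this is the factor that \<open>x\<close> contributes to the bound for the
  correlations. The radius is kept between \<open>\<epsilon>\<close>, where the circles start, and
  \<open>\<kappa>\<close>, up to which they stay in the domain.\<close>

definition trunc_kernel :: "real \<Rightarrow> real \<Rightarrow> real \<Rightarrow> real^2 \<Rightarrow> real^2 \<Rightarrow> real" where
  "trunc_kernel \<kappa> a \<epsilon> x y = max \<epsilon> (min \<kappa> (dist x y / 2)) powr - a"

lemma trunc_kernel_sym: "trunc_kernel \<kappa> a \<epsilon> x y = trunc_kernel \<kappa> a \<epsilon> y x"
  by (simp add: trunc_kernel_def dist_commute)

text \<open>The lower cutoff \<open>\<epsilon>\<close> can only decrease the kernel, and on a
  bounded set the upper cutoff \<open>\<kappa>\<close> costs a constant factor. So a multiple of the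
  pure power dominates, uniformly in \<open>\<epsilon>\<close>.\<close>

lemma trunc_kernel_le:
  assumes \<kappa>: "0 < \<kappa>" and a: "0 < a" and \<Delta>: "0 < \<Delta>" and d: "dist x y \<le> \<Delta>" "x \<noteq> y"
  shows "trunc_kernel \<kappa> a \<epsilon> x y \<le> min (\<kappa> / \<Delta>) (1 / 2) powr - a * dist x y powr - a"
proof -
  define c where "c = min (\<kappa> / \<Delta>) (1 / 2)"
  have c: "0 < c" using \<kappa> \<Delta> by (simp add: c_def)
  have dp: "0 < dist x y" using d by simp
  have c': "c \<le> \<kappa> / \<Delta>" "c \<le> 1 / 2" unfolding c_def by (rule min.cobounded1, rule min.cobounded2)
  have "c * dist x y \<le> \<kappa> / \<Delta> * \<Delta>" using d c c' \<kappa> \<Delta> by (intro mult_mono) auto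
  then have "c * dist x y \<le> \<kappa>" using \<Delta> by simp
  moreover have "c * dist x y \<le> 1 / 2 * dist x y" using c' by (intro mult_right_mono) auto
  ultimately have "c * dist x y \<le> max \<epsilon> (min \<kappa> (dist x y / 2))" by simp
  then have "trunc_kernel \<kappa> a \<epsilon> x y \<le> (c * dist x y) powr - a"
    unfolding trunc_kernel_def using a c dp by (intro powr_mono2') auto
  then show ?thesis using c by (simp add: powr_mult c_def)
qed

text \<open>These are the two bounds required by \<open>nn_integral_functional_graph\<close>, with
  \<open>t\<close> equal to \<open>C\<close> times the area \<open>A\<close> to the power
  \<open>1 - a / 2\<close>. The second kernel is of order \<open>dist powr - (2 * a)\<close> and is
  integrable because \<open>a < 1\<close>. The exponents fit: \<open>A powr (1 - a)\<close> times
  \<open>A\<close> is the square of \<open>A powr (1 - a / 2)\<close>.\<close>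

lemma trunc_kernel_integrals:
  fixes D :: "(real^2) set"
  assumes \<kappa>: "0 < \<kappa>" and a: "0 < a" "a < 1" and D: "bounded D"
  obtains C where "0 < C"
    "\<And>\<epsilon> b1 b2 c1 c2 w w'. b1 \<le> b2 \<Longrightarrow> c1 \<le> c2 \<Longrightarrow> rect b1 b2 c1 c2 \<subseteq> D \<Longrightarrow> w \<in> D \<Longrightarrow> w' \<in> D \<Longrightarrow>
      (\<integral>\<^sup>+z\<in>rect b1 b2 c1 c2. ennreal (trunc_kernel \<kappa> a \<epsilon> z w) \<partial>lborel) \<le> ennreal (C * ((b2 - b1) * (c2 - c1)) powr (1 - a / 2)) \<and>
      (\<integral>\<^sup>+z\<in>rect b1 b2 c1 c2. ennreal (trunc_kernel \<kappa> a \<epsilon> z w) * ennreal (trunc_kernel \<kappa> a \<epsilon> z w') \<partial>lborel) * emeasure lborel (rect b1 b2 c1 c2)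
        \<le> (ennreal (C * ((b2 - b1) * (c2 - c1)) powr (1 - a / 2)))\<^sup>2"
proof -
  obtain R where R: "0 < R" "\<And>x. x \<in> D \<Longrightarrow> norm x \<le> R" using D by (auto simp: bounded_pos)
  define \<Delta> where "\<Delta> = 2 * R"
  have \<Delta>: "0 < \<Delta>" "\<And>x y. x \<in> D \<Longrightarrow> y \<in> D \<Longrightarrow> dist x y \<le> \<Delta>"
  proof -
    show "0 < \<Delta>" using R by (simp add: \<Delta>_def)
    show "dist x y \<le> \<Delta>" if "x \<in> D" "y \<in> D" for x y
      using R(2)[OF that(1)] R(2)[OF that(2)] norm_triangle_ineq4[of x y] by (simp add: \<Delta>_def dist_norm)
  qed
  define q where "q = min (\<kappa> / \<Delta>) (1 / 2) powr - a"
  have "0 < min (\<kappa> / \<Delta>) (1 / 2)" using \<kappa> \<Delta>(1) by simp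
  then have q: "0 < q" unfolding q_def by (simp only: powr_gt_zero)
  \<comment> \<open>One constant for both kernels: \<open>k\<close> belongs to the exponent
    \<open>2 * a\<close> and exceeds the constant for \<open>a\<close>. At the end
    \<open>1 \<le> k\<close> allows \<open>k\<close> to be replaced by its square.\<close>
  define k where "k = (3 / (1 - a))\<^sup>2"
  have k: "(3 / (1 - a / 2))\<^sup>2 \<le> k" "1 \<le> k"
  proof -
    show "(3 / (1 - a / 2))\<^sup>2 \<le> k" unfolding k_def using a by (intro power_mono divide_left_mono) auto
    have "1 \<le> 3 / (1 - a)" using a by (simp add: pos_le_divide_eq)
    then show "1 \<le> k" unfolding k_def by (rule one_le_power)
  qed
  show ?thesis
  proof (rule that[of "q * k"])
    show "0 < q * k" using q k by simp
    fix \<epsilon> b1 b2 c1 c2 :: real and w w' :: "real^2"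
    assume b: "b1 \<le> b2" "c1 \<le> c2" and sub: "rect b1 b2 c1 c2 \<subseteq> D" and w: "w \<in> D" "w' \<in> D"
    let ?R = "rect b1 b2 c1 c2"
    define A where "A = (b2 - b1) * (c2 - c1)"
    have A: "0 \<le> A" using b by (simp add: A_def)
    have g: "trunc_kernel \<kappa> a \<epsilon> z v \<le> q * dist z v powr - a" if "z \<in> ?R" "v \<in> D" "z \<noteq> v" for z v
      unfolding q_def using that sub \<Delta> by (intro trunc_kernel_le[OF \<kappa> a(1)]) auto
    have [measurable]: "(\<lambda>z. trunc_kernel \<kappa> a \<epsilon> z v) \<in> borel_measurable borel" for v
      unfolding trunc_kernel_def by measurable
    have "(\<integral>\<^sup>+z\<in>?R. ennreal (trunc_kernel \<kappa> a \<epsilon> z w) \<partial>lborel) \<le> (\<integral>\<^sup>+z. ennreal q * (ennreal (dist z w powr - a) * indicator ?R z) \<partial>lborel)"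
      using AE_lborel_singleton[of w]
    proof (intro nn_integral_mono_AE, eventually_elim)
      case (elim z)
      then show ?case using g[of z w] w q by (auto split: split_indicator simp flip: ennreal_mult intro: ennreal_leI)
    qed
    also have "\<dots> = ennreal q * (\<integral>\<^sup>+z\<in>?R. ennreal (dist z w powr - a) \<partial>lborel)" by (intro nn_integral_cmult) measurable
    also have "\<dots> \<le> ennreal q * ennreal ((3 / (1 - a / 2))\<^sup>2 * A powr (1 - a / 2))"
      unfolding A_def using a b by (intro mult_left_mono nn_integral_powr_dist_rect) auto
    also have "\<dots> \<le> ennreal q * ennreal (k * A powr (1 - a / 2))"
      using k by (intro mult_left_mono ennreal_leI mult_right_mono) auto
    also have "\<dots> = ennreal (q * k * A powr (1 - a / 2))" using q k by (simp add: mult_ac flip: ennreal_mult)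
    finally have 1: "(\<integral>\<^sup>+z\<in>?R. ennreal (trunc_kernel \<kappa> a \<epsilon> z w) \<partial>lborel) \<le> ennreal (q * k * A powr (1 - a / 2))" .
    have sq: "(\<integral>\<^sup>+z\<in>?R. ennreal (dist z v powr - (2 * a)) \<partial>lborel) \<le> ennreal (k * A powr (1 - a))" for v
      using nn_integral_powr_dist_rect[of "2 * a" b1 b2 c1 c2 v] a b by (simp add: k_def A_def)
    have "(\<integral>\<^sup>+z\<in>?R. ennreal (trunc_kernel \<kappa> a \<epsilon> z w) * ennreal (trunc_kernel \<kappa> a \<epsilon> z w') \<partial>lborel)
        \<le> (\<integral>\<^sup>+z. ennreal (q\<^sup>2 / 2) * (ennreal (dist z w powr - (2 * a)) * indicator ?R z) + ennreal (q\<^sup>2 / 2) * (ennreal (dist z w' powr - (2 * a)) * indicator ?R z) \<partial>lborel)"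
      using AE_lborel_singleton[of w] AE_lborel_singleton[of w']
    proof (intro nn_integral_mono_AE, eventually_elim)
      case (elim z)
      show ?case
      proof (cases "z \<in> ?R")
        case True
        define x where "x = trunc_kernel \<kappa> a \<epsilon> z w"
        define y where "y = trunc_kernel \<kappa> a \<epsilon> z w'"
        have p: "dist z v powr - (2 * a) = (dist z v powr - a)\<^sup>2" for v by (simp add: power2_eq_square flip: powr_add)
        have x: "0 \<le> x" "x\<^sup>2 \<le> q\<^sup>2 * dist z w powr - (2 * a)"
          using power_mono[OF g[OF True w(1)] _, of 2] elim unfolding p x_def by (auto simp: power_mult_distrib trunc_kernel_def)
        have y: "0 \<le> y" "y\<^sup>2 \<le> q\<^sup>2 * dist z w' powr - (2 * a)"
          using power_mono[OF g[OF True w(2)] _, of 2] elim unfolding p y_def by (auto simp: power_mult_distrib trunc_kernel_def)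
        \<comment> \<open>The inequality of arithmetic and geometric means separates the two poles,
          whose mutual position is arbitrary.\<close>
        have "0 \<le> (x - y)\<^sup>2" by simp
        then have "x * y \<le> x\<^sup>2 / 2 + y\<^sup>2 / 2" by (simp add: power2_diff)
        also have "\<dots> \<le> q\<^sup>2 / 2 * dist z w powr - (2 * a) + q\<^sup>2 / 2 * dist z w' powr - (2 * a)" using x y by simp
        finally have "ennreal (x * y) \<le> ennreal (q\<^sup>2 / 2 * dist z w powr - (2 * a) + q\<^sup>2 / 2 * dist z w' powr - (2 * a))" by (rule ennreal_leI)
        also have "\<dots> = ennreal (q\<^sup>2 / 2) * ennreal (dist z w powr - (2 * a)) + ennreal (q\<^sup>2 / 2) * ennreal (dist z w' powr - (2 * a))"
          by (subst ennreal_plus) (auto simp only: ennreal_mult' zero_le_power2 powr_ge_zero divide_nonneg_nonneg zero_le_numeral mult_nonneg_nonneg)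
        also have "ennreal (x * y) = ennreal x * ennreal y" using x(1) y(1) by (rule ennreal_mult)
        finally show ?thesis using True by (simp add: x_def y_def)
      qed simp
    qed
    also have "\<dots> = ennreal (q\<^sup>2 / 2) * (\<integral>\<^sup>+z\<in>?R. ennreal (dist z w powr - (2 * a)) \<partial>lborel) + ennreal (q\<^sup>2 / 2) * (\<integral>\<^sup>+z\<in>?R. ennreal (dist z w' powr - (2 * a)) \<partial>lborel)"
      by (subst nn_integral_add) (auto simp: nn_integral_cmult)
    also have "\<dots> \<le> ennreal (q\<^sup>2 / 2) * ennreal (k * A powr (1 - a)) + ennreal (q\<^sup>2 / 2) * ennreal (k * A powr (1 - a))"
      by (intro add_mono mult_left_mono sq) auto
    also have "\<dots> = ennreal (q\<^sup>2 * (k * A powr (1 - a)))"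
      using k by (simp add: mult_ac flip: ennreal_mult ennreal_plus)
    finally have "(\<integral>\<^sup>+z\<in>?R. ennreal (trunc_kernel \<kappa> a \<epsilon> z w) * ennreal (trunc_kernel \<kappa> a \<epsilon> z w') \<partial>lborel) * emeasure lborel ?R
      \<le> ennreal (q\<^sup>2 * (k * A powr (1 - a))) * ennreal A"
      using b by (intro mult_mono) (auto simp: emeasure_rect A_def)
    also have "\<dots> = ennreal (q\<^sup>2 * k * A powr (2 - a))"
    proof -
      have "A powr (1 - a) * A = A powr (2 - a)"
      proof (cases "A = 0")
        case False
        then have "A powr (1 - a) * A powr 1 = A powr (2 - a)" unfolding powr_add[symmetric] by simp
        then show ?thesis using A False by simp
      qed simp
      then show ?thesis using A k by (simp add: mult_ac flip: ennreal_mult)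
    qed
    also have "\<dots> \<le> ennreal ((q * k * A powr (1 - a / 2))\<^sup>2)"
    proof (intro ennreal_leI)
      have "(q * k * A powr (1 - a / 2))\<^sup>2 = q\<^sup>2 * k * k * A powr (2 - a)"
        by (simp add: power2_eq_square mult_ac flip: powr_add) 
      moreover have "q\<^sup>2 * k * A powr (2 - a) * 1 \<le> q\<^sup>2 * k * A powr (2 - a) * k" using k by (intro mult_left_mono) auto
      ultimately show "q\<^sup>2 * k * A powr (2 - a) \<le> (q * k * A powr (1 - a / 2))\<^sup>2" by (simp add: mult_ac)
    qed
    also have "\<dots> = (ennreal (q * k * A powr (1 - a / 2)))\<^sup>2" using q k by (simp add: ennreal_power)
    finally show "(\<integral>\<^sup>+z\<in>?R. ennreal (trunc_kernel \<kappa> a \<epsilon> z w) \<partial>lborel) \<le> ennreal (q * k * ((b2 - b1) * (c2 - c1)) powr (1 - a / 2)) \<and>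
      (\<integral>\<^sup>+z\<in>?R. ennreal (trunc_kernel \<kappa> a \<epsilon> z w) * ennreal (trunc_kernel \<kappa> a \<epsilon> z w') \<partial>lborel) * emeasure lborel ?R
        \<le> (ennreal (q * k * ((b2 - b1) * (c2 - c1)) powr (1 - a / 2)))\<^sup>2"
      using 1 by (simp add: A_def)
  qed
qed

text \<open>Each factor is the kernel at a nearest neighbour, so the product is one of the summands.\<close>

lemma prod_nearest_neighbour_le:
  fixes V :: "nat set" and z :: "nat \<Rightarrow> real^2"
  assumes V: "finite V" "\<And>i. i \<in> V \<Longrightarrow> V - {i} \<noteq> {}"
  defines "d \<equiv> \<lambda>i. Min ((\<lambda>j. dist (z i) (z j)) ` (V - {i}))"
  shows "(\<Prod>i\<in>V. ennreal (max \<epsilon> (min \<kappa> (d i / 2)) powr - a))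
    \<le> (\<Sum>F\<in>(\<Pi>\<^sub>E i\<in>V. V - {i}). \<Prod>i\<in>V. ennreal (trunc_kernel \<kappa> a \<epsilon> (z i) (z (F i))))"
proof -
  have "\<exists>j. j \<in> V - {i} \<and> d i = dist (z i) (z j)" if "i \<in> V" for i
  proof -
    have "d i \<in> (\<lambda>j. dist (z i) (z j)) ` (V - {i})" unfolding d_def using V that by (intro Min_in) auto
    then show ?thesis by blast
  qed
  then obtain F where F: "\<And>i. i \<in> V \<Longrightarrow> F i \<in> V - {i}" "\<And>i. i \<in> V \<Longrightarrow> d i = dist (z i) (z (F i))" by metis
  define F' where "F' = restrict F V"
  have F': "F' \<in> (\<Pi>\<^sub>E i\<in>V. V - {i})" using F(1) by (auto simp: F'_def)
  have "(\<Prod>i\<in>V. ennreal (max \<epsilon> (min \<kappa> (d i / 2)) powr - a)) = (\<Prod>i\<in>V. ennreal (trunc_kernel \<kappa> a \<epsilon> (z i) (z (F' i))))"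
    by (intro prod.cong refl) (simp add: F'_def trunc_kernel_def F(2))
  also have "\<dots> \<le> (\<Sum>F\<in>(\<Pi>\<^sub>E i\<in>V. V - {i}). \<Prod>i\<in>V. ennreal (trunc_kernel \<kappa> a \<epsilon> (z i) (z (F i))))"
    using F' V by (intro member_le_sum) (auto intro!: finite_PiE)
  finally show ?thesis .
qed

text \<open>The nearest neighbour depends on the points, so one sums over all maps without fixed
  points. Their number depends on \<open>V\<close> alone and goes into the constant, and each map
  gives a functional graph with \<open>E = V\<close>, hence the factor
  \<open>t ^ card V\<close>.\<close>

lemma nn_integral_nearest_neighbour:
  fixes D :: "(real^2) set" and V :: "nat set"
  assumes \<kappa>: "0 < \<kappa>" and a: "0 < a" "a < 1" and D: "bounded D" and V: "finite V" "\<And>i. i \<in> V \<Longrightarrow> V - {i} \<noteq> {}"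
    and ne: "V \<noteq> {}"
  obtains C where "0 \<le> C"
    "\<And>\<epsilon> b1 b2 c1 c2. b1 \<le> b2 \<Longrightarrow> c1 \<le> c2 \<Longrightarrow> rect b1 b2 c1 c2 \<subseteq> D \<Longrightarrow>
      (\<integral>\<^sup>+z. (\<Prod>i\<in>V. ennreal (max \<epsilon> (min \<kappa> (Min ((\<lambda>j. dist (z i) (z j)) ` (V - {i})) / 2)) powr - a))
        \<partial>PiM V (\<lambda>_. restrict_space lborel (rect b1 b2 c1 c2)))
      \<le> ennreal (C * ((b2 - b1) * (c2 - c1)) powr (card V * (1 - a / 2)))"
proof -
  obtain C where C: "0 < C"
    and K: "\<And>\<epsilon> b1 b2 c1 c2 w w'. b1 \<le> b2 \<Longrightarrow> c1 \<le> c2 \<Longrightarrow> rect b1 b2 c1 c2 \<subseteq> D \<Longrightarrow> w \<in> D \<Longrightarrow> w' \<in> D \<Longrightarrow>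
      (\<integral>\<^sup>+z\<in>rect b1 b2 c1 c2. ennreal (trunc_kernel \<kappa> a \<epsilon> z w) \<partial>lborel) \<le> ennreal (C * ((b2 - b1) * (c2 - c1)) powr (1 - a / 2)) \<and>
      (\<integral>\<^sup>+z\<in>rect b1 b2 c1 c2. ennreal (trunc_kernel \<kappa> a \<epsilon> z w) * ennreal (trunc_kernel \<kappa> a \<epsilon> z w') \<partial>lborel) * emeasure lborel (rect b1 b2 c1 c2)
        \<le> (ennreal (C * ((b2 - b1) * (c2 - c1)) powr (1 - a / 2)))\<^sup>2"
    by (rule trunc_kernel_integrals[OF \<kappa> a D]) blast
  define P where "P = (\<Pi>\<^sub>E i\<in>V. V - {i})"
  have fP: "finite P" unfolding P_def using V by (intro finite_PiE) auto
  show ?thesis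
  proof (rule that[of "real (card P) * C ^ card V"])
    show "0 \<le> real (card P) * C ^ card V" using C by simp
    fix \<epsilon> b1 b2 c1 c2 :: real
    assume b: "b1 \<le> b2" "c1 \<le> c2" and sub: "rect b1 b2 c1 c2 \<subseteq> D"
    define R where "R = rect b1 b2 c1 c2"
    define N where "N = restrict_space lborel R"
    have Rm[measurable]: "R \<in> sets borel" unfolding R_def by measurable
    have sN: "space N = R" by (simp add: N_def space_restrict_space)
    have eN: "emeasure N (space N) = emeasure lborel R" unfolding sN unfolding N_def by (subst emeasure_restrict_space) auto
    interpret N: finite_measure N
      by (rule finite_measureI) (use b in \<open>simp add: eN R_def emeasure_rect\<close>)
    interpret PN: product_sigma_finite "\<lambda>_ :: nat. N" by standard
    define A where "A = (b2 - b1) * (c2 - c1)"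
    define t where "t = ennreal (C * A powr (1 - a / 2))"
    have nnr: "(\<integral>\<^sup>+z. f z \<partial>N) = (\<integral>\<^sup>+z\<in>R. f z \<partial>lborel)" for f
      unfolding N_def by (rule nn_integral_restrict_space) simp
    define g where "g x y = ennreal (trunc_kernel \<kappa> a \<epsilon> x y)" for x y
    have gm0: "(\<lambda>(x, y). g x y) \<in> borel_measurable (borel \<Otimes>\<^sub>M borel)"
      unfolding g_def trunc_kernel_def by measurable
    have idN: "(\<lambda>x. x) \<in> measurable N borel" unfolding N_def by (intro measurable_restrict_space1) measurable
    have gm: "(\<lambda>(x, y). g x y) \<in> borel_measurable (N \<Otimes>\<^sub>M N)"
    proof -
      note [measurable] = idN gm0
      have "(\<lambda>p. (\<lambda>(x, y). g x y) (fst p, snd p)) \<in> borel_measurable (N \<Otimes>\<^sub>M N)" by measurable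
      then show ?thesis by simp
    qed
    have each: "(\<integral>\<^sup>+z. (\<Prod>i\<in>V. g (z i) (z (F i))) \<partial>PiM V (\<lambda>_. N)) \<le> t ^ card V" if F: "F \<in> P" for F
    proof -
      have "(\<integral>\<^sup>+z. (\<Prod>i\<in>V. g (z i) (z (F i))) \<partial>PiM V (\<lambda>_. N)) \<le> t ^ card V * emeasure N (space N) ^ (card V - card V)"
      proof (rule N.nn_integral_functional_graph[OF gm])
        show "g x y = g y x" for x y unfolding g_def by (subst trunc_kernel_sym) simp
        show "(\<integral>\<^sup>+z. g z w \<partial>N) \<le> t" if "w \<in> space N" for w
          using K[OF b sub, of w w \<epsilon>] that sub unfolding nnr sN g_def t_def A_def R_def by blast
        show "(\<integral>\<^sup>+z. g z w * g z w' \<partial>N) * emeasure N (space N) \<le> t\<^sup>2" if "w \<in> space N" "w' \<in> space N" for w w'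
          using K[OF b sub, of w w' \<epsilon>] that sub unfolding nnr eN unfolding sN g_def t_def A_def R_def by blast
      qed (use F V in \<open>auto simp: P_def PiE_def Pi_def\<close>)
      then show ?thesis by simp
    qed
    have mm: "(\<lambda>z. \<Prod>i\<in>V. g (z i) (z (F i))) \<in> borel_measurable (PiM V (\<lambda>_. N))" if F: "F \<in> P" for F
    proof (intro borel_measurable_prod_ennreal)
      fix i assume i: "i \<in> V"
      have Fi: "F i \<in> V" using F i by (auto simp: P_def PiE_def Pi_def)
      note [measurable] = gm measurable_component_singleton[OF i, of "\<lambda>_. N"] measurable_component_singleton[OF Fi, of "\<lambda>_. N"]
      have "(\<lambda>z. (\<lambda>(x, y). g x y) (z i, z (F i))) \<in> borel_measurable (PiM V (\<lambda>_. N))" by measurable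
      then show "(\<lambda>z. g (z i) (z (F i))) \<in> borel_measurable (PiM V (\<lambda>_. N))" by simp
    qed
    have "(\<integral>\<^sup>+z. (\<Prod>i\<in>V. ennreal (max \<epsilon> (min \<kappa> (Min ((\<lambda>j. dist (z i) (z j)) ` (V - {i})) / 2)) powr - a)) \<partial>PiM V (\<lambda>_. N))
        \<le> (\<integral>\<^sup>+z. (\<Sum>F\<in>P. \<Prod>i\<in>V. g (z i) (z (F i))) \<partial>PiM V (\<lambda>_. N))"
      unfolding g_def P_def by (intro nn_integral_mono prod_nearest_neighbour_le V)
    also have "\<dots> = (\<Sum>F\<in>P. \<integral>\<^sup>+z. (\<Prod>i\<in>V. g (z i) (z (F i))) \<partial>PiM V (\<lambda>_. N))" by (rule nn_integral_sum) (rule mm)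
    also have "\<dots> \<le> (\<Sum>F\<in>P. t ^ card V)" by (intro sum_mono each)
    also have "\<dots> = ennreal (real (card P) * C ^ card V * A powr (card V * (1 - a / 2)))"
    proof -
      \<comment> \<open>For area 0 both sides vanish because \<open>V\<close> is nonempty; an empty
        \<open>V\<close> would set 1 against \<open>0 powr 0 = 0\<close>.\<close>
      have "(A powr (1 - a / 2)) ^ card V = A powr (card V * (1 - a / 2))"
      proof (cases "A = 0")
        case True
        then show ?thesis using V ne by (simp add: power_0_left)
      next
        case False
        then show ?thesis by (simp add: powr_powr mult.commute flip: powr_realpow)
      qed
      then show ?thesis using C
        by (simp add: t_def ennreal_power power_mult_distrib ennreal_of_nat_eq_real_of_nat mult_ac flip: ennreal_mult)
    qed
    finally show "(\<integral>\<^sup>+z. (\<Prod>i\<in>V. ennreal (max \<epsilon> (min \<kappa> (Min ((\<lambda>j. dist (z i) (z j)) ` (V - {i})) / 2)) powr - a))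
        \<partial>PiM V (\<lambda>_. restrict_space lborel (rect b1 b2 c1 c2)))
      \<le> ennreal (real (card P) * C ^ card V * ((b2 - b1) * (c2 - c1)) powr (card V * (1 - a / 2)))"
      by (simp add: N_def R_def A_def)
  qed
qed

lemma prod_lessThan_split:
  fixes a b :: complex
  shows "(\<Prod>j<2 * n. if j < n then a else b) = a ^ n * b ^ n"
proof -
  have "{..<2 * n} \<inter> {j. j < n} = {..<n}" "{..<2 * n} \<inter> - {j. j < n} = {n..<2 * n}" by auto
  then show ?thesis by (subst prod.If_cases) auto
qed

section \<open>Even moments as integrals of correlations\<close>

text \<open>The modulus to the power \<open>2 * n\<close> is the \<open>n\<close>-th power of the
  integral times that of its conjugate. This is an integral over \<open>2 * n\<close> points, the
  first \<open>n\<close> of which carry \<open>\<beta>\<close> and the others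
  \<open>- \<beta>\<close>, and Fubini's theorem brings the expectation inside.\<close>

lemma rect_moment_at:
  fixes D :: "(real^2) set" and \<Gamma>c :: "real \<Rightarrow> real^2 \<Rightarrow> 'a \<Rightarrow> real" and n :: nat
  assumes M: "prob_space M" and R: "R \<in> sets borel" "emeasure lborel R < \<infinity>"
    and ca: "(\<lambda>(x, \<omega>). \<Gamma>c \<epsilon> x \<omega>) \<in> borel_measurable (restrict_space borel U \<Otimes>\<^sub>M M)" and RU: "R \<subseteq> U"
    and \<beta>: "0 < \<beta>"
    and bound: "\<And>z. (\<And>i. i < 2 * n \<Longrightarrow> z i \<in> R) \<Longrightarrow>
      ennreal (cmod (\<integral>\<omega>. exp (\<i> * complex_of_real (\<Sum>i<2 * n. (if i < n then \<beta> else - \<beta>) * \<Gamma>c \<epsilon> (z i) \<omega>)) \<partial>M)) \<le> f z"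
  shows "(\<lambda>\<omega>. LINT x:R|lborel. exp (\<i> * complex_of_real (\<beta> * \<Gamma>c \<epsilon> x \<omega>))) \<in> borel_measurable M"
    and "(\<integral>\<^sup>+\<omega>. ennreal (cmod (LINT x:R|lborel. exp (\<i> * complex_of_real (\<beta> * \<Gamma>c \<epsilon> x \<omega>))) ^ (2 * n)) \<partial>M)
      \<le> (\<integral>\<^sup>+z. f z \<partial>PiM {..<2 * n} (\<lambda>_. restrict_space lborel R))"
proof -
  interpret M: prob_space M by (rule M)
  define N where "N = restrict_space lborel R"
  note [measurable] = R(1)
  have sN: "space N = R" by (simp add: N_def space_restrict_space)
  have eN: "emeasure N (space N) = emeasure lborel R" unfolding sN unfolding N_def by (subst emeasure_restrict_space) auto
  interpret N: finite_measure N by (rule finite_measureI) (use R(2) in \<open>simp add: eN\<close>)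
  interpret PN: product_sigma_finite "\<lambda>_ :: nat. N" by standard
  let ?V = "{..<2 * n}"
  define PV where "PV = PiM ?V (\<lambda>_ :: nat. N)"
  interpret PVm: finite_measure PV
  proof (rule finite_measureI)
    have "emeasure PV (space PV) = (\<Prod>i\<in>?V. emeasure N (space N))"
      unfolding PV_def space_PiM by (rule PN.emeasure_PiM) auto
    then show "emeasure PV (space PV) \<noteq> \<infinity>" by (simp add: N.emeasure_eq_measure ennreal_power)
  qed
  have idN: "(\<lambda>x. x) \<in> measurable N (restrict_space borel U)"
    unfolding N_def using RU by (intro measurable_restrict_space3) auto
  have mG: "(\<lambda>(x, \<omega>). \<Gamma>c \<epsilon> x \<omega>) \<in> borel_measurable (N \<Otimes>\<^sub>M M)"
  proof -
    have "(\<lambda>p. (fst p, snd p)) \<in> measurable (N \<Otimes>\<^sub>M M) (restrict_space borel U \<Otimes>\<^sub>M M)"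
      by (intro measurable_Pair measurable_compose[OF measurable_fst idN]) auto
    from measurable_compose[OF this ca] show ?thesis by (simp add: case_prod_unfold)
  qed
  define E where "E s x \<omega> = exp (\<i> * complex_of_real (s * \<Gamma>c \<epsilon> x \<omega>))" for s x \<omega>
  have mE: "(\<lambda>(x, \<omega>). E s x \<omega>) \<in> borel_measurable (N \<Otimes>\<^sub>M M)" for s
  proof -
    note [measurable] = mG
    have "(\<lambda>p. exp (\<i> * complex_of_real (s * (\<lambda>(x, \<omega>). \<Gamma>c \<epsilon> x \<omega>) p))) \<in> borel_measurable (N \<Otimes>\<^sub>M M)" by measurable
    then show ?thesis by (simp add: E_def case_prod_unfold)
  qed
  have nE: "cmod (E s x \<omega>) = 1" for s x \<omega> by (simp add: E_def)
  have LI: "(LINT x:R|lborel. exp (\<i> * complex_of_real (\<beta> * \<Gamma>c \<epsilon> x \<omega>))) = (\<integral>x. E \<beta> x \<omega> \<partial>N)" for \<omega>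
    unfolding N_def set_lebesgue_integral_def E_def by (subst integral_restrict_space) auto
  define I where "I \<omega> = (\<integral>x. E \<beta> x \<omega> \<partial>N)" for \<omega>
  have mI[measurable]: "I \<in> borel_measurable M"
    unfolding I_def[abs_def]
  proof (rule N.borel_measurable_lebesgue_integral)
    have "(\<lambda>p. E \<beta> (snd p) (fst p)) \<in> borel_measurable (M \<Otimes>\<^sub>M N)"
      using measurable_compose[OF measurable_Pair[OF measurable_snd measurable_fst] mE[of \<beta>]] by simp
    then show "(\<lambda>(\<omega>, x). E \<beta> x \<omega>) \<in> borel_measurable (M \<Otimes>\<^sub>M N)" by (simp add: case_prod_unfold)
  qed
  then show "(\<lambda>\<omega>. LINT x:R|lborel. exp (\<i> * complex_of_real (\<beta> * \<Gamma>c \<epsilon> x \<omega>))) \<in> borel_measurable M"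
    unfolding LI I_def[abs_def] .
  have mEs: "(\<lambda>x. E s x \<omega>) \<in> borel_measurable N" if "\<omega> \<in> space M" for s \<omega>
    using measurable_compose[OF measurable_Pair2'[OF that] mE[of s]] by simp
  have iE: "integrable N (\<lambda>x. E s x \<omega>)" if "\<omega> \<in> space M" for s \<omega>
    by (rule N.integrable_const_bound[where B=1]) (use mEs[OF that] in \<open>auto simp: nE\<close>)
  define s where "s i = (if i < n then \<beta> else - \<beta>)" for i
  define F where "F z \<omega> = exp (\<i> * complex_of_real (\<Sum>i<2 * n. s i * \<Gamma>c \<epsilon> (z i) \<omega>))" for z \<omega>
  have mF: "(\<lambda>(z, \<omega>). F z \<omega>) \<in> borel_measurable (PV \<Otimes>\<^sub>M M)"
  proof -
    have "(\<lambda>p. \<Gamma>c \<epsilon> (fst p i) (snd p)) \<in> borel_measurable (PV \<Otimes>\<^sub>M M)" if i: "i \<in> ?V" for i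
    proof -
      have "(\<lambda>p. fst p i) \<in> measurable (PV \<Otimes>\<^sub>M M) N"
        unfolding PV_def by (rule measurable_compose[OF measurable_fst measurable_component_singleton[OF i]])
      then have "(\<lambda>p. (fst p i, snd p)) \<in> measurable (PV \<Otimes>\<^sub>M M) (N \<Otimes>\<^sub>M M)" by (intro measurable_Pair) auto
      from measurable_compose[OF this mG] show ?thesis by simp
    qed
    then have "(\<lambda>p. \<Sum>i<2 * n. s i * \<Gamma>c \<epsilon> (fst p i) (snd p)) \<in> borel_measurable (PV \<Otimes>\<^sub>M M)"
      by (intro borel_measurable_sum borel_measurable_times) auto
    then have "(\<lambda>p. exp (\<i> * complex_of_real (\<Sum>i<2 * n. s i * \<Gamma>c \<epsilon> (fst p i) (snd p)))) \<in> borel_measurable (PV \<Otimes>\<^sub>M M)" by measurable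
    then show ?thesis by (simp add: F_def case_prod_unfold)
  qed
  have pow: "complex_of_real (cmod (I \<omega>) ^ (2 * n)) = (\<integral>z. F z \<omega> \<partial>PV)" if \<omega>: "\<omega> \<in> space M" for \<omega>
  proof -
    have cI: "cnj (I \<omega>) = (\<integral>x. E (- \<beta>) x \<omega> \<partial>N)"
    proof -
      have "cnj (E \<beta> x \<omega>) = E (- \<beta>) x \<omega>" for x by (simp add: E_def exp_cnj)
      then have "(\<lambda>x. cnj (E \<beta> x \<omega>)) = (\<lambda>x. E (- \<beta>) x \<omega>)" by (intro ext)
      with Bochner_Integration.integral_cnj[of N "\<lambda>x. E \<beta> x \<omega>"] show ?thesis unfolding I_def by (simp only:)
    qed
    have "complex_of_real (cmod (I \<omega>) ^ (2 * n)) = (I \<omega> * cnj (I \<omega>)) ^ n"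
      unfolding complex_norm_square[symmetric] by (simp add: power_mult)
    also have "\<dots> = (\<Prod>j<2 * n. if j < n then I \<omega> else cnj (I \<omega>))" unfolding prod_lessThan_split by (rule power_mult_distrib)
    also have "\<dots> = (\<Prod>j<2 * n. (\<integral>x. E (s j) x \<omega> \<partial>N))" unfolding cI by (intro prod.cong) (auto simp: s_def I_def)
    also have "\<dots> = (\<integral>z. (\<Prod>j<2 * n. E (s j) (z j) \<omega>) \<partial>PV)"
      unfolding PV_def by (rule PN.product_integral_prod[symmetric]) (auto intro: iE[OF \<omega>])
    also have "\<dots> = (\<integral>z. F z \<omega> \<partial>PV)"
      by (simp add: F_def E_def sum_distrib_left exp_sum)
    finally show ?thesis .
  qed
  interpret PM: pair_sigma_finite PV M ..
  interpret PMf: finite_measure "PV \<Otimes>\<^sub>M M" by (rule finite_measure_pair_measure) unfold_locales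
  have iF: "integrable (PV \<Otimes>\<^sub>M M) (\<lambda>(z, \<omega>). F z \<omega>)"
    by (rule PMf.integrable_const_bound[where B=1]) (use mF in \<open>auto simp: F_def\<close>)
  define m where "m = measure N (space N)"
  have Im: "cmod (I \<omega>) \<le> m" if "\<omega> \<in> space M" for \<omega>
  proof -
    have "cmod (I \<omega>) \<le> (\<integral>x. cmod (E \<beta> x \<omega>) \<partial>N)" unfolding I_def by (rule integral_norm_bound)
    then show ?thesis by (simp add: nE m_def)
  qed
  have iI: "integrable M (\<lambda>\<omega>. cmod (I \<omega>) ^ (2 * n))"
    by (rule M.integrable_const_bound[where B="m ^ (2 * n)"]) (auto intro!: AE_I2 power_mono Im)
  have "complex_of_real (\<integral>\<omega>. cmod (I \<omega>) ^ (2 * n) \<partial>M) = (\<integral>\<omega>. complex_of_real (cmod (I \<omega>) ^ (2 * n)) \<partial>M)"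
    by (rule integral_complex_of_real[symmetric])
  also have "\<dots> = (\<integral>\<omega>. (\<integral>z. F z \<omega> \<partial>PV) \<partial>M)" by (intro Bochner_Integration.integral_cong refl pow)
  also have "\<dots> = (\<integral>z. (\<integral>\<omega>. F z \<omega> \<partial>M) \<partial>PV)" using PM.Fubini_integral[OF iF] by simp
  finally have eq: "complex_of_real (\<integral>\<omega>. cmod (I \<omega>) ^ (2 * n) \<partial>M) = (\<integral>z. (\<integral>\<omega>. F z \<omega> \<partial>M) \<partial>PV)" .
  have i2: "integrable PV (\<lambda>z. \<integral>\<omega>. F z \<omega> \<partial>M)" using PM.integrable_fst[OF iF] .
  have "(\<integral>\<^sup>+\<omega>. ennreal (cmod (I \<omega>) ^ (2 * n)) \<partial>M) = ennreal (\<integral>\<omega>. cmod (I \<omega>) ^ (2 * n) \<partial>M)"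
    by (rule nn_integral_eq_integral[OF iI]) auto
  also have "\<dots> = ennreal (cmod (\<integral>z. (\<integral>\<omega>. F z \<omega> \<partial>M) \<partial>PV))"
    unfolding eq[symmetric] norm_of_real by (simp add: integral_nonneg_AE)
  also have "\<dots> \<le> (\<integral>\<^sup>+z. ennreal (cmod (\<integral>\<omega>. F z \<omega> \<partial>M)) \<partial>PV)" by (rule integral_norm_bound_ennreal[OF i2])
  also have "\<dots> \<le> (\<integral>\<^sup>+z. f z \<partial>PV)"
  proof (rule nn_integral_mono)
    fix z assume "z \<in> space PV"
    then have "z i \<in> R" if "i < 2 * n" for i using that by (auto simp: PV_def space_PiM sN PiE_def Pi_def)
    from bound[OF this] show "ennreal (cmod (\<integral>\<omega>. F z \<omega> \<partial>M)) \<le> f z" by (simp add: F_def s_def)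
  qed
  finally show "(\<integral>\<^sup>+\<omega>. ennreal (cmod (LINT x:R|lborel. exp (\<i> * complex_of_real (\<beta> * \<Gamma>c \<epsilon> x \<omega>))) ^ (2 * n)) \<partial>M)
      \<le> (\<integral>\<^sup>+z. f z \<partial>PiM {..<2 * n} (\<lambda>_. restrict_space lborel R))"
    unfolding LI I_def[symmetric] unfolding PV_def N_def .
qed

text \<open>For two given points both radii are at most the maximum of \<open>\<epsilon>\<close> and
  half their distance. If this is half the distance, the radii add up to at most the distance; if it
  is \<open>\<epsilon>\<close>, both radii equal \<open>\<epsilon>\<close>, whatever the
  overlap.\<close>

lemma nearest_neighbour_radii:
  fixes z :: "nat \<Rightarrow> real^2"
  assumes V: "finite V" and \<epsilon>: "0 < \<epsilon>" "\<epsilon> \<le> \<kappa>"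
  defines "r \<equiv> \<lambda>i. max \<epsilon> (min \<kappa> (Min ((\<lambda>j. dist (z i) (z j)) ` (V - {i})) / 2))"
  shows "\<epsilon> \<le> r i" "r i \<le> \<kappa>"
    "i \<in> V \<Longrightarrow> j \<in> V \<Longrightarrow> i \<noteq> j \<Longrightarrow> (r i = \<epsilon> \<and> r j = \<epsilon>) \<or> r i + r j \<le> dist (z i) (z j)"
proof -
  show "\<epsilon> \<le> r i" "r i \<le> \<kappa>" using \<epsilon> by (auto simp: r_def)
  assume ij: "i \<in> V" "j \<in> V" "i \<noteq> j"
  have le: "r i \<le> max \<epsilon> (dist (z i) (z j) / 2)" if "i \<in> V" "j \<in> V" "i \<noteq> j" for i j
  proof -
    have "Min ((\<lambda>j. dist (z i) (z j)) ` (V - {i})) \<le> dist (z i) (z j)" using V that by (intro Min_le) auto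
    then show ?thesis unfolding r_def by (auto simp: max_def min_def)
  qed
  have "r i \<le> max \<epsilon> (dist (z i) (z j) / 2)" "r j \<le> max \<epsilon> (dist (z i) (z j) / 2)"
    using le[OF ij] le[OF ij(2,1)] ij(3) by (auto simp: dist_commute)
  moreover have "\<epsilon> \<le> r i" "\<epsilon> \<le> r j" by (auto simp: r_def)
  ultimately show "(r i = \<epsilon> \<and> r j = \<epsilon>) \<or> r i + r j \<le> dist (z i) (z j)"
    by (cases "dist (z i) (z j) / 2 \<le> \<epsilon>") (simp_all only: max_absorb1 max_absorb2 not_le less_imp_le, auto)
qed

text \<open>The power of \<open>\<epsilon>\<close> gained from the self-energies cancels the
  normalisation of the chaos exactly, so the constant is uniform in
  \<open>\<epsilon>\<close>.\<close>

lemma rect_moment: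
  fixes D :: "(real^2) set" and \<Gamma>c :: "real \<Rightarrow> real^2 \<Rightarrow> 'a \<Rightarrow> real" and n :: nat
  assumes M: "prob_space M" and D: "open D" "bounded D" and G: "dirichlet_green D G" and gff: "gff M D G \<Gamma>"
    and ca: "circle_average_process M D \<Gamma> \<Gamma>c" and \<kappa>: "0 < \<kappa>" and \<beta>: "0 < \<beta>" "\<beta> < sqrt 2" and n: "0 < n"
  obtains C where "0 \<le> C"
    "\<And>\<epsilon> b1 b2 c1 c2. 0 < \<epsilon> \<Longrightarrow> \<epsilon> \<le> \<kappa> \<Longrightarrow> b1 \<le> b2 \<Longrightarrow> c1 \<le> c2 \<Longrightarrow>
      (\<And>x. x \<in> rect b1 b2 c1 c2 \<Longrightarrow> cball x (3 * \<kappa>) \<subseteq> D) \<Longrightarrow>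
      (\<integral>\<^sup>+\<omega>. ennreal (cmod (\<epsilon> powr (- (\<beta>\<^sup>2 / 2)) *\<^sub>R (LINT x:rect b1 b2 c1 c2|lborel. exp (\<i> * complex_of_real (\<beta> * \<Gamma>c \<epsilon> x \<omega>)))) ^ (2 * n)) \<partial>M)
        \<le> ennreal (C * ((b2 - b1) * (c2 - c1)) powr (real (2 * n) * (1 - \<beta>\<^sup>2 / 4)))"
proof -
  define a where "a = \<beta>\<^sup>2 / 2"
  have a: "0 < a" "a < 1"
  proof -
    show "0 < a" using \<beta> by (simp add: a_def)
    have "\<beta>\<^sup>2 < (sqrt 2)\<^sup>2" using \<beta> by (intro power_strict_mono) auto
    then show "a < 1" by (simp add: a_def)
  qed
  let ?V = "{..<2 * n}"
  have V: "finite ?V" "?V \<noteq> {}" using n by (auto simp: lessThan_empty_iff)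
  have Vi: "?V - {i} \<noteq> {}" if "i \<in> ?V" for i
  proof -
    have "(if i = 0 then 1 else 0) \<in> ?V - {i}" using n by auto
    then show ?thesis by blast
  qed
  obtain B where B: "0 \<le> B"
    and char: "\<And>(V :: nat set) (c :: nat \<Rightarrow> real) z r \<epsilon>. finite V \<Longrightarrow> 0 < \<epsilon> \<Longrightarrow> \<epsilon> \<le> \<kappa> \<Longrightarrow> (\<And>i. i \<in> V \<Longrightarrow> cball (z i) (3 * \<kappa>) \<subseteq> D) \<Longrightarrow>
      (\<And>i. i \<in> V \<Longrightarrow> \<epsilon> \<le> r i) \<Longrightarrow> (\<And>i. i \<in> V \<Longrightarrow> r i \<le> \<kappa>) \<Longrightarrow>
      (\<And>i j. i \<in> V \<Longrightarrow> j \<in> V \<Longrightarrow> i \<noteq> j \<Longrightarrow> (r i = \<epsilon> \<and> r j = \<epsilon>) \<or> r i + r j \<le> dist (z i) (z j)) \<Longrightarrow>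
      cmod (\<integral>\<omega>. exp (\<i> * complex_of_real (\<Sum>i\<in>V. c i * \<Gamma>c \<epsilon> (z i) \<omega>)) \<partial>M)
        \<le> exp (- (\<Sum>i\<in>V. (c i)\<^sup>2 * ln (r i / \<epsilon>)) / 2 + B * (\<Sum>i\<in>V. \<bar>c i\<bar>)\<^sup>2)"
    by (rule circle_average_char_bound[OF M D G gff ca \<kappa>]) blast
  obtain C where C: "0 \<le> C" and nn: "\<And>\<epsilon> b1 b2 c1 c2. b1 \<le> b2 \<Longrightarrow> c1 \<le> c2 \<Longrightarrow> rect b1 b2 c1 c2 \<subseteq> D \<Longrightarrow>
      (\<integral>\<^sup>+z. (\<Prod>i\<in>?V. ennreal (max \<epsilon> (min \<kappa> (Min ((\<lambda>j. dist (z i) (z j)) ` (?V - {i})) / 2)) powr - a))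
        \<partial>PiM ?V (\<lambda>_. restrict_space lborel (rect b1 b2 c1 c2)))
      \<le> ennreal (C * ((b2 - b1) * (c2 - c1)) powr (card ?V * (1 - a / 2)))"
    by (rule nn_integral_nearest_neighbour[OF \<kappa> a D(2) V(1) Vi V(2)]; blast)
  \<comment> \<open>The absolute values of the \<open>2 * n\<close> coefficients add up to
    \<open>2 * n * \<beta>\<close>.\<close>
  define b where "b = exp (B * (real (2 * n) * \<beta>)\<^sup>2)"
  show ?thesis
  proof (rule that[of "b * C"])
    show "0 \<le> b * C" using C by (simp add: b_def)
    fix \<epsilon> b1 b2 c1 c2 :: real
    assume \<epsilon>: "0 < \<epsilon>" "\<epsilon> \<le> \<kappa>" and bc: "b1 \<le> b2" "c1 \<le> c2" and sub: "\<And>x. x \<in> rect b1 b2 c1 c2 \<Longrightarrow> cball x (3 * \<kappa>) \<subseteq> D"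
    define R where "R = rect b1 b2 c1 c2"
    define r where "r z i = max \<epsilon> (min \<kappa> (Min ((\<lambda>j. dist (z i) (z j)) ` (?V - {i})) / 2))" for z :: "nat \<Rightarrow> real^2" and i
    define P where "P z = (\<Prod>i\<in>?V. ennreal (r z i powr - a))" for z
    let ?e = "\<epsilon> powr (a * real (2 * n))"
    have RD: "R \<subseteq> D" using sub \<kappa> by (force simp: R_def)
    have RU: "R \<subseteq> {x. cball x \<epsilon> \<subseteq> D}"
    proof
      fix x assume "x \<in> R"
      then have "cball x (3 * \<kappa>) \<subseteq> D" using sub by (simp add: R_def)
      moreover have "cball x \<epsilon> \<subseteq> cball x (3 * \<kappa>)" using \<epsilon> \<kappa> by (intro subset_cball) simp
      ultimately show "x \<in> {x. cball x \<epsilon> \<subseteq> D}" by blast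
    qed
    have bd: "ennreal (cmod (\<integral>\<omega>. exp (\<i> * complex_of_real (\<Sum>i<2 * n. (if i < n then \<beta> else - \<beta>) * \<Gamma>c \<epsilon> (z i) \<omega>)) \<partial>M)) \<le> ennreal (b * ?e) * P z"
      if z: "\<And>i. i < 2 * n \<Longrightarrow> z i \<in> R" for z
    proof -
      have rr: "0 < r z i" for i using nearest_neighbour_radii(1)[OF V(1) \<epsilon>, of z i] \<epsilon> unfolding r_def by linarith
      have "cmod (\<integral>\<omega>. exp (\<i> * complex_of_real (\<Sum>i<2 * n. (if i < n then \<beta> else - \<beta>) * \<Gamma>c \<epsilon> (z i) \<omega>)) \<partial>M)
        \<le> exp (- (\<Sum>i<2 * n. (if i < n then \<beta> else - \<beta>)\<^sup>2 * ln (r z i / \<epsilon>)) / 2 + B * (\<Sum>i<2 * n. \<bar>if i < n then \<beta> else - \<beta>\<bar>)\<^sup>2)"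
      proof (rule char[OF V(1) \<epsilon>])
        show "cball (z i) (3 * \<kappa>) \<subseteq> D" if "i \<in> ?V" for i using sub z that by (simp add: R_def)
        show "\<epsilon> \<le> r z i" "r z i \<le> \<kappa>" for i unfolding r_def by (rule nearest_neighbour_radii(1,2)[OF V(1) \<epsilon>])+
        show "(r z i = \<epsilon> \<and> r z j = \<epsilon>) \<or> r z i + r z j \<le> dist (z i) (z j)" if "i \<in> ?V" "j \<in> ?V" "i \<noteq> j" for i j
          unfolding r_def by (rule nearest_neighbour_radii(3)[OF V(1) \<epsilon> that])
      qed
      also have "(\<Sum>i<2 * n. \<bar>if i < n then \<beta> else - \<beta>\<bar>) = (\<Sum>i<2 * n. \<beta>)" using \<beta> by (intro sum.cong) auto
      also have "\<dots> = real (2 * n) * \<beta>" by simp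
      also have "(\<Sum>i<2 * n. (if i < n then \<beta> else - \<beta>)\<^sup>2 * ln (r z i / \<epsilon>)) = (\<Sum>i<2 * n. \<beta>\<^sup>2 * ln (r z i / \<epsilon>))"
        by (intro sum.cong) auto
      also have "- (\<Sum>i<2 * n. \<beta>\<^sup>2 * ln (r z i / \<epsilon>)) / 2 = (\<Sum>i<2 * n. - a * ln (r z i) + a * ln \<epsilon>)"
        unfolding sum_negf[symmetric] sum_divide_distrib
      proof (intro sum.cong refl)
        fix i
        have "ln (r z i / \<epsilon>) = ln (r z i) - ln \<epsilon>" using rr[of i] \<epsilon> by (simp add: ln_div)
        then show "- (\<beta>\<^sup>2 * ln (r z i / \<epsilon>)) / 2 = - a * ln (r z i) + a * ln \<epsilon>"
          by (simp add: a_def right_diff_distrib diff_divide_distrib)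
      qed
      also have "exp ((\<Sum>i<2 * n. - a * ln (r z i) + a * ln \<epsilon>) + B * (real (2 * n) * \<beta>)\<^sup>2) = (b * ?e) * (\<Prod>i<2 * n. r z i powr - a)"
      proof -
        have "exp (\<Sum>i<2 * n. - a * ln (r z i) + a * ln \<epsilon>) = (\<Prod>i<2 * n. r z i powr - a * \<epsilon> powr a)"
          unfolding exp_sum[OF V(1)]
        proof (intro prod.cong refl)
          fix i
          have "r z i powr - a = exp (- a * ln (r z i))" "\<epsilon> powr a = exp (a * ln \<epsilon>)"
            using rr[of i] \<epsilon> by (simp_all add: powr_def)
          then show "exp (- a * ln (r z i) + a * ln \<epsilon>) = r z i powr - a * \<epsilon> powr a" by (simp only: exp_add)
        qed
        also have "\<dots> = (\<Prod>i<2 * n. r z i powr - a) * ?e"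
          using \<epsilon> by (simp add: prod.distrib powr_powr flip: powr_realpow)
        finally show ?thesis by (simp add: exp_add b_def mult_ac)
      qed
      finally have "ennreal (cmod (\<integral>\<omega>. exp (\<i> * complex_of_real (\<Sum>i<2 * n. (if i < n then \<beta> else - \<beta>) * \<Gamma>c \<epsilon> (z i) \<omega>)) \<partial>M))
          \<le> ennreal ((b * ?e) * (\<Prod>i<2 * n. r z i powr - a))" by (rule ennreal_leI)
      also have "\<dots> = ennreal (b * ?e) * P z"
        unfolding P_def by (subst prod_ennreal) (auto simp: b_def ennreal_mult prod_nonneg)
      finally show ?thesis .
    qed
    have Rm: "R \<in> sets borel" unfolding R_def by measurable
    have Rf: "emeasure lborel R < \<infinity>" unfolding R_def using bc by (simp add: emeasure_rect)
    have caR: "(\<lambda>(x, \<omega>). \<Gamma>c \<epsilon> x \<omega>) \<in> borel_measurable (restrict_space borel {x. cball x \<epsilon> \<subseteq> D} \<Otimes>\<^sub>M M)"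
      using ca \<epsilon> by (simp add: circle_average_process_def)
    note mom = rect_moment_at[where n = n and f = "\<lambda>z. ennreal (b * ?e) * P z" and R = R and \<epsilon> = \<epsilon> and \<Gamma>c = \<Gamma>c and \<beta> = \<beta>,
      OF M Rm Rf caR RU \<beta>(1) bd]
    let ?J = "\<lambda>\<omega>. LINT x:R|lborel. exp (\<i> * complex_of_real (\<beta> * \<Gamma>c \<epsilon> x \<omega>))"
    have mJ[measurable]: "?J \<in> borel_measurable M" by (rule mom(1))
    have "(\<integral>\<^sup>+\<omega>. ennreal (cmod (\<epsilon> powr (- (\<beta>\<^sup>2 / 2)) *\<^sub>R ?J \<omega>) ^ (2 * n)) \<partial>M)
        = (\<integral>\<^sup>+\<omega>. ennreal (inverse ?e) * ennreal (cmod (?J \<omega>) ^ (2 * n)) \<partial>M)"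
    proof (intro nn_integral_cong)
      fix \<omega>
      have "(\<epsilon> powr - a) ^ (2 * n) = inverse ?e"
      proof -
        have "(\<epsilon> powr - a) ^ (2 * n) = \<epsilon> powr (- a * real (2 * n))" using \<epsilon> by (subst powr_power) (auto simp: mult_ac)
        also have "\<dots> = \<epsilon> powr - (a * real (2 * n))" by (simp only: mult_minus_left)
        also have "\<dots> = inverse ?e" by (rule powr_minus)
        finally show ?thesis .
      qed
      then show "ennreal (cmod (\<epsilon> powr (- (\<beta>\<^sup>2 / 2)) *\<^sub>R ?J \<omega>) ^ (2 * n)) = ennreal (inverse ?e) * ennreal (cmod (?J \<omega>) ^ (2 * n))"
        by (simp add: power_mult_distrib ennreal_mult flip: a_def)
    qed
    also have "\<dots> = ennreal (inverse ?e) * (\<integral>\<^sup>+\<omega>. ennreal (cmod (?J \<omega>) ^ (2 * n)) \<partial>M)"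
      by (intro nn_integral_cmult) measurable
    also have "\<dots> \<le> ennreal (inverse ?e) * (\<integral>\<^sup>+z. ennreal (b * ?e) * P z \<partial>PiM ?V (\<lambda>_. restrict_space lborel R))"
      by (intro mult_left_mono mom(2)) auto
    also have "(\<integral>\<^sup>+z. ennreal (b * ?e) * P z \<partial>PiM ?V (\<lambda>_. restrict_space lborel R)) = ennreal (b * ?e) * (\<integral>\<^sup>+z. P z \<partial>PiM ?V (\<lambda>_. restrict_space lborel R))"
    proof (rule nn_integral_cmult)
      have idN: "(\<lambda>x. x) \<in> measurable (restrict_space lborel R) borel" by (intro measurable_restrict_space1) measurable
      have z: "(\<lambda>z. z i) \<in> measurable (PiM ?V (\<lambda>_. restrict_space lborel R)) borel" if "i \<in> ?V" for i
        using measurable_compose[OF measurable_component_singleton[OF that, of "\<lambda>_. restrict_space lborel R"] idN] by simp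
      have "(\<lambda>z. r z i) \<in> borel_measurable (PiM ?V (\<lambda>_. restrict_space lborel R))" if i: "i \<in> ?V" for i
        unfolding r_def using V z i
        by (intro borel_measurable_max borel_measurable_min borel_measurable_const borel_measurable_divide borel_measurable_Min borel_measurable_dist) auto
      then have "(\<lambda>z. ennreal (r z i powr - a)) \<in> borel_measurable (PiM ?V (\<lambda>_. restrict_space lborel R))" if "i \<in> ?V" for i
        using that by measurable
      then show "P \<in> borel_measurable (PiM ?V (\<lambda>_. restrict_space lborel R))"
        unfolding P_def[abs_def] by (rule borel_measurable_prod_ennreal)
    qed
    also have "ennreal (inverse ?e) * (ennreal (b * ?e) * (\<integral>\<^sup>+z. P z \<partial>PiM ?V (\<lambda>_. restrict_space lborel R))) = ennreal b * (\<integral>\<^sup>+z. P z \<partial>PiM ?V (\<lambda>_. restrict_space lborel R))"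
    proof -
      have "inverse ?e * (b * ?e) = b" using \<epsilon> by simp
      then have "ennreal (inverse ?e) * ennreal (b * ?e) = ennreal b" by (simp add: b_def flip: ennreal_mult)
      then show ?thesis by (simp only: mult.assoc[symmetric])
    qed
    also have "\<dots> \<le> ennreal b * ennreal (C * ((b2 - b1) * (c2 - c1)) powr (card ?V * (1 - a / 2)))"
      using nn[OF bc RD[unfolded R_def], of \<epsilon>] by (intro mult_left_mono) (auto simp: P_def r_def R_def)
    also have "\<dots> = ennreal (b * C * ((b2 - b1) * (c2 - c1)) powr (real (2 * n) * (1 - \<beta>\<^sup>2 / 4)))"
      using C by (simp add: b_def a_def mult_ac flip: ennreal_mult)
    finally show "(\<integral>\<^sup>+\<omega>. ennreal (cmod (\<epsilon> powr (- (\<beta>\<^sup>2 / 2)) *\<^sub>R (LINT x:rect b1 b2 c1 c2|lborel. exp (\<i> * complex_of_real (\<beta> * \<Gamma>c \<epsilon> x \<omega>)))) ^ (2 * n)) \<partial>M)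
        \<le> ennreal (b * C * ((b2 - b1) * (c2 - c1)) powr (real (2 * n) * (1 - \<beta>\<^sup>2 / 4)))"
      unfolding R_def .
  qed
qed

section \<open>Increments over squares\<close>

text \<open>Along a sequence with summable \<open>L\<^sup>2\<close> errors the convergence is almost
  sure. The sequence is common to both limits, so that the difference of two masses converges along
  it and Fatou's lemma transfers moment bounds that are uniform in
  \<open>\<epsilon>\<close>.\<close>

lemma L2_tendsto_common_sequence:
  fixes X X' :: "real \<Rightarrow> 'a \<Rightarrow> complex"
  assumes L: "L2_tendsto M X Y (at_right 0)" "L2_tendsto M X' Y' (at_right 0)" and \<kappa>: "0 < \<kappa>"
    and m: "\<And>\<epsilon>. 0 < \<epsilon> \<Longrightarrow> \<epsilon> \<le> \<kappa> \<Longrightarrow> X \<epsilon> \<in> borel_measurable M" "\<And>\<epsilon>. 0 < \<epsilon> \<Longrightarrow> \<epsilon> \<le> \<kappa> \<Longrightarrow> X' \<epsilon> \<in> borel_measurable M"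
      "Y \<in> borel_measurable M" "Y' \<in> borel_measurable M"
  obtains e :: "nat \<Rightarrow> real" where "\<And>k. 0 < e k" "\<And>k. e k \<le> \<kappa>"
    "AE \<omega> in M. (\<lambda>k. X (e k) \<omega>) \<longlonglongrightarrow> Y \<omega>" "AE \<omega> in M. (\<lambda>k. X' (e k) \<omega>) \<longlonglongrightarrow> Y' \<omega>"
proof -
  have "\<exists>\<epsilon>. 0 < \<epsilon> \<and> \<epsilon> \<le> \<kappa> \<and> (\<integral>\<^sup>+\<omega>. ennreal ((norm (X \<epsilon> \<omega> - Y \<omega>))\<^sup>2) \<partial>M) < ennreal ((1 / 2) ^ k) \<and>
      (\<integral>\<^sup>+\<omega>. ennreal ((norm (X' \<epsilon> \<omega> - Y' \<omega>))\<^sup>2) \<partial>M) < ennreal ((1 / 2) ^ k)" for k :: nat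
  proof -
    have p: "(0 :: ennreal) < ennreal ((1 / 2) ^ k)" by simp
    have "eventually (\<lambda>\<epsilon>. (\<epsilon> \<in> {0<..<\<kappa>} \<and> (\<integral>\<^sup>+\<omega>. ennreal ((norm (X \<epsilon> \<omega> - Y \<omega>))\<^sup>2) \<partial>M) < ennreal ((1 / 2) ^ k)) \<and>
      (\<integral>\<^sup>+\<omega>. ennreal ((norm (X' \<epsilon> \<omega> - Y' \<omega>))\<^sup>2) \<partial>M) < ennreal ((1 / 2) ^ k)) (at_right 0)"
      by (intro eventually_conj eventually_at_right_real[OF \<kappa>] order_tendstoD(2)[OF L(1)[unfolded L2_tendsto_def] p]
          order_tendstoD(2)[OF L(2)[unfolded L2_tendsto_def] p])
    from eventually_happens'[OF trivial_limit_at_right_real this] show ?thesis by (auto intro: less_imp_le)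
  qed
  then have "\<exists>e. \<forall>k. 0 < e k \<and> e k \<le> \<kappa> \<and> (\<integral>\<^sup>+\<omega>. ennreal ((norm (X (e k) \<omega> - Y \<omega>))\<^sup>2) \<partial>M) < ennreal ((1 / 2) ^ k) \<and>
      (\<integral>\<^sup>+\<omega>. ennreal ((norm (X' (e k) \<omega> - Y' \<omega>))\<^sup>2) \<partial>M) < ennreal ((1 / 2) ^ k)" by (intro choice allI)
  then obtain e where e: "\<And>k. 0 < e k" "\<And>k. e k \<le> \<kappa>"
    "\<And>k. (\<integral>\<^sup>+\<omega>. ennreal ((norm (X (e k) \<omega> - Y \<omega>))\<^sup>2) \<partial>M) < ennreal ((1 / 2) ^ k)"
    "\<And>k. (\<integral>\<^sup>+\<omega>. ennreal ((norm (X' (e k) \<omega> - Y' \<omega>))\<^sup>2) \<partial>M) < ennreal ((1 / 2) ^ k)" by blast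
  have conv: "AE \<omega> in M. (\<lambda>k. U k \<omega>) \<longlonglongrightarrow> W \<omega>"
    if mU: "\<And>k. U k \<in> borel_measurable M" and mW: "W \<in> borel_measurable M"
      and b: "\<And>k. (\<integral>\<^sup>+\<omega>. ennreal ((norm (U k \<omega> - W \<omega>))\<^sup>2) \<partial>M) < ennreal ((1 / 2) ^ k)"
    for U :: "nat \<Rightarrow> 'a \<Rightarrow> complex" and W
  proof -
    note [measurable] = mU mW
    have "(\<integral>\<^sup>+\<omega>. (\<Sum>k. ennreal ((norm (U k \<omega> - W \<omega>))\<^sup>2)) \<partial>M) = (\<Sum>k. \<integral>\<^sup>+\<omega>. ennreal ((norm (U k \<omega> - W \<omega>))\<^sup>2) \<partial>M)"
      by (intro nn_integral_suminf) measurable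
    also have "\<dots> \<le> (\<Sum>k. ennreal ((1 / 2) ^ k))" using b by (intro suminf_le) (auto intro: less_imp_le)
    also have "\<dots> = ennreal (\<Sum>k. (1 / 2) ^ k)" by (intro suminf_ennreal2 summable_geometric) auto
    also have "\<dots> < \<infinity>" by simp
    finally have "(\<integral>\<^sup>+\<omega>. (\<Sum>k. ennreal ((norm (U k \<omega> - W \<omega>))\<^sup>2)) \<partial>M) \<noteq> \<infinity>" by simp
    then have "AE \<omega> in M. (\<Sum>k. ennreal ((norm (U k \<omega> - W \<omega>))\<^sup>2)) \<noteq> \<infinity>"
      by (intro nn_integral_PInf_AE) measurable
    then show ?thesis
    proof (eventually_elim)
      case (elim \<omega>)
      have "summable (\<lambda>k. (norm (U k \<omega> - W \<omega>))\<^sup>2)" by (rule summable_suminf_not_top) (use elim in auto)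
      then have "(\<lambda>k. (norm (U k \<omega> - W \<omega>))\<^sup>2) \<longlonglongrightarrow> 0" by (rule summable_LIMSEQ_zero)
      then have "(\<lambda>k. sqrt ((norm (U k \<omega> - W \<omega>))\<^sup>2)) \<longlonglongrightarrow> sqrt 0" by (rule tendsto_real_sqrt)
      then show ?case by (simp add: tendsto_norm_zero_iff LIM_zero_iff)
    qed
  qed
  show ?thesis
    by (rule that[OF e(1,2) conv[OF m(1)[OF e(1,2)] m(3) e(3)] conv[OF m(2)[OF e(1,2)] m(4) e(4)]])
qed

lemma nn_integral_AE_limit_le:
  fixes u :: "nat \<Rightarrow> 'a \<Rightarrow> ennreal"
  assumes [measurable]: "\<And>k. u k \<in> borel_measurable M" and lim: "AE \<omega> in M. (\<lambda>k. u k \<omega>) \<longlonglongrightarrow> v \<omega>"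
    and b: "\<And>k. (\<integral>\<^sup>+\<omega>. u k \<omega> \<partial>M) \<le> B"
  shows "(\<integral>\<^sup>+\<omega>. v \<omega> \<partial>M) \<le> B"
proof -
  have "(\<integral>\<^sup>+\<omega>. v \<omega> \<partial>M) = (\<integral>\<^sup>+\<omega>. liminf (\<lambda>k. u k \<omega>) \<partial>M)"
    using lim by (intro nn_integral_cong_AE) (auto elim!: eventually_mono simp: lim_imp_Liminf)
  also have "\<dots> \<le> liminf (\<lambda>k. \<integral>\<^sup>+\<omega>. u k \<omega> \<partial>M)" by (rule nn_integral_liminf) measurable
  also have "\<dots> \<le> liminf (\<lambda>k. B)" using b by (intro Liminf_mono always_eventually) auto
  also have "\<dots> = B" by (simp add: Liminf_const)
  finally show ?thesis .
qed

text \<open>The indicator of a half-open interval is a difference of indicators of two half-lines,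
  one for each end. The left ends and the right ends are compared separately, and the sign records
  the direction of the move.\<close>

lemma indicator_interval_diff:
  fixes a b a' b' t :: real
  assumes "a \<le> b" "a' \<le> b'"
  shows "indicator {a..<b} t - indicator {a'..<b'} t
    = (if a \<le> a' then 1 else - 1) * indicator {min a a'..<max a a'} t - (if b \<le> b' then 1 else - 1) * (indicator {min b b'..<max b b'} t :: real)"
  using assms by (auto split: split_indicator simp: min_def max_def)

lemma power_sum4_le:
  fixes x1 x2 x3 x4 :: real
  assumes "0 \<le> x1" "0 \<le> x2" "0 \<le> x3" "0 \<le> x4"
  shows "(x1 + x2 + x3 + x4) ^ m \<le> 4 ^ m * (x1 ^ m + x2 ^ m + x3 ^ m + x4 ^ m)"
proof -
  define y where "y = max (max x1 x2) (max x3 x4)"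
  have "x1 + x2 + x3 + x4 \<le> 4 * y" by (auto simp: y_def max_def)
  then have "(x1 + x2 + x3 + x4) ^ m \<le> (4 * y) ^ m" using assms by (intro power_mono) auto
  also have "y ^ m \<le> x1 ^ m + x2 ^ m + x3 ^ m + x4 ^ m" using assms by (auto simp: y_def max_def)
  then have "(4 * y) ^ m \<le> 4 ^ m * (x1 ^ m + x2 ^ m + x3 ^ m + x4 ^ m)" by (simp add: power_mult_distrib)
  finally show ?thesis .
qed

text \<open>The difference of two squares is a signed sum of four thin rectangles, obtained by moving the
  four sides one after the other.\<close>

lemma set_integral_squares_diff:
  fixes f :: "real^2 \<Rightarrow> complex" and x x' :: "real^2"
  assumes r: "0 \<le> r" "0 \<le> r'"
    and W: "W \<in> sets borel" "emeasure lborel W < \<infinity>" and f: "(\<lambda>z. indicator W z *\<^sub>R f z) \<in> borel_measurable borel" "\<And>z. cmod (f z) \<le> 1"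
  defines "a \<equiv> x $ 1 - r" and "b \<equiv> x $ 1 + r" and "c \<equiv> x $ 2 - r" and "d \<equiv> x $ 2 + r"
    and "a' \<equiv> x' $ 1 - r'" and "b' \<equiv> x' $ 1 + r'" and "c' \<equiv> x' $ 2 - r'" and "d' \<equiv> x' $ 2 + r'"
  defines "R1 \<equiv> rect (min a a') (max a a') c d" and "R2 \<equiv> rect (min b b') (max b b') c d"
    and "R3 \<equiv> rect a' b' (min c c') (max c c')" and "R4 \<equiv> rect a' b' (min d d') (max d d')"
  assumes sub: "Q x r \<subseteq> W" "Q x' r' \<subseteq> W" "R1 \<subseteq> W" "R2 \<subseteq> W" "R3 \<subseteq> W" "R4 \<subseteq> W"
  shows "cmod ((LINT z:Q x r|lborel. f z) - (LINT z:Q x' r'|lborel. f z))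
    \<le> cmod (LINT z:R1|lborel. f z) + cmod (LINT z:R2|lborel. f z) + cmod (LINT z:R3|lborel. f z) + cmod (LINT z:R4|lborel. f z)"
proof -
  \<comment> \<open>Only on \<open>W\<close> is \<open>f\<close> known to be measurable. The
    extension by zero is a Borel function, and all six sets of integration lie in
    \<open>W\<close>.\<close>
  define F where "F z = indicator W z *\<^sub>R f z" for z
  have [measurable]: "F \<in> borel_measurable borel" using f(1) unfolding F_def .
  have LF: "(LINT z:A|lborel. f z) = (\<integral>z. indicator A z *\<^sub>R F z \<partial>lborel)" if "A \<subseteq> W" for A
    unfolding set_lebesgue_integral_def F_def using that by (intro Bochner_Integration.integral_cong) (auto split: split_indicator)
  have iF: "integrable lborel F"
  proof (rule integrableI_bounded)
    have "(\<integral>\<^sup>+z. ennreal (norm (F z)) \<partial>lborel) \<le> (\<integral>\<^sup>+z. indicator W z \<partial>lborel)"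
      using f(2) by (intro nn_integral_mono) (auto simp: F_def split: split_indicator)
    also have "\<dots> < \<infinity>" using W by simp
    finally show "(\<integral>\<^sup>+z. ennreal (norm (F z)) \<partial>lborel) < \<infinity>" .
  qed measurable
  have iR: "integrable lborel (\<lambda>z. indicator A z *\<^sub>R F z)" if "A \<in> sets borel" for A
    using iF that by (intro integrable_mult_indicator) auto
  \<comment> \<open>The closed square and the half-open rectangle differ only on two lines, which
    are null sets.\<close>
  have Qr: "AE z in lborel. indicator (Q y s) z = (indicator (rect (y $ 1 - s) (y $ 1 + s) (y $ 2 - s) (y $ 2 + s)) z :: real)" for y :: "real^2" and s
    using AE_component_neq[where i=1 and c="y $ 1 + s"] AE_component_neq[where i=2 and c="y $ 2 + s"]
  proof eventually_elim
    case (elim z)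
    have "z \<in> Q y s \<longleftrightarrow> z \<in> rect (y $ 1 - s) (y $ 1 + s) (y $ 2 - s) (y $ 2 + s)"
      using elim by (auto simp: mem_Q rect_def abs_le_iff)
    then show ?case by (simp split: split_indicator)
  qed
  have Qm: "Q y s \<in> sets borel" for y s unfolding Q_def by (intro borel_closed closed_cbox)
  have Qi: "(\<integral>z. indicator (Q y s) z *\<^sub>R F z \<partial>lborel) = (\<integral>z. indicator (rect (y $ 1 - s) (y $ 1 + s) (y $ 2 - s) (y $ 2 + s)) z *\<^sub>R F z \<partial>lborel)" for y :: "real^2" and s
  proof (rule integral_cong_AE)
    note [measurable] = Qm
    show "(\<lambda>z. indicator (Q y s) z *\<^sub>R F z) \<in> borel_measurable lborel" by measurable
    show "(\<lambda>z. indicator (rect (y $ 1 - s) (y $ 1 + s) (y $ 2 - s) (y $ 2 + s)) z *\<^sub>R F z) \<in> borel_measurable lborel" by measurable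
    show "AE z in lborel. indicator (Q y s) z *\<^sub>R F z = indicator (rect (y $ 1 - s) (y $ 1 + s) (y $ 2 - s) (y $ 2 + s)) z *\<^sub>R F z"
      using Qr[of y s] by eventually_elim simp
  qed
  have ord: "a \<le> b" "c \<le> d" "a' \<le> b'" "c' \<le> d'" using r by (auto simp: a_def b_def c_def d_def a'_def b'_def c'_def d'_def)
  define s :: "real \<Rightarrow> real \<Rightarrow> real" where "s p q = (if p \<le> q then 1 else - 1)" for p q
  have ind: "indicator (rect a b c d) z - indicator (rect a' b' c' d') z
      = s a a' * indicator R1 z - s b b' * indicator R2 z + s c c' * indicator R3 z - s d d' * (indicator R4 z :: real)" for z :: "real^2"
  proof -
    have 1: "indicator {a..<b} (z $ 1) - indicator {a'..<b'} (z $ 1) = s a a' * indicator {min a a'..<max a a'} (z $ 1) - s b b' * (indicator {min b b'..<max b b'} (z $ 1) :: real)"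
      unfolding s_def by (rule indicator_interval_diff[OF ord(1,3)])
    have 2: "indicator {c..<d} (z $ 2) - indicator {c'..<d'} (z $ 2) = s c c' * indicator {min c c'..<max c c'} (z $ 2) - s d d' * (indicator {min d d'..<max d d'} (z $ 2) :: real)"
      unfolding s_def by (rule indicator_interval_diff[OF ord(2,4)])
    \<comment> \<open>The first interval is changed while the second is kept, then the second while
      the first is already the new one. So \<open>R1\<close> and \<open>R2\<close> have the height
      of the old square, and \<open>R3\<close> and \<open>R4\<close> the width of the new
      one.\<close>
    have "indicator (rect a b c d) z - indicator (rect a' b' c' d') z
      = (indicator {a..<b} (z $ 1) - indicator {a'..<b'} (z $ 1)) * indicator {c..<d} (z $ 2)
        + indicator {a'..<b'} (z $ 1) * (indicator {c..<d} (z $ 2) - (indicator {c'..<d'} (z $ 2) :: real))"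
      unfolding indicator_rect by (simp add: algebra_simps)
    also have "\<dots> = s a a' * indicator R1 z - s b b' * indicator R2 z + s c c' * indicator R3 z - s d d' * (indicator R4 z :: real)"
      unfolding 1 2 R1_def R2_def R3_def R4_def indicator_rect by (simp add: algebra_simps)
    finally show ?thesis .
  qed
  have Rm: "R1 \<in> sets borel" "R2 \<in> sets borel" "R3 \<in> sets borel" "R4 \<in> sets borel"
    unfolding R1_def R2_def R3_def R4_def by measurable
  have "(LINT z:Q x r|lborel. f z) - (LINT z:Q x' r'|lborel. f z)
      = (\<integral>z. indicator (rect a b c d) z *\<^sub>R F z - indicator (rect a' b' c' d') z *\<^sub>R F z \<partial>lborel)"
    unfolding LF[OF sub(1)] LF[OF sub(2)] Qi a_def b_def c_def d_def a'_def b'_def c'_def d'_def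
    by (rule Bochner_Integration.integral_diff[symmetric]) (intro iR rect_measurable)+
  also have "\<dots> = (\<integral>z. s a a' *\<^sub>R (indicator R1 z *\<^sub>R F z) - s b b' *\<^sub>R (indicator R2 z *\<^sub>R F z) + s c c' *\<^sub>R (indicator R3 z *\<^sub>R F z) - s d d' *\<^sub>R (indicator R4 z *\<^sub>R F z) \<partial>lborel)"
  proof (intro Bochner_Integration.integral_cong refl)
    fix z
    have "indicator (rect a b c d) z *\<^sub>R F z - indicator (rect a' b' c' d') z *\<^sub>R F z = (indicator (rect a b c d) z - indicator (rect a' b' c' d') z) *\<^sub>R F z"
      by (simp add: scaleR_left_diff_distrib)
    also have "\<dots> = s a a' *\<^sub>R (indicator R1 z *\<^sub>R F z) - s b b' *\<^sub>R (indicator R2 z *\<^sub>R F z) + s c c' *\<^sub>R (indicator R3 z *\<^sub>R F z) - s d d' *\<^sub>R (indicator R4 z *\<^sub>R F z)"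
      unfolding ind by (simp only: scaleR_left_diff_distrib scaleR_left_distrib scaleR_scaleR)
    finally show "indicator (rect a b c d) z *\<^sub>R F z - indicator (rect a' b' c' d') z *\<^sub>R F z
      = s a a' *\<^sub>R (indicator R1 z *\<^sub>R F z) - s b b' *\<^sub>R (indicator R2 z *\<^sub>R F z) + s c c' *\<^sub>R (indicator R3 z *\<^sub>R F z) - s d d' *\<^sub>R (indicator R4 z *\<^sub>R F z)" .
  qed
  also have "\<dots> = s a a' *\<^sub>R (LINT z:R1|lborel. f z) - s b b' *\<^sub>R (LINT z:R2|lborel. f z) + s c c' *\<^sub>R (LINT z:R3|lborel. f z) - s d d' *\<^sub>R (LINT z:R4|lborel. f z)"
    unfolding LF[OF sub(3)] LF[OF sub(4)] LF[OF sub(5)] LF[OF sub(6)]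
    using iR[OF Rm(1)] iR[OF Rm(2)] iR[OF Rm(3)] iR[OF Rm(4)]
    by (simp add: Bochner_Integration.integral_diff Bochner_Integration.integral_add integrable_scaleR_right del: scaleR_scaleR)
  finally have eq: "(LINT z:Q x r|lborel. f z) - (LINT z:Q x' r'|lborel. f z)
    = s a a' *\<^sub>R (LINT z:R1|lborel. f z) - s b b' *\<^sub>R (LINT z:R2|lborel. f z) + s c c' *\<^sub>R (LINT z:R3|lborel. f z) - s d d' *\<^sub>R (LINT z:R4|lborel. f z)" .
  have ns: "norm (s p q *\<^sub>R (y :: complex)) = norm y" for p q y by (simp add: s_def)
  have tri: "norm (u1 - u2 + u3 - u4) \<le> norm u1 + norm u2 + norm u3 + norm u4" for u1 u2 u3 u4 :: complex
    by (meson norm_triangle_ineq norm_triangle_ineq4 add_mono order_refl order_trans)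
  show ?thesis unfolding eq using tri[of "s a a' *\<^sub>R (LINT z:R1|lborel. f z)" "s b b' *\<^sub>R (LINT z:R2|lborel. f z)" "s c c' *\<^sub>R (LINT z:R3|lborel. f z)" "s d d' *\<^sub>R (LINT z:R4|lborel. f z)"]
    unfolding ns .
qed

text \<open>The chaining works with the Euclidean norm whereas the final estimate allows any norm.
  The lower constant is the minimum of \<open>N\<close> on the unit sphere, attained by
  compactness.\<close>

lemma is_norm_equivalent:
  fixes N :: "'v::euclidean_space \<Rightarrow> real"
  assumes N: "is_norm N"
  obtains c1 c2 where "0 < c1" "0 < c2" "\<And>v. c1 * norm v \<le> N v" "\<And>v. N v \<le> c2 * norm v"
proof -
  have n0: "0 \<le> N v" and nz: "N v = 0 \<Longrightarrow> v = 0" and sc: "N (c *\<^sub>R v) = \<bar>c\<bar> * N v" and tri: "N (v + w) \<le> N v + N w" for v w c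
    using N by (auto simp: is_norm_def)
  have N0: "N 0 = 0" using sc[of 0 0] by simp
  define c2 where "c2 = (\<Sum>b\<in>Basis. N (b :: 'v)) + 1"
  have c2: "0 < c2" using n0 by (simp add: c2_def add_nonneg_pos sum_nonneg)
  have up: "N v \<le> c2 * norm v" for v
  proof -
    have sumN: "N (\<Sum>b\<in>A. (v \<bullet> b) *\<^sub>R b) \<le> (\<Sum>b\<in>A. norm v * N b)" if "finite A" "A \<subseteq> Basis" for A
      using that
    proof (induction A rule: finite_induct)
      case (insert b A)
      have "N ((v \<bullet> b) *\<^sub>R b) \<le> norm v * N b"
        unfolding sc using insert Basis_le_norm[of b v] n0 by (intro mult_right_mono) auto
      then show ?case using insert tri[of "(v \<bullet> b) *\<^sub>R b" "\<Sum>b\<in>A. (v \<bullet> b) *\<^sub>R b"] by auto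
    qed (simp add: N0)
    have "N v = N (\<Sum>b\<in>Basis. (v \<bullet> b) *\<^sub>R b)" by (simp add: euclidean_representation)
    also have "\<dots> \<le> (\<Sum>b\<in>Basis. norm v * N b)" by (rule sumN) auto
    also have "\<dots> \<le> c2 * norm v" by (simp add: c2_def sum_distrib_left distrib_right distrib_left mult.commute)
    finally show ?thesis .
  qed
  have "\<bar>N v - N w\<bar> \<le> c2 * dist v w" for v w
    using tri[of "v - w" w] tri[of "w - v" v] up[of "v - w"] up[of "w - v"] by (simp add: dist_norm norm_minus_commute abs_le_iff)
  then have "continuous_on (sphere 0 1) N"
    unfolding continuous_on_iff
  proof (intro ballI allI impI)
    fix v :: 'v and e :: real assume e: "0 < e" and l: "\<And>v w. \<bar>N v - N w\<bar> \<le> c2 * dist v w"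
    show "\<exists>d>0. \<forall>x'\<in>sphere 0 1. dist x' v < d \<longrightarrow> dist (N x') (N v) < e"
    proof (intro exI[of _ "e / c2"] conjI ballI impI)
      fix w assume "dist w v < e / c2"
      then have "c2 * dist w v < e" using c2 by (simp add: pos_less_divide_eq mult.commute)
      then show "dist (N w) (N v) < e" using l[of w v] by (simp add: dist_real_def)
    qed (use e c2 in simp)
  qed
  moreover have "sphere (0 :: 'v) 1 \<noteq> {}" by simp
  ultimately obtain v0 where v0: "v0 \<in> sphere 0 1" "\<And>v. v \<in> sphere 0 1 \<Longrightarrow> N v0 \<le> N v"
    using continuous_attains_inf[of "sphere (0 :: 'v) 1" N] by auto
  have "v0 \<noteq> 0" using v0(1) by auto
  then have c1: "0 < N v0" using n0[of v0] nz[of v0] by (cases "N v0 = 0") auto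
  have low: "N v0 * norm v \<le> N v" for v
  proof (cases "v = 0")
    case False
    have "N v0 \<le> N ((1 / norm v) *\<^sub>R v)" using False by (intro v0(2)) simp
    also have "\<dots> = N v / norm v" unfolding sc by simp
    finally show ?thesis using False by (simp add: pos_le_divide_eq)
  qed (simp add: N0)
  show ?thesis by (rule that[OF c1 c2 low up])
qed

section \<open>Moments of increments of the chaos\<close>

lemma chaos_mass_increment_moment:
  fixes D :: "(real^2) set" and \<Gamma>c :: "real \<Rightarrow> real^2 \<Rightarrow> 'a \<Rightarrow> real" and n :: nat and \<mu> :: "(real^2) set \<Rightarrow> 'a \<Rightarrow> complex"
  assumes M: "prob_space M" and D: "open D" "bounded D" and G: "dirichlet_green D G" and gff: "gff M D G \<Gamma>"
    and ca: "circle_average_process M D \<Gamma> \<Gamma>c" and \<kappa>: "0 < \<kappa>" and \<beta>: "0 < \<beta>" "\<beta> < sqrt 2" and n: "0 < n"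
    and \<mu>: "\<And>x r. (x, r) \<in> squares D \<Longrightarrow> chaos_mass M \<beta> \<Gamma>c (Q x r) (\<mu> (Q x r))"
  obtains C where "0 \<le> C"
    "\<And>x r x' r' h. (x, r) \<in> inner_squares D \<kappa> \<Longrightarrow> (x', r') \<in> inner_squares D \<kappa> \<Longrightarrow> 0 < h \<Longrightarrow> h \<le> \<kappa> / 8 \<Longrightarrow>
      near h (x, r) (x', r') \<Longrightarrow>
      (\<integral>\<^sup>+\<omega>. ennreal (cmod (\<mu> (Q x r) \<omega> - \<mu> (Q x' r') \<omega>) ^ (2 * n)) \<partial>M)
        \<le> ennreal (C * (max r r' * h) powr (real (2 * n) * (1 - \<beta>\<^sup>2 / 4)))"
proof -
  \<comment> \<open>The margin that remains on the thin rectangles is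
    \<open>3 * k = \<kappa> / 2\<close>; their points lie within
    \<open>2 * h \<le> \<kappa> / 4\<close> of one of the squares.\<close>
  define k where "k = \<kappa> / 6"
  have k: "0 < k" "3 * k = \<kappa> / 2" using \<kappa> by (auto simp: k_def)
  define g where "g = real (2 * n) * (1 - \<beta>\<^sup>2 / 4)"
  have "\<beta>\<^sup>2 < (sqrt 2)\<^sup>2" using \<beta> by (intro power_strict_mono) auto
  then have g: "0 < g" using n by (simp add: g_def)
  obtain C where C: "0 \<le> C"
    and mom: "\<And>\<epsilon> b1 b2 c1 c2. 0 < \<epsilon> \<Longrightarrow> \<epsilon> \<le> k \<Longrightarrow> b1 \<le> b2 \<Longrightarrow> c1 \<le> c2 \<Longrightarrow>
      (\<And>x. x \<in> rect b1 b2 c1 c2 \<Longrightarrow> cball x (3 * k) \<subseteq> D) \<Longrightarrow>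
      (\<integral>\<^sup>+\<omega>. ennreal (cmod (\<epsilon> powr (- (\<beta>\<^sup>2 / 2)) *\<^sub>R (LINT x:rect b1 b2 c1 c2|lborel. exp (\<i> * complex_of_real (\<beta> * \<Gamma>c \<epsilon> x \<omega>)))) ^ (2 * n)) \<partial>M)
        \<le> ennreal (C * ((b2 - b1) * (c2 - c1)) powr g)"
    using rect_moment[OF M D G gff ca k(1) \<beta> n] unfolding g_def by blast
  \<comment> \<open>The factor \<open>4 ^ (2 * n)\<close> comes from the power of a sum of four
    terms, the next 4 from adding four moments, and \<open>4 powr g\<close> from the area bound
    \<open>(2 * h) * (2 * max r r')\<close>.\<close>
  define C' where "C' = 4 ^ (2 * n) * (4 * (C * 4 powr g))"
  have C': "0 \<le> C'" using C by (simp add: C'_def)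
  have "(\<integral>\<^sup>+\<omega>. ennreal (cmod (\<mu> (Q x r) \<omega> - \<mu> (Q x' r') \<omega>) ^ (2 * n)) \<partial>M) \<le> ennreal (C' * (max r r' * h) powr g)"
    if p: "(x, r) \<in> inner_squares D \<kappa>" and q: "(x', r') \<in> inner_squares D \<kappa>" and h: "0 < h" "h \<le> \<kappa> / 8"
      and nr: "near h (x, r) (x', r')" for x r x' r' h
  proof -
    have r: "0 \<le> r" "0 \<le> r'" using p q by (auto simp: inner_squares_def)
    have xs: "\<bar>x $ 1 - x' $ 1\<bar> \<le> h" "\<bar>x $ 2 - x' $ 2\<bar> \<le> h" "\<bar>r - r'\<bar> \<le> h" using nr by (auto simp: near_def)
    define a b c d where "a = x $ 1 - r" and "b = x $ 1 + r" and "c = x $ 2 - r" and "d = x $ 2 + r"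
    define a' b' c' d' where "a' = x' $ 1 - r'" and "b' = x' $ 1 + r'" and "c' = x' $ 2 - r'" and "d' = x' $ 2 + r'"
    note defs = a_def b_def c_def d_def a'_def b'_def c'_def d'_def
    define R1 where "R1 = rect (min a a') (max a a') c d"
    define R2 where "R2 = rect (min b b') (max b b') c d"
    define R3 where "R3 = rect a' b' (min c c') (max c c')"
    define R4 where "R4 = rect a' b' (min d d') (max d d')"
    note Rdefs = R1_def R2_def R3_def R4_def
    have diffs: "\<bar>a - a'\<bar> \<le> 2 * h" "\<bar>b - b'\<bar> \<le> 2 * h" "\<bar>c - c'\<bar> \<le> 2 * h" "\<bar>d - d'\<bar> \<le> 2 * h"
      using xs by (auto simp: defs)
    have QD: "cball z \<kappa> \<subseteq> D" if "z \<in> Q x r \<or> z \<in> Q x' r'" for z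
      using that p q by (auto simp: inner_squares_def)
    \<comment> \<open>A point of a thin rectangle is compared with its projection, with coordinates
      \<open>u\<close> and \<open>v\<close>, onto the side of the square that is being
      moved.\<close>
    have cbv: "cball z (3 * k) \<subseteq> D" if "vector [u, v] \<in> Q x r \<or> vector [u, v] \<in> Q x' r'" "\<bar>z $ 1 - u\<bar> + \<bar>z $ 2 - v\<bar> \<le> 2 * h"
      for z :: "real^2" and u v
    proof -
      have "dist z (vector [u, v]) \<le> (\<Sum>i\<in>UNIV. \<bar>(z - vector [u, v]) $ i\<bar>)" unfolding dist_norm by (rule norm_le_l1_cart)
      also have "\<dots> \<le> 2 * h" using that(2) by (simp add: sum_2)
      finally have "dist z (vector [u, v]) + 3 * k \<le> \<kappa>" using h k(2) by simp
      then have "cball z (3 * k) \<subseteq> cball (vector [u, v]) \<kappa>" by (subst cball_subset_cball_iff) (auto simp: dist_commute)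
      then show ?thesis using QD[OF that(1)] by blast
    qed
    have cb1: "cball z (3 * k) \<subseteq> D" if "z \<in> R1" for z
      by (rule cbv[of a "z $ 2"]) (use that diffs(1) r in \<open>auto simp: R1_def rect_def mem_Q defs\<close>)
    have cb2: "cball z (3 * k) \<subseteq> D" if "z \<in> R2" for z
      by (rule cbv[of b "z $ 2"]) (use that diffs(2) r in \<open>auto simp: R2_def rect_def mem_Q defs\<close>)
    have cb3: "cball z (3 * k) \<subseteq> D" if "z \<in> R3" for z
      by (rule cbv[of "z $ 1" c']) (use that diffs(3) r in \<open>auto simp: R3_def rect_def mem_Q defs\<close>)
    have cb4: "cball z (3 * k) \<subseteq> D" if "z \<in> R4" for z
      by (rule cbv[of "z $ 1" d']) (use that diffs(4) r in \<open>auto simp: R4_def rect_def mem_Q defs\<close>)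
    have cbQ: "cball z (3 * k) \<subseteq> D" if "z \<in> Q x r \<or> z \<in> Q x' r'" for z
      using QD[OF that] subset_cball[of "3 * k" \<kappa> z] k(2) \<kappa> by auto
    \<comment> \<open>One set that contains every set of integration and on which the discs of
      radius up to \<open>k\<close> stay in the domain.\<close>
    define W where "W = Q x r \<union> Q x' r' \<union> R1 \<union> R2 \<union> R3 \<union> R4"
    have WD: "cball z (3 * k) \<subseteq> D" if "z \<in> W" for z
      using that cb1 cb2 cb3 cb4 cbQ unfolding W_def by blast
    have WU: "W \<subseteq> {z. cball z \<epsilon> \<subseteq> D}" if "\<epsilon> \<le> k" for \<epsilon>
    proof
      fix z assume "z \<in> W"
      then have "cball z (3 * k) \<subseteq> D" by (rule WD)
      moreover have "cball z \<epsilon> \<subseteq> cball z (3 * k)" using that k(1) by (intro subset_cball) simp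
      ultimately show "z \<in> {z. cball z \<epsilon> \<subseteq> D}" by auto
    qed
    have "W \<subseteq> D" using WD k(1) by force
    then have Wb: "bounded W" using D(2) bounded_subset by blast
    have Qm: "Q y s \<in> sets borel" for y s unfolding Q_def by (intro borel_closed closed_cbox)
    have Rm: "R1 \<in> sets borel" "R2 \<in> sets borel" "R3 \<in> sets borel" "R4 \<in> sets borel"
      unfolding Rdefs by measurable
    have Wm: "W \<in> sets borel" unfolding W_def using Qm Rm by auto
    have fin: "emeasure lborel A < \<infinity>" if "A \<subseteq> W" for A
      using emeasure_bounded_finite[OF bounded_subset[OF Wb that]] by simp
    define f where "f \<epsilon> \<omega> z = exp (\<i> * complex_of_real (\<beta> * \<Gamma>c \<epsilon> z \<omega>))" for \<epsilon> \<omega> z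
    define J where "J A \<epsilon> \<omega> = \<epsilon> powr (- (\<beta>\<^sup>2 / 2)) *\<^sub>R (LINT z:A|lborel. f \<epsilon> \<omega> z)" for A \<epsilon> \<omega>
    have cam: "(\<lambda>(x, \<omega>). \<Gamma>c \<epsilon> x \<omega>) \<in> borel_measurable (restrict_space borel {x. cball x \<epsilon> \<subseteq> D} \<Otimes>\<^sub>M M)" if "0 < \<epsilon>" for \<epsilon>
      using ca that by (auto simp: circle_average_process_def)
    have Jm: "J A \<epsilon> \<in> borel_measurable M" if "0 < \<epsilon>" "\<epsilon> \<le> k" "A \<in> sets borel" "A \<subseteq> W" for A \<epsilon>
    proof -
      \<comment> \<open>Only measurability is wanted here, so the moment lemma is taken with
        \<open>n = 0\<close> and the trivial bound.\<close>
      have "(\<lambda>\<omega>. LINT z:A|lborel. f \<epsilon> \<omega> z) \<in> borel_measurable M"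
        unfolding f_def
        by (rule rect_moment_at(1)[where \<Gamma>c = \<Gamma>c and \<epsilon> = \<epsilon> and n = 0 and f = "\<lambda>_. top",
              OF M that(3) fin[OF that(4)] cam[OF that(1)] order_trans[OF that(4) WU[OF that(2)]] \<beta>(1)]) simp
      then show ?thesis unfolding J_def by measurable
    qed
    have fm: "(\<lambda>z. indicator W z *\<^sub>R f \<epsilon> \<omega> z) \<in> borel_measurable borel" if "0 < \<epsilon>" "\<epsilon> \<le> k" "\<omega> \<in> space M" for \<epsilon> \<omega>
    proof -
      have "(\<lambda>z. \<Gamma>c \<epsilon> z \<omega>) \<in> borel_measurable (restrict_space borel {x. cball x \<epsilon> \<subseteq> D})"
        using measurable_Pair1[OF cam[OF that(1)] that(3)] by simp
      then have [measurable]: "(\<lambda>z. \<Gamma>c \<epsilon> z \<omega>) \<in> borel_measurable (restrict_space borel W)"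
        by (rule measurable_restrict_mono[OF _ WU[OF that(2)]])
      have "f \<epsilon> \<omega> \<in> borel_measurable (restrict_space borel W)" unfolding f_def by measurable
      then show ?thesis by (subst (asm) borel_measurable_restrict_space_iff) (use Wm in auto)
    qed
    have Jb: "cmod (J (Q x r) \<epsilon> \<omega> - J (Q x' r') \<epsilon> \<omega>) ^ (2 * n)
        \<le> 4 ^ (2 * n) * (cmod (J R1 \<epsilon> \<omega>) ^ (2 * n) + cmod (J R2 \<epsilon> \<omega>) ^ (2 * n) + cmod (J R3 \<epsilon> \<omega>) ^ (2 * n) + cmod (J R4 \<epsilon> \<omega>) ^ (2 * n))"
      if "0 < \<epsilon>" "\<epsilon> \<le> k" "\<omega> \<in> space M" for \<epsilon> \<omega>
    proof -
      let ?I = "\<lambda>A. LINT z:A|lborel. f \<epsilon> \<omega> z" and ?e = "\<epsilon> powr (- (\<beta>\<^sup>2 / 2))"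
      have d: "cmod (?I (Q x r) - ?I (Q x' r')) \<le> cmod (?I R1) + cmod (?I R2) + cmod (?I R3) + cmod (?I R4)"
        unfolding Rdefs defs
        by (rule set_integral_squares_diff[OF r Wm fin[OF order_refl] fm[OF that]])
          (auto simp: W_def Rdefs defs f_def)
      have "cmod (J (Q x r) \<epsilon> \<omega> - J (Q x' r') \<epsilon> \<omega>) = ?e * cmod (?I (Q x r) - ?I (Q x' r'))"
        unfolding J_def by (simp add: scaleR_diff_right[symmetric])
      also have "\<dots> \<le> ?e * (cmod (?I R1) + cmod (?I R2) + cmod (?I R3) + cmod (?I R4))" using d by (intro mult_left_mono) auto
      also have "\<dots> = cmod (J R1 \<epsilon> \<omega>) + cmod (J R2 \<epsilon> \<omega>) + cmod (J R3 \<epsilon> \<omega>) + cmod (J R4 \<epsilon> \<omega>)"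
        by (simp add: J_def algebra_simps)
      finally have "cmod (J (Q x r) \<epsilon> \<omega> - J (Q x' r') \<epsilon> \<omega>) ^ (2 * n)
        \<le> (cmod (J R1 \<epsilon> \<omega>) + cmod (J R2 \<epsilon> \<omega>) + cmod (J R3 \<epsilon> \<omega>) + cmod (J R4 \<epsilon> \<omega>)) ^ (2 * n)"
        by (intro power_mono) auto
      also have "\<dots> \<le> 4 ^ (2 * n) * (cmod (J R1 \<epsilon> \<omega>) ^ (2 * n) + cmod (J R2 \<epsilon> \<omega>) ^ (2 * n) + cmod (J R3 \<epsilon> \<omega>) ^ (2 * n) + cmod (J R4 \<epsilon> \<omega>) ^ (2 * n))"
        by (intro power_sum4_le) auto
      finally show ?thesis .
    qed
    define B where "B = C * 4 powr g * (max r r' * h) powr g"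
    have B: "0 \<le> B" using C by (simp add: B_def)
    have area: "(\<integral>\<^sup>+\<omega>. ennreal (cmod (J (rect b1 b2 c1 c2) \<epsilon> \<omega>) ^ (2 * n)) \<partial>M) \<le> ennreal B"
      if e: "0 < \<epsilon>" "\<epsilon> \<le> k" and bc: "b1 \<le> b2" "c1 \<le> c2" "(b2 - b1) * (c2 - c1) \<le> (2 * h) * (2 * max r r')"
        and D': "\<And>z. z \<in> rect b1 b2 c1 c2 \<Longrightarrow> cball z (3 * k) \<subseteq> D" for b1 b2 c1 c2 \<epsilon>
    proof -
      have "((b2 - b1) * (c2 - c1)) powr g \<le> (4 * (max r r' * h)) powr g"
        using bc g by (intro powr_mono2 mult_nonneg_nonneg) (auto simp: algebra_simps)
      also have "\<dots> = 4 powr g * (max r r' * h) powr g" using r h by (intro powr_mult)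
      finally have "C * ((b2 - b1) * (c2 - c1)) powr g \<le> B" unfolding B_def mult.assoc using C by (intro mult_left_mono)
      then show ?thesis using mom[OF e bc(1,2) D'] unfolding J_def f_def by (meson ennreal_leI order_trans)
    qed
    have thin: "(max u u' - min u u') * (2 * s) \<le> (2 * h) * (2 * max r r')" if "\<bar>u - u'\<bar> \<le> 2 * h" "s \<in> {r, r'}" for u u' s
      using that h r by (intro mult_mono) auto
    have m1: "(\<integral>\<^sup>+\<omega>. ennreal (cmod (J R1 \<epsilon> \<omega>) ^ (2 * n)) \<partial>M) \<le> ennreal B" if "0 < \<epsilon>" "\<epsilon> \<le> k" for \<epsilon>
      unfolding R1_def
    proof (rule area[OF that])
      show "(max a a' - min a a') * (d - c) \<le> 2 * h * (2 * max r r')" using thin[OF diffs(1), of r] by (simp add: c_def d_def)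
    qed (use cb1 r in \<open>auto simp: R1_def c_def d_def\<close>)
    have m2: "(\<integral>\<^sup>+\<omega>. ennreal (cmod (J R2 \<epsilon> \<omega>) ^ (2 * n)) \<partial>M) \<le> ennreal B" if "0 < \<epsilon>" "\<epsilon> \<le> k" for \<epsilon>
      unfolding R2_def
    proof (rule area[OF that])
      show "(max b b' - min b b') * (d - c) \<le> 2 * h * (2 * max r r')" using thin[OF diffs(2), of r] by (simp add: c_def d_def)
    qed (use cb2 r in \<open>auto simp: R2_def c_def d_def\<close>)
    have m3: "(\<integral>\<^sup>+\<omega>. ennreal (cmod (J R3 \<epsilon> \<omega>) ^ (2 * n)) \<partial>M) \<le> ennreal B" if "0 < \<epsilon>" "\<epsilon> \<le> k" for \<epsilon>
      unfolding R3_def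
    proof (rule area[OF that])
      show "(b' - a') * (max c c' - min c c') \<le> 2 * h * (2 * max r r')" using thin[OF diffs(3), of r'] by (simp add: a'_def b'_def mult.commute)
    qed (use cb3 r in \<open>auto simp: R3_def a'_def b'_def\<close>)
    have m4: "(\<integral>\<^sup>+\<omega>. ennreal (cmod (J R4 \<epsilon> \<omega>) ^ (2 * n)) \<partial>M) \<le> ennreal B" if "0 < \<epsilon>" "\<epsilon> \<le> k" for \<epsilon>
      unfolding R4_def
    proof (rule area[OF that])
      show "(b' - a') * (max d d' - min d d') \<le> 2 * h * (2 * max r r')" using thin[OF diffs(4), of r'] by (simp add: a'_def b'_def mult.commute)
    qed (use cb4 r in \<open>auto simp: R4_def a'_def b'_def\<close>)
    have fins: "(\<integral>\<^sup>+\<omega>. ennreal (cmod (J (Q x r) \<epsilon> \<omega> - J (Q x' r') \<epsilon> \<omega>) ^ (2 * n)) \<partial>M) \<le> ennreal (C' * (max r r' * h) powr g)"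
      if e: "0 < \<epsilon>" "\<epsilon> \<le> k" for \<epsilon>
    proof -
      have [measurable]: "J R1 \<epsilon> \<in> borel_measurable M" "J R2 \<epsilon> \<in> borel_measurable M" "J R3 \<epsilon> \<in> borel_measurable M" "J R4 \<epsilon> \<in> borel_measurable M"
        by (intro Jm e Rm; auto simp: W_def)+
      let ?E = "\<lambda>A \<omega>. ennreal (cmod (J A \<epsilon> \<omega>) ^ (2 * n))"
      have "(\<integral>\<^sup>+\<omega>. ennreal (cmod (J (Q x r) \<epsilon> \<omega> - J (Q x' r') \<epsilon> \<omega>) ^ (2 * n)) \<partial>M)
        \<le> (\<integral>\<^sup>+\<omega>. ennreal (4 ^ (2 * n)) * (?E R1 \<omega> + ?E R2 \<omega> + ?E R3 \<omega> + ?E R4 \<omega>) \<partial>M)"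
      proof (rule nn_integral_mono)
        fix \<omega> assume "\<omega> \<in> space M"
        from ennreal_leI[OF Jb[OF e this]]
        show "ennreal (cmod (J (Q x r) \<epsilon> \<omega> - J (Q x' r') \<epsilon> \<omega>) ^ (2 * n)) \<le> ennreal (4 ^ (2 * n)) * (?E R1 \<omega> + ?E R2 \<omega> + ?E R3 \<omega> + ?E R4 \<omega>)"
          by (simp add: ennreal_mult ennreal_plus)
      qed
      also have "\<dots> = ennreal (4 ^ (2 * n)) * ((\<integral>\<^sup>+\<omega>. ?E R1 \<omega> \<partial>M) + (\<integral>\<^sup>+\<omega>. ?E R2 \<omega> \<partial>M) + (\<integral>\<^sup>+\<omega>. ?E R3 \<omega> \<partial>M) + (\<integral>\<^sup>+\<omega>. ?E R4 \<omega> \<partial>M))"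
        by (simp add: nn_integral_cmult nn_integral_add)
      also have "\<dots> \<le> ennreal (4 ^ (2 * n)) * (ennreal B + ennreal B + ennreal B + ennreal B)"
        by (intro mult_left_mono add_mono m1 m2 m3 m4 e) simp
      also have "\<dots> = ennreal (4 ^ (2 * n)) * ennreal (B + B + B + B)" using B by (simp only: ennreal_plus add_nonneg_nonneg)
      also have "\<dots> = ennreal (4 ^ (2 * n) * (B + B + B + B))" using B by (simp add: ennreal_mult)
      also have "4 ^ (2 * n) * (B + B + B + B) = C' * (max r r' * h) powr g" by (simp add: C'_def B_def)
      finally show ?thesis .
    qed
    have sq: "(x, r) \<in> squares D" "(x', r') \<in> squares D" using p q inner_squares_subset[of \<kappa> D] \<kappa> by auto
    have J\<mu>: "\<mu> (Q y s) \<in> borel_measurable M" "L2_tendsto M (J (Q y s)) (\<mu> (Q y s)) (at_right 0)"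
      if "(y, s) \<in> squares D" for y s
      using \<mu>[OF that] unfolding chaos_mass_def J_def[abs_def] f_def by blast+
    have QW: "Q x r \<subseteq> W" "Q x' r' \<subseteq> W" by (auto simp: W_def)
    obtain e where e: "\<And>j. 0 < e j" "\<And>j. e j \<le> k"
      and ae: "AE \<omega> in M. (\<lambda>j :: nat. J (Q x r) (e j) \<omega>) \<longlonglongrightarrow> \<mu> (Q x r) \<omega>" "AE \<omega> in M. (\<lambda>j. J (Q x' r') (e j) \<omega>) \<longlonglongrightarrow> \<mu> (Q x' r') \<omega>"
      by (rule L2_tendsto_common_sequence[OF J\<mu>(2)[OF sq(1)] J\<mu>(2)[OF sq(2)] k(1) Jm[OF _ _ Qm QW(1)] Jm[OF _ _ Qm QW(2)] J\<mu>(1)[OF sq(1)] J\<mu>(1)[OF sq(2)]])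
        blast+
    show ?thesis
    proof (rule nn_integral_AE_limit_le[where u = "\<lambda>j \<omega>. ennreal (cmod (J (Q x r) (e j) \<omega> - J (Q x' r') (e j) \<omega>) ^ (2 * n))"])
      fix j
      have [measurable]: "J (Q x r) (e j) \<in> borel_measurable M" "J (Q x' r') (e j) \<in> borel_measurable M"
        by (rule Jm[OF e Qm QW(1)], rule Jm[OF e Qm QW(2)])
      show "(\<lambda>\<omega>. ennreal (cmod (J (Q x r) (e j) \<omega> - J (Q x' r') (e j) \<omega>) ^ (2 * n))) \<in> borel_measurable M" by measurable
      show "(\<integral>\<^sup>+\<omega>. ennreal (cmod (J (Q x r) (e j) \<omega> - J (Q x' r') (e j) \<omega>) ^ (2 * n)) \<partial>M) \<le> ennreal (C' * (max r r' * h) powr g)"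
        by (rule fins[OF e])
    next
      show "AE \<omega> in M. (\<lambda>j. ennreal (cmod (J (Q x r) (e j) \<omega> - J (Q x' r') (e j) \<omega>) ^ (2 * n)))
          \<longlonglongrightarrow> ennreal (cmod (\<mu> (Q x r) \<omega> - \<mu> (Q x' r') \<omega>) ^ (2 * n))"
        using ae by eventually_elim (intro tendsto_intros)
    qed
  qed
  with that[OF C'] show ?thesis unfolding g_def by blast
qed

text \<open>A square of radius zero is a single point, so all approximations are 0 and their limit
  is 0 almost surely.\<close>

lemma chaos_mass_point:
  assumes c: "chaos_mass M \<beta> \<Gamma>c (Q x 0) Y"
  shows "AE \<omega> in M. Y \<omega> = 0"
proof -
  have [measurable]: "Y \<in> borel_measurable M" using c by (simp add: chaos_mass_def)
  have "(LINT z:Q x 0|lborel. f z) = 0" for f :: "real^2 \<Rightarrow> complex"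
    unfolding set_lebesgue_integral_def
  proof (rule integral_eq_zero_AE)
    show "AE z in lborel. indicat_real (Q x 0) z *\<^sub>R f z = 0"
      using AE_lborel_singleton[of x] by eventually_elim (auto simp: mem_Q vec_eq_iff forall_2)
  qed
  then have "((\<lambda>\<epsilon> :: real. \<integral>\<^sup>+\<omega>. ennreal ((cmod (Y \<omega>))\<^sup>2) \<partial>M) \<longlongrightarrow> 0) (at_right 0)"
    using c by (simp add: chaos_mass_def L2_tendsto_def)
  then have "(\<integral>\<^sup>+\<omega>. ennreal ((cmod (Y \<omega>))\<^sup>2) \<partial>M) = 0"
    by (simp add: tendsto_const_iff)
  then have "AE \<omega> in M. ennreal ((cmod (Y \<omega>))\<^sup>2) = 0" by (subst (asm) nn_integral_0_iff_AE) auto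
  then show ?thesis by eventually_elim (simp add: ennreal_eq_0_iff)
qed

theorem proposition1p1:
  fixes M :: "'a measure"
    and \<beta> :: real
    and D :: "(real^2) set"
    and G :: "real^2 \<Rightarrow> real^2 \<Rightarrow> real"
    and \<Gamma> :: "'a \<Rightarrow> (real^2 \<Rightarrow> real) \<Rightarrow> real"
    and \<Gamma>c :: "real \<Rightarrow> real^2 \<Rightarrow> 'a \<Rightarrow> real"
    and \<mu> :: "(real^2) set \<Rightarrow> 'a \<Rightarrow> complex"
    and N :: "(real^2) \<times> real \<Rightarrow> real"
  assumes "prob_space M"
    and "0 < \<beta>" and "\<beta> < sqrt 2"
    and "open D" and "bounded D" and "D \<noteq> {}" and "simply_connected D"
    and "dirichlet_green D G"
    and "gff M D G \<Gamma>"
    and "circle_average_process M D \<Gamma> \<Gamma>c"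
    and "\<forall>(x, r)\<in>squares D. chaos_mass M \<beta> \<Gamma>c (Q x r) (\<mu> (Q x r))"
    and "is_norm N"
  shows "\<exists>\<nu> :: (real^2) \<times> real \<Rightarrow> 'a \<Rightarrow> complex.
    (\<forall>(x, r)\<in>squares D. \<nu> (x, r) \<in> borel_measurable M \<and>
        (AE \<omega> in M. \<nu> (x, r) \<omega> = \<mu> (Q x r) \<omega>)) \<and>
    (\<forall>\<omega>\<in>space M. continuous_on (squares D) (\<lambda>p. \<nu> p \<omega>)) \<and>
    (\<forall>K \<alpha>. compact K \<longrightarrow> K \<subseteq> D \<longrightarrow> \<alpha> < 1 - \<beta>\<^sup>2 / 4 \<longrightarrow>
       (\<exists>C :: 'a \<Rightarrow> real. C \<in> borel_measurable M \<and>
          (AE \<omega> in M. \<forall>(x, r)\<in>squares D. \<forall>(x', r')\<in>squares D.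
             Q x r \<subseteq> K \<longrightarrow> Q x' r' \<subseteq> K \<longrightarrow>
             cmod (\<nu> (x, r) \<omega> - \<nu> (x', r') \<omega>)
               \<le> C \<omega> * max r r' powr \<alpha> * N ((x, r) - (x', r')) powr \<alpha>)))"
proof -
  note M = assms(1) and \<beta> = assms(2,3) and D = assms(4,5)
  define \<gamma> where "\<gamma> = 1 - \<beta>\<^sup>2 / 4"
  have "\<beta>\<^sup>2 < (sqrt 2)\<^sup>2" using \<beta> by (intro power_strict_mono) auto
  then have \<gamma>: "0 < \<gamma>" by (simp add: \<gamma>_def)
  have \<mu>: "chaos_mass M \<beta> \<Gamma>c (Q x r) (\<mu> (Q x r))" if "(x, r) \<in> squares D" for x r
    using assms(11) that by auto
  \<comment> \<open>The masses of single points vanish only almost surely, while the chaining needs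
    them to vanish identically. For each square the change concerns a null set.\<close>
  define Y where "Y p \<omega> = (if snd p = 0 then 0 else \<mu> (Q (fst p) (snd p)) \<omega>)" for p \<omega>
  have Y\<mu>: "AE \<omega> in M. Y (x, r) \<omega> = \<mu> (Q x r) \<omega>" if "(x, r) \<in> squares D" for x r
  proof (cases "r = 0")
    case True
    show ?thesis using chaos_mass_point[OF \<mu>[OF that, unfolded True]] by eventually_elim (simp add: Y_def True)
  qed (simp add: Y_def)
  have meas: "Y p \<in> borel_measurable M" if "p \<in> squares D" for p
    using \<mu>[of "fst p" "snd p"] that unfolding Y_def[abs_def] by (cases "snd p = 0") (auto simp: chaos_mass_def)
  have mom: "\<exists>C\<ge>0. \<exists>h0>0. \<forall>p\<in>inner_squares D \<kappa>. \<forall>q\<in>inner_squares D \<kappa>. \<forall>h>0. h \<le> h0 \<longrightarrow> near h p q \<longrightarrow>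
      (\<integral>\<^sup>+\<omega>. ennreal (cmod (Y p \<omega> - Y q \<omega>) ^ (2 * n)) \<partial>M) \<le> ennreal (C * (max (snd p) (snd q) * h) powr (real (2 * n) * \<gamma>))"
    if \<kappa>: "0 < \<kappa>" and n: "0 < n" for \<kappa> and n :: nat
  proof -
    obtain C where C: "0 \<le> C" and CC: "\<And>x r x' r' h. (x, r) \<in> inner_squares D \<kappa> \<Longrightarrow> (x', r') \<in> inner_squares D \<kappa> \<Longrightarrow> 0 < h \<Longrightarrow> h \<le> \<kappa> / 8 \<Longrightarrow>
      near h (x, r) (x', r') \<Longrightarrow>
      (\<integral>\<^sup>+\<omega>. ennreal (cmod (\<mu> (Q x r) \<omega> - \<mu> (Q x' r') \<omega>) ^ (2 * n)) \<partial>M) \<le> ennreal (C * (max r r' * h) powr (real (2 * n) * \<gamma>))"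
      by (rule chaos_mass_increment_moment[OF M D assms(8-10) \<kappa> \<beta> n \<mu>, folded \<gamma>_def]) (assumption | (rule that, assumption, blast))+
    have inc: "(\<integral>\<^sup>+\<omega>. ennreal (cmod (Y p \<omega> - Y q \<omega>) ^ (2 * n)) \<partial>M) \<le> ennreal (C * (max (snd p) (snd q) * h) powr (real (2 * n) * \<gamma>))"
      if pq: "p \<in> inner_squares D \<kappa>" "q \<in> inner_squares D \<kappa>" and h: "0 < h" "h \<le> \<kappa> / 8" and nr: "near h p q" for p q h
    proof -
      obtain x r x' r' where e: "p = (x, r)" "q = (x', r')" by (metis surj_pair)
      have sq: "(x, r) \<in> squares D" "(x', r') \<in> squares D" using pq inner_squares_subset[of \<kappa> D] \<kappa> by (auto simp: e)
      have "(\<integral>\<^sup>+\<omega>. ennreal (cmod (Y p \<omega> - Y q \<omega>) ^ (2 * n)) \<partial>M) = (\<integral>\<^sup>+\<omega>. ennreal (cmod (\<mu> (Q x r) \<omega> - \<mu> (Q x' r') \<omega>) ^ (2 * n)) \<partial>M)"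
        by (rule nn_integral_cong_AE) (use Y\<mu>[OF sq(1)] Y\<mu>[OF sq(2)] in \<open>eventually_elim, simp add: e\<close>)
      also have "\<dots> \<le> ennreal (C * (max r r' * h) powr (real (2 * n) * \<gamma>))" by (rule CC) (use pq h nr e in auto)
      finally show ?thesis by (simp add: e)
    qed
    show ?thesis
    proof (intro exI conjI ballI allI impI)
      show "0 \<le> C" by (rule C)
      show "0 < \<kappa> / 8" using \<kappa> by simp
    qed (rule inc)
  qed
  have "\<exists>\<nu>. (\<forall>p\<in>squares D. \<nu> p \<in> borel_measurable M \<and> (AE \<omega> in M. \<nu> p \<omega> = Y p \<omega>)) \<and>
    (\<forall>\<omega>. continuous_on (squares D) (\<lambda>p. \<nu> p \<omega>)) \<and>
    (\<forall>\<kappa>>0. \<forall>\<alpha><\<gamma>. \<exists>\<alpha>'>max \<alpha> 0. \<exists>Z. Z \<in> borel_measurable M \<and> (AE \<omega> in M. 0 \<le> Z \<omega> \<and>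
      (\<forall>p\<in>inner_squares D \<kappa>. \<forall>q\<in>inner_squares D \<kappa>.
        cmod (\<nu> p \<omega> - \<nu> q \<omega>) \<le> Z \<omega> * (max (snd p) (snd q) * norm (p - q)) powr \<alpha>')))"
    by (rule kolmogorov_squares[OF D \<gamma> meas _ mom]) (simp_all add: Y_def)
  then obtain \<nu> where \<nu>: "\<forall>p\<in>squares D. \<nu> p \<in> borel_measurable M \<and> (AE \<omega> in M. \<nu> p \<omega> = Y p \<omega>)"
    and cont: "\<forall>\<omega>. continuous_on (squares D) (\<lambda>p. \<nu> p \<omega>)"
    and hoelder: "\<forall>\<kappa>>0. \<forall>\<alpha><\<gamma>. \<exists>\<alpha>'>max \<alpha> 0. \<exists>Z. Z \<in> borel_measurable M \<and> (AE \<omega> in M. 0 \<le> Z \<omega> \<and>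
      (\<forall>p\<in>inner_squares D \<kappa>. \<forall>q\<in>inner_squares D \<kappa>.
        cmod (\<nu> p \<omega> - \<nu> q \<omega>) \<le> Z \<omega> * (max (snd p) (snd q) * norm (p - q)) powr \<alpha>'))"
    by (elim exE conjE) (rule that)
  obtain c1 c2 where c: "0 < c1" "0 < c2" "\<And>v. c1 * norm v \<le> N v" "\<And>v. N v \<le> c2 * norm v"
    by (rule is_norm_equivalent[OF assms(12)]) blast
  obtain b where b: "0 < b" "\<And>x. x \<in> D \<Longrightarrow> norm x \<le> b" using D(2) by (auto simp: bounded_pos)
  \<comment> \<open>An upper bound for \<open>N\<close> on differences of parameters; it will
    convert a surplus of the Hoelder exponent into a constant.\<close>
  define L where "L = c2 * (2 * b + 1)"
  have L: "N ((x, r) - (x', r')) \<le> L" if "(x, r) \<in> squares D" "(x', r') \<in> squares D" for x r x' r'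
  proof -
    have "norm ((x, r) - (x', r')) \<le> norm (x - x') + norm (r - r')" using norm_Pair_le[of "x - x'" "r - r'"] by simp
    also have "\<dots> \<le> 2 * b + 1" using that b(2)[of x] b(2)[of x'] norm_triangle_ineq4[of x x'] by (auto simp: squares_def)
    finally have "c2 * norm ((x, r) - (x', r')) \<le> L" unfolding L_def using c(2) by (intro mult_left_mono) auto
    then show ?thesis using c(4) order_trans by blast
  qed
  have bound: "\<exists>C :: 'a \<Rightarrow> real. C \<in> borel_measurable M \<and>
      (AE \<omega> in M. \<forall>(x, r)\<in>squares D. \<forall>(x', r')\<in>squares D.
         Q x r \<subseteq> K \<longrightarrow> Q x' r' \<subseteq> K \<longrightarrow>
         cmod (\<nu> (x, r) \<omega> - \<nu> (x', r') \<omega>) \<le> C \<omega> * max r r' powr \<alpha> * N ((x, r) - (x', r')) powr \<alpha>)"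
    if K: "compact K" "K \<subseteq> D" and \<alpha>: "\<alpha> < \<gamma>" for K \<alpha>
  proof -
    obtain \<kappa> where \<kappa>: "0 < \<kappa>" "\<And>y. y \<in> K \<Longrightarrow> cball y \<kappa> \<subseteq> D" by (rule compact_in_open_cball[OF K(1) D(1) K(2)]) (rule that; blast)
    \<comment> \<open>The exponent \<open>\<alpha>\<close> may be negative, and the Hoelder estimate
      comes with a larger, positive exponent. The surplus in the radius is absorbed by
      \<open>max r r' \<le> 1\<close>, the surplus in the distance by \<open>L\<close>.\<close>
    obtain \<alpha>' Z where \<alpha>': "max \<alpha> 0 < \<alpha>'" and Z: "Z \<in> borel_measurable M"
      and ae: "AE \<omega> in M. 0 \<le> Z \<omega> \<and> (\<forall>p\<in>inner_squares D \<kappa>. \<forall>q\<in>inner_squares D \<kappa>.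
        cmod (\<nu> p \<omega> - \<nu> q \<omega>) \<le> Z \<omega> * (max (snd p) (snd q) * norm (p - q)) powr \<alpha>')"
      using hoelder[THEN spec, THEN mp, OF \<kappa>(1), THEN spec, THEN mp, OF \<alpha>] by (elim exE conjE) (rule that)
    define A where "A = (1 / c1) powr \<alpha>' * L powr (\<alpha>' - \<alpha>)"
    show ?thesis
    proof (intro exI[of _ "\<lambda>\<omega>. A * Z \<omega>"] conjI)
      show "(\<lambda>\<omega>. A * Z \<omega>) \<in> borel_measurable M" using Z by measurable
      show "AE \<omega> in M. \<forall>(x, r)\<in>squares D. \<forall>(x', r')\<in>squares D.
         Q x r \<subseteq> K \<longrightarrow> Q x' r' \<subseteq> K \<longrightarrow>
         cmod (\<nu> (x, r) \<omega> - \<nu> (x', r') \<omega>) \<le> A * Z \<omega> * max r r' powr \<alpha> * N ((x, r) - (x', r')) powr \<alpha>"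
        using ae
      proof eventually_elim
        case (elim \<omega>)
        have "cmod (\<nu> (x, r) \<omega> - \<nu> (x', r') \<omega>) \<le> A * Z \<omega> * max r r' powr \<alpha> * N ((x, r) - (x', r')) powr \<alpha>"
          if sq: "(x, r) \<in> squares D" "(x', r') \<in> squares D" and QK: "Q x r \<subseteq> K" "Q x' r' \<subseteq> K" for x r x' r'
        proof -
          let ?R = "max r r'" and ?v = "(x, r) - (x', r')"
          have "(x, r) \<in> inner_squares D \<kappa>" "(x', r') \<in> inner_squares D \<kappa>"
            using sq QK \<kappa>(2) by (auto simp: inner_squares_def squares_def)
          then have "cmod (\<nu> (x, r) \<omega> - \<nu> (x', r') \<omega>) \<le> Z \<omega> * (?R * norm ?v) powr \<alpha>'" using elim by fastforce
          also have "\<dots> \<le> Z \<omega> * (?R powr \<alpha> * ((1 / c1) powr \<alpha>' * (N ?v powr \<alpha> * L powr (\<alpha>' - \<alpha>))))"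
          proof (intro mult_left_mono)
            have R: "0 \<le> ?R" "?R \<le> 1" using sq by (auto simp: squares_def)
            have Nv: "0 \<le> N ?v" using assms(12) unfolding is_norm_def by blast
            have "(?R * norm ?v) powr \<alpha>' = ?R powr \<alpha>' * norm ?v powr \<alpha>'" by (rule powr_mult)
            also have "\<dots> \<le> ?R powr \<alpha> * ((1 / c1) * N ?v) powr \<alpha>'"
            proof (intro mult_mono)
              \<comment> \<open>At radius zero both powers are 0, even for a negative exponent;
                otherwise the base is at most 1.\<close>
              show "?R powr \<alpha>' \<le> ?R powr \<alpha>" using R \<alpha>' by (cases "?R = 0") (auto intro!: powr_mono')
              have "norm ?v \<le> (1 / c1) * N ?v" using c(1) c(3)[of ?v] by (simp add: field_simps)
              then show "norm ?v powr \<alpha>' \<le> ((1 / c1) * N ?v) powr \<alpha>'" using \<alpha>' by (intro powr_mono2) auto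
            qed auto
            also have "((1 / c1) * N ?v) powr \<alpha>' = (1 / c1) powr \<alpha>' * N ?v powr \<alpha>'" by (rule powr_mult)
            also have "N ?v powr \<alpha>' = N ?v powr \<alpha> * N ?v powr (\<alpha>' - \<alpha>)" by (simp add: powr_add[symmetric])
            also have "?R powr \<alpha> * ((1 / c1) powr \<alpha>' * (N ?v powr \<alpha> * N ?v powr (\<alpha>' - \<alpha>)))
                \<le> ?R powr \<alpha> * ((1 / c1) powr \<alpha>' * (N ?v powr \<alpha> * L powr (\<alpha>' - \<alpha>)))"
              using L[OF sq] Nv \<alpha>' by (intro mult_left_mono powr_mono2) auto
            finally show "(?R * norm ?v) powr \<alpha>' \<le> ?R powr \<alpha> * ((1 / c1) powr \<alpha>' * (N ?v powr \<alpha> * L powr (\<alpha>' - \<alpha>)))" .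
          qed (use elim in blast)
          also have "\<dots> = A * Z \<omega> * ?R powr \<alpha> * N ?v powr \<alpha>" by (simp add: A_def)
          finally show ?thesis .
        qed
        then show ?case by blast
      qed
    qed
  qed
  show ?thesis
  proof (intro exI[of _ \<nu>] conjI allI impI ballI)
    show "case p of (x, r) \<Rightarrow> \<nu> (x, r) \<in> borel_measurable M \<and> (AE \<omega> in M. \<nu> (x, r) \<omega> = \<mu> (Q x r) \<omega>)"
      if p: "p \<in> squares D" for p
    proof -
      obtain x r where e: "p = (x, r)" by fastforce
      have "AE \<omega> in M. \<nu> (x, r) \<omega> = \<mu> (Q x r) \<omega>"
        using bspec[OF \<nu> p, THEN conjunct2] Y\<mu>[OF p[unfolded e]] unfolding e by eventually_elim simp
      then show ?thesis using bspec[OF \<nu> p] by (simp add: e)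
    qed
    show "continuous_on (squares D) (\<lambda>p. \<nu> p \<omega>)" for \<omega> by (rule spec[OF cont])
  qed (rule bound, auto simp: \<gamma>_def)
qed

end
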